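(* Let $W$ be a finite Coxeter group of type $A_n$ ($n\ge 2$), $B_n$ ($n\ge 2$), $I_2(m)$ ($m\ge 3$) or $H_3$, and let $o$ be the following $W$-orbit: in type $A_n$, $o=\{e_1,\dots,e_{n+1}\}$; in type $B_n$, $o=\{\pm e_1,\dots,\pm e_n\}$; in type $I_2(m)$, an orbit consisting of the vertices of a regular $m$-gon; in type $H_3$, the orbit consisting of the 12 vertices of a regular icosahedron. Two distinct almost positive roots, represented by collections $C_1$ and $C_2$ of line segments (their diagrams constructed from $o$), are compatible if and only if no segment in $C_1$ crosses any segment in $C_2$, unless the two segments coincide (as unlabeled segments).
   Context: Setting. $(W,S)$ is a finite irreducible Coxeter system of rank $n$, represented as a real reflection group on a Euclidean space $V$ so that only the origin is fixed by $W$. Type $A_n$ is $S_{n+1}$ permuting coordinates of $\mathbb{R}^{n+1}$ modulo the line spanned by $(1,\dots,1)$ (equivalently, project orthogonally to the sum-zero hyperplane); type $B_n$ is the group of signed permutations on $\mathbb{R}^n$; type $I_2(m)$ is the dihedral group of order $2m$; type $H_3$ is the symmetry group of the regular icosahedron. $\Phi$ is a root system for $W$ (a $W$-stable set with exactly two opposite roots normal to each reflecting hyperplane) with simple roots $\alpha_s$ ($s\in S$) and positive roots $\Phi^+$. The almost positive roots are $\Phi_{\ge-1}=\Phi^+\cup\{-\alpha_s:s\in S\}$. $S=S_+\sqcup S_-$ is a bipartition of the Coxeter diagram, $c_\pm=\prod_{s\in S_\pm}s$, $c=c_-c_+$, and $h$ is the order of $c$. Compatibility. For $\varepsilon\in\{+,-\}$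 define the involution $\tau_\varepsilon$ on $\Phi_{\ge-1}$ by $\tau_\varepsilon(\alpha)=\alpha$ if $\alpha=-\alpha_s$ with $s\in S_{-\varepsilon}$, and $\tau_\varepsilon(\alpha)=c_\varepsilon(\alpha)$ otherwise. Compatibility is the unique $\langle\tau_+,\tau_-\rangle$-invariant binary relation on $\Phi_{\ge-1}$ such that for every $s\in S$, $\beta$ is compatible with $-\alpha_s$ iff $\alpha_s$ has coefficient $0$ in the simple root expansion of $\beta$. Every $\langle\tau_+,\tau_-\rangle$-orbit in $\Phi_{\ge -1}$ contains a negative simple root. Coxeter plane. Let $(c_s)_{s\in S}$ be a positive eigenvector, for the smallest eigenvalue, of the Gram matrix of the unit simple roots $\alpha_s/|\alpha_s|$, and $(\omega_s)$ the basis dual to the unit simple roots. The Coxeter plane is $P=\mathrm{span}(\lambda,\mu)$, $\lambda=\sum_{s\in S_+}c_s\omega_s$, $\mu=\sum_{s\in S_-}c_s\omega_s$; the angle between $\lambda$ and $\mu$ is $\pi/h$. Use polar coordinates on $P$ with $\lambda$ at angle $0$ and $\mu$ at angle $\pi/h$. Diagrams of almost positive roots. In the types considered here, the elements of $o$ that do not project orthogonally to the origin of $P$ project to the vertices of a regular $h$-gon centered at the origin, each vertex having angle $k\pi/h$ for an integer $1\le k\le 2h$. In type $H_3$ two elements of $o$ project to the origin; they are called origin points and are kept distinguishable (labeled by the corresponding element of $o$). The $h$-gon is enlarged to a regular $(h+2)$-gon with the same distance of vertices to the origin, by subdividing each of the two edges perpendicular to $\mathbb{R}\lambda$ or $\mathbb{R}\mu$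 by a new vertex and then making the polygon regular. Explicitly, $x\in o$ with projection at radius $r>0$ and angle $k\pi/h$ is sent to the point $\hat x$ at radius $r$ and angle $(k+2)\pi/(h+2)$ if $1\le k\le h$, and $(k+4)\pi/(h+2)$ if $h+1\le k\le 2h$; the $(h+2)$-gon is the regular $(h+2)$-gon centered at the origin whose vertices include all these $\hat x$. If $x$ projects to the origin, $\hat x$ is the origin labeled by $x$. The diagram of $-\alpha_s$ is the collection of (labeled) line segments $\hat x\,\widehat{sx}$ over all $x\in o$ with $sx\ne x$. Let $L'_+$ and $L'_-$ be the lines through the origin at angles $\pi/(h+2)$ and $2\pi/(h+2)$; reflection in $L'_\varepsilon$ preserves the (unlabeled) diagrams of $-\alpha_s$ for $s\in S_{-\varepsilon}$. Let $\tau_\varepsilon$ act on labeled segments $AB$ as follows: if neither endpoint is at the origin, reflect both endpoints in $L'_\varepsilon$; if $A$ is an origin point and $AB$ is not perpendicular to $L'_\varepsilon$, reflect $B$ in $L'_\varepsilon$ and replace the label $x$ of $A$ by $c_\varepsilon x$; if $A$ is an origin point and $AB$ is perpendicular to $L'_\varepsilon$, fix $AB$. The diagrams of all almost positive roots are uniquely determined by requiring that the diagram of $\tau_\varepsilon(\beta)$ be the image under $\tau_\varepsilon$ of the diagram of $\beta$. Two segments cross if they intersect in a point of the relative interior of both (labels of origin points are ignored); pairs of segments that coincide as unlabeled segments are permitted by the criterion. *)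

theory Defs
  imports "HOL-Analysis.Analysis"
begin

section \<open>Root systems of finite reflection groups\<close>

definition reflection :: "'a::euclidean_space \<Rightarrow> 'a \<Rightarrow> 'a" where
  "reflection \<alpha> x = x - (2 * (x \<bullet> \<alpha>) / (\<alpha> \<bullet> \<alpha>)) *\<^sub>R \<alpha>"

text \<open>A reflection group is represented by the set \<^term>\<open>W\<close> of its elements, as linear maps. The
  ambient space may be larger than the space \<^term>\<open>V = span \<Phi>\<close> on which \<^term>\<open>W\<close> is essential
  (this happens in type A only). Roots of different \<^term>\<open>W\<close>-orbits may have unrelated lengths.\<close>

definition root_system :: "('a::euclidean_space \<Rightarrow> 'a) set \<Rightarrow> 'a set \<Rightarrow> bool" where
  "root_system W \<Phi> \<longleftrightarrow>
     0 \<notin> \<Phi> \<and>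
     (\<forall>w\<in>W. w ` \<Phi> \<subseteq> \<Phi>) \<and>
     (\<forall>\<alpha>\<in>\<Phi>. reflection \<alpha> \<in> W) \<and>
     (\<forall>\<alpha>. \<alpha> \<noteq> 0 \<and> reflection \<alpha> \<in> W \<longrightarrow> (\<exists>\<beta>. \<Phi> \<inter> span {\<alpha>} = {\<beta>, - \<beta>}))"

definition simple_system :: "'a::euclidean_space set \<Rightarrow> 'a set \<Rightarrow> bool" where
  "simple_system \<Phi> B \<longleftrightarrow>
     B \<subseteq> \<Phi> \<and> independent B \<and> \<Phi> \<subseteq> span B \<and>
     (\<forall>\<beta>\<in>\<Phi>. (\<forall>\<alpha>\<in>B. representation B \<beta> \<alpha> \<ge> 0) \<or> (\<forall>\<alpha>\<in>B. representation B \<beta> \<alpha> \<le> 0))"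

definition positive_roots :: "'a::euclidean_space set \<Rightarrow> 'a set \<Rightarrow> 'a set" where
  "positive_roots \<Phi> B = {\<beta>\<in>\<Phi>. \<forall>\<alpha>\<in>B. representation B \<beta> \<alpha> \<ge> 0}"

datatype sign = Pos | Neg

fun opp :: "sign \<Rightarrow> sign" where
  "opp Pos = Neg"
| "opp Neg = Pos"

text \<open>The simple reflections are indexed by their simple roots. The simple roots are given as a
  family \<^term>\<open>\<Delta>\<close> of two sets, where \<^term>\<open>\<Delta> \<epsilon>\<close> consists of the simple roots \<open>\<alpha>\<^sub>s\<close> with \<open>s \<in> S\<^sub>\<epsilon>\<close>.
  Two vertices of the Coxeter diagram are joined by an edge if and only if the corresponding
  simple reflections do not commute, that is, if and only if their roots are not orthogonal.\<close>

definition simple_roots :: "(sign \<Rightarrow> 'a set) \<Rightarrow> 'a set" where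
  "simple_roots \<Delta> = \<Delta> Pos \<union> \<Delta> Neg"

definition bipartition :: "(sign \<Rightarrow> 'a::euclidean_space set) \<Rightarrow> bool" where
  "bipartition \<Delta> \<longleftrightarrow> \<Delta> Pos \<inter> \<Delta> Neg = {} \<and> (\<forall>\<epsilon>. pairwise orthogonal (\<Delta> \<epsilon>))"

definition almost_positive_roots :: "'a::euclidean_space set \<Rightarrow> (sign \<Rightarrow> 'a set) \<Rightarrow> 'a set" where
  "almost_positive_roots \<Phi> \<Delta> = positive_roots \<Phi> (simple_roots \<Delta>) \<union> uminus ` simple_roots \<Delta>"

text \<open>The factors of the product \<open>c\<^sub>\<epsilon>\<close> commute, so the order in which they are folded is irrelevant.\<close>

definition cox_part :: "(sign \<Rightarrow> 'a::euclidean_space set) \<Rightarrow> sign \<Rightarrow> 'a \<Rightarrow> 'a" where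
  "cox_part \<Delta> \<epsilon> = Finite_Set.fold (\<lambda>\<alpha> f. reflection \<alpha> \<circ> f) id (\<Delta> \<epsilon>)"

definition cox_element :: "(sign \<Rightarrow> 'a::euclidean_space set) \<Rightarrow> 'a \<Rightarrow> 'a" where
  "cox_element \<Delta> = cox_part \<Delta> Neg \<circ> cox_part \<Delta> Pos"

definition cox_number :: "(sign \<Rightarrow> 'a::euclidean_space set) \<Rightarrow> nat" where
  "cox_number \<Delta> = (LEAST k. k > 0 \<and> cox_element \<Delta> ^^ k = id)"


section \<open>Compatibility\<close>

definition tau :: "(sign \<Rightarrow> 'a::euclidean_space set) \<Rightarrow> sign \<Rightarrow> 'a \<Rightarrow> 'a" where
  "tau \<Delta> \<epsilon> \<alpha> = (if \<alpha> \<in> uminus ` \<Delta> (opp \<epsilon>) then \<alpha> else cox_part \<Delta> \<epsilon> \<alpha>)"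

definition compatibility_relation ::
    "'a::euclidean_space set \<Rightarrow> (sign \<Rightarrow> 'a set) \<Rightarrow> ('a \<times> 'a) set \<Rightarrow> bool" where
  "compatibility_relation \<Phi> \<Delta> R \<longleftrightarrow>
     R \<subseteq> almost_positive_roots \<Phi> \<Delta> \<times> almost_positive_roots \<Phi> \<Delta> \<and>
     (\<forall>\<epsilon>. \<forall>\<beta>\<in>almost_positive_roots \<Phi> \<Delta>. \<forall>\<gamma>\<in>almost_positive_roots \<Phi> \<Delta>.
        (tau \<Delta> \<epsilon> \<beta>, tau \<Delta> \<epsilon> \<gamma>) \<in> R \<longleftrightarrow> (\<beta>, \<gamma>) \<in> R) \<and>
     (\<forall>\<alpha>\<in>simple_roots \<Delta>. \<forall>\<beta>\<in>almost_positive_roots \<Phi> \<Delta>.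
        (\<beta>, - \<alpha>) \<in> R \<longleftrightarrow> representation (simple_roots \<Delta>) \<beta> \<alpha> = 0)"

definition compatible_roots ::
    "'a::euclidean_space set \<Rightarrow> (sign \<Rightarrow> 'a set) \<Rightarrow> 'a \<Rightarrow> 'a \<Rightarrow> bool" where
  "compatible_roots \<Phi> \<Delta> \<beta> \<gamma> \<longleftrightarrow> (\<beta>, \<gamma>) \<in> (THE R. compatibility_relation \<Phi> \<Delta> R)"


section \<open>The Coxeter plane\<close>

text \<open>For the Gram matrix of the unit simple roots \<^term>\<open>sgn \<alpha>\<close>; vectors indexed by the finite
  set \<^term>\<open>B\<close> are functions of which only the values on \<^term>\<open>B\<close> matter.\<close>

definition gram_eigenvector :: "'a::euclidean_space set \<Rightarrow> real \<Rightarrow> ('a \<Rightarrow> real) \<Rightarrow> bool" where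
  "gram_eigenvector B \<kappa> v \<longleftrightarrow>
     (\<exists>\<alpha>\<in>B. v \<alpha> \<noteq> 0) \<and> (\<forall>\<alpha>\<in>B. (\<Sum>\<beta>\<in>B. (sgn \<alpha> \<bullet> sgn \<beta>) * v \<beta>) = \<kappa> * v \<alpha>)"

definition positive_min_eigenvector :: "'a::euclidean_space set \<Rightarrow> ('a \<Rightarrow> real) \<Rightarrow> bool" where
  "positive_min_eigenvector B c \<longleftrightarrow>
     (\<forall>\<alpha>\<in>B. c \<alpha> > 0) \<and>
     (\<exists>\<kappa>. gram_eigenvector B \<kappa> c \<and> (\<forall>\<kappa>' v. gram_eigenvector B \<kappa>' v \<longrightarrow> \<kappa> \<le> \<kappa>'))"

definition dual_to_unit_roots :: "'a::euclidean_space set \<Rightarrow> ('a \<Rightarrow> 'a) \<Rightarrow> bool" where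
  "dual_to_unit_roots B \<omega> \<longleftrightarrow>
     (\<forall>\<alpha>\<in>B. \<omega> \<alpha> \<in> span B \<and> (\<forall>\<beta>\<in>B. \<omega> \<alpha> \<bullet> sgn \<beta> = (if \<alpha> = \<beta> then 1 else 0)))"

definition cox_vector ::
    "(sign \<Rightarrow> 'a::euclidean_space set) \<Rightarrow> ('a \<Rightarrow> real) \<Rightarrow> ('a \<Rightarrow> 'a) \<Rightarrow> sign \<Rightarrow> 'a" where
  "cox_vector \<Delta> c \<omega> \<epsilon> = (\<Sum>\<alpha>\<in>\<Delta> \<epsilon>. c \<alpha> *\<^sub>R \<omega> \<alpha>)"

text \<open>Orthogonal projection to the Coxeter plane, spanned by \<open>\<lambda>\<close> and \<open>\<mu>\<close>, followed by the isometry
  of that plane with the complex numbers that puts \<open>\<lambda>\<close> at angle 0 and \<open>\<mu>\<close> in the upper half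
  plane. As the angle between \<open>\<lambda>\<close> and \<open>\<mu>\<close> is \<open>\<pi>/h\<close>, the argument of \<open>\<mu>\<close> becomes \<open>\<pi>/h\<close>.\<close>

definition plane_coord ::
    "(sign \<Rightarrow> 'a::euclidean_space set) \<Rightarrow> ('a \<Rightarrow> real) \<Rightarrow> ('a \<Rightarrow> 'a) \<Rightarrow> 'a \<Rightarrow> complex" where
  "plane_coord \<Delta> c \<omega> x =
     (let l = cox_vector \<Delta> c \<omega> Pos; \<mu> = cox_vector \<Delta> c \<omega> Neg;
          e1 = sgn l; e2 = sgn (\<mu> - (\<mu> \<bullet> e1) *\<^sub>R e1)
      in Complex (x \<bullet> e1) (x \<bullet> e2))"


section \<open>Diagrams of almost positive roots\<close>

text \<open>Points of the plane, where origin points carry a label.\<close>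

datatype 'a dpoint = Vertex complex | Origin 'a

primrec location :: "'a dpoint \<Rightarrow> complex" where
  "location (Vertex z) = z"
| "location (Origin x) = 0"

text \<open>The passage from the \<open>h\<close>-gon to the \<open>(h + 2)\<close>-gon, applied to a nonzero point whose
  angle is a multiple of \<open>\<pi>/h\<close>.\<close>

definition enlarge :: "nat \<Rightarrow> complex \<Rightarrow> complex" where
  "enlarge h z =
     (let k = (THE k. 1 \<le> k \<and> k \<le> 2 * h \<and> z = rcis (cmod z) (real k * pi / real h))
      in rcis (cmod z) (real (if k \<le> h then k + 2 else k + 4) * pi / real (h + 2)))"

definition hat ::
    "(sign \<Rightarrow> 'a::euclidean_space set) \<Rightarrow> ('a \<Rightarrow> real) \<Rightarrow> ('a \<Rightarrow> 'a) \<Rightarrow> 'a \<Rightarrow> 'a dpoint" where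
  "hat \<Delta> c \<omega> x =
     (if plane_coord \<Delta> c \<omega> x = 0 then Origin x
      else Vertex (enlarge (cox_number \<Delta>) (plane_coord \<Delta> c \<omega> x)))"

text \<open>A labeled segment is represented by the set of its two endpoints, a diagram by a set of
  labeled segments.\<close>

definition neg_simple_diagram ::
    "(sign \<Rightarrow> 'a::euclidean_space set) \<Rightarrow> ('a \<Rightarrow> real) \<Rightarrow> ('a \<Rightarrow> 'a) \<Rightarrow> 'a set \<Rightarrow> 'a
      \<Rightarrow> 'a dpoint set set" where
  "neg_simple_diagram \<Delta> c \<omega> orb \<alpha> =
     {{hat \<Delta> c \<omega> x, hat \<Delta> c \<omega> (reflection \<alpha> x)} | x. x \<in> orb \<and> reflection \<alpha> x \<noteq> x}"

text \<open>The angle of the line \<open>L'\<^sub>\<epsilon>\<close>.\<close>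

primrec axis_angle :: "nat \<Rightarrow> sign \<Rightarrow> real" where
  "axis_angle h Pos = pi / real (h + 2)"
| "axis_angle h Neg = 2 * pi / real (h + 2)"

primrec tau_point ::
    "(sign \<Rightarrow> 'a::euclidean_space set) \<Rightarrow> sign \<Rightarrow> 'a dpoint \<Rightarrow> 'a dpoint" where
  "tau_point \<Delta> \<epsilon> (Vertex z) = Vertex (cis (2 * axis_angle (cox_number \<Delta>) \<epsilon>) * cnj z)"
| "tau_point \<Delta> \<epsilon> (Origin x) = Origin (cox_part \<Delta> \<epsilon> x)"

definition tau_segment ::
    "(sign \<Rightarrow> 'a::euclidean_space set) \<Rightarrow> sign \<Rightarrow> 'a dpoint set \<Rightarrow> 'a dpoint set" where
  "tau_segment \<Delta> \<epsilon> s =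
     (if \<exists>x z. s = {Origin x, Vertex z} \<and> orthogonal z (cis (axis_angle (cox_number \<Delta>) \<epsilon>))
      then s else tau_point \<Delta> \<epsilon> ` s)"

definition diagram_assignment ::
    "'a::euclidean_space set \<Rightarrow> (sign \<Rightarrow> 'a set) \<Rightarrow> ('a \<Rightarrow> real) \<Rightarrow> ('a \<Rightarrow> 'a) \<Rightarrow> 'a set
      \<Rightarrow> ('a \<Rightarrow> 'a dpoint set set) \<Rightarrow> bool" where
  "diagram_assignment \<Phi> \<Delta> c \<omega> orb D \<longleftrightarrow>
     D \<in> extensional (almost_positive_roots \<Phi> \<Delta>) \<and>
     (\<forall>\<alpha>\<in>simple_roots \<Delta>. D (- \<alpha>) = neg_simple_diagram \<Delta> c \<omega> orb \<alpha>) \<and>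
     (\<forall>\<epsilon>. \<forall>\<beta>\<in>almost_positive_roots \<Phi> \<Delta>. D (tau \<Delta> \<epsilon> \<beta>) = tau_segment \<Delta> \<epsilon> ` D \<beta>)"

definition diagram ::
    "'a::euclidean_space set \<Rightarrow> (sign \<Rightarrow> 'a set) \<Rightarrow> ('a \<Rightarrow> real) \<Rightarrow> ('a \<Rightarrow> 'a) \<Rightarrow> 'a set \<Rightarrow> 'a
      \<Rightarrow> 'a dpoint set set" where
  "diagram \<Phi> \<Delta> c \<omega> orb = (THE D. diagram_assignment \<Phi> \<Delta> c \<omega> orb D)"

definition crosses :: "'a dpoint set \<Rightarrow> 'a dpoint set \<Rightarrow> bool" where
  "crosses s t \<longleftrightarrow>
     rel_interior (convex hull (location ` s)) \<inter> rel_interior (convex hull (location ` t)) \<noteq> {}"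

definition coincide :: "'a dpoint set \<Rightarrow> 'a dpoint set \<Rightarrow> bool" where
  "coincide s t \<longleftrightarrow> location ` s = location ` t"


section \<open>The groups and their orbits\<close>

definition orbit_of :: "('a \<Rightarrow> 'a) set \<Rightarrow> 'a set \<Rightarrow> bool" where
  "orbit_of W orb \<longleftrightarrow> (\<exists>x. orb = (\<lambda>w. w x) ` W)"

definition symmetry_group :: "'a::euclidean_space set \<Rightarrow> ('a \<Rightarrow> 'a) set" where
  "symmetry_group Q = {f. orthogonal_transformation f \<and> f ` Q = Q}"

text \<open>In type A the elements of the orbit are the orthogonal projections of the standard basis
  vectors to the hyperplane of vectors with coordinate sum zero.\<close>

definition type_A :: "nat \<Rightarrow> ('a::euclidean_space \<Rightarrow> 'a) set \<Rightarrow> 'a set \<Rightarrow> bool" where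
  "type_A n W orb \<longleftrightarrow>
     n \<ge> 2 \<and> DIM('a) = n + 1 \<and>
     W = {f. linear f \<and> (\<exists>\<pi>. \<pi> permutes Basis \<and> (\<forall>b\<in>Basis. f b = \<pi> b))} \<and>
     orb = (\<lambda>b. b - (1 / real (n + 1)) *\<^sub>R \<Sum>Basis) ` Basis"

definition type_B :: "nat \<Rightarrow> ('a::euclidean_space \<Rightarrow> 'a) set \<Rightarrow> 'a set \<Rightarrow> bool" where
  "type_B n W orb \<longleftrightarrow>
     n \<ge> 2 \<and> DIM('a) = n \<and>
     W = {f. linear f \<and> (\<exists>\<pi> \<sigma>. \<pi> permutes Basis \<and>
            (\<forall>b\<in>Basis. \<sigma> b \<in> {1, -1::real} \<and> f b = \<sigma> b *\<^sub>R \<pi> b))} \<and>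
     orb = Basis \<union> uminus ` Basis"

definition regular_polygon :: "nat \<Rightarrow> 'a::euclidean_space set \<Rightarrow> bool" where
  "regular_polygon m Q \<longleftrightarrow>
     (\<exists>r u v. r > 0 \<and> norm u = 1 \<and> norm v = 1 \<and> u \<bullet> v = 0 \<and>
        Q = (\<lambda>k. r *\<^sub>R (cos (2 * pi * real k / real m) *\<^sub>R u
                      + sin (2 * pi * real k / real m) *\<^sub>R v)) ` {..<m})"

definition type_I2 :: "nat \<Rightarrow> ('a::euclidean_space \<Rightarrow> 'a) set \<Rightarrow> 'a set \<Rightarrow> bool" where
  "type_I2 m W orb \<longleftrightarrow>
     m \<ge> 3 \<and> DIM('a) = 2 \<and>
     (\<exists>Q. regular_polygon m Q \<and> W = symmetry_group Q) \<and>
     orbit_of W orb \<and> regular_polygon m orb"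

text \<open>The vertices of a regular icosahedron are, up to similarity, the cyclic permutations of
  \<open>(0, \<plusminus>1, \<plusminus>\<phi>)\<close>, where \<open>\<phi>\<close> is the golden ratio.\<close>

definition regular_icosahedron :: "'a::euclidean_space set \<Rightarrow> bool" where
  "regular_icosahedron Q \<longleftrightarrow>
     (\<exists>r u v w. r > 0 \<and> norm u = 1 \<and> norm v = 1 \<and> norm w = 1 \<and>
        u \<bullet> v = 0 \<and> v \<bullet> w = 0 \<and> w \<bullet> u = 0 \<and>
        Q = {r *\<^sub>R (s *\<^sub>R a + (t * ((1 + sqrt 5) / 2)) *\<^sub>R b) | s t a b.
               s \<in> {1, -1} \<and> t \<in> {1, -1} \<and> (a, b) \<in> {(u, v), (v, w), (w, u)}})"

definition type_H3 :: "('a::euclidean_space \<Rightarrow> 'a) set \<Rightarrow> 'a set \<Rightarrow> bool" where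
  "type_H3 W orb \<longleftrightarrow>
     DIM('a) = 3 \<and>
     (\<exists>Q. regular_icosahedron Q \<and> W = symmetry_group Q) \<and>
     orbit_of W orb \<and> regular_icosahedron orb"

end

theory Submission
  imports Defs "HOL-Combinatorics.Permutations"
begin

text \<open>In types A, B and \<open>I\<^sub>2\<close> every difference of two orbit points is a multiple of a root, so the
  positive roots order the orbit totally, \<open>e\<^sub>1 > \<dots> > e\<^sub>h\<close>. Consecutive differences are multiples of
  simple roots taken alternately from \<open>\<Delta>\<^sub>+\<close> and \<open>\<Delta>\<^sub>-\<close>, hence \<open>c\<^sub>+\<close> and \<open>c\<^sub>-\<close> exchange neighbours, and the
  projections of \<open>e\<^sub>1, \<dots>, e\<^sub>h\<close> zigzag through the \<open>h\<close>-gon; their monotonicity along \<open>\<lambda>\<close> and \<open>\<mu>\<close> forces the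
  angle \<open>\<pi>/h\<close>. Continue the zigzag to the vertices \<open>v\<^sub>0, \<dots>, v\<^bsub>h+1\<^esub>\<close> of the \<open>(h + 2)\<close>-gon. The diagram of
  an almost positive root \<open>\<beta>\<close> consists of the diagonals \<open>v\<^bsub>p-1\<^esub> v\<^bsub>q+1\<^esub>\<close> for all \<open>p, q\<close> such that \<open>e\<^sub>p - e\<^sub>q\<close> is
  a positive multiple of \<open>\<beta>\<close>. Such a diagonal with \<open>p < q\<close> crosses \<open>v\<^sub>i v\<^bsub>i+1\<^esub>\<close> if and only if \<open>p \<le> i < q\<close>, that
  is, if and only if the simple root of the step \<open>e\<^sub>i - e\<^bsub>i+1\<^esub>\<close> occurs in \<open>\<beta>\<close>. In type \<open>H\<^sub>3\<close> exactly one
  antipodal pair \<open>\<plusminus>f\<close> is not comparable; it sits in the middle of the chain and gives the origin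
  points.

  As noncrossing is invariant under \<open>\<tau>\<^sub>\<plusminus>\<close>, it is itself a compatibility relation. Uniqueness of that
  relation and of the diagrams holds because every \<open>\<tau>\<close>-orbit contains a negative simple root.\<close>

section \<open>Reflections and simple systems\<close>

text \<open>The index shift lets one formula serve both signs. For a negative simple root the pairs
  run backwards, from \<open>e (Suc i)\<close> to \<open>e i\<close>, and the formula returns the
  prescribed segment from \<open>V i\<close> to \<open>V (Suc i)\<close>; for a positive root the
  diagonal sticks out by one vertex at each end. Away from the ends of the chain, c_\<epsilon> moves
  the indices of the orbit points exactly as the reflection in L'_\<epsilon> moves the shifted
  indices of the vertices. The one clash is at the roots -\<alpha> with \<alpha> in
  \<open>\<Delta> (opp \<epsilon>)\<close>, which \<tau> fixes although c_\<epsilon> in general does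
  not. There a segment from \<open>V i\<close> to \<open>V (Suc i)\<close> is its own mirror image,
  and the two radii of type H3 are mirror images of each other although the labeled rule leaves both
  alone. So the unlabeled diagram is reflected in all cases, and crossing depends on it only.

  Nothing is read off from a classification: the simple system is arbitrary, roots match differences
  of orbit points up to positive factors, and the Coxeter number and the angle between \<lambda> and
  \<mu> are computed from the chain.\<close>

lemma linear_reflection: "linear (reflection \<alpha>)"
  by (rule linearI) (simp_all add: reflection_def algebra_simps add_divide_distrib inner_add_left)

lemma reflection_zero [simp]: "reflection 0 x = x"
  by (simp add: reflection_def)

lemma reflection_inner: "reflection \<alpha> x \<bullet> y = x \<bullet> reflection \<alpha> y"
  by (simp add: reflection_def inner_diff_left inner_diff_right inner_commute)

lemma reflection_reflection [simp]: "reflection \<alpha> (reflection \<alpha> x) = x"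
proof (cases "\<alpha> = 0")
  case False
  then have "\<alpha> \<bullet> \<alpha> \<noteq> 0" by simp
  then show ?thesis
    by (simp add: reflection_def inner_diff_left algebra_simps flip: scaleR_add_left)
qed simp

lemma norm_reflection [simp]: "norm (reflection \<alpha> x) = norm x"
  by (simp add: norm_eq_sqrt_inner reflection_inner)

lemma reflection_scaleR: "k \<noteq> 0 \<Longrightarrow> reflection (k *\<^sub>R \<alpha>) = reflection \<alpha>"
  by (rule ext) (simp add: reflection_def)

lemma reflection_minus [simp]: "reflection (- \<alpha>) = reflection \<alpha>"
  using reflection_scaleR[of "-1" \<alpha>] by simp

lemma reflection_self [simp]: "reflection \<alpha> \<alpha> = - \<alpha>"
proof (cases "\<alpha> = 0")
  case False
  then have "2 *\<^sub>R \<alpha> = (2 :: real) *\<^sub>R \<alpha>" "\<alpha> \<bullet> \<alpha> \<noteq> 0" by auto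
  then show ?thesis by (simp add: reflection_def scaleR_2)
qed simp

lemma reflection_fixed_iff: "\<alpha> \<noteq> 0 \<Longrightarrow> reflection \<alpha> x = x \<longleftrightarrow> x \<bullet> \<alpha> = 0"
  by (simp add: reflection_def)

lemma reflection_diff_swap:
  assumes "norm x = norm y"
  shows "reflection (x - y) x = y"
proof (cases "x = y")
  case False
  have "x \<bullet> x = y \<bullet> y" using assms by (simp add: norm_eq)
  then have "(x - y) \<bullet> (x - y) = 2 * (x \<bullet> (x - y))"
    by (simp add: inner_diff_left inner_diff_right inner_commute)
  moreover have "(x - y) \<bullet> (x - y) \<noteq> 0" using False by simp
  ultimately show ?thesis by (simp add: reflection_def)
qed simp

lemma reflection_swap:
  assumes "norm x = norm y" "x - y = k *\<^sub>R \<alpha>" "k \<noteq> 0"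
  shows "reflection \<alpha> x = y"
  using reflection_diff_swap[OF assms(1)] assms by (simp add: reflection_scaleR)

lemma reflection_commute:
  assumes "orthogonal \<alpha> \<beta>"
  shows "reflection \<alpha> \<circ> reflection \<beta> = reflection \<beta> \<circ> reflection \<alpha>"
proof (rule ext)
  have "\<alpha> \<bullet> \<beta> = 0" "\<beta> \<bullet> \<alpha> = 0" using assms by (auto simp: orthogonal_def inner_commute)
  then show "(reflection \<alpha> \<circ> reflection \<beta>) x = (reflection \<beta> \<circ> reflection \<alpha>) x" for x
    by (simp add: reflection_def inner_diff_left)
qed

text \<open>Reflections in pairwise orthogonal vectors commute, so the order of the fold is
  irrelevant, and each leaves the components along the other vectors alone; hence all components are
  reversed at once.\<close>

lemma fold_reflection:
  assumes "finite A" "pairwise orthogonal A"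
  shows "Finite_Set.fold (\<lambda>\<alpha> f. reflection \<alpha> \<circ> f) id A x
       = x - (\<Sum>\<alpha>\<in>A. (2 * (x \<bullet> \<alpha>) / (\<alpha> \<bullet> \<alpha>)) *\<^sub>R \<alpha>)"
  using assms
proof (induction A rule: finite_induct)
  case (insert \<alpha> A)
  interpret comp_fun_commute_on "insert \<alpha> A" "\<lambda>\<alpha> f. reflection \<alpha> \<circ> f"
  proof
    fix u v assume "u \<in> insert \<alpha> A" "v \<in> insert \<alpha> A"
    then have "u = v \<or> orthogonal u v" using insert.prems by (auto simp: pairwise_def)
    then show "(\<circ>) (reflection v) \<circ> (\<circ>) (reflection u) = (\<circ>) (reflection u) \<circ> (\<circ>) (reflection v)"
      using reflection_commute[of u v] by (auto simp: fun_eq_iff)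
  qed
  have ort: "\<beta> \<bullet> \<alpha> = 0" if "\<beta> \<in> A" for \<beta>
    using insert.prems insert.hyps that by (auto simp: pairwise_def orthogonal_def)
  have z: "(\<Sum>\<beta>\<in>A. (2 * (x \<bullet> \<beta>) / (\<beta> \<bullet> \<beta>)) *\<^sub>R \<beta>) \<bullet> \<alpha> = 0"
    by (simp add: inner_sum_left ort)
  have ih: "Finite_Set.fold (\<lambda>\<alpha> f. reflection \<alpha> \<circ> f) id A x
      = x - (\<Sum>\<alpha>\<in>A. (2 * (x \<bullet> \<alpha>) / (\<alpha> \<bullet> \<alpha>)) *\<^sub>R \<alpha>)"
    by (rule insert.IH) (use insert.prems in \<open>simp add: pairwise_insert\<close>)
  have "Finite_Set.fold (\<lambda>\<alpha> f. reflection \<alpha> \<circ> f) id (insert \<alpha> A)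
      = reflection \<alpha> \<circ> Finite_Set.fold (\<lambda>\<alpha> f. reflection \<alpha> \<circ> f) id A"
    using insert.hyps by (intro fold_insert) auto
  then have f: "Finite_Set.fold (\<lambda>\<alpha> f. reflection \<alpha> \<circ> f) id (insert \<alpha> A) x
      = reflection \<alpha> (x - (\<Sum>\<alpha>\<in>A. (2 * (x \<bullet> \<alpha>) / (\<alpha> \<bullet> \<alpha>)) *\<^sub>R \<alpha>))"
    by (simp only: o_apply ih)
  show ?case unfolding f using insert.hyps z
    by (simp add: reflection_def[of \<alpha>] inner_diff_left)
qed simp

lemma cox_part_eq:
  assumes "finite (\<Delta> \<epsilon>)" "pairwise orthogonal (\<Delta> \<epsilon>)"
  shows "cox_part \<Delta> \<epsilon> x = x - (\<Sum>\<alpha>\<in>\<Delta> \<epsilon>. (2 * (x \<bullet> \<alpha>) / (\<alpha> \<bullet> \<alpha>)) *\<^sub>R \<alpha>)"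
  unfolding cox_part_def by (rule fold_reflection[OF assms])

lemma opp_opp [simp]: "opp (opp \<epsilon>) = \<epsilon>"
  by (cases \<epsilon>) auto

lemma opp_neq [simp]: "opp \<epsilon> \<noteq> \<epsilon>" "\<epsilon> \<noteq> opp \<epsilon>"
  by (cases \<epsilon>; simp)+

locale root_setup =
  fixes W :: "('a::euclidean_space \<Rightarrow> 'a) set" and \<Phi> :: "'a set" and \<Delta> :: "sign \<Rightarrow> 'a set"
    and \<omega> :: "'a \<Rightarrow> 'a"
  assumes rs: "root_system W \<Phi>" and ss: "simple_system \<Phi> (simple_roots \<Delta>)"
    and bp: "bipartition \<Delta>" and du: "dual_to_unit_roots (simple_roots \<Delta>) \<omega>"
begin

abbreviation "B \<equiv> simple_roots \<Delta>"
abbreviation "cx \<equiv> cox_part \<Delta>"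
abbreviation "APR \<equiv> almost_positive_roots \<Phi> \<Delta>"

lemma B_subset: "B \<subseteq> \<Phi>" and indep: "independent B" and Phi_span: "\<Phi> \<subseteq> span B"
  using ss by (auto simp: simple_system_def)

lemma finite_B: "finite B"
  using indep by (rule independent_imp_finite)

lemma Delta_subset: "\<Delta> \<epsilon> \<subseteq> B"
  by (cases \<epsilon>) (auto simp: simple_roots_def)

lemma B_cases: "\<alpha> \<in> B \<Longrightarrow> \<alpha> \<in> \<Delta> \<epsilon> \<or> \<alpha> \<in> \<Delta> (opp \<epsilon>)"
  by (cases \<epsilon>) (auto simp: simple_roots_def)

lemma Delta_disj: "\<alpha> \<in> \<Delta> \<epsilon> \<Longrightarrow> \<alpha> \<notin> \<Delta> (opp \<epsilon>)"
  using bp by (cases \<epsilon>) (auto simp: bipartition_def)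

lemma finite_Delta: "finite (\<Delta> \<epsilon>)"
  using finite_subset[OF Delta_subset finite_B] .

lemma Delta_orth: "\<alpha> \<in> \<Delta> \<epsilon> \<Longrightarrow> \<beta> \<in> \<Delta> \<epsilon> \<Longrightarrow> \<alpha> \<noteq> \<beta> \<Longrightarrow> \<alpha> \<bullet> \<beta> = 0"
  using bp by (auto simp: bipartition_def pairwise_def orthogonal_def)

lemma cx_eq: "cx \<epsilon> x = x - (\<Sum>\<alpha>\<in>\<Delta> \<epsilon>. (2 * (x \<bullet> \<alpha>) / (\<alpha> \<bullet> \<alpha>)) *\<^sub>R \<alpha>)"
  using bp by (intro cox_part_eq finite_Delta) (simp add: bipartition_def)

lemma zero_notin: "0 \<notin> \<Phi>"
  using rs by (simp add: root_system_def)

lemma B_nonzero: "\<alpha> \<in> B \<Longrightarrow> \<alpha> \<noteq> 0"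
  using B_subset zero_notin by auto

lemma reflection_in_W: "\<alpha> \<in> \<Phi> \<Longrightarrow> reflection \<alpha> \<in> W"
  using rs by (simp add: root_system_def)

lemma reflection_Phi: "\<alpha> \<in> \<Phi> \<Longrightarrow> \<beta> \<in> \<Phi> \<Longrightarrow> reflection \<alpha> \<beta> \<in> \<Phi>"
  using rs by (auto simp: root_system_def)

lemma uminus_Phi: "\<beta> \<in> \<Phi> \<Longrightarrow> - \<beta> \<in> \<Phi>"
  using reflection_Phi[of \<beta> \<beta>] by simp

lemma Phi_parallel:
  assumes "\<alpha> \<in> \<Phi>" "k *\<^sub>R \<alpha> \<in> \<Phi>"
  shows "k = 1 \<or> k = -1"
proof -
  have ne: "\<alpha> \<noteq> 0" using assms zero_notin by auto
  then obtain \<beta> where \<beta>: "\<Phi> \<inter> span {\<alpha>} = {\<beta>, - \<beta>}"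
    using rs assms(1) unfolding root_system_def by blast
  have "\<alpha> \<in> {\<beta>, - \<beta>}" "k *\<^sub>R \<alpha> \<in> {\<beta>, - \<beta>}"
    using assms by (auto simp flip: \<beta> simp: span_base span_scale)
  then have "k *\<^sub>R \<alpha> = 1 *\<^sub>R \<alpha> \<or> k *\<^sub>R \<alpha> = (-1) *\<^sub>R \<alpha>" by auto
  then show ?thesis using ne by (simp only: scaleR_cancel_right) simp
qed

lemma omega_inner: "\<alpha> \<in> B \<Longrightarrow> \<beta> \<in> B \<Longrightarrow> \<beta> \<bullet> \<omega> \<alpha> = (if \<alpha> = \<beta> then norm \<beta> else 0)"
proof -
  assume a: "\<alpha> \<in> B" "\<beta> \<in> B"
  then have "\<omega> \<alpha> \<bullet> sgn \<beta> = (if \<alpha> = \<beta> then 1 else 0)"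
    using du by (simp add: dual_to_unit_roots_def)
  then show ?thesis using B_nonzero[OF a(2)]
    by (auto simp: sgn_div_norm inner_commute field_simps split: if_splits)
qed

lemma omega_span: "\<alpha> \<in> B \<Longrightarrow> \<omega> \<alpha> \<in> span B"
  using du by (simp add: dual_to_unit_roots_def)

text \<open>Pairing with the dual vectors reads off coefficients up to the positive factor
  \<open>norm \<alpha>\<close>. As only the sign or the vanishing of a coefficient matters later,
  \<open>z \<bullet> \<omega> \<alpha>\<close> replaces \<open>representation\<close> from here
  on.\<close>

lemma span_expand:
  assumes "z \<in> span B"
  shows "z = (\<Sum>\<alpha>\<in>B. (z \<bullet> \<omega> \<alpha> / norm \<alpha>) *\<^sub>R \<alpha>)" and
    "\<alpha> \<in> B \<Longrightarrow> representation B z \<alpha> = z \<bullet> \<omega> \<alpha> / norm \<alpha>"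
proof -
  have z: "z = (\<Sum>\<alpha>\<in>B. representation B z \<alpha> *\<^sub>R \<alpha>)"
    using sum_representation_eq[OF indep assms finite_B subset_refl] by simp
  have r: "representation B z \<alpha> = z \<bullet> \<omega> \<alpha> / norm \<alpha>" if "\<alpha> \<in> B" for \<alpha>
  proof -
    have "z \<bullet> \<omega> \<alpha> = (\<Sum>\<beta>\<in>B. representation B z \<beta> * (\<beta> \<bullet> \<omega> \<alpha>))"
      by (subst z) (simp add: inner_sum_left)
    also have "\<dots> = (\<Sum>\<beta>\<in>B. if \<alpha> = \<beta> then representation B z \<beta> * norm \<beta> else 0)"
      using that by (intro sum.cong) (auto simp: omega_inner)
    also have "\<dots> = representation B z \<alpha> * norm \<alpha>"
      using that finite_B by simp
    finally show ?thesis using B_nonzero[OF that] by simp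
  qed
  show "z = (\<Sum>\<alpha>\<in>B. (z \<bullet> \<omega> \<alpha> / norm \<alpha>) *\<^sub>R \<alpha>)"
    using z r by (metis (no_types, lifting) sum.cong)
  show "\<alpha> \<in> B \<Longrightarrow> representation B z \<alpha> = z \<bullet> \<omega> \<alpha> / norm \<alpha>" by (rule r)
qed

lemma span_eq_0: "z \<in> span B \<Longrightarrow> (\<And>\<alpha>. \<alpha> \<in> B \<Longrightarrow> z \<bullet> \<omega> \<alpha> = 0) \<Longrightarrow> z = 0"
  by (subst span_expand(1)) auto

lemma span_single:
  assumes "z \<in> span B" "\<alpha> \<in> B" "\<And>\<beta>. \<beta> \<in> B \<Longrightarrow> \<beta> \<noteq> \<alpha> \<Longrightarrow> z \<bullet> \<omega> \<beta> = 0"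
  shows "z = (z \<bullet> \<omega> \<alpha> / norm \<alpha>) *\<^sub>R \<alpha>"
proof -
  have "z = (\<Sum>\<beta>\<in>B. (z \<bullet> \<omega> \<beta> / norm \<beta>) *\<^sub>R \<beta>)" using span_expand(1)[OF assms(1)] .
  also have "\<dots> = (\<Sum>\<beta>\<in>{\<alpha>}. (z \<bullet> \<omega> \<beta> / norm \<beta>) *\<^sub>R \<beta>)"
    using assms finite_B by (intro sum.mono_neutral_right) auto
  finally show ?thesis by simp
qed

text \<open>\<open>x - y \<in> cone\<close> is the root order by which the orbit is sorted later; it
  makes sense also for differences that are not multiples of roots.\<close>

definition cone :: "'a set" where
  "cone = {z \<in> span B. \<forall>\<alpha>\<in>B. z \<bullet> \<omega> \<alpha> \<ge> 0}"

lemma cone_span: "z \<in> cone \<Longrightarrow> z \<in> span B" and cone_ge: "z \<in> cone \<Longrightarrow> \<alpha> \<in> B \<Longrightarrow> z \<bullet> \<omega> \<alpha> \<ge> 0"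
  by (auto simp: cone_def)

lemma cone_0 [simp]: "0 \<in> cone"
  by (simp add: cone_def span_zero)

lemma cone_add: "x \<in> cone \<Longrightarrow> y \<in> cone \<Longrightarrow> x + y \<in> cone"
  by (auto simp: cone_def inner_add_left span_add)

lemma cone_scale: "x \<in> cone \<Longrightarrow> k \<ge> 0 \<Longrightarrow> k *\<^sub>R x \<in> cone"
  by (auto simp: cone_def span_scale)

lemma cone_trans: "x - y \<in> cone \<Longrightarrow> y - z \<in> cone \<Longrightarrow> x - z \<in> cone"
  using cone_add[of "x - y" "y - z"] by simp

lemma cone_antisym: "x \<in> cone \<Longrightarrow> - x \<in> cone \<Longrightarrow> x = 0"
proof (rule span_eq_0)
  assume x: "x \<in> cone" "- x \<in> cone"
  show "x \<in> span B" using x by (simp add: cone_def)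
  fix \<alpha> assume "\<alpha> \<in> B"
  then show "x \<bullet> \<omega> \<alpha> = 0" using cone_ge[OF x(1)] cone_ge[OF x(2)] by force
qed

lemma B_cone: "\<alpha> \<in> B \<Longrightarrow> \<alpha> \<in> cone"
  by (auto simp: cone_def omega_inner span_base)

lemma rep_ge_iff:
  assumes "z \<in> span B" "\<alpha> \<in> B"
  shows "representation B z \<alpha> \<ge> 0 \<longleftrightarrow> z \<bullet> \<omega> \<alpha> \<ge> 0" "representation B z \<alpha> \<le> 0 \<longleftrightarrow> z \<bullet> \<omega> \<alpha> \<le> 0"
    "representation B z \<alpha> = 0 \<longleftrightarrow> z \<bullet> \<omega> \<alpha> = 0"
  using B_nonzero[OF assms(2)]
  by (simp_all add: span_expand(2)[OF assms] zero_le_divide_iff divide_le_0_iff)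

lemma positive_roots_eq: "positive_roots \<Phi> B = \<Phi> \<inter> cone"
  using Phi_span by (auto simp: positive_roots_def cone_def rep_ge_iff subset_iff)

lemma root_cases:
  assumes "\<beta> \<in> \<Phi>"
  shows "\<beta> \<in> cone \<or> - \<beta> \<in> cone"
proof -
  have s: "\<beta> \<in> span B" using assms Phi_span by auto
  have "(\<forall>\<alpha>\<in>B. representation B \<beta> \<alpha> \<ge> 0) \<or> (\<forall>\<alpha>\<in>B. representation B \<beta> \<alpha> \<le> 0)"
    using ss assms by (auto simp: simple_system_def)
  then show ?thesis using s by (auto simp: cone_def rep_ge_iff span_neg)
qed

text \<open>Expand \<open>z \<bullet> z > 0\<close> along the simple roots: some summand is
  positive, and since its coefficient is nonnegative, both of its factors are positive.\<close>

lemma cone_inner_pos: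
  assumes "z \<in> cone" "z \<noteq> 0"
  obtains \<alpha> where "\<alpha> \<in> B" "z \<bullet> \<alpha> > 0" "z \<bullet> \<omega> \<alpha> > 0"
proof -
  have "z \<bullet> z = z \<bullet> (\<Sum>\<alpha>\<in>B. (z \<bullet> \<omega> \<alpha> / norm \<alpha>) *\<^sub>R \<alpha>)"
    by (rule arg_cong[OF span_expand(1)[OF cone_span[OF assms(1)]]])
  also have "\<dots> = (\<Sum>\<alpha>\<in>B. (z \<bullet> \<omega> \<alpha> / norm \<alpha>) * (z \<bullet> \<alpha>))"
    by (simp add: inner_sum_right)
  finally have "z \<bullet> z = (\<Sum>\<alpha>\<in>B. (z \<bullet> \<omega> \<alpha> / norm \<alpha>) * (z \<bullet> \<alpha>))" .
  moreover have "z \<bullet> z > 0" using assms by simp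
  ultimately obtain \<alpha> where \<alpha>: "\<alpha> \<in> B" "(z \<bullet> \<omega> \<alpha> / norm \<alpha>) * (z \<bullet> \<alpha>) > 0"
    using sum_nonpos[of B "\<lambda>\<alpha>. (z \<bullet> \<omega> \<alpha> / norm \<alpha>) * (z \<bullet> \<alpha>)"] by (auto simp: not_less[symmetric])
  have "norm \<alpha> > 0" using B_nonzero \<alpha> by simp
  then have "(z \<bullet> \<omega> \<alpha>) * (z \<bullet> \<alpha>) > 0" using \<alpha>(2) by (simp add: zero_less_divide_iff)
  then have "z \<bullet> \<alpha> > 0 \<and> z \<bullet> \<omega> \<alpha> > 0"
    using cone_ge[OF assms(1) \<alpha>(1)] by (auto simp: zero_less_mult_iff)
  then show ?thesis using that \<alpha>(1) by blast
qed

text \<open>Up to the norms of the simple roots this is the height of a root. Being linear and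
  positive on the nonzero elements of \<open>cone\<close>, it can be used to sort and to
  minimise.\<close>

definition ht :: "'a \<Rightarrow> real" where "ht x = (\<Sum>\<alpha>\<in>B. x \<bullet> \<omega> \<alpha>)"

lemma ht_diff: "ht (x - y) = ht x - ht y"
  by (simp add: ht_def inner_diff_left sum_subtractf)

lemma ht_pos:
  assumes "z \<in> cone" "z \<noteq> 0"
  shows "ht z > 0"
proof -
  obtain \<alpha> where "\<alpha> \<in> B" "z \<bullet> \<omega> \<alpha> > 0" using cone_inner_pos[OF assms] by blast
  then show ?thesis unfolding ht_def
    using finite_B cone_ge[OF assms(1)] by (intro sum_pos2[of B \<alpha>]) auto
qed

lemma linear_cx: "linear (cx \<epsilon>)"
proof (rule linearI)
  fix x y :: 'a and k :: real
  have "(2 * ((x + y) \<bullet> \<alpha>) / (\<alpha> \<bullet> \<alpha>)) *\<^sub>R \<alpha>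
      = (2 * (x \<bullet> \<alpha>) / (\<alpha> \<bullet> \<alpha>)) *\<^sub>R \<alpha> + (2 * (y \<bullet> \<alpha>) / (\<alpha> \<bullet> \<alpha>)) *\<^sub>R \<alpha>" for \<alpha>
    by (simp add: inner_add_left add_divide_distrib ring_distribs flip: scaleR_add_left)
  then show "cx \<epsilon> (x + y) = cx \<epsilon> x + cx \<epsilon> y" by (simp add: cx_eq sum.distrib)
  show "cx \<epsilon> (k *\<^sub>R x) = k *\<^sub>R cx \<epsilon> x"
    by (simp add: cx_eq scaleR_sum_right scaleR_diff_right mult.left_commute)
qed

lemmas cx_add = linear_add[OF linear_cx] and cx_diff = linear_diff[OF linear_cx]
  and cx_scale = linear_scale[OF linear_cx] and cx_minus = linear_neg[OF linear_cx]
  and cx_sum = linear_sum[OF linear_cx]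

lemma cx_inner: "cx \<epsilon> x \<bullet> y = x \<bullet> cx \<epsilon> y"
proof -
  have "((2 * (x \<bullet> \<alpha>) / (\<alpha> \<bullet> \<alpha>)) *\<^sub>R \<alpha>) \<bullet> y = x \<bullet> ((2 * (y \<bullet> \<alpha>) / (\<alpha> \<bullet> \<alpha>)) *\<^sub>R \<alpha>)" for \<alpha>
    by (simp add: inner_commute)
  then show ?thesis
    by (simp only: cx_eq inner_diff_left inner_diff_right inner_sum_left inner_sum_right)
qed

lemma cx_root: 
  assumes "\<alpha> \<in> \<Delta> \<epsilon>"
  shows "cx \<epsilon> \<alpha> = - \<alpha>"
proof -
  have "(\<Sum>\<beta>\<in>\<Delta> \<epsilon>. (2 * (\<alpha> \<bullet> \<beta>) / (\<beta> \<bullet> \<beta>)) *\<^sub>R \<beta>) = (\<Sum>\<beta>\<in>{\<alpha>}. (2 * (\<alpha> \<bullet> \<beta>) / (\<beta> \<bullet> \<beta>)) *\<^sub>R \<beta>)"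
    using assms finite_Delta Delta_orth by (intro sum.mono_neutral_right) auto
  moreover have "\<alpha> \<bullet> \<alpha> \<noteq> 0" using B_nonzero Delta_subset assms by auto
  ultimately show ?thesis by (simp add: cx_eq scaleR_2)
qed

lemma cx_fix: "(\<And>\<alpha>. \<alpha> \<in> \<Delta> \<epsilon> \<Longrightarrow> x \<bullet> \<alpha> = 0) \<Longrightarrow> cx \<epsilon> x = x"
  by (simp add: cx_eq)

lemma cx_cx [simp]: "cx \<epsilon> (cx \<epsilon> x) = x"
proof -
  have "cx \<epsilon> (cx \<epsilon> x) = cx \<epsilon> x - (\<Sum>\<alpha>\<in>\<Delta> \<epsilon>. (2 * (x \<bullet> \<alpha>) / (\<alpha> \<bullet> \<alpha>)) *\<^sub>R cx \<epsilon> \<alpha>)"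
    by (subst (2) cx_eq) (simp add: cx_diff cx_sum cx_scale)
  also have "\<dots> = cx \<epsilon> x + (\<Sum>\<alpha>\<in>\<Delta> \<epsilon>. (2 * (x \<bullet> \<alpha>) / (\<alpha> \<bullet> \<alpha>)) *\<^sub>R \<alpha>)"
    by (simp add: cx_root sum_negf)
  also have "\<dots> = x" by (simp add: cx_eq)
  finally show ?thesis .
qed

lemma norm_cx [simp]: "norm (cx \<epsilon> x) = norm x"
  by (simp add: norm_eq_sqrt_inner cx_inner)

lemma cx_omega: "\<alpha> \<in> \<Delta> (opp \<epsilon>) \<Longrightarrow> cx \<epsilon> (\<omega> \<alpha>) = \<omega> \<alpha>"
proof (rule cx_fix)
  fix \<beta> assume a: "\<alpha> \<in> \<Delta> (opp \<epsilon>)" "\<beta> \<in> \<Delta> \<epsilon>"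
  then have "\<alpha> \<noteq> \<beta>" using Delta_disj by blast
  then show "\<omega> \<alpha> \<bullet> \<beta> = 0"
    using omega_inner[of \<alpha> \<beta>] a Delta_subset by (auto simp: inner_commute)
qed

lemma cx_coeff: "\<alpha> \<in> \<Delta> (opp \<epsilon>) \<Longrightarrow> cx \<epsilon> z \<bullet> \<omega> \<alpha> = z \<bullet> \<omega> \<alpha>"
  by (simp add: cx_inner cx_omega)

lemma cx_Phi:
  assumes "\<beta> \<in> \<Phi>"
  shows "cx \<epsilon> \<beta> \<in> \<Phi>"
proof -
  have "\<beta> - (\<Sum>\<alpha>\<in>A. (2 * (\<beta> \<bullet> \<alpha>) / (\<alpha> \<bullet> \<alpha>)) *\<^sub>R \<alpha>) \<in> \<Phi>"
    if "finite A" "A \<subseteq> \<Delta> \<epsilon>" for A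
    using that
  proof (induction A rule: finite_induct)
    case (insert \<alpha> A)
    have "\<gamma> \<bullet> \<alpha> = 0" if "\<gamma> \<in> A" for \<gamma>
      using that insert by (intro Delta_orth) auto
    then have z: "(\<Sum>\<gamma>\<in>A. (2 * (\<beta> \<bullet> \<gamma>) / (\<gamma> \<bullet> \<gamma>)) *\<^sub>R \<gamma>) \<bullet> \<alpha> = 0"
      by (simp add: inner_sum_left)
    have "\<alpha> \<in> \<Phi>" using insert.prems Delta_subset B_subset by blast
    then have "reflection \<alpha> (\<beta> - (\<Sum>\<alpha>\<in>A. (2 * (\<beta> \<bullet> \<alpha>) / (\<alpha> \<bullet> \<alpha>)) *\<^sub>R \<alpha>)) \<in> \<Phi>"
      using insert by (intro reflection_Phi) auto
    then show ?case using insert.hyps z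
      by (simp add: reflection_def inner_diff_left algebra_simps)
  qed (use assms in simp)
  then show ?thesis using finite_Delta by (simp add: cx_eq)
qed

lemma cx_span: "z \<in> span B \<Longrightarrow> cx \<epsilon> z \<in> span B"
  unfolding cx_eq using Delta_subset
  by (intro span_diff span_sum span_scale) (auto intro: span_base)

text \<open>Reflect in a simple root \<open>\<alpha>\<close> that occurs in \<open>\<beta>\<close>.
  The roots of one class are orthogonal, so the coefficient at \<open>\<alpha>\<close> is just
  negated while the others stay; a root has no mixed signs, hence no other simple root occurs and
  \<open>\<beta>\<close> is a multiple of \<open>\<alpha>\<close>.\<close>

lemma cone_root_single:
  assumes "\<beta> \<in> \<Phi>" "\<beta> \<in> cone" "\<And>\<alpha>. \<alpha> \<in> \<Delta> (opp \<epsilon>) \<Longrightarrow> \<beta> \<bullet> \<omega> \<alpha> = 0"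
  shows "\<beta> \<in> \<Delta> \<epsilon>"
proof -
  have "\<beta> \<noteq> 0" using assms zero_notin by auto
  then obtain \<alpha> where \<alpha>: "\<alpha> \<in> B" "\<beta> \<bullet> \<alpha> > 0" "\<beta> \<bullet> \<omega> \<alpha> > 0"
    using cone_inner_pos assms(2) by blast
  then have \<alpha>': "\<alpha> \<in> \<Delta> \<epsilon>" using B_cases assms(3) by force
  let ?g = "reflection \<alpha> \<beta>"
  have co: "?g \<bullet> \<omega> \<gamma> = \<beta> \<bullet> \<omega> \<gamma>" if "\<gamma> \<in> B" "\<gamma> \<noteq> \<alpha>" for \<gamma>
    using that \<alpha> by (simp add: reflection_def inner_diff_left omega_inner)
  have "\<beta> = (\<beta> \<bullet> \<omega> \<alpha> / norm \<alpha>) *\<^sub>R \<alpha>" 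
  proof (rule span_single)
    show "\<beta> \<in> span B" using assms(2) by (rule cone_span)
    fix \<gamma> assume \<gamma>: "\<gamma> \<in> B" "\<gamma> \<noteq> \<alpha>"
    show "\<beta> \<bullet> \<omega> \<gamma> = 0"
    proof (cases "\<gamma> \<in> \<Delta> \<epsilon>")
      case True
      have "?g \<in> \<Phi>" using reflection_Phi \<alpha> assms B_subset by auto
      moreover have "?g \<bullet> \<omega> \<alpha> < 0"
      proof -
        have "\<beta> \<bullet> \<alpha> = (\<Sum>\<gamma>\<in>B. (\<beta> \<bullet> \<omega> \<gamma> / norm \<gamma>) *\<^sub>R \<gamma>) \<bullet> \<alpha>"
          by (rule arg_cong[OF span_expand(1)[OF cone_span[OF assms(2)]]])
        also have "\<dots> = (\<Sum>\<gamma>\<in>B. (\<beta> \<bullet> \<omega> \<gamma> / norm \<gamma>) * (\<gamma> \<bullet> \<alpha>))"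
          by (simp add: inner_sum_left)
        also have "\<dots> = (\<Sum>\<gamma>\<in>{\<alpha>}. (\<beta> \<bullet> \<omega> \<gamma> / norm \<gamma>) * (\<gamma> \<bullet> \<alpha>))"
          using finite_B \<alpha> 
        proof (intro sum.mono_neutral_right ballI)
          fix \<gamma> assume g: "\<gamma> \<in> B - {\<alpha>}"
          show "(\<beta> \<bullet> \<omega> \<gamma> / norm \<gamma>) * (\<gamma> \<bullet> \<alpha>) = 0"
            using B_cases[of \<gamma> \<epsilon>] g assms(3)[of \<gamma>] Delta_orth[of \<gamma> \<epsilon> \<alpha>] \<alpha>' by auto
        qed auto
        finally have "\<beta> \<bullet> \<alpha> = (\<beta> \<bullet> \<omega> \<alpha>) * (\<alpha> \<bullet> \<alpha>) / norm \<alpha>" by simp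
        moreover have "\<alpha> \<bullet> \<alpha> \<noteq> 0" "norm \<alpha> \<noteq> 0" using B_nonzero \<alpha> by auto
        ultimately have "?g \<bullet> \<omega> \<alpha> = - (\<beta> \<bullet> \<omega> \<alpha>)"
          using \<alpha>(1) by (simp add: reflection_def inner_diff_left omega_inner field_simps)
        then show ?thesis using \<alpha> by simp
      qed
      ultimately have "- ?g \<in> cone" using root_cases cone_ge[OF _ \<alpha>(1)] by force
      then have "?g \<bullet> \<omega> \<gamma> \<le> 0" using cone_ge[OF _ \<gamma>(1)] by fastforce
      then show ?thesis using co[OF \<gamma>] cone_ge[OF assms(2) \<gamma>(1)] by simp
    next
      case False
      then show ?thesis using B_cases assms(3) \<gamma> by blast
    qed
  qed (use \<alpha> in auto)
  moreover have "\<beta> \<bullet> \<omega> \<alpha> / norm \<alpha> > 0" using \<alpha> B_nonzero by simp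
  ultimately have "\<beta> = \<alpha>"
  proof -
    assume a: "\<beta> = (\<beta> \<bullet> \<omega> \<alpha> / norm \<alpha>) *\<^sub>R \<alpha>" "\<beta> \<bullet> \<omega> \<alpha> / norm \<alpha> > 0"
    then have "\<beta> \<bullet> \<omega> \<alpha> / norm \<alpha> = 1 \<or> \<beta> \<bullet> \<omega> \<alpha> / norm \<alpha> = -1"
      using assms(1) \<alpha>(1) B_subset by (intro Phi_parallel[of \<alpha>]) auto
    then have "\<beta> \<bullet> \<omega> \<alpha> / norm \<alpha> = 1" using a(2) by linarith
    then show "\<beta> = \<alpha>" using a(1) by (simp only: scaleR_one)
  qed
  then show ?thesis using \<alpha>' by simp
qed

lemma APR_cases:
  assumes "\<beta> \<in> APR"
  obtains "\<beta> \<in> \<Phi>" "\<beta> \<in> cone" | \<alpha> where "\<alpha> \<in> B" "\<beta> = - \<alpha>"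
  using assms by (auto simp: almost_positive_roots_def positive_roots_eq)

lemma APR_Phi: "\<beta> \<in> APR \<Longrightarrow> \<beta> \<in> \<Phi>"
  by (erule APR_cases) (use B_subset uminus_Phi in auto)

lemma pos_APR: "\<beta> \<in> \<Phi> \<Longrightarrow> \<beta> \<in> cone \<Longrightarrow> \<beta> \<in> APR"
  by (auto simp: almost_positive_roots_def positive_roots_eq)

lemma neg_APR: "\<alpha> \<in> B \<Longrightarrow> - \<alpha> \<in> APR"
  by (auto simp: almost_positive_roots_def)

lemma neg_not_cone: "\<alpha> \<in> B \<Longrightarrow> - \<alpha> \<notin> cone"
  using cone_antisym[of \<alpha>] B_cone B_nonzero by auto

lemma tau_neg_opp: "\<alpha> \<in> \<Delta> (opp \<epsilon>) \<Longrightarrow> tau \<Delta> \<epsilon> (- \<alpha>) = - \<alpha>"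
  by (simp add: tau_def)

lemma tau_neg: "\<alpha> \<in> \<Delta> \<epsilon> \<Longrightarrow> tau \<Delta> \<epsilon> (- \<alpha>) = \<alpha>"
  using Delta_disj[of \<alpha> \<epsilon>] by (auto simp: tau_def cx_minus cx_root)

lemma tau_simple: "\<alpha> \<in> \<Delta> \<epsilon> \<Longrightarrow> tau \<Delta> \<epsilon> \<alpha> = - \<alpha>"
proof -
  assume a: "\<alpha> \<in> \<Delta> \<epsilon>"
  then have "\<alpha> \<in> cone" using B_cone Delta_subset by blast
  then have "\<alpha> \<notin> uminus ` \<Delta> (opp \<epsilon>)" using neg_not_cone Delta_subset by blast
  then show ?thesis using a by (simp add: tau_def cx_root)
qed

text \<open>The coefficients over \<open>\<Delta> (opp \<epsilon>)\<close> do not change under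
  \<open>cx \<epsilon>\<close>, and by \<open>cone_root_single\<close> one of them is positive; that
  decides the sign of the whole image root.\<close>

lemma tau_pos:
  assumes "\<beta> \<in> \<Phi>" "\<beta> \<in> cone" "\<beta> \<notin> \<Delta> \<epsilon>"
  shows "tau \<Delta> \<epsilon> \<beta> = cx \<epsilon> \<beta>" "cx \<epsilon> \<beta> \<in> \<Phi>" "cx \<epsilon> \<beta> \<in> cone"
proof -
  have "\<beta> \<notin> uminus ` \<Delta> (opp \<epsilon>)"
    using assms(2) neg_not_cone Delta_subset by auto
  then show "tau \<Delta> \<epsilon> \<beta> = cx \<epsilon> \<beta>" by (simp add: tau_def)
  show P: "cx \<epsilon> \<beta> \<in> \<Phi>" using assms(1) by (rule cx_Phi)
  obtain \<alpha> where \<alpha>: "\<alpha> \<in> \<Delta> (opp \<epsilon>)" "\<beta> \<bullet> \<omega> \<alpha> \<noteq> 0"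
    using cone_root_single assms by blast
  have aB: "\<alpha> \<in> B" using \<alpha> Delta_subset by auto
  have "cx \<epsilon> \<beta> \<bullet> \<omega> \<alpha> > 0" using \<alpha> cone_ge[OF assms(2) aB] by (simp add: cx_coeff)
  then have "- cx \<epsilon> \<beta> \<notin> cone" using cone_ge[OF _ aB] by fastforce
  then show "cx \<epsilon> \<beta> \<in> cone" using root_cases[OF P] by blast
qed

lemma tau_APR:
  assumes "\<beta> \<in> APR"
  shows "tau \<Delta> \<epsilon> \<beta> \<in> APR" "tau \<Delta> \<epsilon> (tau \<Delta> \<epsilon> \<beta>) = \<beta>"
proof -
  have "tau \<Delta> \<epsilon> \<beta> \<in> APR \<and> tau \<Delta> \<epsilon> (tau \<Delta> \<epsilon> \<beta>) = \<beta>"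
    using assms
  proof (cases rule: APR_cases)
    case 1
    show ?thesis
    proof (cases "\<beta> \<in> \<Delta> \<epsilon>")
      case True
      then have "\<beta> \<in> B" using Delta_subset by blast
      then show ?thesis using True by (simp add: tau_simple tau_neg neg_APR)
    next
      case False
      note t = tau_pos[OF 1 False]
      have "cx \<epsilon> \<beta> \<notin> \<Delta> \<epsilon>"
      proof
        assume "cx \<epsilon> \<beta> \<in> \<Delta> \<epsilon>"
        then have "\<beta> = - cx \<epsilon> \<beta>" using cx_root cx_cx by metis
        then show False using 1 t cone_antisym zero_notin by metis
      qed
      then show ?thesis using t tau_pos[OF t(2,3)] pos_APR by simp
    qed
  next
    case (2 \<alpha>)
    then consider "\<alpha> \<in> \<Delta> \<epsilon>" | "\<alpha> \<in> \<Delta> (opp \<epsilon>)" using B_cases by blast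
    then show ?thesis
      by cases (use 2 assms in \<open>auto simp: tau_neg tau_simple tau_neg_opp pos_APR B_cone B_subset[THEN subsetD]\<close>)
  qed
  then show "tau \<Delta> \<epsilon> \<beta> \<in> APR" "tau \<Delta> \<epsilon> (tau \<Delta> \<epsilon> \<beta>) = \<beta>" by auto
qed

text \<open>The equation says \<open>cx Pos z = cx Neg z\<close>. The displacement
  \<open>cx Pos z - z\<close> has no coefficients over \<open>\<Delta> Neg\<close>, and
  \<open>cx Neg z - z\<close> has none over \<open>\<Delta> Pos\<close>; being equal, both vanish,
  and \<open>z\<close> is orthogonal to every simple root.\<close>

lemma cx_both_fixed:
  assumes "z \<in> span B" "cx Neg (cx Pos z) = z"
  shows "z = 0"
proof -
  have e: "cx Pos z = cx Neg z" using assms(2) cx_cx by metis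
  have "cx \<epsilon> z - z = 0" for \<epsilon>
  proof (rule span_eq_0)
    show "cx \<epsilon> z - z \<in> span B" using assms cx_span span_diff by blast
    fix \<alpha> assume "\<alpha> \<in> B"
    then consider "\<alpha> \<in> \<Delta> Pos" | "\<alpha> \<in> \<Delta> Neg" by (auto simp: simple_roots_def)
    then show "(cx \<epsilon> z - z) \<bullet> \<omega> \<alpha> = 0"
      using e cx_coeff[of \<alpha> Neg z] cx_coeff[of \<alpha> Pos z]
      by cases (cases \<epsilon>; simp add: inner_diff_left)+
  qed
  then have "z \<bullet> \<alpha> = 0" if "\<alpha> \<in> \<Delta> \<epsilon>" for \<alpha> \<epsilon>
    using cx_inner[of \<epsilon> z \<alpha>] cx_root[OF that] by simp
  then have "\<forall>\<alpha>\<in>B. z \<bullet> \<alpha> = 0" by (auto simp: simple_roots_def)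
  then have "\<forall>y\<in>span B. z \<bullet> y = 0"
    by (metis orthogonal_def orthogonal_to_span orthogonal_commute)
  then have "z \<bullet> z = 0" using assms(1) by blast
  then show ?thesis by simp
qed

text \<open>On a \<open>\<tau>\<close>-stable set of positive roots the \<open>\<tau>\<close>s act as \<open>c\<^sub>\<plusminus>\<close>, and the sum of a root over the
  powers of the Coxeter element would be a nonzero vector fixed by it.\<close>

lemma tau_closed_empty:
  assumes "X \<subseteq> APR" "\<And>\<epsilon> \<beta>. \<beta> \<in> X \<Longrightarrow> tau \<Delta> \<epsilon> \<beta> \<in> X" "X \<inter> uminus ` B = {}"
    and "h > 0" "(cox_element \<Delta>) ^^ h = id"
  shows "X = {}"
proof (rule ccontr)
  assume "X \<noteq> {}"
  then obtain \<beta> where \<beta>: "\<beta> \<in> X" by auto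
  let ?c = "cox_element \<Delta>"
  have pos: "\<gamma> \<in> \<Phi>" "\<gamma> \<in> cone" if "\<gamma> \<in> X" for \<gamma>
    using that assms(1,3) by (auto elim!: APR_cases simp: subset_iff)
  have tau: "cx \<epsilon> \<gamma> \<in> X" if "\<gamma> \<in> X" for \<epsilon> \<gamma>
  proof -
    have "\<gamma> \<notin> \<Delta> \<epsilon>"
    proof
      assume g: "\<gamma> \<in> \<Delta> \<epsilon>"
      then have "- \<gamma> \<in> X" using assms(2)[OF that, of \<epsilon>] by (simp add: tau_simple)
      then show False using assms(3) g Delta_subset by blast
    qed
    then show ?thesis using tau_pos(1) pos that assms(2) by metis
  qed
  have inX: "(?c ^^ k) \<beta> \<in> X" for k
    by (induction k) (use \<beta> tau in \<open>auto simp: cox_element_def\<close>)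
  have lin: "linear ?c" unfolding cox_element_def by (intro linear_compose linear_cx)
  define S where "S = (\<Sum>k<h. (?c ^^ k) \<beta>)"
  have "?c S = (\<Sum>k<h. (?c ^^ Suc k) \<beta>)" by (simp add: S_def linear_sum[OF lin])
  also have "\<dots> = S + (?c ^^ h) \<beta> - (?c ^^ 0) \<beta>"
  proof -
    have "(\<Sum>k<Suc h. (?c ^^ k) \<beta>) = (?c ^^ 0) \<beta> + (\<Sum>k<h. (?c ^^ Suc k) \<beta>)"
      by (rule sum.lessThan_Suc_shift)
    then show ?thesis by (simp add: S_def)
  qed
  also have "\<dots> = S" using assms(5) by simp
  finally have "cx Neg (cx Pos S) = S" by (simp add: cox_element_def)
  moreover have "S \<in> span B" unfolding S_def using inX pos cone_span by (intro span_sum) auto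
  ultimately have "S = 0" using cx_both_fixed by blast
  then have "ht S = 0" by (simp add: ht_def)
  moreover have "ht S = (\<Sum>k<h. ht ((?c ^^ k) \<beta>))"
    unfolding ht_def S_def by (simp only: inner_sum_left) (rule sum.swap)
  moreover have "ht ((?c ^^ k) \<beta>) > 0" for k
    using ht_pos[OF pos(2)[OF inX]] pos(1)[OF inX] zero_notin by metis
  then have "(\<Sum>k<h. ht ((?c ^^ k) \<beta>)) > 0" using \<open>h > 0\<close> by (intro sum_pos) auto
  ultimately show False by simp
qed

text \<open>Both \<tau> are involutions of the almost positive roots, so the counterexamples form a
  \<tau>-stable set; containing no negative simple root, it is empty.\<close>

lemma tau_induct [consumes 3, case_names neg tau]:
  assumes "\<beta> \<in> APR" and h: "h > 0" "(cox_element \<Delta>) ^^ h = id"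
    and neg: "\<And>\<alpha>. \<alpha> \<in> B \<Longrightarrow> P (- \<alpha>)"
    and step: "\<And>\<epsilon> \<beta>. \<beta> \<in> APR \<Longrightarrow> P \<beta> \<Longrightarrow> P (tau \<Delta> \<epsilon> \<beta>)"
  shows "P \<beta>"
proof -
  have "{\<beta> \<in> APR. \<not> P \<beta>} = {}"
  proof (rule tau_closed_empty[OF _ _ _ h])
    fix \<epsilon> \<beta> assume b: "\<beta> \<in> {\<beta> \<in> APR. \<not> P \<beta>}"
    then have "\<not> P (tau \<Delta> \<epsilon> \<beta>)"
      using step[of "tau \<Delta> \<epsilon> \<beta>" \<epsilon>] tau_APR[of \<beta> \<epsilon>] by auto
    then show "tau \<Delta> \<epsilon> \<beta> \<in> {\<beta> \<in> APR. \<not> P \<beta>}" using b tau_APR by blast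
  qed (use neg in auto)
  then show ?thesis using assms(1) by blast
qed

end

section \<open>Crossing segments\<close>

text \<open>The action of \<open>tau_point\<close> on locations, with a free parameter in place of
  the Coxeter number, whose value is found only later.\<close>

definition refl_axis :: "nat \<Rightarrow> sign \<Rightarrow> complex \<Rightarrow> complex" where
  "refl_axis h \<epsilon> z = cis (2 * axis_angle h \<epsilon>) * cnj z"

lemma linear_refl_axis: "linear (refl_axis h \<epsilon>)"
  by (rule linearI) (simp_all add: refl_axis_def algebra_simps scaleR_conv_of_real)

lemma refl_axis_invol [simp]: "refl_axis h \<epsilon> (refl_axis h \<epsilon> z) = z"
  by (simp add: refl_axis_def cis_mult cis_cnj flip: mult.assoc)

lemma inj_refl_axis: "inj (refl_axis h \<epsilon>)"
  by (metis injI refl_axis_invol)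

definition meet :: "complex set \<Rightarrow> complex set \<Rightarrow> bool" where
  "meet S T \<longleftrightarrow> rel_interior (convex hull S) \<inter> rel_interior (convex hull T) \<noteq> {}"

lemma crosses_meet: "crosses s t \<longleftrightarrow> meet (location ` s) (location ` t)"
  by (simp add: crosses_def meet_def)

lemma meet_image:
  assumes "linear f" "inj f"
  shows "meet (f ` S) (f ` T) \<longleftrightarrow> meet S T"
proof -
  have "rel_interior (convex hull (f ` S)) = f ` rel_interior (convex hull S)" for S
    using rel_interior_injective_linear_image[of f "convex hull S"] assms
    by (simp only: convex_hull_linear_image linear_conv_bounded_linear)
  then show ?thesis using assms(2)
    by (simp add: meet_def image_Int[symmetric])
qed

lemma rel_interior_pair:
  fixes x y :: "'a::euclidean_space"
  shows "x \<noteq> y \<Longrightarrow> rel_interior (convex hull {x, y}) = open_segment x y"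
  by (simp add: rel_interior_closed_segment flip: segment_convex_hull)

lemma meet_pair:
  "x \<noteq> y \<Longrightarrow> z \<noteq> w \<Longrightarrow> meet {x, y} {z, w} \<longleftrightarrow> open_segment x y \<inter> open_segment z w \<noteq> {}"
  by (simp add: meet_def rel_interior_pair)

lemma open_segment_inner:
  fixes x y a :: "'a::euclidean_space"
  assumes "z \<in> open_segment x y"
  obtains t where "0 < t" "t < 1" "z = (1 - t) *\<^sub>R x + t *\<^sub>R y" 
    "z \<bullet> a = (1 - t) * (x \<bullet> a) + t * (y \<bullet> a)"
  using assms by (auto simp: in_segment inner_add_left)

lemma open_segment_inner_less:
  fixes x y a :: "'a::euclidean_space"
  assumes "z \<in> open_segment x y" "x \<bullet> a \<le> C" "y \<bullet> a \<le> C" "x \<bullet> a < C \<or> y \<bullet> a < C"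
  shows "z \<bullet> a < C"
proof -
  obtain t where t: "0 < t" "t < 1" "z \<bullet> a = (1 - t) * (x \<bullet> a) + t * (y \<bullet> a)"
    using open_segment_inner[OF assms(1)] by metis
  have "(1 - t) * (x \<bullet> a) \<le> (1 - t) * C" "t * (y \<bullet> a) \<le> t * C" using t assms by simp_all
  moreover have "(1 - t) * (x \<bullet> a) < (1 - t) * C \<or> t * (y \<bullet> a) < t * C" using t assms by auto
  moreover have "(1 - t) * C + t * C = C" by (simp add: algebra_simps)
  ultimately show ?thesis using t(3) by linarith
qed

lemma open_segment_inner_ge:
  fixes x y a :: "'a::euclidean_space"
  assumes "z \<in> open_segment x y" "x \<bullet> a \<ge> C" "y \<bullet> a \<ge> C"
  shows "z \<bullet> a \<ge> C"
proof -
  obtain t where t: "0 < t" "t < 1" "z \<bullet> a = (1 - t) * (x \<bullet> a) + t * (y \<bullet> a)"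
    using open_segment_inner[OF assms(1)] by metis
  have "(1 - t) * C \<le> (1 - t) * (x \<bullet> a)" "t * C \<le> t * (y \<bullet> a)" using t assms by simp_all
  moreover have "(1 - t) * C + t * C = C" by (simp add: algebra_simps)
  ultimately show ?thesis using t(3) by linarith
qed

text \<open>Strictness at one endpoint of the first segment is enough, because it passes to all
  points of its relative interior. So segments that share an endpoint are covered as well.\<close>

lemma not_meet_separated:
  assumes "x \<noteq> y" "z \<noteq> w" "x \<bullet> a \<le> C" "y \<bullet> a \<le> C" "x \<bullet> a < C \<or> y \<bullet> a < C" "z \<bullet> a \<ge> C" "w \<bullet> a \<ge> C"
  shows "\<not> meet {x, y} {z, w}" "\<not> meet {z, w} {x, y}"
proof -
  have "open_segment x y \<inter> open_segment z w = {}"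
    using open_segment_inner_less[OF _ assms(3-5)] open_segment_inner_ge[OF _ assms(6,7)] by fastforce
  then show "\<not> meet {x, y} {z, w}" "\<not> meet {z, w} {x, y}"
    using assms by (simp_all add: meet_pair Int_commute)
qed

lemma cross_level:
  fixes x y :: complex
  assumes "cmod x \<le> r" "cmod y \<le> r" "x \<bullet> a > C" "y \<bullet> a < C"
  obtains z where "z \<in> open_segment x y" "z \<bullet> a = C" "cmod z < r"
proof -
  define t where "t = (x \<bullet> a - C) / (x \<bullet> a - y \<bullet> a)"
  define z where "z = (1 - t) *\<^sub>R x + t *\<^sub>R y"
  have t: "0 < t" "t < 1" using assms by (auto simp: t_def field_simps)
  have ne: "x \<noteq> y" using assms by auto
  then have z: "z \<in> open_segment x y" using t by (auto simp: in_segment z_def)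
  have "t * (x \<bullet> a - y \<bullet> a) = x \<bullet> a - C" using assms by (simp add: t_def)
  then have "z \<bullet> a = C" by (simp add: z_def inner_add_left algebra_simps)
  moreover have "cmod z < r"
    using dist_decreases_open_segment[OF z, of 0] assms(1,2) by auto
  ultimately show ?thesis using that z by blast
qed

text \<open>In coordinates along \<open>a\<close> and the perpendicular \<open>b\<close>, points of
  norm \<open>r\<close> at height \<open>C\<close> differ only in the sign of their second
  coordinate, by Pythagoras; a point at the same height inside the circle has a smaller one in
  absolute value and lies between them.\<close>

lemma chord_level:
  fixes w w' z :: complex
  assumes "cmod a = 1" "cmod w = r" "cmod w' = r" "w \<bullet> a = C" "w' \<bullet> a = C" "w \<noteq> w'"
    and "z \<bullet> a = C" "cmod z < r"
  shows "z \<in> open_segment w w'"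
proof -
  define b where "b = \<i> * a"
  have na: "Re a * Re a + Im a * Im a = 1" 
    using assms(1) by (metis cmod_power2 one_power2 power2_eq_square)
  have ex: "u = C *\<^sub>R a + (u \<bullet> b) *\<^sub>R b" if "u \<bullet> a = C" for u
  proof (rule complex_eqI)
    have C: "C = Re u * Re a + Im u * Im a" using that by (simp add: inner_complex_def)
    have "Re (C *\<^sub>R a + (u \<bullet> b) *\<^sub>R b) = Re u * (Re a * Re a + Im a * Im a)"
      by (simp add: C b_def inner_complex_def algebra_simps)
    then show "Re u = Re (C *\<^sub>R a + (u \<bullet> b) *\<^sub>R b)" by (simp add: na)
    have "Im (C *\<^sub>R a + (u \<bullet> b) *\<^sub>R b) = Im u * (Re a * Re a + Im a * Im a)"
      by (simp add: C b_def inner_complex_def algebra_simps)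
    then show "Im u = Im (C *\<^sub>R a + (u \<bullet> b) *\<^sub>R b)" by (simp add: na)
  qed
  have nrm: "(cmod u)\<^sup>2 = C\<^sup>2 + (u \<bullet> b)\<^sup>2" if "u \<bullet> a = C" for u
  proof -
    have C: "C = Re u * Re a + Im u * Im a" using that by (simp add: inner_complex_def)
    have "C\<^sup>2 + (u \<bullet> b)\<^sup>2 = (cmod u)\<^sup>2 * (Re a * Re a + Im a * Im a)"
      unfolding cmod_power2 by (simp add: C b_def inner_complex_def power2_eq_square algebra_simps)
    then show ?thesis by (simp add: na)
  qed
  have eq: "(w \<bullet> b)\<^sup>2 = (w' \<bullet> b)\<^sup>2" using nrm[of w] nrm[of w'] assms by simp
  have "w \<bullet> b \<noteq> w' \<bullet> b" using ex[of w] ex[of w'] assms by metis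
  then have w': "w' \<bullet> b = - (w \<bullet> b)" using eq by (simp add: power2_eq_iff)
  have "(cmod z)\<^sup>2 < (cmod w)\<^sup>2" using assms by (simp add: power_strict_mono)
  then have lt: "\<bar>z \<bullet> b\<bar> < \<bar>w \<bullet> b\<bar>" using nrm[of z] nrm[of w] assms
    abs_le_square_iff[of "w \<bullet> b" "z \<bullet> b"] by linarith
  define t where "t = (w \<bullet> b - z \<bullet> b) / (2 * (w \<bullet> b))"
  have t: "0 < t" "t < 1" using lt by (auto simp: t_def field_simps abs_if split: if_splits)
  have "(1 - t) * (w \<bullet> b) + t * (w' \<bullet> b) = z \<bullet> b"
    using lt by (simp add: w' t_def field_simps)
  moreover have "(1 - t) *\<^sub>R (C *\<^sub>R a + p *\<^sub>R b) + t *\<^sub>R (C *\<^sub>R a + q *\<^sub>R b)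
      = C *\<^sub>R a + ((1 - t) * p + t * q) *\<^sub>R b" for p q
    by (simp add: algebra_simps)
  ultimately have "z = (1 - t) *\<^sub>R w + t *\<^sub>R w'"
    using ex[OF assms(7)] ex[OF assms(4)] ex[OF assms(5)] by metis
  then show ?thesis using t assms(6) by (auto simp: in_segment)
qed

lemma chords_meet:
  fixes x y :: complex
  assumes "cmod a = 1" "cmod w = r" "cmod w' = r" "w \<bullet> a = C" "w' \<bullet> a = C" "w \<noteq> w'"
    and "cmod x \<le> r" "cmod y \<le> r" "x \<bullet> a > C" "y \<bullet> a < C"
  shows "meet {x, y} {w, w'}"
proof -
  obtain z where "z \<in> open_segment x y" "z \<bullet> a = C" "cmod z < r"
    using cross_level assms(7-) by metis
  moreover have "x \<noteq> y" using assms by auto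
  ultimately show ?thesis using chord_level[OF assms(1-6)] assms(6) by (auto simp: meet_pair)
qed

text \<open>The chord hits the diameter through \<open>w\<close> at a point inside the circle. This
  is not the centre, since a chord through the centre has antipodal ends, so it lies in the relative
  interior of one of the two radii.\<close>

lemma chord_radius_meet:
  fixes x y :: complex
  assumes "cmod a = 1" "cmod w = r" "w \<bullet> a = 0" "cmod x = r" "cmod y = r" "x \<noteq> - y"
    and "x \<bullet> a > 0" "y \<bullet> a < 0"
  shows "meet {x, y} {0, w} \<or> meet {x, y} {0, - w}"
proof -
  obtain z where z: "z \<in> open_segment x y" "z \<bullet> a = 0" "cmod z < r"
    using cross_level[of x r y 0 a] assms by auto
  have r: "r > 0" using z(3) norm_ge_zero[of z] by linarith
  have z0: "z \<noteq> 0"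
  proof
    assume "z = 0"
    then obtain t where t: "0 < t" "t < 1" "0 = (1 - t) *\<^sub>R x + t *\<^sub>R y"
      using z(1) by (auto simp: in_segment)
    then have "(1 - t) *\<^sub>R x = - (t *\<^sub>R y)" by (simp add: eq_neg_iff_add_eq_0)
    then have "norm ((1 - t) *\<^sub>R x) = norm (t *\<^sub>R y)" by simp
    then have "(1 - t) * r = t * r" using t assms by simp
    then have t2: "t = 1 / 2" using r by simp
    then have "0 = (1/2) *\<^sub>R x + (1/2) *\<^sub>R y" using t(3) unfolding t2 by simp
    then have "2 *\<^sub>R ((1/2) *\<^sub>R x + (1/2) *\<^sub>R y) = 0" by (simp only: scaleR_zero_right)
    then have "x + y = 0" unfolding scaleR_add_right by simp
    then show False using assms(6) by (simp add: eq_neg_iff_add_eq_0)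
  qed
  have w: "w \<noteq> - w" using assms r by auto
  have "z \<in> open_segment w (- w)"
    using chord_level[of a w r "- w" 0 z] assms w z by simp
  then obtain t where t: "0 < t" "t < 1" "z = (1 - t) *\<^sub>R w + t *\<^sub>R (- w)" by (auto simp: in_segment)
  then have "z = ((1 - t) - t) *\<^sub>R w" by (simp only: scaleR_left_diff_distrib scaleR_minus_right) simp
  then have z': "z = (1 - 2 * t) *\<^sub>R w" by simp
  have xy: "x \<noteq> y" using assms by auto
  have w0: "0 \<noteq> w" "0 \<noteq> - w" using r assms by auto
  consider "1 - 2 * t > 0" | "1 - 2 * t < 0" using z' z0 by fastforce
  then show ?thesis
  proof cases
    case 1
    then have "z \<in> open_segment 0 w" using t z' w0 by (auto simp: in_segment intro!: exI[of _ "1 - 2 * t"])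
    then show ?thesis using z(1) xy w0 by (auto simp: meet_pair)
  next
    case 2
    then have "z \<in> open_segment 0 (- w)" using t z' w0
      by (auto simp: in_segment algebra_simps intro!: exI[of _ "2 * t - 1"])
    then show ?thesis using z(1) xy w0 by (auto simp: meet_pair)
  qed
qed

section \<open>Reduction of the theorem to properties of a candidate for the diagrams\<close>

context root_setup
begin

text \<open>Separates the candidate \<open>D\<close> from the definite descriptions:
  \<open>neg\<close> and \<open>tau\<close> identify it with \<open>diagram\<close>, while
  \<open>loc\<close> and \<open>cr\<close> turn noncrossing into a compatibility relation. The rule
  \<open>loc\<close> is not a consequence of \<open>tau\<close>, because \<open>tau_segment\<close>
  leaves certain origin segments in place instead of reflecting them.\<close>

lemma assembly:
  fixes D :: "'a \<Rightarrow> 'a dpoint set set"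
  assumes h: "h > 0" "(cox_element \<Delta>) ^^ h = id"
    and neg: "\<And>\<alpha>. \<alpha> \<in> B \<Longrightarrow> D (- \<alpha>) = neg_simple_diagram \<Delta> c \<omega> orb \<alpha>"
    and tau: "\<And>\<beta> \<epsilon>. \<beta> \<in> APR \<Longrightarrow> D (tau \<Delta> \<epsilon> \<beta>) = tau_segment \<Delta> \<epsilon> ` D \<beta>"
    and loc: "\<And>\<beta> \<epsilon>. \<beta> \<in> APR \<Longrightarrow>
      (\<lambda>s. location ` s) ` D (tau \<Delta> \<epsilon> \<beta>) = (\<lambda>s. refl_axis h \<epsilon> ` location ` s) ` D \<beta>"
    and cr: "\<And>\<beta> \<alpha>. \<beta> \<in> APR \<Longrightarrow> \<alpha> \<in> B \<Longrightarrow> \<beta> \<noteq> - \<alpha> \<Longrightarrow>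
      (\<forall>s\<in>D \<beta>. \<forall>t\<in>D (- \<alpha>). crosses s t \<longrightarrow> coincide s t) \<longleftrightarrow> \<beta> \<bullet> \<omega> \<alpha> = 0"
    and "\<beta> \<in> APR" "\<gamma> \<in> APR" "\<beta> \<noteq> \<gamma>"
  shows "compatible_roots \<Phi> \<Delta> \<beta> \<gamma> \<longleftrightarrow>
    (\<forall>s\<in>diagram \<Phi> \<Delta> c \<omega> orb \<beta>. \<forall>t\<in>diagram \<Phi> \<Delta> c \<omega> orb \<gamma>. crosses s t \<longrightarrow> coincide s t)"
proof -
  have "diagram_assignment \<Phi> \<Delta> c \<omega> orb (restrict D APR)"
    using neg tau tau_APR(1) by (simp add: diagram_assignment_def neg_APR)
  moreover have "E = restrict D APR" if E: "diagram_assignment \<Phi> \<Delta> c \<omega> orb E" for E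
  proof (rule extensionalityI)
    show "E \<in> extensional APR" using E by (simp add: diagram_assignment_def)
    fix \<beta> assume b: "\<beta> \<in> APR"
    then show "E \<beta> = restrict D APR \<beta>"
    proof (induction rule: tau_induct[OF b h])
      case (1 \<alpha>)
      then show ?case using E neg by (simp add: diagram_assignment_def neg_APR)
    next
      case (2 \<epsilon> \<beta>)
      then show ?case using E tau tau_APR(1) by (simp add: diagram_assignment_def)
    qed
  qed simp
  ultimately have diag: "diagram \<Phi> \<Delta> c \<omega> orb = restrict D APR"
    unfolding diagram_def by (rule the_equality)
  define NC where "NC \<beta> \<gamma> \<longleftrightarrow> (\<forall>s\<in>D \<beta>. \<forall>t\<in>D \<gamma>. crosses s t \<longrightarrow> coincide s t)" for \<beta> \<gamma>
  have NC: "NC \<beta> \<gamma> \<longleftrightarrow> (\<forall>S\<in>(\<lambda>s. location ` s) ` D \<beta>. \<forall>T\<in>(\<lambda>s. location ` s) ` D \<gamma>.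
      meet S T \<longrightarrow> S = T)" for \<beta> \<gamma>
    by (simp add: NC_def crosses_meet coincide_def)
  have inv: "NC (tau \<Delta> \<epsilon> \<beta>) (tau \<Delta> \<epsilon> \<gamma>) \<longleftrightarrow> NC \<beta> \<gamma>" if "\<beta> \<in> APR" "\<gamma> \<in> APR" for \<beta> \<gamma> \<epsilon>
    unfolding NC loc[OF that(1)] loc[OF that(2)]
    by (simp add: meet_image[OF linear_refl_axis inj_refl_axis] inj_image_eq_iff[OF inj_refl_axis])
  \<comment> \<open>\<open>\<beta> \<noteq> \<gamma>\<close> is forced by the defining condition:
    \<open>- \<alpha>\<close> has a nonzero coefficient at \<open>\<alpha>\<close>, so it must not
    be compatible with itself, whatever its segments do.\<close>
  define R where "R = {(\<beta>, \<gamma>). \<beta> \<in> APR \<and> \<gamma> \<in> APR \<and> \<beta> \<noteq> \<gamma> \<and> NC \<beta> \<gamma>}"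
  have rep: "representation B \<beta> \<alpha> = 0 \<longleftrightarrow> \<beta> \<bullet> \<omega> \<alpha> = 0" if "\<beta> \<in> APR" "\<alpha> \<in> B" for \<alpha> \<beta>
    using that APR_Phi Phi_span by (intro rep_ge_iff) auto
  have CR: "compatibility_relation \<Phi> \<Delta> R"
    unfolding compatibility_relation_def
  proof (intro conjI allI ballI)
    show "R \<subseteq> APR \<times> APR" by (auto simp: R_def)
    fix \<epsilon> \<beta> \<gamma> assume b: "\<beta> \<in> APR" "\<gamma> \<in> APR"
    have "tau \<Delta> \<epsilon> \<beta> = tau \<Delta> \<epsilon> \<gamma> \<longleftrightarrow> \<beta> = \<gamma>" using tau_APR(2) b by metis
    then show "(tau \<Delta> \<epsilon> \<beta>, tau \<Delta> \<epsilon> \<gamma>) \<in> R \<longleftrightarrow> (\<beta>, \<gamma>) \<in> R"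
      using inv[OF b] b tau_APR(1) by (simp add: R_def)
  next
    fix \<alpha> \<beta> assume a: "\<alpha> \<in> B" "\<beta> \<in> APR"
    have "(- \<alpha>) \<bullet> \<omega> \<alpha> \<noteq> 0" using a B_nonzero by (simp add: omega_inner)
    then show "(\<beta>, - \<alpha>) \<in> R \<longleftrightarrow> representation B \<beta> \<alpha> = 0"
      using cr[OF a(2,1)] a rep[OF a(2,1)] by (cases "\<beta> = - \<alpha>") (auto simp: R_def neg_APR NC_def)
  qed
  have uniq: "R' = R" if R': "compatibility_relation \<Phi> \<Delta> R'" for R'
  proof -
    note R = CR
    have sub: "R' \<subseteq> APR \<times> APR" "R \<subseteq> APR \<times> APR" using R R' by (auto simp: compatibility_relation_def)
    have "\<forall>\<beta>\<in>APR. (\<beta>, \<gamma>) \<in> R' \<longleftrightarrow> (\<beta>, \<gamma>) \<in> R" if g: "\<gamma> \<in> APR" for \<gamma>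
    proof (induction rule: tau_induct[OF g h])
      case (1 \<alpha>)
      then show ?case using R R' unfolding compatibility_relation_def by metis
    next
      case (2 \<epsilon> \<gamma>)
      show ?case
      proof
        fix \<beta> assume b: "\<beta> \<in> APR"
        note t = tau_APR[OF b, of \<epsilon>]
        \<comment> \<open>As \<tau> is an involution, it can be moved from the second argument to
          the first, where the induction hypothesis for \<open>\<gamma>\<close> applies to
          \<open>tau \<Delta> \<epsilon> \<beta>\<close>.\<close>
        have "(tau \<Delta> \<epsilon> (tau \<Delta> \<epsilon> \<beta>), tau \<Delta> \<epsilon> \<gamma>) \<in> R' \<longleftrightarrow> (tau \<Delta> \<epsilon> \<beta>, \<gamma>) \<in> R'"
          using R' 2(1) t(1) unfolding compatibility_relation_def by blast
        moreover have "(tau \<Delta> \<epsilon> (tau \<Delta> \<epsilon> \<beta>), tau \<Delta> \<epsilon> \<gamma>) \<in> R \<longleftrightarrow> (tau \<Delta> \<epsilon> \<beta>, \<gamma>) \<in> R"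
          using R 2(1) t(1) unfolding compatibility_relation_def by blast
        ultimately show "(\<beta>, tau \<Delta> \<epsilon> \<gamma>) \<in> R' \<longleftrightarrow> (\<beta>, tau \<Delta> \<epsilon> \<gamma>) \<in> R"
          using 2(2) t by simp
      qed
    qed
    then have eq: "(\<beta>, \<gamma>) \<in> R' \<longleftrightarrow> (\<beta>, \<gamma>) \<in> R" if "\<beta> \<in> APR" "\<gamma> \<in> APR" for \<beta> \<gamma>
      using that by blast
    show ?thesis
    proof (rule set_eqI)
      fix x :: "'a \<times> 'a"
      obtain \<beta> \<gamma> where x: "x = (\<beta>, \<gamma>)" by (cases x)
      show "x \<in> R' \<longleftrightarrow> x \<in> R"
        using eq[of \<beta> \<gamma>] sub unfolding x by blast
    qed
  qed
  have "(THE R. compatibility_relation \<Phi> \<Delta> R) = R" by (rule the_equality) (fact CR, fact uniq)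
  then show ?thesis
    using assms(7-9) by (simp add: compatible_roots_def diag R_def NC_def)
qed

end

section \<open>The Coxeter plane\<close>

lemma cis_eq_iff_int: "cis x = cis y \<longleftrightarrow> (\<exists>n::int. x = y + 2 * pi * of_int n)"
  using sin_cos_eq_iff[of x y] by (auto simp: complex_eq_iff)

lemma cis_multiples_inj:
  assumes "N > 0" "cis (of_int a * pi / real N) = cis (of_int b * pi / real N)" "\<bar>a - b\<bar> < 2 * int N"
  shows "a = b"
proof -
  obtain n :: int where "of_int a * pi / real N = of_int b * pi / real N + 2 * pi * of_int n"
    using assms(2) by (auto simp: cis_eq_iff_int)
  then have "pi * of_int (a - b) = pi * of_int (2 * n * int N)" using assms(1) by (simp add: field_simps)
  then have "a - b = 2 * n * int N" using pi_neq_zero mult_left_cancel of_int_eq_iff by blast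
  then have "\<bar>a - b\<bar> = \<bar>n\<bar> * (2 * int N)" by (simp add: abs_mult)
  then have "\<bar>n\<bar> < 1" using assms by (simp add: mult_less_cancel_right2)
  then show ?thesis using \<open>a - b = 2 * n * int N\<close> by simp
qed

locale coxeter_plane = root_setup +
  fixes c :: "'a \<Rightarrow> real"
  assumes ev: "positive_min_eigenvector (simple_roots \<Delta>) c" and nonempty: "\<Delta> \<epsilon> \<noteq> {}"
begin

abbreviation "cv \<equiv> cox_vector \<Delta> c \<omega>"
abbreviation "pc \<equiv> plane_coord \<Delta> c \<omega>"

lemma c_pos: "\<alpha> \<in> B \<Longrightarrow> c \<alpha> > 0"
  using ev by (simp add: positive_min_eigenvector_def)

definition \<kappa> :: real where
  "\<kappa> = (SOME \<kappa>. gram_eigenvector B \<kappa> c)"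

lemma eigen:
  assumes "\<beta> \<in> B"
  shows "(\<Sum>\<alpha>\<in>B. (sgn \<beta> \<bullet> sgn \<alpha>) * c \<alpha>) = \<kappa> * c \<beta>"
proof -
  obtain \<kappa>' where "gram_eigenvector B \<kappa>' c" using ev by (auto simp: positive_min_eigenvector_def)
  then have "gram_eigenvector B \<kappa> c" unfolding \<kappa>_def by (rule someI)
  then show ?thesis using assms unfolding gram_eigenvector_def by blast
qed

lemma cv_inner: "\<beta> \<in> B \<Longrightarrow> cv \<epsilon> \<bullet> \<beta> = (if \<beta> \<in> \<Delta> \<epsilon> then c \<beta> * norm \<beta> else 0)"
proof -
  assume b: "\<beta> \<in> B"
  have "cv \<epsilon> \<bullet> \<beta> = (\<Sum>\<alpha>\<in>\<Delta> \<epsilon>. if \<beta> = \<alpha> then c \<alpha> * norm \<alpha> else 0)"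
    unfolding cox_vector_def inner_sum_left
  proof (rule sum.cong[OF refl])
    fix \<alpha> assume "\<alpha> \<in> \<Delta> \<epsilon>"
    then have "\<alpha> \<in> B" using Delta_subset by blast
    then show "(c \<alpha> *\<^sub>R \<omega> \<alpha>) \<bullet> \<beta> = (if \<beta> = \<alpha> then c \<alpha> * norm \<alpha> else 0)"
      using omega_inner[of \<alpha> \<beta>] b by (auto simp: inner_commute)
  qed
  then show ?thesis using finite_Delta by simp
qed

lemma cv_inner_right: "z \<bullet> cv \<epsilon> = (\<Sum>\<alpha>\<in>\<Delta> \<epsilon>. c \<alpha> * (z \<bullet> \<omega> \<alpha>))"
  by (simp add: cox_vector_def inner_sum_right)

lemma cv_span: "cv \<epsilon> \<in> span B"
  unfolding cox_vector_def using Delta_subset omega_span by (intro span_sum span_scale) auto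

lemma cv_nonzero: "cv \<epsilon> \<noteq> 0"
proof
  assume z: "cv \<epsilon> = 0"
  obtain \<alpha> where "\<alpha> \<in> \<Delta> \<epsilon>" using nonempty by auto
  moreover have "\<alpha> \<in> B" using calculation Delta_subset by blast
  ultimately show False using cv_inner[of \<alpha> \<epsilon>] z c_pos[of \<alpha>] B_nonzero[of \<alpha>] by simp
qed

lemma span_inner_zero:
  assumes "y \<in> span B" "\<And>\<beta>. \<beta> \<in> B \<Longrightarrow> z \<bullet> \<beta> = 0"
  shows "z \<bullet> y = 0"
  using orthogonal_to_span[OF assms(1), of z] assms(2) by (simp add: orthogonal_def)

text \<open>The eigenvector equation taken one class at a time. Against \<beta> in
  \<open>\<Delta> \<epsilon>\<close> only the term of \<beta> itself survives; against \<beta> in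
  the other class the sum is what \<open>c \<beta>\<close> leaves of
  \<open>\<kappa> * c \<beta>\<close>. Both sides lie in the span, so testing against the simple
  roots suffices.\<close>

lemma sum_sgn: "(\<Sum>\<alpha>\<in>\<Delta> \<epsilon>. c \<alpha> *\<^sub>R sgn \<alpha>) = cv \<epsilon> + (\<kappa> - 1) *\<^sub>R cv (opp \<epsilon>)" (is "?s = ?r")
proof -
  have "(?s - ?r) \<bullet> \<beta> = 0" if b: "\<beta> \<in> B" for \<beta>
  proof -
    have nb: "norm \<beta> > 0" using b B_nonzero by simp
    have b1: "sgn \<beta> \<bullet> sgn \<beta> = 1" using nb
      by (simp add: norm_sgn flip: norm_eq_1)
    have s: "?s \<bullet> sgn \<beta> = (\<Sum>\<alpha>\<in>\<Delta> \<epsilon>. (sgn \<beta> \<bullet> sgn \<alpha>) * c \<alpha>)"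
      unfolding inner_sum_left by (intro sum.cong refl) (simp add: inner_commute)
    have orth: "(\<Sum>\<alpha>\<in>\<Delta> \<delta>. (sgn \<beta> \<bullet> sgn \<alpha>) * c \<alpha>) = c \<beta>" if "\<beta> \<in> \<Delta> \<delta>" for \<delta>
    proof -
      have "(\<Sum>\<alpha>\<in>\<Delta> \<delta>. (sgn \<beta> \<bullet> sgn \<alpha>) * c \<alpha>) = (\<Sum>\<alpha>\<in>{\<beta>}. (sgn \<beta> \<bullet> sgn \<alpha>) * c \<alpha>)"
        using that finite_Delta Delta_orth[OF that]
        by (intro sum.mono_neutral_right) (auto simp: sgn_div_norm)
      then show ?thesis using b1 by simp
    qed
    have tot: "(\<Sum>\<alpha>\<in>\<Delta> \<epsilon>. (sgn \<beta> \<bullet> sgn \<alpha>) * c \<alpha>) + (\<Sum>\<alpha>\<in>\<Delta> (opp \<epsilon>). (sgn \<beta> \<bullet> sgn \<alpha>) * c \<alpha>) = \<kappa> * c \<beta>"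
    proof -
      have "\<Delta> \<epsilon> \<union> \<Delta> (opp \<epsilon>) = B" by (cases \<epsilon>) (auto simp: simple_roots_def)
      moreover have "\<Delta> \<epsilon> \<inter> \<Delta> (opp \<epsilon>) = {}" using Delta_disj by auto
      ultimately show ?thesis using eigen[OF b] finite_Delta
        by (metis (no_types, lifting) sum.union_disjoint)
    qed
    have "?s \<bullet> sgn \<beta> = ?r \<bullet> sgn \<beta>"
    proof (cases "\<beta> \<in> \<Delta> \<epsilon>")
      case True
      then have "\<beta> \<notin> \<Delta> (opp \<epsilon>)" by (rule Delta_disj)
      then have "?r \<bullet> sgn \<beta> = c \<beta>"
        using True b nb by (simp add: inner_add_left sgn_div_norm cv_inner)
      then show ?thesis unfolding s orth[OF True] by simp
    next
      case False
      then have "\<beta> \<in> \<Delta> (opp \<epsilon>)" using B_cases b by blast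
      moreover from this have "?r \<bullet> sgn \<beta> = (\<kappa> - 1) * c \<beta>"
        using False b nb by (simp add: inner_add_left sgn_div_norm cv_inner)
      ultimately show ?thesis unfolding s using tot orth[of "opp \<epsilon>"] by (simp add: algebra_simps)
    qed
    then have "(?s - ?r) \<bullet> sgn \<beta> = 0" by (simp add: inner_diff_left)
    then show ?thesis using nb by (simp add: sgn_div_norm)
  qed
  then have "\<forall>y\<in>span B. (?s - ?r) \<bullet> y = 0" using span_inner_zero by blast
  moreover have "?s - ?r \<in> span B"
  proof (intro span_diff span_sum span_scale span_add cv_span)
    fix \<alpha> assume "\<alpha> \<in> \<Delta> \<epsilon>"
    then have "\<alpha> \<in> span B" using Delta_subset by (auto intro: span_base)
    then show "sgn \<alpha> \<in> span B" by (simp add: sgn_div_norm span_scale)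
  qed
  ultimately have "(?s - ?r) \<bullet> (?s - ?r) = 0" by (rule bspec)
  then show ?thesis by simp
qed

text \<open>By \<open>sum_sgn\<close> the vector that the reflections subtract lies in the plane
  again; with \<open>cx_cv_opp\<close>, the Coxeter plane is stable under both
  \<open>cx \<epsilon>\<close>.\<close>

lemma cx_cv: "cx \<epsilon> (cv \<epsilon>) = - cv \<epsilon> + (2 * (1 - \<kappa>)) *\<^sub>R cv (opp \<epsilon>)"
proof -
  have "cx \<epsilon> (cv \<epsilon>) = cv \<epsilon> - (\<Sum>\<alpha>\<in>\<Delta> \<epsilon>. 2 *\<^sub>R (c \<alpha> *\<^sub>R sgn \<alpha>))"
    unfolding cx_eq
  proof (intro arg_cong2[where f = minus] refl sum.cong)
    fix \<alpha> assume a: "\<alpha> \<in> \<Delta> \<epsilon>"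
    then have "\<alpha> \<in> B" using Delta_subset by blast
    then show "(2 * (cv \<epsilon> \<bullet> \<alpha>) / (\<alpha> \<bullet> \<alpha>)) *\<^sub>R \<alpha> = 2 *\<^sub>R c \<alpha> *\<^sub>R sgn \<alpha>"
      using a B_nonzero by (simp add: cv_inner sgn_div_norm power2_norm_eq_inner[symmetric] power2_eq_square
          divide_inverse)
  qed
  also have "\<dots> = cv \<epsilon> - 2 *\<^sub>R (cv \<epsilon> + (\<kappa> - 1) *\<^sub>R cv (opp \<epsilon>))"
    by (simp only: scaleR_sum_right[symmetric] sum_sgn)
  also have "\<dots> = - cv \<epsilon> + (2 * (1 - \<kappa>)) *\<^sub>R cv (opp \<epsilon>)"
    by (simp add: algebra_simps scaleR_2)
  finally show ?thesis .
qed

lemma cx_cv_opp: "cx \<epsilon> (cv (opp \<epsilon>)) = cv (opp \<epsilon>)"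
  unfolding cox_vector_def by (simp add: cx_sum cx_scale cx_omega)

lemma cv_cv: "cv \<epsilon> \<bullet> cv (opp \<epsilon>) = (1 - \<kappa>) * (cv (opp \<epsilon>) \<bullet> cv (opp \<epsilon>))"
proof -
  have "cx \<epsilon> (cv \<epsilon>) \<bullet> cv (opp \<epsilon>) = cv \<epsilon> \<bullet> cv (opp \<epsilon>)" by (simp add: cx_inner cx_cv_opp)
  then show ?thesis by (simp add: cx_cv inner_add_left algebra_simps)
qed

text \<open>The angle between \<lambda> and \<mu>, kept as an unknown here. Its value is forced
  later by an orbit that zigzags around the plane.\<close>

definition \<theta> :: real where
  "\<theta> = arccos ((cv Pos \<bullet> cv Neg) / (norm (cv Pos) * norm (cv Neg)))"

definition u1 :: 'a where "u1 = sgn (cv Pos)"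
definition u2 :: 'a where "u2 = sgn (cv Neg - (cv Neg \<bullet> u1) *\<^sub>R u1)"
definition um :: 'a where "um = sgn (cv Neg)"

lemma pc_eq: "pc x = Complex (x \<bullet> u1) (x \<bullet> u2)"
  by (simp add: plane_coord_def u1_def u2_def Let_def)

lemma units: "u1 \<bullet> u1 = 1" "um \<bullet> um = 1" "norm u1 = 1" "norm um = 1"
  using cv_nonzero by (auto simp: u1_def um_def norm_sgn simp flip: power2_norm_eq_inner)

lemma cv_eqs: "cv Pos = norm (cv Pos) *\<^sub>R u1" "cv Neg = norm (cv Neg) *\<^sub>R um"
  using cv_nonzero by (simp_all add: u1_def um_def sgn_div_norm)

lemma theta: "cos \<theta> = u1 \<bullet> um" "0 < \<theta>" "\<theta> < pi"
proof -
  have eq: "(cv Pos \<bullet> cv Neg) / (norm (cv Pos) * norm (cv Neg)) = u1 \<bullet> um"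
    by (simp add: u1_def um_def sgn_div_norm divide_inverse)
  \<comment> \<open>A simple root in \<open>\<Delta> Pos\<close> is orthogonal to \<mu> but not to
    \<lambda>, so the two are not parallel.\<close>
  have par: False if "u1 = s *\<^sub>R um" for s
  proof -
    obtain \<alpha> where a: "\<alpha> \<in> \<Delta> Pos" using nonempty by auto
    then have aB: "\<alpha> \<in> B" and n: "\<alpha> \<notin> \<Delta> Neg" using Delta_subset Delta_disj[of \<alpha> Pos] by auto
    have "um \<bullet> \<alpha> = 0" using cv_inner[OF aB, of Neg] n by (simp add: um_def sgn_div_norm)
    then have "u1 \<bullet> \<alpha> = 0" using that by simp
    then have "cv Pos \<bullet> \<alpha> = 0" by (subst cv_eqs) simp
    then show False using cv_inner[OF aB, of Pos] a c_pos[OF aB] B_nonzero[OF aB] by simp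
  qed
  have "\<bar>u1 \<bullet> um\<bar> \<le> 1" using Cauchy_Schwarz_ineq2[of u1 um] units by simp
  moreover have "u1 \<bullet> um \<noteq> 1"
  proof
    assume "u1 \<bullet> um = 1"
    then have "(u1 - um) \<bullet> (u1 - um) = 0" using units by (simp add: inner_diff_left inner_diff_right inner_commute)
    then show False using par[of 1] by simp
  qed
  moreover have "u1 \<bullet> um \<noteq> -1"
  proof
    assume "u1 \<bullet> um = -1"
    then have "(u1 + um) \<bullet> (u1 + um) = 0" using units by (simp add: inner_add_left inner_add_right inner_commute)
    then show False using par[of "-1"] by (simp add: add_eq_0_iff)
  qed
  ultimately have b: "-1 < u1 \<bullet> um" "u1 \<bullet> um < 1" by auto
  then show "cos \<theta> = u1 \<bullet> um" "0 < \<theta>" "\<theta> < pi"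
    using arccos_lt_bounded[OF b] by (simp_all add: \<theta>_def eq cos_arccos)
qed

lemma sin_theta: "sin \<theta> > 0"
  using theta by (intro sin_gt_zero) auto

lemma u2_eq: "u2 = (1 / sin \<theta>) *\<^sub>R (um - cos \<theta> *\<^sub>R u1)"
proof -
  let ?d = "um - cos \<theta> *\<^sub>R u1"
  have "cv Neg - (cv Neg \<bullet> u1) *\<^sub>R u1 = norm (cv Neg) *\<^sub>R ?d"
    by (subst (1 2) cv_eqs(2)) (simp add: theta inner_commute algebra_simps)
  moreover have "norm (cv Neg) > 0" using cv_nonzero by simp
  ultimately have "u2 = sgn ?d" by (simp add: u2_def sgn_scaleR)
  moreover have "?d \<bullet> ?d = um \<bullet> um - 2 * cos \<theta> * (u1 \<bullet> um) + cos \<theta> * cos \<theta> * (u1 \<bullet> u1)"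
    by (simp add: inner_diff_left inner_diff_right inner_commute algebra_simps)
  then have "?d \<bullet> ?d = (sin \<theta>)\<^sup>2"
    unfolding sin_squared_eq by (simp add: units(1,2) power2_eq_square flip: theta(1))
  then have "norm ?d = sin \<theta>" using sin_theta by (simp add: norm_eq_sqrt_inner)
  ultimately show ?thesis by (simp add: sgn_div_norm divide_inverse)
qed

text \<open>On the plane \<open>cx Neg\<close> is the reflection in the line of \<lambda> and
  \<open>cx Pos\<close> the one in the line of \<mu>, written in the oblique basis of the two unit
  vectors. The factors come from \<open>cv_cv\<close>, which gives the inner product of \<lambda>
  and \<mu> in two ways.\<close>

lemma cx_u1: "cx Neg u1 = u1" "cx Pos u1 = - u1 + (2 * cos \<theta>) *\<^sub>R um"
  and cx_um: "cx Pos um = um" "cx Neg um = - um + (2 * cos \<theta>) *\<^sub>R u1"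
proof -
  have nz: "norm (cv Pos) > 0" "norm (cv Neg) > 0" using cv_nonzero by auto
  have n2: "cv \<epsilon> \<bullet> cv \<epsilon> = norm (cv \<epsilon>) * norm (cv \<epsilon>)" for \<epsilon>
    by (simp add: power2_norm_eq_inner flip: power2_eq_square)
  have dot: "cv Pos \<bullet> cv Neg = norm (cv Pos) * norm (cv Neg) * cos \<theta>"
    using arg_cong2[where f = inner, OF cv_eqs] by (simp add: theta)
  have k: "(1 - \<kappa>) * norm (cv Neg) = norm (cv Pos) * cos \<theta>"
    "(1 - \<kappa>) * norm (cv Pos) = norm (cv Neg) * cos \<theta>"
  proof -
    have "norm (cv Pos) * norm (cv Neg) * cos \<theta> = (1 - \<kappa>) * (norm (cv Neg) * norm (cv Neg))"
      using cv_cv[of Pos] dot by (simp add: n2)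
    then show "(1 - \<kappa>) * norm (cv Neg) = norm (cv Pos) * cos \<theta>" using nz by simp
    have "norm (cv Pos) * norm (cv Neg) * cos \<theta> = (1 - \<kappa>) * (norm (cv Pos) * norm (cv Pos))"
      using cv_cv[of Neg] unfolding dot[symmetric] n2[symmetric] by (simp add: inner_commute)
    then show "(1 - \<kappa>) * norm (cv Pos) = norm (cv Neg) * cos \<theta>" using nz by auto
  qed
  show "cx Neg u1 = u1" "cx Pos um = um"
    using cx_cv_opp[of Neg] cx_cv_opp[of Pos] by (simp_all add: u1_def um_def sgn_div_norm cx_scale)
  have sc: "t *\<^sub>R cv Pos = (t * norm (cv Pos)) *\<^sub>R u1" "t *\<^sub>R cv Neg = (t * norm (cv Neg)) *\<^sub>R um" for t
    using arg_cong[OF cv_eqs(1), of "scaleR t"] arg_cong[OF cv_eqs(2), of "scaleR t"] by simp_all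
  have "cx Pos u1 = (1 / norm (cv Pos)) *\<^sub>R cx Pos (cv Pos)"
    by (simp add: u1_def sgn_div_norm cx_scale divide_inverse)
  also have "\<dots> = (1 / norm (cv Pos)) *\<^sub>R (- norm (cv Pos) *\<^sub>R u1 + (2 * ((1 - \<kappa>) * norm (cv Neg))) *\<^sub>R um)"
    unfolding cx_cv using cv_eqs sc[of "2 * (1 - \<kappa>)"] by (simp add: mult.assoc)
  also have "\<dots> = - u1 + (2 * cos \<theta>) *\<^sub>R um"
    unfolding k using nz by (simp add: scaleR_diff_right)
  finally show "cx Pos u1 = - u1 + (2 * cos \<theta>) *\<^sub>R um" .
  have "cx Neg um = (1 / norm (cv Neg)) *\<^sub>R cx Neg (cv Neg)"
    by (simp add: um_def sgn_div_norm cx_scale divide_inverse)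
  also have "\<dots> = (1 / norm (cv Neg)) *\<^sub>R (- norm (cv Neg) *\<^sub>R um + (2 * ((1 - \<kappa>) * norm (cv Pos))) *\<^sub>R u1)"
    unfolding cx_cv using cv_eqs sc[of "2 * (1 - \<kappa>)"] by (simp add: mult.assoc)
  also have "\<dots> = - um + (2 * cos \<theta>) *\<^sub>R u1"
    unfolding k using nz by (simp add: scaleR_diff_right)
  finally show "cx Neg um = - um + (2 * cos \<theta>) *\<^sub>R u1" .
qed

lemma um_eq: "x \<bullet> um = cos \<theta> * (x \<bullet> u1) + sin \<theta> * (x \<bullet> u2)"
  using sin_theta by (simp add: u2_eq inner_diff_right)

lemma pc_cx_Neg: "pc (cx Neg x) = cnj (pc x)"
proof -
  have "cx Neg u2 = - u2"
    by (simp add: u2_eq cx_scale cx_diff cx_u1 cx_um algebra_simps scaleR_2 flip: scaleR_add_left)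
  then show ?thesis by (simp add: pc_eq cx_inner cx_u1 complex_eq_iff)
qed

text \<open>Since \<open>cx Pos\<close> is self-adjoint and preserves the plane, projecting the
  image of \<open>x\<close> amounts to reflecting the projection of \<open>x\<close> in the line of
  \<mu>, which has angle \<open>\<theta>\<close>. The second coordinate is computed after
  multiplication by \<open>sin \<theta>\<close> to clear the denominator in
  \<open>u2_eq\<close>.\<close>

lemma pc_cx_Pos: "pc (cx Pos x) = cis (2 * \<theta>) * cnj (pc x)"
proof -
  have s2: "sin \<theta> * sin \<theta> = 1 - cos \<theta> * cos \<theta>"
    using sin_cos_squared_add[of \<theta>] by (simp add: power2_eq_square)
  have "x \<bullet> cx Pos u1 = cos (2 * \<theta>) * (x \<bullet> u1) + sin (2 * \<theta>) * (x \<bullet> u2)"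
  proof -
    have "x \<bullet> cx Pos u1 = - (x \<bullet> u1) + 2 * cos \<theta> * (cos \<theta> * (x \<bullet> u1) + sin \<theta> * (x \<bullet> u2))"
      by (simp add: cx_u1 inner_diff_right um_eq)
    also have "\<dots> = (2 * cos \<theta> * cos \<theta> - 1) * (x \<bullet> u1) + 2 * sin \<theta> * cos \<theta> * (x \<bullet> u2)"
      by (simp add: algebra_simps)
    finally show ?thesis by (simp add: cos_double_cos sin_double power2_eq_square)
  qed
  moreover have "x \<bullet> cx Pos u2 = sin (2 * \<theta>) * (x \<bullet> u1) - cos (2 * \<theta>) * (x \<bullet> u2)"
  proof -
    let ?a = "x \<bullet> u1" and ?b = "x \<bullet> u2"
    have "sin \<theta> * (x \<bullet> cx Pos u2) = x \<bullet> um - cos \<theta> * (- ?a + 2 * cos \<theta> * (x \<bullet> um))"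
      using sin_theta by (simp add: u2_eq cx_scale cx_diff cx_u1 cx_um inner_diff_right inner_add_right)
    also have "\<dots> = cos \<theta> * (1 + 1 - 2 * cos \<theta> * cos \<theta>) * ?a + sin \<theta> * (1 - 2 * cos \<theta> * cos \<theta>) * ?b"
      by (simp add: um_eq algebra_simps)
    also have "\<dots> = sin \<theta> * ((2 * sin \<theta> * cos \<theta>) * ?a - (2 * cos \<theta> * cos \<theta> - 1) * ?b)"
    proof -
      have "1 + 1 - 2 * cos \<theta> * cos \<theta> = 2 * (sin \<theta> * sin \<theta>)" by (simp add: s2)
      then show ?thesis by (simp only:) (simp add: algebra_simps)
    qed
    finally have "x \<bullet> cx Pos u2 = (2 * sin \<theta> * cos \<theta>) * ?a - (2 * cos \<theta> * cos \<theta> - 1) * ?b"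
      using sin_theta by (metis less_irrefl mult_left_cancel)
    then show ?thesis by (simp add: cos_double_cos sin_double power2_eq_square)
  qed
  ultimately show ?thesis by (simp add: pc_eq cx_inner complex_eq_iff)
qed

lemma inner_cv_Pos: "x \<bullet> cv Pos = norm (cv Pos) * Re (pc x)"
  by (subst cv_eqs) (simp add: pc_eq)

lemma inner_cv_Neg: "x \<bullet> cv Neg = norm (cv Neg) * Re (pc x * cis (- \<theta>))"
  by (subst cv_eqs) (simp add: pc_eq um_eq mult.commute)

end

section \<open>Zigzag orbits\<close>

text \<open>The class of the step from \<open>e i\<close> to \<open>e (Suc i)\<close> when the first
  step has class \<open>\<epsilon>\<close>. The value at 0 is used too, for the additional vertex
  \<open>V 0\<close>.\<close>

definition alt :: "sign \<Rightarrow> nat \<Rightarrow> sign" where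
  "alt \<epsilon> i = (if odd i then \<epsilon> else opp \<epsilon>)"

lemma alt_Suc [simp]: "alt \<epsilon> (Suc i) = opp (alt \<epsilon> i)"
  by (simp add: alt_def)

lemma sign_cases2: "\<epsilon> = \<delta> \<or> \<epsilon> = opp \<delta>"
  by (cases \<epsilon>; cases \<delta>) auto

text \<open>What the plane geometry needs of a sorted orbit: neighbours are exchanged by the two
  \<open>cox_part\<close> maps in turn, the ends stay fixed, and each step is nonnegative with a
  positive coefficient in its own class. \<open>F\<close> holds the origin points; there one of the
  maps is -1 and the other is 1, and even \<open>h\<close> makes the h-th power of the Coxeter
  element trivial on them.\<close>

locale zigzag = coxeter_plane W \<Phi> \<Delta> \<omega> c
  for W :: "('a::euclidean_space \<Rightarrow> 'a) set" and \<Phi> \<Delta> \<omega> c +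
  fixes h :: nat and e :: "nat \<Rightarrow> 'a" and \<epsilon>0 :: sign and F :: "'a set"
  assumes h3: "h \<ge> 3"
    and cx_e: "\<And>i. 1 \<le> i \<Longrightarrow> i < h \<Longrightarrow> cox_part \<Delta> (alt \<epsilon>0 i) (e i) = e (Suc i)"
    and cx_e1: "cox_part \<Delta> (opp \<epsilon>0) (e 1) = e 1"
    and cx_eh: "cox_part \<Delta> (alt \<epsilon>0 h) (e h) = e h"
    and step_ge: "\<And>i \<alpha>. 1 \<le> i \<Longrightarrow> i < h \<Longrightarrow> \<alpha> \<in> simple_roots \<Delta> \<Longrightarrow> (e i - e (Suc i)) \<bullet> \<omega> \<alpha> \<ge> 0"
    and step_pos: "\<And>i. 1 \<le> i \<Longrightarrow> i < h \<Longrightarrow> \<exists>\<alpha>\<in>\<Delta> (alt \<epsilon>0 i). (e i - e (Suc i)) \<bullet> \<omega> \<alpha> > 0"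
    and cx_F: "\<And>f. f \<in> F \<Longrightarrow> even h \<and> (\<exists>\<epsilon>. cox_part \<Delta> \<epsilon> f = - f \<and> cox_part \<Delta> (opp \<epsilon>) f = f)"
    and span_eF: "simple_roots \<Delta> \<subseteq> span (e ` {1..h} \<union> F)"
begin

abbreviation "par \<equiv> alt \<epsilon>0"

text \<open>Angle of \<open>e j\<close> in units of \<open>\<theta>\<close>. The reflection
  \<open>cx Neg\<close> negates it and \<open>cx Pos\<close> turns k into 2 - k, which is just the
  passage from \<open>kx j\<close> to \<open>kx (Suc j)\<close>; the points swing from side to side
  with growing amplitude.\<close>

definition kx :: "nat \<Rightarrow> int" where "kx j = (if par j = Neg then int j else 1 - int j)"

text \<open>The radius with a sign: \<open>e 1\<close> lies on the line fixed by
  \<open>cx (opp \<epsilon>0)\<close>, but on which side of the origin becomes clear only through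
  \<open>rr_sin\<close>.\<close>

definition rr :: real where "rr = Re (pc (e 1) * cis (- of_int (kx 1) * \<theta>))"

lemma pc_diff: "pc (x - y) = pc x - pc y"
  by (simp add: pc_eq inner_diff_left complex_eq_iff)

lemma pc_minus: "pc (- y) = - pc y"
  by (simp add: pc_eq complex_eq_iff)

lemma cx_e_down: "1 \<le> i \<Longrightarrow> i < h \<Longrightarrow> cx (par i) (e (Suc i)) = e i"
  using cx_e cx_cx by metis

lemma pc_e1: "pc (e 1) = of_real rr * cis (of_int (kx 1) * \<theta>)"
proof (cases \<epsilon>0)
  case Pos
  then have "cnj (pc (e 1)) = pc (e 1)" using cx_e1 pc_cx_Neg by (metis opp.simps(1))
  moreover have k: "kx 1 = 0" unfolding kx_def alt_def using Pos by simp
  ultimately show ?thesis unfolding rr_def k by (simp add: complex_eq_iff)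
next
  case Neg
  define w where "w = pc (e 1) * cis (- \<theta>)"
  have "pc (e 1) = cis (2 * \<theta>) * cnj (pc (e 1))" using Neg cx_e1 pc_cx_Pos by (metis opp.simps(2))
  moreover have pw: "pc (e 1) = w * cis \<theta>" by (simp add: w_def cis_mult mult.assoc)
  ultimately have "w * cis \<theta> = cis (2 * \<theta>) * (cnj w * cis (- \<theta>))" by (simp add: cis_cnj)
  also have "\<dots> = cnj w * (cis (2 * \<theta>) * cis (- \<theta>))" by (simp add: mult.commute mult.left_commute)
  finally have "w = cnj w" by (simp add: cis_mult)
  then have wr: "w = of_real (Re w)" by (simp add: complex_eq_iff)
  have k: "kx 1 = 1" unfolding kx_def alt_def using Neg by simp
  have w1: "pc (e 1) * cis (- of_int 1 * \<theta>) = w" by (simp add: w_def)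
  show ?thesis unfolding rr_def k w1 using pw wr by (metis mult_1 of_int_1)
qed

lemma pc_e: "1 \<le> i \<Longrightarrow> i \<le> h \<Longrightarrow> pc (e i) = of_real rr * cis (of_int (kx i) * \<theta>)"
proof (induction i rule: nat_induct_at_least)
  case base
  show ?case by (rule pc_e1)
next
  case (Suc i)
  then have e: "e (Suc i) = cx (par i) (e i)" and IH: "pc (e i) = of_real rr * cis (of_int (kx i) * \<theta>)"
    using cx_e by auto
  show ?case
  proof (cases "par i")
    case Pos
    then show ?thesis unfolding e Pos pc_cx_Pos IH using Pos
      by (simp add: kx_def cis_cnj cis_mult algebra_simps)
  next
    case Neg
    then show ?thesis unfolding e Neg pc_cx_Neg IH using Neg
      by (simp add: kx_def cis_cnj)
  qed
qed

text \<open>\<lambda> and \<mu> are positive combinations of the dual vectors of their class, so the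
  one of class \<open>par i\<close> has positive inner product with \<open>e i - e (Suc i)\<close>.
  In polar coordinates the same product is a positive multiple of
  \<open>rr * (cos ((i - 1) * \<theta>) - cos ((i + 1) * \<theta>))\<close>.\<close>

lemma rr_sin: "1 \<le> i \<Longrightarrow> i < h \<Longrightarrow> rr * sin (real i * \<theta>) > 0"
proof -
  assume i: "1 \<le> i" "i < h"
  define z where "z = e i - e (Suc i)"
  have "z \<bullet> cv (par i) > 0"
  proof -
    obtain \<alpha> where a: "\<alpha> \<in> \<Delta> (par i)" "z \<bullet> \<omega> \<alpha> > 0" using step_pos[OF i] by (auto simp: z_def)
    have "\<beta> \<in> B" if "\<beta> \<in> \<Delta> (par i)" for \<beta> using that Delta_subset by blast
    then show ?thesis unfolding cv_inner_right using a finite_Delta step_ge[OF i] c_pos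
      by (intro sum_pos2[of _ \<alpha>]) (auto simp: z_def less_imp_le)
  qed
  moreover have "norm (cv (par i)) > 0" using cv_nonzero by simp
  moreover have pz: "pc z = rr * (cis (of_int (kx i) * \<theta>) - cis (of_int (kx (Suc i)) * \<theta>))"
    unfolding z_def pc_diff using i by (simp add: pc_e algebra_simps)
  have cd: "cos ((real i - 1) * \<theta>) - cos ((real i + 1) * \<theta>) = 2 * sin (real i * \<theta>) * sin \<theta>"
  proof -
    have "((real i - 1) * \<theta> + (real i + 1) * \<theta>) / 2 = real i * \<theta>"
      "((real i + 1) * \<theta> - (real i - 1) * \<theta>) / 2 = \<theta>" by (simp_all add: algebra_simps)
    then show ?thesis by (simp only: cos_diff_cos)
  qed
  have "z \<bullet> cv (par i) = norm (cv (par i)) * (rr * (cos ((real i - 1) * \<theta>) - cos ((real i + 1) * \<theta>)))"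
  proof (cases "par i")
    case Pos
    have "cos ((1 - real i) * \<theta>) = cos ((real i - 1) * \<theta>)"
      by (subst cos_minus[symmetric]) (simp add: algebra_simps)
    moreover have "kx i = 1 - int i" "kx (Suc i) = int i + 1" using Pos by (simp_all add: kx_def)
    moreover have "z \<bullet> cv (par i) = norm (cv (par i)) * Re (pc z)" using Pos inner_cv_Pos by simp
    ultimately show ?thesis unfolding pz by simp
  next
    case Neg
    have "Re (pc z * cis (- \<theta>)) = rr * (cos ((real i - 1) * \<theta>) - cos ((- real i - 1) * \<theta>))"
    proof -
      have "kx i = int i" "kx (Suc i) = - int i" using Neg by (simp_all add: kx_def)
      then have "pc z * cis (- \<theta>) = of_real rr * (cis (real i * \<theta>) * cis (- \<theta>) - cis (- real i * \<theta>) * cis (- \<theta>))"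
        unfolding pz by (simp add: algebra_simps)
      also have "\<dots> = of_real rr * (cis ((real i - 1) * \<theta>) - cis ((- real i - 1) * \<theta>))"
      proof -
        have "real i * \<theta> + - \<theta> = (real i - 1) * \<theta>" "- real i * \<theta> + - \<theta> = (- real i - 1) * \<theta>"
          by (simp_all add: algebra_simps)
        then show ?thesis by (simp only: cis_mult)
      qed
      finally show ?thesis by simp
    qed
    moreover have "cos ((- real i - 1) * \<theta>) = cos ((real i + 1) * \<theta>)"
      by (subst cos_minus[symmetric]) (simp add: algebra_simps)
    moreover have "z \<bullet> cv (par i) = norm (cv (par i)) * Re (pc z * cis (- \<theta>))" using Neg inner_cv_Neg by simp
    ultimately show ?thesis by simp
  qed
  ultimately have "norm (cv (par i)) * (2 * sin \<theta>) * (rr * sin (real i * \<theta>)) > 0"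
    by (simp add: cd mult.commute mult.left_commute)
  moreover have "norm (cv (par i)) * (2 * sin \<theta>) > 0"
    using \<open>norm (cv (par i)) > 0\<close> sin_theta by simp
  ultimately show ?thesis by (rule zero_less_mult_pos)
qed

lemma rr_pos: "rr > 0"
  using rr_sin[of 1] sin_theta h3 by (simp add: zero_less_mult_iff)

text \<open>The sines of \<open>i * \<theta>\<close> for \<open>i < h\<close> are positive and
  consecutive angles differ by less than \<pi>, so the lower half turn is never entered and
  \<open>(h - 1) * \<theta> < pi\<close>. As the last point is fixed by its reflection,
  \<open>2 * h * \<theta>\<close> is a whole number of turns, and only
  \<open>h * \<theta> = pi\<close> is left.\<close>

lemma theta_eq: "\<theta> = pi / real h"
proof -
  have lt: "real i * \<theta> < pi" if "1 \<le> i" "i < h" for i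
    using that
  proof (induction i rule: nat_induct_at_least)
    case base
    then show ?case using theta by simp
  next
    case (Suc i)
    then have "real i * \<theta> < pi" by simp
    then have lt2: "real (Suc i) * \<theta> < 2 * pi" using theta by (simp add: algebra_simps)
    have "sin (real (Suc i) * \<theta>) > 0"
      using rr_sin[of "Suc i"] Suc rr_pos by (simp add: zero_less_mult_iff)
    then show ?case using lt2 sin_le_zero[of "real (Suc i) * \<theta>"] by force
  qed
  have hm: "real h * \<theta> < 2 * pi" "real h * \<theta> > 0"
  proof -
    have "1 \<le> h - 1" "h - 1 < h" using h3 by auto
    then have "real (h - 1) * \<theta> < pi" by (rule lt)
    moreover have "real (h - 1) * \<theta> = real h * \<theta> - \<theta>" using h3 by (simp add: of_nat_diff algebra_simps)
    ultimately show "real h * \<theta> < 2 * pi" using theta by linarith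
  qed (use h3 theta in simp)
  have "cis (2 * real h * \<theta>) = 1"
  proof (cases "par h")
    case Pos
    have "cis (2 * \<theta>) * cnj (pc (e h)) = pc (e h)" using cx_eh pc_cx_Pos[of "e h"] Pos by simp
    then have "cis (2 * \<theta>) * cis ((real h - 1) * \<theta>) = cis ((1 - real h) * \<theta>)"
      using rr_pos h3 Pos by (simp add: pc_e kx_def cis_cnj algebra_simps)
    then have "cis (2 * \<theta>) * cis ((real h - 1) * \<theta>) * cis ((real h - 1) * \<theta>)
        = cis ((1 - real h) * \<theta>) * cis ((real h - 1) * \<theta>)" by simp
    then show ?thesis unfolding cis_mult by (simp add: algebra_simps)
  next
    case Neg
    have "cnj (pc (e h)) = pc (e h)" using cx_eh pc_cx_Neg[of "e h"] Neg by simp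
    then have "cis (- (real h * \<theta>)) = cis (real h * \<theta>)"
      using rr_pos h3 Neg by (simp add: pc_e kx_def cis_cnj)
    then have "cis (- (real h * \<theta>)) * cis (real h * \<theta>) = cis (real h * \<theta>) * cis (real h * \<theta>)" by simp
    then show ?thesis unfolding cis_mult by (simp add: algebra_simps)
  qed
  then obtain n :: int where "2 * real h * \<theta> = 2 * pi * of_int n"
    using cis_eq_iff_int[of "2 * real h * \<theta>" 0] by auto
  then have n: "real h * \<theta> = pi * of_int n" by simp
  then have "n = 1" using hm by (simp add: zero_less_mult_iff)
  then show ?thesis using n h3 by (simp add: field_simps)
qed

lemma pc_e': "1 \<le> i \<Longrightarrow> i \<le> h \<Longrightarrow> pc (e i) = of_real rr * cis (of_int (kx i) * pi / real h)"
  by (simp add: pc_e theta_eq)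

lemma pc_inj: "1 \<le> i \<Longrightarrow> i \<le> h \<Longrightarrow> 1 \<le> j \<Longrightarrow> j \<le> h \<Longrightarrow> pc (e i) = pc (e j) \<Longrightarrow> i = j"
proof -
  assume a: "1 \<le> i" "i \<le> h" "1 \<le> j" "j \<le> h" "pc (e i) = pc (e j)"
  then have "cis (of_int (kx i) * pi / real h) = cis (of_int (kx j) * pi / real h)"
    using rr_pos by (simp add: pc_e')
  then have "kx i = kx j" using a h3
    by (intro cis_multiples_inj) (auto simp: kx_def split: if_splits)
  then show "i = j" using a by (auto simp: kx_def split: if_splits)
qed

lemma inj_e: "inj_on e {1..h}"
  using pc_inj by (auto simp: inj_on_def)

lemma e_nonzero: "1 \<le> i \<Longrightarrow> i \<le> h \<Longrightarrow> pc (e i) \<noteq> 0"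
  using rr_pos by (simp add: pc_e)

text \<open>One reflection of the plane fixes \<open>pc f\<close> and the other negates it, so their
  product, a rotation by \<open>2 * \<theta>\<close> in one of the two directions, acts on it as -1.
  Since \<open>h \<ge> 3\<close>, this is less than a half turn, and only 0 is possible.\<close>

lemma pc_F: "f \<in> F \<Longrightarrow> pc f = 0"
proof -
  assume f: "f \<in> F"
  obtain \<epsilon> where e: "cx \<epsilon> f = - f" "cx (opp \<epsilon>) f = f" using cx_F[OF f] by auto
  have "2 * \<theta> < pi" using h3 by (simp add: theta_eq field_simps)
  then have "cos (2 * \<theta>) > cos pi" using theta by (intro cos_monotone_0_pi) auto
  then have ne: "1 + cis (2 * \<theta>) \<noteq> 0" by (auto simp: complex_eq_iff)
  have "cis (2 * \<theta>) * cnj (pc f) = - cnj (pc f)"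
  proof (cases \<epsilon>)
    case Pos
    then show ?thesis using e pc_cx_Neg[of f] pc_cx_Pos[of f] by (simp add: pc_minus)
  next
    case Neg
    then have "- pc f = cnj (pc f)" "pc f = cis (2 * \<theta>) * cnj (pc f)"
      using e pc_cx_Neg[of f] pc_cx_Pos[of f] by (simp_all add: pc_minus)
    then show ?thesis by (metis minus_minus)
  qed
  then have "(1 + cis (2 * \<theta>)) * cnj (pc f) = 0" by (simp add: algebra_simps)
  then show "pc f = 0" using ne by simp
qed

definition nx :: "sign \<Rightarrow> nat \<Rightarrow> nat" where
  "nx \<epsilon> i = (if par i = \<epsilon> then if i < h then Suc i else i else if i > 1 then i - 1 else i)"

lemma nx_range: "1 \<le> i \<Longrightarrow> i \<le> h \<Longrightarrow> 1 \<le> nx \<epsilon> i \<and> nx \<epsilon> i \<le> h"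
  by (auto simp: nx_def)

lemma cx_nx: "1 \<le> i \<Longrightarrow> i \<le> h \<Longrightarrow> cx \<epsilon> (e i) = e (nx \<epsilon> i)"
proof -
  assume i: "1 \<le> i" "i \<le> h"
  show ?thesis
  proof (cases "par i = \<epsilon>")
    case True
    then show ?thesis using i cx_e cx_eh by (cases "i = h") (auto simp: nx_def)
  next
    case False
    show ?thesis
    proof (cases "i = 1")
      case True
      then have "\<epsilon> = opp \<epsilon>0" using False sign_cases2[of \<epsilon> \<epsilon>0] by (auto simp: alt_def)
      then show ?thesis using True False cx_e1 by (simp add: nx_def)
    next
      case f: False
      then obtain j where j: "i = Suc j" "1 \<le> j" using i by (cases i) auto
      then have "par j = \<epsilon>" using False sign_cases2[of \<epsilon> "par j"] by auto
      then show ?thesis using cx_e_down[of j] j i False by (simp add: nx_def)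
    qed
  qed
qed

abbreviation "cox \<equiv> cox_element \<Delta>"

lemma pc_cox: "pc (cox x) = cis (- 2 * \<theta>) * pc x"
  by (simp add: cox_element_def pc_cx_Pos pc_cx_Neg cis_cnj)

lemma pc_cox_pow: "pc ((cox ^^ k) x) = cis (- (2 * real k * \<theta>)) * pc x"
proof (induction k)
  case (Suc k)
  have "pc ((cox ^^ Suc k) x) = (cis (- 2 * \<theta>) * cis (- (2 * real k * \<theta>))) * pc x"
    by (simp add: pc_cox Suc mult.assoc)
  also have "cis (- 2 * \<theta>) * cis (- (2 * real k * \<theta>)) = cis (- (2 * real (Suc k) * \<theta>))"
    unfolding cis_mult by (simp add: algebra_simps)
  finally show ?case .
qed simp

lemma linear_cox: "linear cox"
  unfolding cox_element_def by (intro linear_compose linear_cx)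

lemma linear_cox_pow: "linear (cox ^^ k)"
proof (induction k)
  case 0
  then show ?case using linear_id by (simp add: id_def)
next
  case (Suc k)
  then show ?case using linear_compose[OF _ linear_cox] by (simp add: o_def)
qed

text \<open>Checked on the chain, on \<open>F\<close> and on the complement of the span. The Coxeter
  element permutes the chain, and \<open>pc\<close> is injective there, so each \<open>e i\<close>
  is fixed as soon as its projection is, and the h-th power turns the plane by a full turn.\<close>

lemma cox_pow_h: "cox ^^ h = id"
proof -
  have e: "(cox ^^ k) (e i) \<in> e ` {1..h}" if "1 \<le> i" "i \<le> h" for i k
  proof (induction k)
    case (Suc k)
    then obtain j where "j \<in> {1..h}" "(cox ^^ k) (e i) = e j" by auto
    then have "(cox ^^ Suc k) (e i) = e (nx Neg (nx Pos j))" "nx Neg (nx Pos j) \<in> {1..h}"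
      using nx_range by (simp_all add: cox_element_def cx_nx)
    then show ?case by blast
  qed (use that in auto)
  have 1: "(cox ^^ h) (e i) = e i" if i: "1 \<le> i" "i \<le> h" for i
  proof -
    obtain j where j: "1 \<le> j" "j \<le> h" "(cox ^^ h) (e i) = e j" using e[OF i, of h] by auto
    have "2 * real h * \<theta> = 2 * pi" using h3 by (simp add: theta_eq)
    then have "cis (- (2 * real h * \<theta>)) = cnj (cis (2 * pi))" by (simp only: cis_cnj)
    then have "cis (- (2 * real h * \<theta>)) = 1" by simp
    then have "pc (e j) = pc (e i)" using pc_cox_pow[of h "e i"] j by (metis mult_1)
    then show ?thesis using pc_inj i j by metis
  qed
  have 2: "(cox ^^ h) f = f" if f: "f \<in> F" for f
  proof -
    obtain \<epsilon> where "cx \<epsilon> f = - f" "cx (opp \<epsilon>) f = f" and ev: "even h" using cx_F[OF f] by auto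
    then have cf: "cox f = - f" by (cases \<epsilon>) (simp_all add: cox_element_def cx_minus)
    have "(cox ^^ k) f = (if even k then f else - f)" for k
      by (induction k) (auto simp: cf linear_neg[OF linear_cox])
    then show ?thesis using ev by simp
  qed
  have sp: "(cox ^^ h) x = x" if "x \<in> span B" for x
  proof -
    have "x \<in> span (e ` {1..h} \<union> F)"
      using that span_eF span_mono[OF span_eF] span_span by blast
    then show ?thesis
      by (rule linear_eq_on_span[OF linear_cox_pow linear_ident, rotated]) (use 1 2 in auto)
  qed
  show ?thesis
  proof
    fix x
    \<comment> \<open>The roots need not span the ambient space (type A), and \<open>id\<close> is
      demanded on all of it.\<close>
    obtain y z where y: "y \<in> span B" and z: "\<And>w. w \<in> span B \<Longrightarrow> orthogonal z w" and x: "x = y + z"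
      using orthogonal_subspace_decomp_exists[of B x] by metis
    have "cx \<epsilon> z = z" for \<epsilon>
      using z Delta_subset by (intro cx_fix) (auto simp: orthogonal_def intro: span_base)
    then have "cox z = z" by (simp add: cox_element_def)
    then have "(cox ^^ k) z = z" for k by (induction k) auto
    then show "(cox ^^ h) x = id x" using sp[OF y] by (simp add: x linear_add[OF linear_cox_pow])
  qed
qed

text \<open>Minimality is visible in the plane: a power that fixes the nonzero projection of
  \<open>e 1\<close> rotates by a whole number of turns, and the Coxeter element itself rotates by
  \<open>2 * pi / h\<close>.\<close>

lemma cox_number_eq: "cox_number \<Delta> = h"
  unfolding cox_number_def
proof (rule Least_equality)
  show "0 < h \<and> cox ^^ h = id" using cox_pow_h h3 by simp
  fix k assume k: "0 < k \<and> cox ^^ k = id"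
  then have "cis (- (2 * real k * \<theta>)) * pc (e 1) = pc (e 1)" using pc_cox_pow[of k "e 1"] by simp
  then have "cis (- (2 * real k * \<theta>)) = 1" using e_nonzero[of 1] h3 by simp
  then obtain n :: int where "- (2 * real k * \<theta>) = 2 * pi * of_int n"
    using cis_eq_iff_int[of "- (2 * real k * \<theta>)" 0] by auto
  then have "pi * of_int (int k) = pi * of_int (- n * int h)"
    using h3 by (simp add: theta_eq field_simps)
  then have "of_int (int k) = (of_int (- n * int h) :: real)"
    using pi_neq_zero mult_left_cancel by blast
  then have "int k = - n * int h" by (simp only: of_int_eq_iff)
  then have "h dvd k" by (metis dvd_triv_right int_dvd_int_iff)
  then show "h \<le> k" using k by (simp add: dvd_imp_le)
qed

text \<open>Angle of the vertex \<open>V j\<close> in units of \<pi>/(h + 2), obtained by applying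
  \<open>enlarge\<close> to \<open>kx j\<close>. In class \<open>Neg\<close> the index j itself
  gains 2; in class \<open>Pos\<close> the admissible representative is
  \<open>1 - j + 2 * h\<close>, which gains 4, and \<open>2 * (h + 2)\<close> is then dropped as a
  full turn. At j = 0 and j = h + 1 the formula gives the two vertices added to the polygon.\<close>

definition ax :: "nat \<Rightarrow> int" where "ax j = (if par j = Neg then int j + 2 else 1 - int j)"

definition V :: "nat \<Rightarrow> complex" where
  "V j = of_real rr * cis (of_int (ax j) * pi / real (h + 2))"

lemma V_inj: "i \<le> h + 1 \<Longrightarrow> j \<le> h + 1 \<Longrightarrow> V i = V j \<Longrightarrow> i = j"
proof -
  assume a: "i \<le> h + 1" "j \<le> h + 1" "V i = V j"
  then have "cis (of_int (ax i) * pi / real (h + 2)) = cis (of_int (ax j) * pi / real (h + 2))"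
    using rr_pos by (simp add: V_def)
  then have "ax i = ax j" using a h3
    by (intro cis_multiples_inj[of "h + 2"]) (auto simp: ax_def split: if_splits)
  then show "i = j" using a by (auto simp: ax_def split: if_splits)
qed

lemma enlarge_rcis:
  assumes "r > 0" "1 \<le> k" "k \<le> 2 * h"
  shows "enlarge h (rcis r (real k * pi / real h))
    = rcis r (real (if k \<le> h then k + 2 else k + 4) * pi / real (h + 2))"
proof -
  let ?z = "rcis r (real k * pi / real h)"
  have c: "cmod ?z = r" using assms by simp
  have "(THE k. 1 \<le> k \<and> k \<le> 2 * h \<and> ?z = rcis (cmod ?z) (real k * pi / real h)) = k"
  proof (rule the_equality)
    show "1 \<le> k \<and> k \<le> 2 * h \<and> ?z = rcis (cmod ?z) (real k * pi / real h)" using assms c by simp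
    fix l assume l: "1 \<le> l \<and> l \<le> 2 * h \<and> ?z = rcis (cmod ?z) (real l * pi / real h)"
    then have "cis (of_int (int k) * pi / real h) = cis (of_int (int l) * pi / real h)"
      using assms c by (simp add: rcis_def)
    then have "int k = int l" using l assms h3 by (intro cis_multiples_inj) auto
    then show "l = k" by simp
  qed
  then show ?thesis unfolding enlarge_def c by (simp add: Let_def)
qed

lemma cis_shift: "N > 0 \<Longrightarrow> cis (of_int (a + 2 * int N) * pi / real N) = cis (of_int a * pi / real N)"
  by (subst cis_eq_iff_int) (auto intro!: exI[of _ 1] simp: field_simps)

lemma hat_e: "1 \<le> j \<Longrightarrow> j \<le> h \<Longrightarrow> hat \<Delta> c \<omega> (e j) = Vertex (V j)"
proof -
  assume j: "1 \<le> j" "j \<le> h"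
  have "enlarge h (pc (e j)) = V j"
  proof (cases "par j")
    case Neg
    then have "pc (e j) = rcis rr (real j * pi / real h)" using j by (simp add: pc_e' kx_def rcis_def)
    then show ?thesis using enlarge_rcis[OF rr_pos, of j] j Neg by (simp add: V_def ax_def rcis_def add.commute)
  next
    case Pos
    \<comment> \<open>\<open>enlarge\<close> expects an index from 1 to \<open>2 * h\<close>, so a
      full turn is added to the nonpositive \<open>1 - j\<close>; the result exceeds
      \<open>h\<close> and takes the second branch.\<close>
    define k where "k = 2 * h + 1 - j"
    have k: "1 \<le> k" "k \<le> 2 * h" "\<not> k \<le> h" "int k = 1 - int j + 2 * int h"
      using j by (auto simp: k_def)
    have "cis (of_int (int k) * pi / real h) = cis (of_int (1 - int j) * pi / real h)"
      unfolding k(4) by (rule cis_shift) (use h3 in simp)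
    moreover have "kx j = 1 - int j" using Pos by (simp add: kx_def)
    ultimately have "pc (e j) = rcis rr (of_int (int k) * pi / real h)"
      unfolding rcis_def pc_e'[OF j] by metis
    then have "enlarge h (pc (e j)) = rcis rr (of_int (int (k + 4)) * pi / real (h + 2))"
      using enlarge_rcis[OF rr_pos k(1,2)] k(3) by simp
    also have "int (k + 4) = ax j + 2 * int (h + 2)" using k(4) Pos by (simp add: ax_def)
    finally show ?thesis using cis_shift[of "h + 2" "ax j"] by (simp add: V_def rcis_def)
  qed
  then show ?thesis using e_nonzero[OF j] by (simp add: hat_def cox_number_eq)
qed

lemma hat_F: "f \<in> F \<Longrightarrow> hat \<Delta> c \<omega> f = Origin f"
  by (simp add: hat_def pc_F)

lemma cmod_V: "cmod (V j) = rr"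
  using rr_pos by (simp add: V_def norm_mult)

text \<open>The reflections of the \<open>(h + 2)\<close>-gon in the lines \<open>L'\<close> exchange neighbours in the zigzag order.\<close>

definition vx :: "sign \<Rightarrow> nat \<Rightarrow> nat" where
  "vx \<epsilon> j = (if par j = \<epsilon> then if j > 0 then j - 1 else j else if j \<le> h then Suc j else j)"

lemma refl_V: "j \<le> h + 1 \<Longrightarrow> refl_axis h \<epsilon> (V j) = V (vx \<epsilon> j)"
proof -
  assume j: "j \<le> h + 1"
  \<comment> \<open>Twice the index of the axis: the reflection sends the angular index a to s -
    a.\<close>
  define s :: int where "s = (case \<epsilon> of Pos \<Rightarrow> 2 | Neg \<Rightarrow> 4)"
  have "refl_axis h \<epsilon> (V j) = of_real rr * cis (of_int (s - ax j) * pi / real (h + 2))"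
    by (cases \<epsilon>) (simp_all add: refl_axis_def V_def s_def cis_cnj cis_mult left_diff_distrib diff_divide_distrib mult.left_commute)
  also have "\<dots> = V (vx \<epsilon> j)"
  proof -
    \<comment> \<open>A full turn has to be added or dropped only at the end
      \<open>j = h + 1\<close> of the zigzag.\<close>
    have "s - ax j = ax (vx \<epsilon> j) \<or> s - ax j + 2 * int (h + 2) = ax (vx \<epsilon> j) \<or> s - ax j = ax (vx \<epsilon> j) + 2 * int (h + 2)"
    proof (cases "par j")
      case Pos
      then have "j > 0 \<Longrightarrow> par (j - 1) = Neg" using alt_Suc[of \<epsilon>0 "j - 1"] by (cases "par (j - 1)") auto
      then show ?thesis using Pos j by (cases \<epsilon>) (auto simp: ax_def vx_def s_def of_nat_diff)
    next
      case Neg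
      then have "j > 0 \<Longrightarrow> par (j - 1) = Pos" using alt_Suc[of \<epsilon>0 "j - 1"] by (cases "par (j - 1)") auto
      then show ?thesis using Neg j by (cases \<epsilon>) (auto simp: ax_def vx_def s_def of_nat_diff)
    qed
    moreover have "cis (of_int (a + 2 * int (h + 2)) * pi / real (h + 2)) = cis (of_int a * pi / real (h + 2))" for a
      by (rule cis_shift) simp
    ultimately show ?thesis unfolding V_def by metis
  qed
  finally show ?thesis .
qed

text \<open>Angular distance of \<open>V j\<close> from the ray of L'_\<epsilon> at
  \<open>axis_angle\<close>, in units of \<pi>/(h + 2). It never decreases along the zigzag, so the
  coordinate along the axis falls, with ties only between neighbours \<open>V j\<close>,
  \<open>V (Suc j)\<close> such that \<open>par j \<noteq> \<epsilon>\<close>.\<close>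

definition ux :: "sign \<Rightarrow> nat \<Rightarrow> nat" where "ux \<epsilon> j = (if par j = \<epsilon> then j else Suc j)"

lemma inner_V: "V j \<bullet> cis (axis_angle h \<epsilon>) = rr * cos (real (ux \<epsilon> j) * pi / real (h + 2))"
proof -
  define s :: int where "s = (case \<epsilon> of Pos \<Rightarrow> 1 | Neg \<Rightarrow> 2)"
  have s: "axis_angle h \<epsilon> = of_int s * pi / real (h + 2)" by (cases \<epsilon>) (simp_all add: s_def)
  have "V j \<bullet> cis (axis_angle h \<epsilon>) = rr * cos (of_int (ax j - s) * pi / real (h + 2))"
    unfolding s V_def by (simp add: inner_complex_def cos_diff left_diff_distrib diff_divide_distrib algebra_simps)
  also have "cos (of_int (ax j - s) * pi / real (h + 2)) = cos (real (ux \<epsilon> j) * pi / real (h + 2))"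
  proof -
    have "ax j - s = int (ux \<epsilon> j) \<or> ax j - s = - int (ux \<epsilon> j)"
      by (cases \<epsilon>; cases "par j") (simp_all add: ax_def s_def ux_def)
    then show ?thesis
    proof
      assume eq: "ax j - s = int (ux \<epsilon> j)"
      show ?thesis unfolding eq by simp
    next
      assume eq: "ax j - s = - int (ux \<epsilon> j)"
      show ?thesis unfolding eq by simp
    qed
  qed
  finally show ?thesis .
qed

lemma inner_V_less: 
  assumes "i \<le> h + 1" "j \<le> h + 1" "ux \<epsilon> i < ux \<epsilon> j"
  shows "V i \<bullet> cis (axis_angle h \<epsilon>) > V j \<bullet> cis (axis_angle h \<epsilon>)"
proof -
  have "cos (real (ux \<epsilon> i) * pi / real (h + 2)) > cos (real (ux \<epsilon> j) * pi / real (h + 2))"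
  proof (rule cos_monotone_0_pi)
    show "real (ux \<epsilon> i) * pi / real (h + 2) < real (ux \<epsilon> j) * pi / real (h + 2)"
      using assms by (simp add: divide_strict_right_mono)
    have "ux \<epsilon> j \<le> h + 2" using assms by (simp add: ux_def)
    then have "real (ux \<epsilon> j) \<le> real (h + 2)" by (simp only: of_nat_le_iff)
    then have "real (ux \<epsilon> j) * pi / real (h + 2) \<le> real (h + 2) * pi / real (h + 2)"
      by (intro divide_right_mono mult_right_mono) auto
    then show "real (ux \<epsilon> j) * pi / real (h + 2) \<le> pi" by simp
  qed simp
  then show ?thesis using rr_pos by (simp add: inner_V)
qed

end

text \<open>A whole orbit with its order relations. A nonempty \<open>F\<close> is a pair of
  opposite points between \<open>e m\<close> and \<open>e (Suc m) = - e m\<close>: the middle step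
  is then not a multiple of one simple root but splits at either origin point
  (\<open>F_step\<close>), and \<open>no_root\<close> prevents opposite points from forming a pair.
  By \<open>root_pair\<close> every root is visible as a difference of two chain points, without
  recourse to origin points.\<close>

locale zigzag_orbit = zigzag W \<Phi> \<Delta> \<omega> c h e \<epsilon>0 F
  for W :: "('a::euclidean_space \<Rightarrow> 'a) set" and \<Phi> \<Delta> \<omega> c h e \<epsilon>0 F +
  fixes orb :: "'a set" and m :: nat
  assumes orb_eq: "orb = e ` {1..h} \<union> F"
    and orb_norm: "\<And>x y. x \<in> orb \<Longrightarrow> y \<in> orb \<Longrightarrow> norm x = norm y"
    and orb_inv: "\<And>\<alpha> x. \<alpha> \<in> \<Phi> \<Longrightarrow> x \<in> orb \<Longrightarrow> reflection \<alpha> x \<in> orb"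
    and root_pair: "\<And>\<beta>. \<beta> \<in> \<Phi> \<Longrightarrow> \<exists>p\<in>{1..h}. \<exists>q\<in>{1..h}. \<exists>k. k \<noteq> 0 \<and> e p - e q = k *\<^sub>R \<beta>"
    and step_single: "\<And>i. 1 \<le> i \<Longrightarrow> i < h \<Longrightarrow> F = {} \<or> i \<noteq> m \<Longrightarrow>
        \<exists>\<alpha>\<in>\<Delta> (alt \<epsilon>0 i). \<exists>k>0. e i - e (Suc i) = k *\<^sub>R \<alpha>"
    and F_pm: "\<And>f g. f \<in> F \<Longrightarrow> h = 2 * m \<and> - f \<in> F \<and> (g \<in> F \<longrightarrow> g = f \<or> g = - f)"
    and F_cx: "\<And>f. f \<in> F \<Longrightarrow> cox_part \<Delta> (alt \<epsilon>0 m) f = - f \<and> cox_part \<Delta> (opp (alt \<epsilon>0 m)) f = f"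
    and F_step: "\<And>f. f \<in> F \<Longrightarrow> \<exists>\<alpha>\<in>\<Delta> (alt \<epsilon>0 m). \<exists>k>0. e m - f = k *\<^sub>R \<alpha>"
    and e_neg: "\<And>i. F \<noteq> {} \<Longrightarrow> i \<in> {1..h} \<Longrightarrow> e (h + 1 - i) = - e i"
    and no_root: "\<And>x \<beta> k. F \<noteq> {} \<Longrightarrow> x \<in> orb \<Longrightarrow> \<beta> \<in> \<Phi> \<Longrightarrow> x \<noteq> k *\<^sub>R \<beta>"
begin

lemma h_m: "F \<noteq> {} \<Longrightarrow> h = 2 * m \<and> 2 \<le> m"
  using F_pm h3 by fastforce

lemma m_lt: "F \<noteq> {} \<Longrightarrow> 2 \<le> m \<and> Suc m < h"
  using h_m by fastforce

lemma e_Suc_m: "F \<noteq> {} \<Longrightarrow> e (Suc m) = - e m"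
  using e_neg[of m] h_m by auto

lemma F_step_down: "f \<in> F \<Longrightarrow> \<exists>\<alpha>\<in>\<Delta> (par m). \<exists>k>0. f - e (Suc m) = k *\<^sub>R \<alpha>"
proof -
  assume f: "f \<in> F"
  then have "- f \<in> F" using F_pm by blast
  moreover have "e m - - f = f - e (Suc m)" using f by (subst e_Suc_m) auto
  ultimately show ?thesis using F_step[of "- f"] by simp
qed

lemma pos_multiple_cone: "\<alpha> \<in> \<Delta> \<epsilon> \<Longrightarrow> k > 0 \<Longrightarrow> k *\<^sub>R \<alpha> \<in> cone"
  using B_cone cone_scale Delta_subset by (meson less_imp_le subsetD)

lemma F_cone: "f \<in> F \<Longrightarrow> e m - f \<in> cone" "f \<in> F \<Longrightarrow> f - e (Suc m) \<in> cone"
  using F_step[of f] F_step_down[of f] pos_multiple_cone by force+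

lemma step_cone: "1 \<le> i \<Longrightarrow> i < h \<Longrightarrow> e i - e (Suc i) \<in> cone"
proof -
  assume i: "1 \<le> i" "i < h"
  show ?thesis
  proof (cases "F = {} \<or> i \<noteq> m")
    case True
    then show ?thesis using step_single[OF i] pos_multiple_cone by force
  next
    case False
    then obtain f where "f \<in> F" "i = m" by auto
    then show ?thesis using cone_trans F_cone by blast
  qed
qed

lemma e_cone: "p \<le> q \<Longrightarrow> 1 \<le> p \<Longrightarrow> q \<le> h \<Longrightarrow> e p - e q \<in> cone"
proof (induction q rule: dec_induct)
  case (step q)
  then show ?case using cone_trans[of "e p" "e q"] step_cone[of q] by simp
qed simp

text \<open>Cutting out the step i leaves \<open>e p - e i\<close> and
  \<open>e (Suc i) - e q\<close>, which both lie in the cone.\<close>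

lemma step_coeff_le: "1 \<le> p \<Longrightarrow> p \<le> i \<Longrightarrow> i < q \<Longrightarrow> q \<le> h \<Longrightarrow> \<alpha> \<in> B \<Longrightarrow>
    (e i - e (Suc i)) \<bullet> \<omega> \<alpha> \<le> (e p - e q) \<bullet> \<omega> \<alpha>"
  using cone_ge[OF e_cone[of p i], of \<alpha>] cone_ge[OF e_cone[of "Suc i" q], of \<alpha>]
  by (simp add: inner_diff_left)

lemma step_coeff_le_F: "1 \<le> p \<Longrightarrow> p \<le> i \<Longrightarrow> i < m \<Longrightarrow> f \<in> F \<Longrightarrow> \<alpha> \<in> B \<Longrightarrow>
    (e i - e (Suc i)) \<bullet> \<omega> \<alpha> \<le> (e p - f) \<bullet> \<omega> \<alpha>"
  using step_coeff_le[of p i m \<alpha>] cone_ge[OF F_cone(1), of f \<alpha>] h_m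
  by (force simp: inner_diff_left)

lemma step_coeff_le_F': "m < i \<Longrightarrow> i < q \<Longrightarrow> q \<le> h \<Longrightarrow> f \<in> F \<Longrightarrow> \<alpha> \<in> B \<Longrightarrow>
    (e i - e (Suc i)) \<bullet> \<omega> \<alpha> \<le> (f - e q) \<bullet> \<omega> \<alpha>"
  using step_coeff_le[of "Suc m" i q \<alpha>] cone_ge[OF F_cone(2), of f \<alpha>] h_m
  by (force simp: inner_diff_left)

text \<open>For \<open>- \<alpha>\<close> with a simple root \<alpha>, these are the orbit points
  exchanged by the reflection in \<alpha>, with the lower point first. Multiples are allowed because
  root lengths are arbitrary.\<close>

definition pairs :: "'a \<Rightarrow> ('a \<times> 'a) set" where
  "pairs \<beta> = {(x, y). x \<in> orb \<and> y \<in> orb \<and> (\<exists>k>0. x - y = k *\<^sub>R \<beta>)}"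

text \<open>A positive difference orders the two points, hence their indices. When there are origin
  points, opposite points are impossible, since half of their difference would be an orbit point
  proportional to a root; this also excludes two origin points.\<close>

lemma pairs_pos:
  assumes "\<beta> \<in> \<Phi>" "\<beta> \<in> cone" "(x, y) \<in> pairs \<beta>"
  obtains (ee) p q where "1 \<le> p" "p < q" "q \<le> h" "x = e p" "y = e q" "F \<noteq> {} \<Longrightarrow> p + q \<noteq> h + 1"
  | (eF) p where "1 \<le> p" "p \<le> m" "x = e p" "y \<in> F"
  | (Fe) q where "m < q" "q \<le> h" "x \<in> F" "y = e q"
proof -
  obtain k where k: "k > 0" "x - y = k *\<^sub>R \<beta>" and o: "x \<in> orb" "y \<in> orb"
    using assms by (auto simp: pairs_def)
  have nz: "\<beta> \<noteq> 0" using assms zero_notin by auto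
  have c: "x - y \<in> cone" using k assms by (simp add: cone_scale)
  have n: "y - x \<notin> cone"
  proof
    assume "y - x \<in> cone"
    then have "x - y = 0" using cone_antisym[OF c] by simp
    then show False using k nz by simp
  qed
  have neg: "y \<noteq> - x" if "F \<noteq> {}"
  proof
    assume "y = - x"
    then have "2 *\<^sub>R x = k *\<^sub>R \<beta>" using k by (simp add: scaleR_2)
    then have "(1/2) *\<^sub>R (2 *\<^sub>R x) = (1/2) *\<^sub>R (k *\<^sub>R \<beta>)" by simp
    then have "x = (k / 2) *\<^sub>R \<beta>" by simp
    then show False using no_root[OF that o(1) assms(1)] by blast
  qed
  consider (1) p q where "p \<in> {1..h}" "q \<in> {1..h}" "x = e p" "y = e q"
    | (2) p where "p \<in> {1..h}" "x = e p" "y \<in> F"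
    | (3) q where "q \<in> {1..h}" "x \<in> F" "y = e q" | (4) "x \<in> F" "y \<in> F"
    using o by (auto simp: orb_eq)
  then show ?thesis
  proof cases
    case 1
    then have "p < q" using n e_cone[of q p] by (cases "p < q") auto
    moreover have "p + q \<noteq> h + 1" if "F \<noteq> {}"
    proof
      assume "p + q = h + 1"
      then have "q = h + 1 - p" by simp
      then show False using e_neg[OF that, of p] neg[OF that] 1 by simp
    qed
    ultimately show ?thesis using ee 1 by auto
  next
    case 2
    have "p \<le> m"
    proof (rule ccontr)
      assume "\<not> p \<le> m"
      then have "e (Suc m) - e p \<in> cone" using 2 by (intro e_cone) auto
      then show False using F_cone(2)[OF 2(3)] n cone_trans 2 by blast
    qed
    then show ?thesis using eF 2 by auto
  next
    case 3
    have "m < q"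
    proof (rule ccontr)
      assume "\<not> m < q"
      moreover have "F \<noteq> {}" using 3 by auto
      ultimately have "e q - e m \<in> cone" using 3 h_m by (intro e_cone) auto
      then show False using F_cone(1)[OF 3(2)] n cone_trans 3 by blast
    qed
    then show ?thesis using Fe 3 by auto
  next
    case 4
    then have "y = x" using F_pm[of x y] neg by auto
    then show ?thesis using k nz by simp
  qed
qed

lemma coeff_same:
  assumes "\<alpha> \<in> B" "k *\<^sub>R \<alpha> = z" "\<alpha>' \<in> B" "z \<bullet> \<omega> \<alpha>' > 0"
  shows "\<alpha>' = \<alpha>"
  using assms by (auto simp: omega_inner split: if_splits)

text \<open>A multiple of a simple root cannot contain two consecutive steps: each step has a
  positive coefficient at some root of its class, that root would have to be \<alpha>, and \<alpha>
  would lie in both classes. So only neighbours in the order occur.\<close>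

lemma pairs_neg:
  assumes "\<alpha> \<in> B" "(x, y) \<in> pairs (- \<alpha>)"
  obtains (ee) i where "1 \<le> i" "i < h" "x = e (Suc i)" "y = e i" "\<alpha> \<in> \<Delta> (par i)" "F \<noteq> {} \<Longrightarrow> i \<noteq> m"
  | (eF) "x = e (Suc m)" "y \<in> F" "\<alpha> \<in> \<Delta> (par m)"
  | (Fe) "x \<in> F" "y = e m" "\<alpha> \<in> \<Delta> (par m)"
proof -
  obtain k where k: "k > 0" "x - y = k *\<^sub>R (- \<alpha>)" "x \<in> orb" "y \<in> orb"
    using assms by (auto simp: pairs_def)
  then have k': "y - x = k *\<^sub>R \<alpha>" by (metis minus_diff_eq minus_minus scaleR_minus_right)
  then have yx: "(y, x) \<in> pairs \<alpha>" using k by (auto simp: pairs_def)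
  have aP: "\<alpha> \<in> \<Phi>" "\<alpha> \<in> cone" using assms B_subset B_cone by auto
  have par_in: "\<alpha> \<in> \<Delta> (par i)" if i: "1 \<le> i" "i < h"
    and le: "\<And>\<alpha>'. \<alpha>' \<in> B \<Longrightarrow> (e i - e (Suc i)) \<bullet> \<omega> \<alpha>' \<le> (y - x) \<bullet> \<omega> \<alpha>'" for i
  proof -
    obtain \<alpha>' where a': "\<alpha>' \<in> \<Delta> (par i)" "(e i - e (Suc i)) \<bullet> \<omega> \<alpha>' > 0" using step_pos[OF i] by blast
    then have "\<alpha>' \<in> B" using Delta_subset by blast
    then have "\<alpha>' = \<alpha>" using coeff_same[OF assms(1) k'[symmetric]] le[of \<alpha>'] a' by fastforce
    then show ?thesis using a' by simp
  qed
  have contra: False if "\<alpha> \<in> \<Delta> (par i)" "\<alpha> \<in> \<Delta> (par (Suc i))" for i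
    using that Delta_disj[of \<alpha> "par i"] by simp
  show ?thesis
    using aP yx
  proof (cases rule: pairs_pos)
    case (ee p q)
    have "q = Suc p"
    proof (rule ccontr)
      assume "q \<noteq> Suc p"
      then have "\<alpha> \<in> \<Delta> (par p)" "\<alpha> \<in> \<Delta> (par (Suc p))"
        using ee step_coeff_le by (intro par_in; simp)+
      then show False by (rule contra)
    qed
    moreover have "\<alpha> \<in> \<Delta> (par p)" using ee step_coeff_le by (intro par_in) auto
    moreover have "F \<noteq> {} \<Longrightarrow> p \<noteq> m" using ee h_m calculation by auto
    ultimately show ?thesis using that(1)[of p] ee by auto
  next
    case (eF p)
    then have "F \<noteq> {}" by auto
    then have hm0: "h = 2 * m" and hm: "2 \<le> m" "Suc m < h" using h_m m_lt by auto
    obtain \<alpha>' k1 where a': "\<alpha>' \<in> \<Delta> (par m)" "k1 > 0" "e m - x = k1 *\<^sub>R \<alpha>'" using F_step eF by blast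
    have aB: "\<alpha>' \<in> B" using a' Delta_subset by blast
    have "(y - x) \<bullet> \<omega> \<alpha>' \<ge> (e m - x) \<bullet> \<omega> \<alpha>'"
      using cone_ge[OF e_cone[of p m] aB] eF hm by (simp add: inner_diff_left)
    then have "(y - x) \<bullet> \<omega> \<alpha>' > 0" using a' aB B_nonzero[OF aB] by (auto simp: omega_inner intro: less_le_trans[rotated])
    then have am: "\<alpha> \<in> \<Delta> (par m)" using coeff_same[OF assms(1) k'[symmetric] aB] a' by simp
    have "p = m"
    proof (rule ccontr)
      assume "p \<noteq> m"
      then have "\<alpha> \<in> \<Delta> (par (m - 1))" using eF hm step_coeff_le_F[of p "m - 1" x] by (intro par_in) auto
      then show False using contra[of "m - 1"] am hm by simp
    qed
    then show ?thesis using that(3) eF am by auto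
  next
    case (Fe q)
    then have "F \<noteq> {}" by auto
    then have hm0: "h = 2 * m" and hm: "2 \<le> m" "Suc m < h" using h_m m_lt by auto
    obtain \<alpha>' k1 where a': "\<alpha>' \<in> \<Delta> (par m)" "k1 > 0" "y - e (Suc m) = k1 *\<^sub>R \<alpha>'" using F_step_down Fe by blast
    have aB: "\<alpha>' \<in> B" using a' Delta_subset by blast
    have "(y - x) \<bullet> \<omega> \<alpha>' \<ge> (y - e (Suc m)) \<bullet> \<omega> \<alpha>'"
      using cone_ge[OF e_cone[of "Suc m" q] aB] Fe hm by (simp add: inner_diff_left)
    then have "(y - x) \<bullet> \<omega> \<alpha>' > 0" using a' aB B_nonzero[OF aB] by (auto simp: omega_inner intro: less_le_trans[rotated])
    then have am: "\<alpha> \<in> \<Delta> (par m)" using coeff_same[OF assms(1) k'[symmetric] aB] a' by simp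
    have "q = Suc m"
    proof (rule ccontr)
      assume "q \<noteq> Suc m"
      then have "\<alpha> \<in> \<Delta> (par (Suc m))" using Fe hm step_coeff_le_F'[of "Suc m" q y] by (intro par_in) auto
      then show False using contra[of m] am by simp
    qed
    then show ?thesis using that(2) Fe am by auto
  qed
qed

definition idx :: "'a \<Rightarrow> nat" where "idx x = (THE i. i \<in> {1..h} \<and> e i = x)"

lemma idx_e: "1 \<le> i \<Longrightarrow> i \<le> h \<Longrightarrow> idx (e i) = i"
  unfolding idx_def by (rule the_equality) (auto intro: inj_onD[OF inj_e])

lemma e_notin_F: "1 \<le> i \<Longrightarrow> i \<le> h \<Longrightarrow> e i \<notin> F"
  using e_nonzero pc_F by blast

text \<open>The left and the right endpoint of the segment that belongs to a pair: \<open>e\<^sub>p - e\<^sub>q\<close> gives the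
  diagonal from vertex \<open>p - 1\<close> to vertex \<open>q + 1\<close> in the zigzag order. Origin points change sign.\<close>

definition lpt :: "'a \<Rightarrow> 'a dpoint" where
  "lpt x = (if x \<in> F then Origin (- x) else Vertex (V (idx x - 1)))"

definition rpt :: "'a \<Rightarrow> 'a dpoint" where
  "rpt x = (if x \<in> F then Origin (- x) else Vertex (V (idx x + 1)))"

definition D :: "'a \<Rightarrow> 'a dpoint set set" where
  "D \<beta> = (\<lambda>(x, y). {lpt x, rpt y}) ` pairs \<beta>"

lemma lpt_e: "1 \<le> i \<Longrightarrow> i \<le> h \<Longrightarrow> lpt (e i) = Vertex (V (i - 1))"
  and rpt_e: "1 \<le> i \<Longrightarrow> i \<le> h \<Longrightarrow> rpt (e i) = Vertex (V (i + 1))"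
  and pt_F: "x \<in> F \<Longrightarrow> lpt x = Origin (- x)" "x \<in> F \<Longrightarrow> rpt x = Origin (- x)"
  by (simp_all add: lpt_def rpt_def e_notin_F idx_e)

lemma D_I: "(x, y) \<in> pairs \<beta> \<Longrightarrow> {lpt x, rpt y} \<in> D \<beta>"
  by (auto simp: D_def)

lemma pairs_flip: "F \<noteq> {} \<Longrightarrow> (x, y) \<in> pairs \<beta> \<Longrightarrow> (- y, - x) \<in> pairs \<beta>"
proof -
  assume a: "F \<noteq> {}" "(x, y) \<in> pairs \<beta>"
  have "- z \<in> orb" if z: "z \<in> orb" for z
  proof (cases "z \<in> F")
    case True
    then show ?thesis using F_pm[OF True] by (auto simp: orb_eq)
  next
    case False
    then obtain i where i: "i \<in> {1..h}" "z = e i" using z by (auto simp: orb_eq)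
    then show ?thesis using e_neg[OF a(1) i(1)] by (auto simp: orb_eq intro!: image_eqI[of _ _ "h + 1 - i"])
  qed
  then show ?thesis using a by (auto simp: pairs_def)
qed

text \<open>Between chain points the shift exchanges the places of \<open>e i\<close> and
  \<open>e (Suc i)\<close>, which leaves the segment as a set. Next to an origin point the shift
  carries \<open>e (Suc m)\<close> to the place of \<open>e m = - e (Suc m)\<close>; with the label
  negated as well, this is the segment of the pair given by \<open>pairs_flip\<close>, which belongs
  to the same diagram.\<close>

lemma D_neg: "\<alpha> \<in> B \<Longrightarrow> D (- \<alpha>) = neg_simple_diagram \<Delta> c \<omega> orb \<alpha>"
proof -
  assume a: "\<alpha> \<in> B"
  have aP: "\<alpha> \<in> \<Phi>" using a B_subset by auto
  have sw: "reflection \<alpha> y = x" "reflection \<alpha> x = y" "x \<noteq> y" if xy: "(x, y) \<in> pairs (- \<alpha>)" for x y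
  proof -
    obtain k where k: "k > 0" "x - y = k *\<^sub>R (- \<alpha>)" "x \<in> orb" "y \<in> orb"
      using xy by (auto simp: pairs_def)
    then show 1: "reflection \<alpha> x = y" using orb_norm[of x y] reflection_swap[of x y "- k" \<alpha>] by simp
    then show "reflection \<alpha> y = x" by (metis reflection_reflection)
    show "x \<noteq> y" using k B_nonzero[OF a] by auto
  qed
  have mem: "{hat \<Delta> c \<omega> y, hat \<Delta> c \<omega> x} \<in> neg_simple_diagram \<Delta> c \<omega> orb \<alpha>"
    if xy: "(x, y) \<in> pairs (- \<alpha>)" for x y
    using sw[OF xy] xy by (auto simp: neg_simple_diagram_def pairs_def)
  have F': "- f \<in> F" if "f \<in> F" for f using F_pm[OF that] by blast
  show ?thesis
  proof (intro equalityI subsetI)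
    fix s assume "s \<in> D (- \<alpha>)"
    then obtain x y where s: "s = {lpt x, rpt y}" and xy: "(x, y) \<in> pairs (- \<alpha>)" by (auto simp: D_def)
    show "s \<in> neg_simple_diagram \<Delta> c \<omega> orb \<alpha>"
      using a xy
    proof (cases rule: pairs_neg)
      case (ee i)
      then show ?thesis using mem[OF xy] s by (simp add: lpt_e rpt_e hat_e insert_commute)
    next
      case eF
      then have Fne: "F \<noteq> {}" by auto
      have nx: "- x = e m" using eF e_Suc_m[OF Fne] by simp
      have "s = {hat \<Delta> c \<omega> (- x), hat \<Delta> c \<omega> (- y)}"
        unfolding s nx using eF m_lt[OF Fne] F'[of y] by (simp add: lpt_e pt_F hat_e hat_F)
      then show ?thesis using mem[OF pairs_flip[OF Fne xy]] by simp
    next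
      case Fe
      then have Fne: "F \<noteq> {}" by auto
      have ny: "- y = e (Suc m)" using Fe e_Suc_m[OF Fne] by simp
      have "s = {hat \<Delta> c \<omega> (- x), hat \<Delta> c \<omega> (- y)}"
        unfolding s ny using Fe m_lt[OF Fne] F'[of x] by (simp add: rpt_e pt_F hat_e hat_F)
      then show ?thesis using mem[OF pairs_flip[OF Fne xy]] by simp
    qed
  next
    fix s assume "s \<in> neg_simple_diagram \<Delta> c \<omega> orb \<alpha>"
    then obtain u where u: "s = {hat \<Delta> c \<omega> u, hat \<Delta> c \<omega> (reflection \<alpha> u)}" "u \<in> orb" "reflection \<alpha> u \<noteq> u"
      by (auto simp: neg_simple_diagram_def)
    define t where "t = 2 * (u \<bullet> \<alpha>) / (\<alpha> \<bullet> \<alpha>)"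
    have t: "u - reflection \<alpha> u = t *\<^sub>R \<alpha>" "t \<noteq> 0" using u(3) by (auto simp: reflection_def t_def)
    have r: "reflection \<alpha> u \<in> orb" using orb_inv aP u by blast
    have "(reflection \<alpha> u, u) \<in> pairs (- \<alpha>) \<or> (u, reflection \<alpha> u) \<in> pairs (- \<alpha>)"
    proof (cases "t > 0")
      case True
      have "reflection \<alpha> u - u = t *\<^sub>R (- \<alpha>)" using t(1) by (metis minus_diff_eq scaleR_minus_right)
      then show ?thesis using True r u by (auto simp: pairs_def)
    next
      case False
      then have "u - reflection \<alpha> u = (- t) *\<^sub>R (- \<alpha>)" "- t > 0" using t by auto
      then show ?thesis using r u unfolding pairs_def by blast
    qed
    then obtain x y where xy: "(x, y) \<in> pairs (- \<alpha>)" and s: "s = {hat \<Delta> c \<omega> x, hat \<Delta> c \<omega> y}"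
      using u(1) by (auto simp: insert_commute)
    show "s \<in> D (- \<alpha>)"
      using a xy
    proof (cases rule: pairs_neg)
      case (ee i)
      then have "s = {lpt x, rpt y}" using s by (simp add: lpt_e rpt_e hat_e insert_commute)
      then show ?thesis using D_I[OF xy] by simp
    next
      case eF
      then have Fne: "F \<noteq> {}" by auto
      have nx: "- x = e m" using eF e_Suc_m[OF Fne] by simp
      have "s = {lpt (- y), rpt (- x)}"
        unfolding s nx using eF m_lt[OF Fne] F'[of y]
        by (simp add: rpt_e pt_F hat_e hat_F insert_commute)
      then show ?thesis using D_I[OF pairs_flip[OF Fne xy]] by simp
    next
      case Fe
      then have Fne: "F \<noteq> {}" by auto
      have ny: "- y = e (Suc m)" using Fe e_Suc_m[OF Fne] by simp
      have "s = {lpt (- y), rpt (- x)}"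
        unfolding s ny using Fe m_lt[OF Fne] F'[of x]
        by (simp add: lpt_e pt_F hat_e hat_F insert_commute)
      then show ?thesis using D_I[OF pairs_flip[OF Fne xy]] by simp
    qed
  qed
qed

text \<open>The shift is compatible with both motions of indices:
  \<open>nx \<epsilon> p - 1 = vx \<epsilon> (p - 1)\<close>. The excluded case is the fixed end
  \<open>e h\<close>, where the chain stops but the polygon goes on; \<open>rpt_cx\<close> excludes
  \<open>e 1\<close> likewise.\<close>

lemma lpt_cx: "1 \<le> p \<Longrightarrow> p \<le> h \<Longrightarrow> \<not> (p = h \<and> par h = \<epsilon>) \<Longrightarrow> lpt (cx \<epsilon> (e p)) = tau_point \<Delta> \<epsilon> (lpt (e p))"
proof -
  assume a: "1 \<le> p" "p \<le> h" "\<not> (p = h \<and> par h = \<epsilon>)"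
  obtain j where p: "p = Suc j" using a by (cases p) auto
  have "nx \<epsilon> p - 1 = vx \<epsilon> (p - 1)"
  proof (cases "par j = \<epsilon>")
    case True
    then show ?thesis using a by (auto simp: nx_def vx_def p)
  next
    case False
    then have "opp (par j) = \<epsilon>" using sign_cases2[of "par j" \<epsilon>] by auto
    then show ?thesis using a False by (auto simp: nx_def vx_def p)
  qed
  then show ?thesis using a nx_range[OF a(1,2), of \<epsilon>] refl_V[of "p - 1" \<epsilon>]
    by (simp add: cx_nx lpt_e cox_number_eq refl_axis_def)
qed

lemma rpt_cx: "1 \<le> q \<Longrightarrow> q \<le> h \<Longrightarrow> \<not> (q = 1 \<and> par 1 \<noteq> \<epsilon>) \<Longrightarrow> rpt (cx \<epsilon> (e q)) = tau_point \<Delta> \<epsilon> (rpt (e q))"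
proof -
  assume a: "1 \<le> q" "q \<le> h" "\<not> (q = 1 \<and> par 1 \<noteq> \<epsilon>)"
  have "nx \<epsilon> q + 1 = vx \<epsilon> (q + 1)"
  proof (cases "par q = \<epsilon>")
    case True
    then show ?thesis using a by (auto simp: nx_def vx_def)
  next
    case False
    then have "opp (par q) = \<epsilon>" using sign_cases2[of "par q" \<epsilon>] by auto
    moreover have "q > 1" using a False by (metis le_neq_implies_less)
    ultimately show ?thesis using False unfolding nx_def vx_def by simp
  qed
  then show ?thesis using a nx_range[OF a(1,2), of \<epsilon>] refl_V[of "q + 1" \<epsilon>]
    by (simp add: cx_nx rpt_e cox_number_eq refl_axis_def)
qed

lemma cx_in_F: "f \<in> F \<Longrightarrow> cx \<epsilon> f \<in> F"
  using F_cx[of f] F_pm[of f] sign_cases2[of \<epsilon> "par m"] by auto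

lemma F_pt_cx: "f \<in> F \<Longrightarrow> lpt (cx \<epsilon> f) = tau_point \<Delta> \<epsilon> (lpt f)" "f \<in> F \<Longrightarrow> rpt (cx \<epsilon> f) = tau_point \<Delta> \<epsilon> (rpt f)"
  using cx_in_F by (simp_all add: pt_F cx_minus)

text \<open>Here \<open>h + 2 = 2 * (m + 1)\<close>, so \<open>ux = Suc m\<close> is a quarter turn
  from the axis.\<close>

lemma inner_V_mid:
  assumes "h = 2 * m" "ux \<epsilon> j \<le> h + 2"
  shows "ux \<epsilon> j = Suc m \<Longrightarrow> V j \<bullet> cis (axis_angle h \<epsilon>) = 0"
    "ux \<epsilon> j < Suc m \<Longrightarrow> V j \<bullet> cis (axis_angle h \<epsilon>) > 0"
    "ux \<epsilon> j > Suc m \<Longrightarrow> V j \<bullet> cis (axis_angle h \<epsilon>) < 0"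
proof -
  have half: "real (Suc m) * pi / real (h + 2) = pi / 2" using assms(1) by (simp add: field_simps)
  show "V j \<bullet> cis (axis_angle h \<epsilon>) = 0" if "ux \<epsilon> j = Suc m"
    unfolding inner_V that half by simp
  have mono: "real a * pi / real (h + 2) < real b * pi / real (h + 2)" if "a < b" for a b :: nat
    using that by (simp add: divide_strict_right_mono)
  have top: "real (h + 2) * pi / real (h + 2) = pi" by simp
  show "ux \<epsilon> j < Suc m \<Longrightarrow> V j \<bullet> cis (axis_angle h \<epsilon>) > 0"
  proof -
    assume "ux \<epsilon> j < Suc m"
    then have "real (ux \<epsilon> j) * pi / real (h + 2) < pi / 2" using mono unfolding half[symmetric] by blast
    moreover have "0 \<le> real (ux \<epsilon> j) * pi / real (h + 2)" by simp
    ultimately have "cos (real (ux \<epsilon> j) * pi / real (h + 2)) > 0"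
      using pi_half_gt_zero by (intro cos_gt_zero_pi) linarith+
    then show ?thesis unfolding inner_V using rr_pos by simp
  qed
  show "ux \<epsilon> j > Suc m \<Longrightarrow> V j \<bullet> cis (axis_angle h \<epsilon>) < 0"
  proof -
    assume u: "ux \<epsilon> j > Suc m"
    have "real (ux \<epsilon> j) * pi / real (h + 2) \<le> real (h + 2) * pi / real (h + 2)"
      using assms(2) by (intro divide_right_mono mult_right_mono) auto
    then have "cos (real (ux \<epsilon> j) * pi / real (h + 2)) < cos (pi / 2)"
      using mono[OF u] unfolding half top by (intro cos_monotone_0_pi) auto
    then show ?thesis unfolding inner_V using rr_pos by (simp add: mult_pos_neg)
  qed
qed

text \<open>A radius is perpendicular to the axis only if its vertex has \<open>ux = Suc m\<close>.
  For positive roots, and for the negative simple roots that \<tau> moves, the vertex of each radius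
  lies strictly on one side, so the exceptional rule of \<open>tau_segment\<close> does not fire and
  the diagram simply follows \<open>cx \<epsilon>\<close>.\<close>

lemma not_perp:
  assumes "\<beta> \<in> APR" "\<beta> \<notin> uminus ` \<Delta> (opp \<epsilon>)" "(x, y) \<in> pairs \<beta>"
  shows "tau_segment \<Delta> \<epsilon> {lpt x, rpt y} = tau_point \<Delta> \<epsilon> ` {lpt x, rpt y}"
    and "{lpt (cx \<epsilon> x), rpt (cx \<epsilon> y)} = tau_point \<Delta> \<epsilon> ` {lpt x, rpt y}"
proof -
  have seg: "tau_segment \<Delta> \<epsilon> s = tau_point \<Delta> \<epsilon> ` s"
    if "\<And>x z. s = {Origin x, Vertex z} \<Longrightarrow> z \<bullet> cis (axis_angle h \<epsilon>) \<noteq> 0" for s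
    using that unfolding tau_segment_def orthogonal_def cox_number_eq by (intro if_not_P) blast
  have "tau_segment \<Delta> \<epsilon> {lpt x, rpt y} = tau_point \<Delta> \<epsilon> ` {lpt x, rpt y} \<and>
    {lpt (cx \<epsilon> x), rpt (cx \<epsilon> y)} = tau_point \<Delta> \<epsilon> ` {lpt x, rpt y}"
    using assms(1)
  proof (cases rule: APR_cases)
    case 1
    show ?thesis using 1 assms(3)
    proof (cases rule: pairs_pos)
      case (ee p q)
      then have "lpt (cx \<epsilon> x) = tau_point \<Delta> \<epsilon> (lpt x)" "rpt (cx \<epsilon> y) = tau_point \<Delta> \<epsilon> (rpt y)"
        using lpt_cx[of p \<epsilon>] rpt_cx[of q \<epsilon>] by auto
      moreover have "tau_segment \<Delta> \<epsilon> {lpt x, rpt y} = tau_point \<Delta> \<epsilon> ` {lpt x, rpt y}"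
        using ee by (intro seg) (auto simp: lpt_e rpt_e doubleton_eq_iff)
      ultimately show ?thesis by simp
    next
      case (eF p)
      then have "F \<noteq> {}" by auto
      then have hm0: "h = 2 * m" and hm: "2 \<le> m" "Suc m < h" using h_m m_lt by auto
      then have "lpt (cx \<epsilon> x) = tau_point \<Delta> \<epsilon> (lpt x)" "rpt (cx \<epsilon> y) = tau_point \<Delta> \<epsilon> (rpt y)"
        using lpt_cx[of p \<epsilon>] F_pt_cx(2)[of y] eF by auto
      moreover have "V (p - 1) \<bullet> cis (axis_angle h \<epsilon>) > 0"
        using eF hm by (intro inner_V_mid(2)[OF hm0]) (auto simp: ux_def)
      then have "tau_segment \<Delta> \<epsilon> {lpt x, rpt y} = tau_point \<Delta> \<epsilon> ` {lpt x, rpt y}"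
        using eF hm by (intro seg) (auto simp: lpt_e pt_F doubleton_eq_iff)
      ultimately show ?thesis by simp
    next
      case (Fe q)
      then have "F \<noteq> {}" by auto
      then have hm0: "h = 2 * m" and hm: "2 \<le> m" "Suc m < h" using h_m m_lt by auto
      then have "lpt (cx \<epsilon> x) = tau_point \<Delta> \<epsilon> (lpt x)" "rpt (cx \<epsilon> y) = tau_point \<Delta> \<epsilon> (rpt y)"
        using rpt_cx[of q \<epsilon>] F_pt_cx(1)[of x] Fe by auto
      moreover have "V (q + 1) \<bullet> cis (axis_angle h \<epsilon>) < 0"
        using Fe hm by (intro inner_V_mid(3)[OF hm0]) (auto simp: ux_def)
      then have "tau_segment \<Delta> \<epsilon> {lpt x, rpt y} = tau_point \<Delta> \<epsilon> ` {lpt x, rpt y}"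
        using Fe hm by (intro seg) (auto simp: rpt_e pt_F doubleton_eq_iff)
      ultimately show ?thesis by simp
    qed
  next
    case (2 \<alpha>)
    then have a: "\<alpha> \<in> \<Delta> \<epsilon>" using assms(2) B_cases by blast
    have par: "par i = \<epsilon>" if "\<alpha> \<in> \<Delta> (par i)" for i
      using that a Delta_disj[of \<alpha> \<epsilon>] sign_cases2[of "par i" \<epsilon>] by auto
    have xy: "(x, y) \<in> pairs (- \<alpha>)" using assms(3) 2 by simp
    show ?thesis using 2(1) xy
    proof (cases rule: pairs_neg)
      case (ee i)
      then have pi: "par i = \<epsilon>" using par by blast
      have "\<not> (Suc i = h \<and> par h = \<epsilon>)" using pi by (metis alt_Suc opp_neq(1))
      moreover have "\<not> (i = 1 \<and> par 1 \<noteq> \<epsilon>)" using pi by metis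
      ultimately have "lpt (cx \<epsilon> x) = tau_point \<Delta> \<epsilon> (lpt x)" "rpt (cx \<epsilon> y) = tau_point \<Delta> \<epsilon> (rpt y)"
        using lpt_cx[of "Suc i" \<epsilon>] rpt_cx[of i \<epsilon>] ee by auto
      moreover have "tau_segment \<Delta> \<epsilon> {lpt x, rpt y} = tau_point \<Delta> \<epsilon> ` {lpt x, rpt y}"
        using ee by (intro seg) (auto simp: lpt_e rpt_e doubleton_eq_iff)
      ultimately show ?thesis by simp
    next
      case eF
      then have "F \<noteq> {}" by auto
      then have hm0: "h = 2 * m" and hm: "2 \<le> m" "Suc m < h" using h_m m_lt by auto
      then have "lpt (cx \<epsilon> x) = tau_point \<Delta> \<epsilon> (lpt x)" "rpt (cx \<epsilon> y) = tau_point \<Delta> \<epsilon> (rpt y)"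
        using lpt_cx[of "Suc m" \<epsilon>] F_pt_cx(2)[of y] eF by auto
      moreover have "V m \<bullet> cis (axis_angle h \<epsilon>) > 0"
        using eF hm par by (intro inner_V_mid(2)[OF hm0]) (auto simp: ux_def)
      then have "tau_segment \<Delta> \<epsilon> {lpt x, rpt y} = tau_point \<Delta> \<epsilon> ` {lpt x, rpt y}"
        using eF hm by (intro seg) (auto simp: lpt_e pt_F doubleton_eq_iff)
      ultimately show ?thesis by simp
    next
      case Fe
      then have "F \<noteq> {}" by auto
      then have hm0: "h = 2 * m" and hm: "2 \<le> m" "Suc m < h" using h_m m_lt by auto
      then have "lpt (cx \<epsilon> x) = tau_point \<Delta> \<epsilon> (lpt x)" "rpt (cx \<epsilon> y) = tau_point \<Delta> \<epsilon> (rpt y)"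
        using rpt_cx[of m \<epsilon>] F_pt_cx(1)[of x] Fe by auto
      moreover have "V (Suc m) \<bullet> cis (axis_angle h \<epsilon>) < 0"
        using Fe hm par by (intro inner_V_mid(3)[OF hm0]) (auto simp: ux_def)
      then have "tau_segment \<Delta> \<epsilon> {lpt x, rpt y} = tau_point \<Delta> \<epsilon> ` {lpt x, rpt y}"
        using Fe hm by (intro seg) (auto simp: rpt_e pt_F doubleton_eq_iff)
      ultimately show ?thesis by simp
    qed
  qed
  then show "tau_segment \<Delta> \<epsilon> {lpt x, rpt y} = tau_point \<Delta> \<epsilon> ` {lpt x, rpt y}"
    and "{lpt (cx \<epsilon> x), rpt (cx \<epsilon> y)} = tau_point \<Delta> \<epsilon> ` {lpt x, rpt y}" by auto
qed

text \<open>Here the axis is perpendicular to the segment of the step. A segment from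
  \<open>V i\<close> to \<open>V (Suc i)\<close> is its own mirror image. A radius falls under the
  exceptional rule and stays, while its mirror image is the opposite radius, which occurs in the
  same diagram with the opposite label by \<open>pairs_flip\<close>.\<close>

lemma pairs_fixed:
  assumes "\<alpha> \<in> \<Delta> (opp \<epsilon>)" "(x, y) \<in> pairs (- \<alpha>)"
  shows "tau_segment \<Delta> \<epsilon> {lpt x, rpt y} = {lpt x, rpt y}"
    and "\<exists>s\<in>D (- \<alpha>). location ` s = refl_axis h \<epsilon> ` location ` {lpt x, rpt y}"
proof -
  have aB: "\<alpha> \<in> B" using assms Delta_subset by blast
  have par: "par i = opp \<epsilon>" if "\<alpha> \<in> \<Delta> (par i)" for i
    using that assms Delta_disj[of \<alpha> \<epsilon>] sign_cases2[of "par i" \<epsilon>] by auto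
  have seg: "tau_segment \<Delta> \<epsilon> {Origin u, Vertex z} = {Origin u, Vertex z}"
    if "z \<bullet> cis (axis_angle h \<epsilon>) = 0" for u z
    using that unfolding tau_segment_def orthogonal_def cox_number_eq by (intro if_P) blast
  have "tau_segment \<Delta> \<epsilon> {lpt x, rpt y} = {lpt x, rpt y} \<and>
    (\<exists>s\<in>D (- \<alpha>). location ` s = refl_axis h \<epsilon> ` location ` {lpt x, rpt y})"
    using aB assms(2)
  proof (cases rule: pairs_neg)
    case (ee i)
    have i: "par i = opp \<epsilon>" using ee par by blast
    have r: "refl_axis h \<epsilon> (V i) = V (Suc i)" "refl_axis h \<epsilon> (V (Suc i)) = V i"
      using refl_V[of i \<epsilon>] refl_V[of "Suc i" \<epsilon>] ee i by (auto simp: vx_def)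
    have s: "{lpt x, rpt y} = {Vertex (V i), Vertex (V (Suc i))}" using ee by (simp add: lpt_e rpt_e)
    have "tau_segment \<Delta> \<epsilon> {lpt x, rpt y} = tau_point \<Delta> \<epsilon> ` {lpt x, rpt y}"
      unfolding s tau_segment_def by (intro if_not_P) (auto simp: doubleton_eq_iff)
    also have "\<dots> = {lpt x, rpt y}"
      using r unfolding s by (simp add: cox_number_eq refl_axis_def insert_commute)
    finally have "tau_segment \<Delta> \<epsilon> {lpt x, rpt y} = {lpt x, rpt y}" .
    moreover have "location ` {lpt x, rpt y} = refl_axis h \<epsilon> ` location ` {lpt x, rpt y}"
      unfolding s by (simp add: r insert_commute)
    ultimately show ?thesis using D_I[OF assms(2)] by blast
  next
    case eF
    then have Fne: "F \<noteq> {}" by auto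
    then have hm0: "h = 2 * m" and hm: "2 \<le> m" "Suc m < h" using h_m m_lt by auto
    have i: "par m = opp \<epsilon>" using eF par by blast
    have s: "{lpt x, rpt y} = {Origin (- y), Vertex (V m)}" using eF hm by (auto simp: lpt_e pt_F)
    have "V m \<bullet> cis (axis_angle h \<epsilon>) = 0" using hm i by (intro inner_V_mid(1)[OF hm0]) (auto simp: ux_def)
    then have 1: "tau_segment \<Delta> \<epsilon> {lpt x, rpt y} = {lpt x, rpt y}" unfolding s by (rule seg)
    have "- y \<in> F" using F_pm eF by blast
    moreover have nx: "- x = e m" using eF e_Suc_m[OF Fne] by simp
    ultimately have "{lpt (- y), rpt (- x)} = {Origin y, Vertex (V (Suc m))}"
      unfolding nx using hm by (simp add: rpt_e pt_F)
    moreover have "refl_axis h \<epsilon> (V m) = V (Suc m)" using refl_V[of m \<epsilon>] hm i by (simp add: vx_def)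
    ultimately have "location ` {lpt (- y), rpt (- x)} = refl_axis h \<epsilon> ` location ` {lpt x, rpt y}"
      unfolding s by (simp add: refl_axis_def)
    then show ?thesis using 1 D_I[OF pairs_flip[OF Fne assms(2)]] by blast
  next
    case Fe
    then have Fne: "F \<noteq> {}" by auto
    then have hm0: "h = 2 * m" and hm: "2 \<le> m" "Suc m < h" using h_m m_lt by auto
    have i: "par m = opp \<epsilon>" using Fe par by blast
    have s: "{lpt x, rpt y} = {Origin (- x), Vertex (V (Suc m))}" using Fe hm by (auto simp: rpt_e pt_F)
    have "V (Suc m) \<bullet> cis (axis_angle h \<epsilon>) = 0" using hm i by (intro inner_V_mid(1)[OF hm0]) (auto simp: ux_def)
    then have 1: "tau_segment \<Delta> \<epsilon> {lpt x, rpt y} = {lpt x, rpt y}" unfolding s by (rule seg)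
    have "- x \<in> F" using F_pm Fe by blast
    moreover have ny: "- y = e (Suc m)" using Fe e_Suc_m[OF Fne] by simp
    ultimately have "{lpt (- y), rpt (- x)} = {Origin x, Vertex (V m)}"
      unfolding ny using hm by (auto simp: lpt_e pt_F)
    moreover have "refl_axis h \<epsilon> (V (Suc m)) = V m" using refl_V[of "Suc m" \<epsilon>] hm i by (simp add: vx_def)
    ultimately have "location ` {lpt (- y), rpt (- x)} = refl_axis h \<epsilon> ` location ` {lpt x, rpt y}"
      unfolding s by (simp add: refl_axis_def)
    then show ?thesis using 1 D_I[OF pairs_flip[OF Fne assms(2)]] by blast
  qed
  then show "tau_segment \<Delta> \<epsilon> {lpt x, rpt y} = {lpt x, rpt y}"
    and "\<exists>s\<in>D (- \<alpha>). location ` s = refl_axis h \<epsilon> ` location ` {lpt x, rpt y}" by auto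
qed

lemma cx_orb: "x \<in> orb \<Longrightarrow> cx \<epsilon> x \<in> orb"
  using cx_nx nx_range cx_in_F by (auto simp: orb_eq)

lemma pairs_cx: "(x, y) \<in> pairs \<beta> \<Longrightarrow> (cx \<epsilon> x, cx \<epsilon> y) \<in> pairs (cx \<epsilon> \<beta>)"
proof -
  assume "(x, y) \<in> pairs \<beta>"
  then obtain k where k: "x \<in> orb" "y \<in> orb" "k > 0" "x - y = k *\<^sub>R \<beta>" by (auto simp: pairs_def)
  then have "cx \<epsilon> x - cx \<epsilon> y = k *\<^sub>R cx \<epsilon> \<beta>" by (metis cx_diff cx_scale)
  then show ?thesis using k cx_orb unfolding pairs_def by blast
qed

lemma D_tau: "\<beta> \<in> APR \<Longrightarrow> D (tau \<Delta> \<epsilon> \<beta>) = tau_segment \<Delta> \<epsilon> ` D \<beta>"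
  and D_loc: "\<beta> \<in> APR \<Longrightarrow>
      (\<lambda>s. location ` s) ` D (tau \<Delta> \<epsilon> \<beta>) = (\<lambda>s. refl_axis h \<epsilon> ` location ` s) ` D \<beta>"
proof -
  assume b: "\<beta> \<in> APR"
  have loc: "location (tau_point \<Delta> \<epsilon> p) = refl_axis h \<epsilon> (location p)" for p
    by (cases p) (simp_all add: refl_axis_def cox_number_eq)
  have r: "D (tau \<Delta> \<epsilon> \<beta>) = tau_segment \<Delta> \<epsilon> ` D \<beta> \<and>
    (\<lambda>s. location ` s) ` D (tau \<Delta> \<epsilon> \<beta>) = (\<lambda>s. refl_axis h \<epsilon> ` location ` s) ` D \<beta>"
  proof (cases "\<beta> \<in> uminus ` \<Delta> (opp \<epsilon>)")
    case True
    then obtain \<alpha> where a: "\<alpha> \<in> \<Delta> (opp \<epsilon>)" "\<beta> = - \<alpha>" by auto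
    have t: "tau \<Delta> \<epsilon> \<beta> = \<beta>" using a by (simp add: tau_neg_opp)
    have 1: "tau_segment \<Delta> \<epsilon> s = s" "\<exists>s'\<in>D \<beta>. location ` s' = refl_axis h \<epsilon> ` location ` s" if "s \<in> D \<beta>" for s
      using that pairs_fixed[OF a(1)] a(2) by (auto simp: D_def)
    have "tau_segment \<Delta> \<epsilon> ` D \<beta> = D \<beta>" using 1(1) by force
    moreover have "(\<lambda>s. location ` s) ` D \<beta> = (\<lambda>s. refl_axis h \<epsilon> ` location ` s) ` D \<beta>"
    proof (intro equalityI image_subsetI)
      fix s assume "s \<in> D \<beta>"
      then obtain s' where s': "s' \<in> D \<beta>" "location ` s' = refl_axis h \<epsilon> ` location ` s"
        using 1(2) by metis
      then have "location ` s = refl_axis h \<epsilon> ` location ` s'" by (simp add: image_image)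
      then show "location ` s \<in> (\<lambda>s. refl_axis h \<epsilon> ` location ` s) ` D \<beta>" using s' by blast
    next
      fix s assume "s \<in> D \<beta>"
      then show "refl_axis h \<epsilon> ` location ` s \<in> (\<lambda>s. location ` s) ` D \<beta>" using 1(2) by (metis imageI)
    qed
    ultimately show ?thesis using t by simp
  next
    case False
    then have t: "tau \<Delta> \<epsilon> \<beta> = cx \<epsilon> \<beta>" by (simp add: tau_def)
    note np = not_perp[OF b False]
    have "D (cx \<epsilon> \<beta>) = tau_segment \<Delta> \<epsilon> ` D \<beta>"
    proof (intro equalityI subsetI)
      fix s assume "s \<in> D (cx \<epsilon> \<beta>)"
      then obtain x y where xy: "(x, y) \<in> pairs (cx \<epsilon> \<beta>)" "s = {lpt x, rpt y}" by (auto simp: D_def)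
      have 1: "(cx \<epsilon> x, cx \<epsilon> y) \<in> pairs \<beta>" using pairs_cx[OF xy(1), of \<epsilon>] by simp
      have "s = tau_segment \<Delta> \<epsilon> {lpt (cx \<epsilon> x), rpt (cx \<epsilon> y)}"
        using np[OF 1] xy(2) by simp
      then show "s \<in> tau_segment \<Delta> \<epsilon> ` D \<beta>" using D_I[OF 1] by blast
    next
      fix s assume "s \<in> tau_segment \<Delta> \<epsilon> ` D \<beta>"
      then obtain x y where xy: "(x, y) \<in> pairs \<beta>" "s = tau_segment \<Delta> \<epsilon> {lpt x, rpt y}" by (auto simp: D_def)
      then show "s \<in> D (cx \<epsilon> \<beta>)" using np[OF xy(1)] D_I[OF pairs_cx[OF xy(1)]] by metis
    qed
    moreover have "location ` tau_segment \<Delta> \<epsilon> s = refl_axis h \<epsilon> ` location ` s" if "s \<in> D \<beta>" for s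
    proof -
      have "tau_segment \<Delta> \<epsilon> s = tau_point \<Delta> \<epsilon> ` s" using that np(1) by (auto simp: D_def)
      then show ?thesis by (simp add: image_image loc)
    qed
    then have "(\<lambda>s. location ` s) ` tau_segment \<Delta> \<epsilon> ` D \<beta> = (\<lambda>s. refl_axis h \<epsilon> ` location ` s) ` D \<beta>"
      unfolding image_image by (rule image_cong[OF refl])
    ultimately show ?thesis unfolding t by simp
  qed
  show "D (tau \<Delta> \<epsilon> \<beta>) = tau_segment \<Delta> \<epsilon> ` D \<beta>" by (rule conjunct1[OF r])
  show "(\<lambda>s. location ` s) ` D (tau \<Delta> \<epsilon> \<beta>) = (\<lambda>s. refl_axis h \<epsilon> ` location ` s) ` D \<beta>"
    by (rule conjunct2[OF r])
qed

end

section \<open>Crossings with the diagrams of the negative simple roots\<close>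

context zigzag_orbit
begin

text \<open>A unit normal of the line through \<open>V i\<close> and \<open>V (Suc i)\<close>, which
  are mirror images in the axis of the class opposite to that of step i. By \<open>V_axis\<close>,
  earlier vertices lie above this line and later ones below.\<close>

abbreviation "axs i \<equiv> cis (axis_angle h (opp (par i)))"

lemma V_axis:
  assumes "i \<le> h"
  shows "V (Suc i) \<bullet> axs i = V i \<bullet> axs i"
    and "j < i \<Longrightarrow> V j \<bullet> axs i > V i \<bullet> axs i"
    and "Suc i < j \<Longrightarrow> j \<le> h + 1 \<Longrightarrow> V j \<bullet> axs i < V i \<bullet> axs i"
proof -
  have u: "ux (opp (par i)) i = Suc i" "ux (opp (par i)) (Suc i) = Suc i" by (simp_all add: ux_def)
  show "V (Suc i) \<bullet> axs i = V i \<bullet> axs i" by (simp add: inner_V u)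
  show "V j \<bullet> axs i > V i \<bullet> axs i" if "j < i"
    using that assms by (intro inner_V_less) (auto simp: u, simp add: ux_def)
  show "V j \<bullet> axs i < V i \<bullet> axs i" if "Suc i < j" "j \<le> h + 1"
    using that assms by (intro inner_V_less) (auto simp: u, simp add: ux_def)
qed

lemma V_axis_le: "i \<le> h \<Longrightarrow> j \<le> Suc i \<Longrightarrow> V j \<bullet> axs i \<ge> V i \<bullet> axs i"
  using V_axis(1,2)[of i] by (cases "j < i"; cases "j = i"; cases "j = Suc i") (auto simp: less_imp_le)

lemma V_axis_ge: "i \<le> h \<Longrightarrow> i \<le> j \<Longrightarrow> j \<le> h + 1 \<Longrightarrow> V j \<bullet> axs i \<le> V i \<bullet> axs i"
  using V_axis(1,3)[of i] by (cases "Suc i < j"; cases "j = i"; cases "j = Suc i") (auto simp: less_imp_le)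

lemma V_axis_mid:
  assumes "F \<noteq> {}" "i \<le> h"
  shows "i < m \<Longrightarrow> V i \<bullet> axs i > 0" "i = m \<Longrightarrow> V i \<bullet> axs i = 0" "i > m \<Longrightarrow> V i \<bullet> axs i < 0"
proof -
  have hm: "h = 2 * m" using h_m assms by simp
  have u: "ux (opp (par i)) i = Suc i" "Suc i \<le> h + 2" using assms by (simp_all add: ux_def)
  show "i < m \<Longrightarrow> V i \<bullet> axs i > 0" "i = m \<Longrightarrow> V i \<bullet> axs i = 0" "i > m \<Longrightarrow> V i \<bullet> axs i < 0"
    using inner_V_mid[OF hm, of "opp (par i)" i] u by auto
qed

lemma V_Suc_neq: "i \<le> h \<Longrightarrow> V i \<noteq> V (Suc i)"
  using V_inj[of i "Suc i"] by auto

lemma V_nonzero: "V j \<noteq> 0"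
  using cmod_V[of j] rr_pos by auto

lemma V_half_turn: "ax i = ax j + int (h + 2) \<Longrightarrow> V i = - V j"
proof -
  assume a: "ax i = ax j + int (h + 2)"
  have "of_int (ax i) * pi / real (h + 2) = of_int (ax j) * pi / real (h + 2) + pi"
    unfolding a by (simp add: field_simps)
  moreover have "cis (t + pi) = - cis t" for t by (simp flip: cis_mult)
  ultimately show ?thesis unfolding V_def by simp
qed

lemma V_neg_m: "F \<noteq> {} \<Longrightarrow> V (Suc m) = - V m"
proof -
  assume F: "F \<noteq> {}"
  then have hm: "h = 2 * m" using h_m by simp
  have "ax m = ax (Suc m) + int (h + 2) \<or> ax (Suc m) = ax m + int (h + 2)"
    by (cases "par m") (simp_all add: ax_def hm)
  then show ?thesis using V_half_turn[of m "Suc m"] V_half_turn[of "Suc m" m] by auto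
qed

text \<open>Used to see that a diagonal misses the origin. As \<open>h\<close> is even, the indices
  j and h + 1 - j have opposite classes, and then \<open>ax\<close> differs by the half turn
  \<open>h + 2\<close>.\<close>

lemma V_neg_eq:
  assumes "F \<noteq> {}" "i \<le> h + 1" "j \<le> h + 1" "V i = - V j"
  shows "i + j = h + 1"
proof -
  have hm: "h = 2 * m" using h_m assms(1) by simp
  define j' where "j' = h + 1 - j"
  have j': "j' \<le> h + 1" "j + j' = h + 1" using assms by (auto simp: j'_def)
  have "par j' = opp (par j)" using j'(2) hm by (auto simp: alt_def j'_def)
  then have "ax j' = ax j + int (h + 2) \<or> ax j = ax j' + int (h + 2)"
    using j'(2) by (cases "par j") (auto simp: ax_def)
  then have "V j' = - V j" using V_half_turn[of j j'] V_half_turn[of j' j] by auto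
  then have "i = j'" using assms V_inj j' by simp
  then show ?thesis using j' by simp
qed

lemma chord_separated:
  assumes i: "i \<le> h" and xy: "x \<noteq> y"
    and "(x \<bullet> axs i \<le> V i \<bullet> axs i \<and> y \<bullet> axs i \<le> V i \<bullet> axs i \<and> (x \<bullet> axs i < V i \<bullet> axs i \<or> y \<bullet> axs i < V i \<bullet> axs i))
      \<or> (x \<bullet> axs i \<ge> V i \<bullet> axs i \<and> y \<bullet> axs i \<ge> V i \<bullet> axs i \<and> (x \<bullet> axs i > V i \<bullet> axs i \<or> y \<bullet> axs i > V i \<bullet> axs i))"
    and "z \<noteq> w" "z \<bullet> axs i = V i \<bullet> axs i" "w \<bullet> axs i = V i \<bullet> axs i"
  shows "\<not> meet {x, y} {z, w}"
  using assms(3)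
proof
  assume a: "x \<bullet> axs i \<le> V i \<bullet> axs i \<and> y \<bullet> axs i \<le> V i \<bullet> axs i \<and> (x \<bullet> axs i < V i \<bullet> axs i \<or> y \<bullet> axs i < V i \<bullet> axs i)"
  show ?thesis
    by (rule not_meet_separated(1)[of x y z w "axs i" "V i \<bullet> axs i"]) (use assms a in auto)
next
  assume a: "x \<bullet> axs i \<ge> V i \<bullet> axs i \<and> y \<bullet> axs i \<ge> V i \<bullet> axs i \<and> (x \<bullet> axs i > V i \<bullet> axs i \<or> y \<bullet> axs i > V i \<bullet> axs i)"
  show ?thesis
    by (rule not_meet_separated(1)[of x y z w "- axs i" "- (V i \<bullet> axs i)"]) (use assms a in \<open>auto simp: inner_minus_right\<close>)
qed

lemma chords_cross: "1 \<le> i \<Longrightarrow> i < h \<Longrightarrow> j < i \<Longrightarrow> Suc i < k \<Longrightarrow> k \<le> h + 1 \<Longrightarrow> meet {V j, V k} {V i, V (Suc i)}"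
  using V_axis[of i] V_Suc_neq[of i] by (intro chords_meet[of "axs i" _ rr]) (auto simp: cmod_V)

text \<open>The unlabeled segments of the diagram of \<open>-\<alpha>\<close>, together with the steps that produce them.\<close>

definition tseg :: "'a \<Rightarrow> complex set \<Rightarrow> nat \<Rightarrow> bool" where
  "tseg \<alpha> T i \<longleftrightarrow> 1 \<le> i \<and> i < h \<and> (e i - e (Suc i)) \<bullet> \<omega> \<alpha> > 0 \<and>
    ((F \<noteq> {} \<longrightarrow> i \<noteq> m) \<and> T = {V i, V (Suc i)} \<or> F \<noteq> {} \<and> i = m \<and> (T = {0, V m} \<or> T = {0, V (Suc m)}))"

lemma tseg_D:
  assumes "\<alpha> \<in> B" "t \<in> D (- \<alpha>)"
  obtains i where "tseg \<alpha> (location ` t) i" "\<And>\<alpha>'. \<alpha>' \<in> B \<Longrightarrow> i \<noteq> m \<or> F = {} \<Longrightarrow> (e i - e (Suc i)) \<bullet> \<omega> \<alpha>' > 0 \<Longrightarrow> \<alpha>' = \<alpha>"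
proof -
  obtain x y where xy: "(x, y) \<in> pairs (- \<alpha>)" and t: "t = {lpt x, rpt y}" using assms by (auto simp: D_def)
  then obtain k where k: "k > 0" "x - y = k *\<^sub>R (- \<alpha>)" by (auto simp: pairs_def)
  then have k': "y - x = k *\<^sub>R \<alpha>" by (metis minus_diff_eq minus_minus scaleR_minus_right)
  have pos: "(y - x) \<bullet> \<omega> \<alpha> > 0" using k k' B_nonzero[OF assms(1)] assms(1) by (simp add: omega_inner)
  show ?thesis using assms(1) xy
  proof (cases rule: pairs_neg)
    case (ee i)
    have "location ` t = {V i, V (Suc i)}" using ee t by (simp add: lpt_e rpt_e)
    then have "tseg \<alpha> (location ` t) i" using pos ee by (simp add: tseg_def)
    then show ?thesis using that coeff_same[OF assms(1) k'[symmetric]] ee by blast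
  next
    case eF
    then have Fne: "F \<noteq> {}" by auto
    have "location ` t = {0, V m}" using eF t m_lt[OF Fne] by (simp add: lpt_e pt_F insert_commute)
    moreover have "(e m - e (Suc m)) \<bullet> \<omega> \<alpha> > 0"
      using pos cone_ge[OF F_cone(1)[OF eF(2)] assms(1)] eF by (simp add: inner_diff_left)
    ultimately have "tseg \<alpha> (location ` t) m" using m_lt[OF Fne] Fne by (simp add: tseg_def)
    then show ?thesis using that Fne by blast
  next
    case Fe
    then have Fne: "F \<noteq> {}" by auto
    have "location ` t = {0, V (Suc m)}" using Fe t m_lt[OF Fne] by (simp add: rpt_e pt_F)
    moreover have "(e m - e (Suc m)) \<bullet> \<omega> \<alpha> > 0"
      using pos cone_ge[OF F_cone(2)[OF Fe(1)] assms(1)] Fe by (simp add: inner_diff_left)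
    ultimately have "tseg \<alpha> (location ` t) m" using m_lt[OF Fne] Fne by (simp add: tseg_def)
    then show ?thesis using that Fne by blast
  qed
qed

lemma tseg_line:
  assumes "tseg \<alpha> T i"
  obtains z w where "T = {z, w}" "z \<noteq> w" "z \<bullet> axs i = V i \<bullet> axs i" "w \<bullet> axs i = V i \<bullet> axs i"
proof -
  have i: "1 \<le> i" "i < h" using assms by (auto simp: tseg_def)
  consider "T = {V i, V (Suc i)}" | "F \<noteq> {}" "i = m" "T = {0, V m}" | "F \<noteq> {}" "i = m" "T = {0, V (Suc m)}"
    using assms by (auto simp: tseg_def)
  then show ?thesis
  proof cases
    case 1
    then show ?thesis using that[of "V i" "V (Suc i)"] V_Suc_neq[of i] V_axis(1)[of i] i by simp
  next
    case 2
    then show ?thesis using that[of 0 "V m"] V_axis_mid(2)[of i] V_nonzero[of m] i by simp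
  next
    case 3
    then show ?thesis using that[of 0 "V (Suc m)"] V_axis_mid(2)[of i] V_axis(1)[of i] V_nonzero[of "Suc m"] i by simp
  qed
qed

lemma tseg_separated:
  assumes "tseg \<alpha> T i" "x \<noteq> y"
    and "(x \<bullet> axs i \<le> V i \<bullet> axs i \<and> y \<bullet> axs i \<le> V i \<bullet> axs i \<and> (x \<bullet> axs i < V i \<bullet> axs i \<or> y \<bullet> axs i < V i \<bullet> axs i))
      \<or> (x \<bullet> axs i \<ge> V i \<bullet> axs i \<and> y \<bullet> axs i \<ge> V i \<bullet> axs i \<and> (x \<bullet> axs i > V i \<bullet> axs i \<or> y \<bullet> axs i > V i \<bullet> axs i))"
  shows "\<not> meet {x, y} T"
proof -
  obtain z w where z: "T = {z, w}" "z \<noteq> w" "z \<bullet> axs i = V i \<bullet> axs i" "w \<bullet> axs i = V i \<bullet> axs i"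
    using tseg_line[OF assms(1)] .
  have "i \<le> h" using assms(1) by (simp add: tseg_def)
  then show ?thesis unfolding z(1) using assms(2,3) z by (intro chord_separated[of i]) auto
qed

text \<open>If step i is not among the steps from p to q, both endpoints of \<open>s\<close> lie on
  one closed side of the line through \<open>T\<close>, not both on it, and the segments are
  separated. So a meeting puts step i inside the pair, and its coefficient at \<alpha> bounds that
  of the whole difference from below. For radii, the origin is on that line only when
  \<open>i = m\<close>.\<close>

lemma pos_meet_coeff:
  assumes b: "\<beta> \<in> \<Phi>" "\<beta> \<in> cone" and a: "\<alpha> \<in> B" and s: "s \<in> D \<beta>" and t: "tseg \<alpha> T i"
    and meet: "meet (location ` s) T"
  shows "\<beta> \<bullet> \<omega> \<alpha> > 0"
proof -
  obtain x y where xy: "(x, y) \<in> pairs \<beta>" and s: "s = {lpt x, rpt y}" using s by (auto simp: D_def)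
  then obtain k where k: "k > 0" "x - y = k *\<^sub>R \<beta>" by (auto simp: pairs_def)
  have i: "1 \<le> i" "i < h" "(e i - e (Suc i)) \<bullet> \<omega> \<alpha> > 0" using t by (auto simp: tseg_def)
  have "(x - y) \<bullet> \<omega> \<alpha> > 0"
    using b xy
  proof (cases rule: pairs_pos)
    case (ee p q)
    have l: "location ` s = {V (p - 1), V (q + 1)}" using ee s by (simp add: lpt_e rpt_e)
    have ne: "V (p - 1) \<noteq> V (q + 1)"
    proof
      assume "V (p - 1) = V (q + 1)"
      then have "p - 1 = q + 1" using ee by (intro V_inj) auto
      then show False using ee by simp
    qed
    have "p \<le> i \<and> i < q"
    proof (rule ccontr)
      assume "\<not> (p \<le> i \<and> i < q)"
      then consider "i < p" | "q \<le> i" "p \<le> i" by linarith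
      then have "\<not> meet {V (p - 1), V (q + 1)} T"
      proof cases
        case 1
        then show ?thesis using ee i ne V_axis_ge[of i "p - 1"] V_axis(3)[of i "q + 1"]
          by (intro tseg_separated[OF t]) (auto simp: less_imp_le)
      next
        case 2
        then show ?thesis using ee i ne V_axis_le[of i "q + 1"] V_axis(2)[of i "p - 1"]
          by (intro tseg_separated[OF t]) (auto simp: less_imp_le)
      qed
      then show False using meet l by simp
    qed
    then show ?thesis using step_coeff_le[of p i q \<alpha>] ee i a by simp
  next
    case (eF p)
    then have Fne: "F \<noteq> {}" by auto
    have hm: "2 \<le> m" "Suc m < h" using m_lt[OF Fne] by auto
    have l: "location ` s = {V (p - 1), 0}" using eF s hm by (simp add: lpt_e pt_F)
    note mid = V_axis_mid[OF Fne, of i]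
    have "p \<le> i \<and> i < m"
    proof (rule ccontr)
      assume "\<not> (p \<le> i \<and> i < m)"
      then consider "i < p" "i < m" | "m < i" | "i = m" using eF by linarith
      then have "\<not> meet {V (p - 1), 0} T"
      proof cases
        case 1
        then show ?thesis using eF i hm V_nonzero mid(1) V_axis_ge[of i "p - 1"]
          by (intro tseg_separated[OF t]) auto
      next
        case 2
        then show ?thesis using eF i hm V_nonzero mid(3) V_axis(2)[of i "p - 1"]
          by (intro tseg_separated[OF t]) (auto simp: less_imp_le)
      next
        case 3
        then show ?thesis using eF i hm V_nonzero mid(2) V_axis(2)[of i "p - 1"]
          by (intro tseg_separated[OF t]) (auto simp: less_imp_le)
      qed
      then show False using meet l by simp
    qed
    then show ?thesis using step_coeff_le_F[of p i y \<alpha>] eF i a by simp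
  next
    case (Fe q)
    then have Fne: "F \<noteq> {}" by auto
    have hm: "2 \<le> m" "Suc m < h" using m_lt[OF Fne] by auto
    have l: "location ` s = {0, V (q + 1)}" using Fe s hm by (simp add: rpt_e pt_F)
    note mid = V_axis_mid[OF Fne, of i]
    have "m < i \<and> i < q"
    proof (rule ccontr)
      assume "\<not> (m < i \<and> i < q)"
      then consider "i < m" | "m < i" "q \<le> i" | "i = m" by linarith
      then have "\<not> meet {0, V (q + 1)} T"
      proof cases
        case 1
        then show ?thesis using Fe i hm V_nonzero[of "Suc q"] mid(1) V_axis(3)[of i "q + 1"]
          by (intro tseg_separated[OF t]) (auto simp: less_imp_le)
      next
        case 2
        then show ?thesis using Fe i hm V_nonzero[of "Suc q"] mid(3) V_axis_le[of i "q + 1"]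
          by (intro tseg_separated[OF t]) (auto simp: less_imp_le)
      next
        case 3
        then show ?thesis using Fe i hm V_nonzero[of "Suc q"] mid(2) V_axis(3)[of i "q + 1"]
          by (intro tseg_separated[OF t]) (auto simp: less_imp_le)
      qed
      then show False using meet l by simp
    qed
    then show ?thesis using step_coeff_le_F'[of i q x \<alpha>] Fe i a by simp
  qed
  then show ?thesis using k by (simp add: zero_less_mult_iff)
qed

text \<open>Segments of different steps are separated by the line through \<open>T\<close>. One step
  can serve two simple roots only in the middle: \<open>e m - f\<close> and \<open>e m + f\<close>
  are multiples of two simple roots whose diagrams consist of the same two radii with different
  labels. Here coinciding segments have to be permitted.\<close>

lemma neg_meet:
  assumes s: "tseg \<alpha> S i" and t: "tseg \<alpha>' T j" and ij: "i = j \<Longrightarrow> F \<noteq> {} \<and> i = m" and meet: "meet S T"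
  shows "S = T"
proof -
  have i: "1 \<le> i" "i < h" and j: "1 \<le> j" "j < h" using s t by (auto simp: tseg_def)
  have half: "\<not> meet {0, V m} {0, V (Suc m)} \<and> \<not> meet {0, V (Suc m)} {0, V m}" if "F \<noteq> {}"
    using V_neg_m[OF that] V_nonzero[of m]
      not_meet_separated[of 0 "- V m" 0 "V m" "V m" 0] by (auto simp: less_imp_le)
  show ?thesis
  proof (cases "i = j")
    case True
    then have Fm: "F \<noteq> {}" "i = m" using ij by auto
    have "S = {0, V m} \<or> S = {0, V (Suc m)}" "T = {0, V m} \<or> T = {0, V (Suc m)}"
      using s t Fm True unfolding tseg_def by auto
    then show ?thesis using half[OF Fm(1)] meet by auto
  next
    case False
    have "\<not> meet S T"
    proof (cases "F \<noteq> {} \<and> i = m")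
      case True
      then obtain v where v: "v = m \<or> v = Suc m" "S = {0, V v}" using s unfolding tseg_def by auto
      have hm: "Suc m < h" using m_lt True by auto
      have Fne: "F \<noteq> {}" using True by simp
      note mid = V_axis_mid[OF Fne, of j]
      show ?thesis
      proof (cases "j < m")
        case True
        then show ?thesis using v j hm V_nonzero[of v] mid(1) V_axis_ge[of j v] unfolding v(2)
          by (intro tseg_separated[OF t]) auto
      next
        case f: False
        then have "j > m" using False True by auto
        then show ?thesis using v j hm V_nonzero[of v] mid(3) V_axis_le[of j v] unfolding v(2)
          by (intro tseg_separated[OF t]) auto
      qed
    next
      case f: False
      then have S: "S = {V i, V (Suc i)}" using s unfolding tseg_def by auto
      show ?thesis
      proof (cases "i < j")
        case True
        then show ?thesis unfolding S using i j V_Suc_neq[of i] V_axis(2)[of j i] V_axis_le[of j "Suc i"]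
          by (intro tseg_separated[OF t]) (auto simp: less_imp_le)
      next
        case n: False
        then have "j < i" using False by simp
        then show ?thesis unfolding S using i j V_Suc_neq[of i] V_axis_ge[of j i] V_axis(3)[of j "Suc i"]
          by (intro tseg_separated[OF t]) (auto simp: less_imp_le)
      qed
    qed
    then show ?thesis using meet by simp
  qed
qed

lemma coeff_pos_step:
  assumes "1 \<le> p" "p \<le> q" "q \<le> h" "\<alpha> \<in> B" "(e p - e q) \<bullet> \<omega> \<alpha> > 0"
  shows "\<exists>i. p \<le> i \<and> i < q \<and> (e i - e (Suc i)) \<bullet> \<omega> \<alpha> > 0"
  using assms(2,3,5)
proof (induction q rule: dec_induct)
  case (step q)
  show ?case
  proof (cases "(e q - e (Suc q)) \<bullet> \<omega> \<alpha> > 0")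
    case True
    then show ?thesis using step by auto
  next
    case False
    then have "(e p - e q) \<bullet> \<omega> \<alpha> > 0" using step by (simp add: inner_diff_left)
    then show ?thesis using step by auto
  qed
qed simp

lemma e_orb: "1 \<le> i \<Longrightarrow> i \<le> h \<Longrightarrow> e i \<in> orb" and F_orb: "f \<in> F \<Longrightarrow> f \<in> orb"
  unfolding orb_eq by auto

lemma root_pair_pos:
  assumes "\<beta> \<in> \<Phi>" "\<beta> \<in> cone"
  obtains p q k where "1 \<le> p" "p < q" "q \<le> h" "k > 0" "e p - e q = k *\<^sub>R \<beta>" "F \<noteq> {} \<Longrightarrow> p + q \<noteq> h + 1"
proof -
  obtain p q k where pq: "p \<in> {1..h}" "q \<in> {1..h}" "k \<noteq> 0" "e p - e q = k *\<^sub>R \<beta>"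
    using root_pair[OF assms(1)] by blast
  obtain p q k where pq: "p \<in> {1..h}" "q \<in> {1..h}" "k > 0" "e p - e q = k *\<^sub>R \<beta>"
  proof (cases "k > 0")
    case False
    have "e q - e p = (- k) *\<^sub>R \<beta>" using pq(4) by (metis minus_diff_eq scaleR_minus_left)
    then show ?thesis using that[of q p "- k"] pq False by simp
  qed (use that pq in blast)
  have "(e p, e q) \<in> pairs \<beta>" using pq by (auto simp: pairs_def e_orb F_orb)
  with assms show ?thesis
  proof (cases rule: pairs_pos)
    case (ee p' q')
    have "p = p'" by (rule inj_onD[OF inj_e ee(4) pq(1)]) (use ee(1-3) in simp)
    moreover have "q = q'" by (rule inj_onD[OF inj_e ee(5) pq(2)]) (use ee(1-3) in simp)
    ultimately show ?thesis using that[of p q k] ee(1-3,6) pq(3,4) by blast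
  next
    case (eF p')
    then show ?thesis using e_notin_F[of q] e_notin_F[of p] pq(1,2) by simp
  next
    case (Fe q')
    then show ?thesis using e_notin_F[of q] e_notin_F[of p] pq(1,2) by simp
  qed
qed

text \<open>A positive coefficient of the difference comes from some step between p and q. Off the
  middle, that step is a multiple of \<alpha> and its segment is crossed by the diagonal. In the
  middle, \<alpha> belongs to \<open>f\<close> or to \<open>- f\<close>, both radii are in its
  diagram, and the diagonal, which misses the origin, crosses one of them.\<close>

lemma coeff_pos_meet:
  assumes b: "\<beta> \<in> \<Phi>" "\<beta> \<in> cone" and a: "\<alpha> \<in> B" "\<beta> \<bullet> \<omega> \<alpha> > 0"
  shows "\<exists>s\<in>D \<beta>. \<exists>t\<in>D (- \<alpha>). meet (location ` s) (location ` t) \<and> location ` s \<noteq> location ` t"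
proof -
  obtain p q k where pq: "1 \<le> p" "p < q" "q \<le> h" "k > 0" "e p - e q = k *\<^sub>R \<beta>"
    and ne: "F \<noteq> {} \<Longrightarrow> p + q \<noteq> h + 1" by (rule root_pair_pos[OF b]) blast
  have xy: "(e p, e q) \<in> pairs \<beta>" using pq by (auto simp: pairs_def e_orb F_orb)
  define s where "s = {lpt (e p), rpt (e q)}"
  have s: "s \<in> D \<beta>" using D_I[OF xy] by (simp add: s_def)
  have ls: "location ` s = {V (p - 1), V (q + 1)}" using pq by (simp add: s_def lpt_e rpt_e)
  have "(e p - e q) \<bullet> \<omega> \<alpha> > 0" using pq a by simp
  then obtain i where i: "p \<le> i" "i < q" "(e i - e (Suc i)) \<bullet> \<omega> \<alpha> > 0"
    using coeff_pos_step[of p q \<alpha>] pq a by auto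
  show ?thesis
  proof (cases "F = {} \<or> i \<noteq> m")
    case True
    then obtain \<alpha>' k' where a': "\<alpha>' \<in> \<Delta> (par i)" "k' > 0" "e i - e (Suc i) = k' *\<^sub>R \<alpha>'"
      using step_single[of i] i pq by auto
    have "\<alpha>' \<in> B" using a' Delta_subset by blast
    then have "\<alpha> = \<alpha>'" using coeff_same[OF _ a'(3)[symmetric] a(1) i(3)] by blast
    then have "e (Suc i) - e i = k' *\<^sub>R (- \<alpha>)" using a'(3) by (metis minus_diff_eq scaleR_minus_right)
    then have xy': "(e (Suc i), e i) \<in> pairs (- \<alpha>)" using a' i pq by (auto simp: pairs_def e_orb F_orb)
    have lt: "location ` {lpt (e (Suc i)), rpt (e i)} = {V i, V (Suc i)}" using i pq by (simp add: lpt_e rpt_e)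
    have "meet {V (p - 1), V (q + 1)} {V i, V (Suc i)}" using i pq by (intro chords_cross) auto
    moreover have "{V (p - 1), V (q + 1)} \<noteq> {V i, V (Suc i)}"
    proof -
      have "p - 1 \<le> h + 1" "p - 1 \<noteq> i" "p - 1 \<noteq> Suc i" "i \<le> h + 1" "Suc i \<le> h + 1" using i pq by auto
      then have "V (p - 1) \<noteq> V i" "V (p - 1) \<noteq> V (Suc i)" using V_inj by metis+
      then show ?thesis by auto
    qed
    ultimately show ?thesis using s D_I[OF xy'] lt ls by metis
  next
    case False
    then have Fne: "F \<noteq> {}" and im: "i = m" by auto
    have hm: "2 \<le> m" "Suc m < h" using m_lt[OF Fne] by auto
    obtain f where f: "f \<in> F" "\<exists>k>0. e m - f = k *\<^sub>R \<alpha>"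
    proof -
      obtain f where f: "f \<in> F" using Fne by auto
      have f': "- f \<in> F" using F_pm[OF f] by blast
      obtain \<alpha>1 k1 where 1: "\<alpha>1 \<in> \<Delta> (par m)" "k1 > 0" "e m - f = k1 *\<^sub>R \<alpha>1" using F_step[OF f] by blast
      obtain \<alpha>2 k2 where 2: "\<alpha>2 \<in> \<Delta> (par m)" "k2 > 0" "e m - - f = k2 *\<^sub>R \<alpha>2" using F_step[OF f'] by blast
      have B12: "\<alpha>1 \<in> B" "\<alpha>2 \<in> B" using 1 2 Delta_subset by blast+
      have "(e m - e (Suc m)) \<bullet> \<omega> \<alpha> = (e m - f) \<bullet> \<omega> \<alpha> + (e m - - f) \<bullet> \<omega> \<alpha>"
        unfolding e_Suc_m[OF Fne] by (simp add: inner_diff_left inner_add_left)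
      then have "(e m - f) \<bullet> \<omega> \<alpha> > 0 \<or> (e m - - f) \<bullet> \<omega> \<alpha> > 0"
        using i(3) unfolding im by linarith
      then have "\<alpha> = \<alpha>1 \<or> \<alpha> = \<alpha>2"
        using coeff_same[OF B12(1) 1(3)[symmetric] a(1)] coeff_same[OF B12(2) 2(3)[symmetric] a(1)] by blast
      then show ?thesis using that[OF f] that[OF f'] 1 2 by blast
    qed
    then obtain k' where k': "k' > 0" "e m - f = k' *\<^sub>R \<alpha>" by auto
    have f': "- f \<in> F" using F_pm[OF f(1)] by blast
    have "f - e m = k' *\<^sub>R (- \<alpha>)" using k' by (metis minus_diff_eq scaleR_minus_right)
    then have xy1: "(f, e m) \<in> pairs (- \<alpha>)" using f k' hm by (auto simp: pairs_def e_orb F_orb)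
    have xy2: "(e (Suc m), - f) \<in> pairs (- \<alpha>)" using pairs_flip[OF Fne xy1] e_Suc_m[OF Fne] by simp
    have l1: "location ` {lpt f, rpt (e m)} = {0, V (Suc m)}" using f hm by (simp add: pt_F rpt_e)
    have l2: "location ` {lpt (e (Suc m)), rpt (- f)} = {0, V m}" using f' hm by (simp add: pt_F lpt_e insert_commute)
    have "meet {V (p - 1), V (q + 1)} {0, V m} \<or> meet {V (p - 1), V (q + 1)} {0, - V m}"
    proof (rule chord_radius_meet[of "axs m" _ rr])
      show "V m \<bullet> axs m = 0" using V_axis_mid(2)[OF Fne, of m] hm by simp
      show "V (p - 1) \<bullet> axs m > 0" "V (q + 1) \<bullet> axs m < 0"
        using V_axis(2)[of m "p - 1"] V_axis(3)[of m "q + 1"] V_axis_mid(2)[OF Fne, of m] hm i im pq by auto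
      show "V (p - 1) \<noteq> - V (q + 1)"
      proof
        assume "V (p - 1) = - V (q + 1)"
        then have "p - 1 + (q + 1) = h + 1" using pq by (intro V_neg_eq[OF Fne]) auto
        then show False using ne[OF Fne] pq by simp
      qed
    qed (simp_all add: cmod_V)
    moreover have "{V (p - 1), V (q + 1)} \<noteq> {0, v}" for v using V_nonzero by (auto simp: doubleton_eq_iff)
    ultimately show ?thesis using s D_I[OF xy1] D_I[OF xy2] l1 l2 ls V_neg_m[OF Fne] by metis
  qed
qed

lemma criterion:
  assumes "\<beta> \<in> APR" "\<alpha> \<in> B" "\<beta> \<noteq> - \<alpha>"
  shows "(\<forall>s\<in>D \<beta>. \<forall>t\<in>D (- \<alpha>). crosses s t \<longrightarrow> coincide s t) \<longleftrightarrow> \<beta> \<bullet> \<omega> \<alpha> = 0"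
  unfolding crosses_meet coincide_def
  using assms(1)
proof (cases rule: APR_cases)
  case 1
  have "\<beta> \<bullet> \<omega> \<alpha> \<ge> 0" using cone_ge 1 assms by blast
  moreover have "\<beta> \<bullet> \<omega> \<alpha> > 0" if "s \<in> D \<beta>" "t \<in> D (- \<alpha>)" "meet (location ` s) (location ` t)" for s t
    using tseg_D[OF assms(2) that(2)] pos_meet_coeff[OF 1 assms(2) that(1) _ that(3)] by metis
  ultimately show "(\<forall>s\<in>D \<beta>. \<forall>t\<in>D (- \<alpha>). meet (location ` s) (location ` t) \<longrightarrow> location ` s = location ` t)
      \<longleftrightarrow> \<beta> \<bullet> \<omega> \<alpha> = 0"
    using coeff_pos_meet[OF 1 assms(2)] by fastforce
next
  case (2 \<alpha>')
  then have ne: "\<alpha>' \<noteq> \<alpha>" using assms(3) by auto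
  have "location ` s = location ` t" if st: "s \<in> D (- \<alpha>')" "t \<in> D (- \<alpha>)" "meet (location ` s) (location ` t)" for s t
  proof -
    obtain i where i: "tseg \<alpha>' (location ` s) i" 
      "\<And>\<gamma>. \<gamma> \<in> B \<Longrightarrow> i \<noteq> m \<or> F = {} \<Longrightarrow> (e i - e (Suc i)) \<bullet> \<omega> \<gamma> > 0 \<Longrightarrow> \<gamma> = \<alpha>'"
      by (rule tseg_D[OF 2(1) st(1)]) blast
    obtain j where j: "tseg \<alpha> (location ` t) j" by (rule tseg_D[OF assms(2) st(2)])
    have "F \<noteq> {} \<and> i = m" if "i = j" using i(2)[of \<alpha>] j ne that assms(2) by (auto simp: tseg_def)
    then show ?thesis using neg_meet[OF i(1) j _ st(3)] by blast
  qed
  moreover have "\<beta> \<bullet> \<omega> \<alpha> = 0" using 2 ne assms(2) by (simp add: omega_inner)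
  ultimately show "(\<forall>s\<in>D \<beta>. \<forall>t\<in>D (- \<alpha>). meet (location ` s) (location ` t) \<longrightarrow> location ` s = location ` t)
      \<longleftrightarrow> \<beta> \<bullet> \<omega> \<alpha> = 0"
    using 2(2) by simp
qed

theorem compatible_iff_diagrams:
  assumes "\<beta> \<in> APR" "\<gamma> \<in> APR" "\<beta> \<noteq> \<gamma>"
  shows "compatible_roots \<Phi> \<Delta> \<beta> \<gamma> \<longleftrightarrow>
    (\<forall>s\<in>diagram \<Phi> \<Delta> c \<omega> orb \<beta>. \<forall>t\<in>diagram \<Phi> \<Delta> c \<omega> orb \<gamma>. crosses s t \<longrightarrow> coincide s t)"
  using h3 by (intro assembly[where D = D and h = h] cox_pow_h D_neg D_tau D_loc criterion assms) auto

end

section \<open>The root order on the orbit\<close>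

context root_setup
begin

lemma diff_root:
  assumes "z \<noteq> 0" "reflection z \<in> W"
  obtains \<beta> k where "\<beta> \<in> \<Phi>" "k > 0" "z = k *\<^sub>R \<beta>"
proof -
  obtain \<beta> where "\<Phi> \<inter> span {z} = {\<beta>, - \<beta>}" using rs assms unfolding root_system_def by blast
  then have b: "\<beta> \<in> \<Phi>" "\<beta> \<in> span {z}" by auto
  then obtain t where t: "\<beta> = t *\<^sub>R z" by (auto simp: span_singleton)
  then have t0: "t \<noteq> 0" using b zero_notin by auto
  then have z: "z = (1 / t) *\<^sub>R \<beta>" using t by simp
  show ?thesis
  proof (cases "t > 0")
    case True
    show ?thesis by (rule that[OF b(1) _ z]) (use True in simp)
  next
    case False
    have "z = (- (1 / t)) *\<^sub>R (- \<beta>)" using z by (simp only: scaleR_minus_left scaleR_minus_right minus_minus)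
    moreover have "- (1 / t) > 0" using False t0 by simp
    ultimately show ?thesis using that uminus_Phi[OF b(1)] by blast
  qed
qed

lemma diff_cone:
  assumes "reflection z \<in> W"
  shows "z \<in> cone \<or> - z \<in> cone"
proof (cases "z = 0")
  case False
  then obtain \<beta> k where b: "\<beta> \<in> \<Phi>" "k > 0" "z = k *\<^sub>R \<beta>" using diff_root assms by blast
  then have "- z = k *\<^sub>R (- \<beta>)" by simp
  then show ?thesis using b root_cases[OF b(1)] cone_scale by (metis less_imp_le)
qed simp

text \<open>A simple root spans an extreme ray of the cone, because coefficients of cone elements
  cannot cancel.\<close>

lemma cone_sum_single:
  assumes "\<alpha> \<in> B" "k *\<^sub>R \<alpha> = z + w" "z \<in> cone" "w \<in> cone"
  shows "z = (z \<bullet> \<omega> \<alpha> / norm \<alpha>) *\<^sub>R \<alpha>"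
proof (rule span_single[OF cone_span[OF assms(3)] assms(1)])
  fix \<gamma> assume g: "\<gamma> \<in> B" "\<gamma> \<noteq> \<alpha>"
  have "(z + w) \<bullet> \<omega> \<gamma> = 0" unfolding assms(2)[symmetric] using g assms(1) by (simp add: omega_inner)
  then show "z \<bullet> \<omega> \<gamma> = 0" using cone_ge[OF assms(3) g(1)] cone_ge[OF assms(4) g(1)]
    by (simp add: inner_add_left)
qed

lemma cone_sum_same:
  assumes "\<alpha> \<in> B" "k *\<^sub>R \<alpha> = k' *\<^sub>R \<alpha>' + w" "\<alpha>' \<in> B" "k' > 0" "w \<in> cone"
  shows "\<alpha>' = \<alpha>"
proof (rule ccontr)
  assume ne: "\<alpha>' \<noteq> \<alpha>"
  have "(k' *\<^sub>R \<alpha>' + w) \<bullet> \<omega> \<alpha>' = 0" unfolding assms(2)[symmetric] using ne assms(1,3) by (simp add: omega_inner)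
  then have "k' * norm \<alpha>' + w \<bullet> \<omega> \<alpha>' = 0" using assms(3) by (simp add: inner_add_left omega_inner)
  moreover have "k' * norm \<alpha>' > 0" using assms B_nonzero by simp
  ultimately show False using cone_ge[OF assms(5,3)] by linarith
qed

lemma reflection_diff: "x - reflection \<alpha> x = (2 * (x \<bullet> \<alpha>) / (\<alpha> \<bullet> \<alpha>)) *\<^sub>R \<alpha>"
  by (simp add: reflection_def)

lemma reflection_below: 
  assumes "\<alpha> \<in> B" "x \<bullet> \<alpha> > 0"
  obtains k where "k > 0" "x - reflection \<alpha> x = k *\<^sub>R \<alpha>" "x - reflection \<alpha> x \<in> cone" "reflection \<alpha> x \<noteq> x"
proof -
  have k: "2 * (x \<bullet> \<alpha>) / (\<alpha> \<bullet> \<alpha>) > 0" using assms B_nonzero by simp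
  have "x - reflection \<alpha> x \<in> cone" unfolding reflection_diff using k B_cone assms cone_scale by (meson less_imp_le)
  moreover have "reflection \<alpha> x \<noteq> x" using assms B_nonzero by (simp add: reflection_fixed_iff)
  ultimately show ?thesis using that k reflection_diff by blast
qed

lemma reflection_above:
  assumes "\<alpha> \<in> B" "x \<bullet> \<alpha> < 0"
  obtains k where "k > 0" "reflection \<alpha> x - x = k *\<^sub>R \<alpha>" "reflection \<alpha> x - x \<in> cone" "reflection \<alpha> x \<noteq> x"
proof -
  have "(- x) \<bullet> \<alpha> > 0" using assms by simp
  moreover have "reflection \<alpha> (- x) = - reflection \<alpha> x" by (rule linear_neg[OF linear_reflection])
  ultimately show ?thesis using reflection_below[OF assms(1), of "- x"] that
    by (metis minus_diff_minus minus_diff_eq minus_minus)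
qed

text \<open>Take a simple \<alpha> whose inner product with \<open>x - y\<close> is positive. Then
  \<open>x \<bullet> \<alpha> > 0\<close> or \<open>y \<bullet> \<alpha> < 0\<close>, so reflecting
  moves \<open>x\<close> down or \<open>y\<close> up along \<alpha>; if nothing lies between, the
  image reaches or passes the other point. Either way a multiple of \<alpha> splits into
  \<open>x - y\<close> and a cone element, and \<open>cone_sum_single\<close> applies.\<close>

lemma cover_simple:
  assumes c: "x - y \<in> cone" "x \<noteq> y"
    and below: "\<And>\<alpha>. \<alpha> \<in> B \<Longrightarrow> (x - y) \<bullet> \<alpha> > 0 \<Longrightarrow> x \<bullet> \<alpha> > 0 \<Longrightarrow> y - reflection \<alpha> x \<in> cone"
    and above: "\<And>\<alpha>. \<alpha> \<in> B \<Longrightarrow> (x - y) \<bullet> \<alpha> > 0 \<Longrightarrow> y \<bullet> \<alpha> < 0 \<Longrightarrow> reflection \<alpha> y - x \<in> cone"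
  shows "\<exists>\<alpha>\<in>B. \<exists>k>0. x - y = k *\<^sub>R \<alpha>"
proof -
  have nz: "x - y \<noteq> 0" using c by simp
  then obtain \<alpha> where a: "\<alpha> \<in> B" "(x - y) \<bullet> \<alpha> > 0" using cone_inner_pos c(1) by blast
  have "\<exists>k w. k *\<^sub>R \<alpha> = (x - y) + w \<and> w \<in> cone"
  proof (cases "x \<bullet> \<alpha> > 0")
    case True
    obtain k where "x - reflection \<alpha> x = k *\<^sub>R \<alpha>" using reflection_below[OF a(1) True] by blast
    then have "k *\<^sub>R \<alpha> = (x - y) + (y - reflection \<alpha> x)" by simp
    then show ?thesis using below[OF a True] by blast
  next
    case False
    then have n: "y \<bullet> \<alpha> < 0" using a by (simp add: inner_diff_left)
    obtain k where "reflection \<alpha> y - y = k *\<^sub>R \<alpha>" using reflection_above[OF a(1) n] by blast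
    then have "k *\<^sub>R \<alpha> = (x - y) + (reflection \<alpha> y - x)" by simp
    then show ?thesis using above[OF a n] by blast
  qed
  then have eq: "x - y = ((x - y) \<bullet> \<omega> \<alpha> / norm \<alpha>) *\<^sub>R \<alpha>" using cone_sum_single[OF a(1)] c(1) by blast
  then have "(x - y) \<bullet> \<omega> \<alpha> \<noteq> 0" using nz by auto
  then have "(x - y) \<bullet> \<omega> \<alpha> / norm \<alpha> > 0"
    using cone_ge[OF c(1) a(1)] B_nonzero[OF a(1)] by simp
  then show ?thesis using eq a(1) by blast
qed

lemma cx_single:
  assumes "\<alpha> \<in> \<Delta> \<epsilon>" "\<And>\<beta>. \<beta> \<in> \<Delta> \<epsilon> \<Longrightarrow> \<beta> \<noteq> \<alpha> \<Longrightarrow> x \<bullet> \<beta> = 0"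
  shows "cx \<epsilon> x = reflection \<alpha> x"
proof -
  have "(\<Sum>\<beta>\<in>\<Delta> \<epsilon>. (2 * (x \<bullet> \<beta>) / (\<beta> \<bullet> \<beta>)) *\<^sub>R \<beta>) = (\<Sum>\<beta>\<in>{\<alpha>}. (2 * (x \<bullet> \<beta>) / (\<beta> \<bullet> \<beta>)) *\<^sub>R \<beta>)"
    using assms finite_Delta by (intro sum.mono_neutral_right) auto
  then show ?thesis by (simp add: cx_eq reflection_def)
qed

lemma cx_double:
  assumes "\<alpha> \<in> \<Delta> \<epsilon>" "\<alpha>' \<in> \<Delta> \<epsilon>" "\<alpha> \<noteq> \<alpha>'" "\<And>\<beta>. \<beta> \<in> \<Delta> \<epsilon> \<Longrightarrow> \<beta> \<noteq> \<alpha> \<Longrightarrow> \<beta> \<noteq> \<alpha>' \<Longrightarrow> x \<bullet> \<beta> = 0"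
  shows "cx \<epsilon> x = x - (x - reflection \<alpha> x) - (x - reflection \<alpha>' x)"
proof -
  have "(\<Sum>\<beta>\<in>\<Delta> \<epsilon>. (2 * (x \<bullet> \<beta>) / (\<beta> \<bullet> \<beta>)) *\<^sub>R \<beta>) = (\<Sum>\<beta>\<in>{\<alpha>, \<alpha>'}. (2 * (x \<bullet> \<beta>) / (\<beta> \<bullet> \<beta>)) *\<^sub>R \<beta>)"
    using assms finite_Delta by (intro sum.mono_neutral_right) auto
  then show ?thesis using assms(3) by (simp add: cx_eq reflection_def)
qed

end

locale orbit_setup = root_setup W \<Phi> \<Delta> \<omega>
  for W :: "('a::euclidean_space \<Rightarrow> 'a) set" and \<Phi> \<Delta> \<omega> +
  fixes c :: "'a \<Rightarrow> real" and orb :: "'a set"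
  assumes ev: "positive_min_eigenvector (simple_roots \<Delta>) c"
    and fin: "finite orb"
    and orb_norm: "\<And>x y. x \<in> orb \<Longrightarrow> y \<in> orb \<Longrightarrow> norm x = norm y"
    and orb_inv: "\<And>\<alpha> x. \<alpha> \<in> \<Phi> \<Longrightarrow> x \<in> orb \<Longrightarrow> reflection \<alpha> x \<in> orb"
    and moves: "\<And>\<alpha>. \<alpha> \<in> \<Phi> \<Longrightarrow> \<exists>x\<in>orb. reflection \<alpha> x \<noteq> x"
begin

lemma B_orb_inv: "\<alpha> \<in> B \<Longrightarrow> x \<in> orb \<Longrightarrow> reflection \<alpha> x \<in> orb"
  using orb_inv B_subset by auto

lemma swap: "x \<in> orb \<Longrightarrow> y \<in> orb \<Longrightarrow> x - y = k *\<^sub>R \<alpha> \<Longrightarrow> k > 0 \<Longrightarrow> reflection \<alpha> x = y \<and> reflection \<alpha> y = x"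
  using reflection_swap[of x y k \<alpha>] orb_norm by (metis reflection_reflection less_irrefl)

lemma enumerate:
  assumes "U \<subseteq> orb" "\<And>x y. x \<in> U \<Longrightarrow> y \<in> U \<Longrightarrow> x \<noteq> y \<Longrightarrow> x - y \<in> cone \<or> y - x \<in> cone"
  obtains e :: "nat \<Rightarrow> 'a" where "e ` {1..card U} = U" "\<And>i j. 1 \<le> i \<Longrightarrow> i < j \<Longrightarrow> j \<le> card U \<Longrightarrow> e i - e j \<in> cone \<and> e i \<noteq> e j"
proof -
  have inj: "inj_on (\<lambda>x. - ht x) U"
  proof (rule inj_onI, rule ccontr)
    fix x y assume xy: "x \<in> U" "y \<in> U" "- ht x = - ht y" "x \<noteq> y"
    then have "x - y \<in> cone \<or> y - x \<in> cone" using assms(2) by blast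
    then have "ht (x - y) > 0 \<or> ht (y - x) > 0" using ht_pos xy(4) by (metis right_minus_eq)
    then show False using xy(3) by (auto simp: ht_diff)
  qed
  let ?M = "(\<lambda>x. - ht x) ` U"
  have fU: "finite U" using finite_subset[OF assms(1) fin] .
  define g where "g = (!) (sorted_list_of_set ?M)"
  have g: "bij_betw g {..<card ?M} ?M" "\<And>i j. i < j \<Longrightarrow> j < card ?M \<Longrightarrow> g i < g j"
    using fU unfolding g_def
    by (auto intro!: bij_betw_nth sorted_wrt_nth_less[OF strict_sorted_list_of_set])
  have cM: "card ?M = card U" by (rule card_image[OF inj])
  \<comment> \<open>The sorted list counts from 0 and increases in \<open>- ht\<close>; the chain
    counts from 1 and descends.\<close>
  define e where "e i = inv_into U (\<lambda>x. - ht x) (g (i - 1))" for i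
  have gM: "g (i - 1) \<in> ?M" if "1 \<le> i" "i \<le> card U" for i
    using g(1) that cM by (auto simp: bij_betw_def)
  have eU: "e i \<in> U" "- ht (e i) = g (i - 1)" if "1 \<le> i" "i \<le> card U" for i
    using inv_into_into[OF gM[OF that]] f_inv_into_f[OF gM[OF that]] by (simp_all add: e_def)
  have lt: "ht (e i) > ht (e j)" if "1 \<le> i" "i < j" "j \<le> card U" for i j
  proof -
    have "g (i - 1) < g (j - 1)" using that cM by (intro g(2)) auto
    then show ?thesis using eU(2)[of i] eU(2)[of j] that by simp
  qed
  have "e i - e j \<in> cone \<and> e i \<noteq> e j" if ij: "1 \<le> i" "i < j" "j \<le> card U" for i j
  proof -
    have ne: "e i \<noteq> e j" using lt[OF ij] by auto
    have "e j - e i \<notin> cone"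
    proof
      assume "e j - e i \<in> cone"
      then have "ht (e j - e i) > 0" using ne by (intro ht_pos) auto
      then show False using lt[OF ij] by (simp add: ht_diff)
    qed
    then show ?thesis using assms(2)[of "e i" "e j"] eU(1)[of i] eU(1)[of j] ij ne by auto
  qed
  moreover have "e ` {1..card U} = U"
  proof (intro equalityI subsetI)
    fix x assume "x \<in> U"
    then obtain i where i: "i < card U" "g i = - ht x" using g(1) cM by (force simp: bij_betw_def)
    then have "e (Suc i) = x" using inv_into_f_f[OF inj \<open>x \<in> U\<close>] by (simp add: e_def)
    then show "x \<in> e ` {1..card U}" using i by (intro image_eqI[of _ _ "Suc i"]) auto
  qed (use eU in auto)
  ultimately show ?thesis using that by blast
qed

text \<open>Two consecutive covering steps in the same class would commute, and the other order of the two
  steps would produce a second intermediate element.\<close>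

lemma alternate:
  assumes o: "x \<in> orb" "y \<in> orb" "z \<in> orb"
    and a: "\<alpha> \<in> \<Delta> \<epsilon>" "k > 0" "x - y = k *\<^sub>R \<alpha>" and a': "\<alpha>' \<in> B" "k' > 0" "y - z = k' *\<^sub>R \<alpha>'"
    and uniq: "\<And>w. w \<in> orb \<Longrightarrow> x - w \<in> cone \<Longrightarrow> w - z \<in> cone \<Longrightarrow> w \<noteq> x \<Longrightarrow> w \<noteq> z \<Longrightarrow> w = y"
  shows "\<alpha>' \<in> \<Delta> (opp \<epsilon>)"
proof (rule ccontr)
  assume "\<alpha>' \<notin> \<Delta> (opp \<epsilon>)"
  then have d: "\<alpha>' \<in> \<Delta> \<epsilon>" using B_cases a'(1) by blast
  have aB: "\<alpha> \<in> B" using a Delta_subset by blast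
  note nz = B_nonzero[OF aB] B_nonzero[OF a'(1)]
  have s1: "reflection \<alpha> y = x" and s2: "reflection \<alpha>' y = z" using swap o a a' by blast+
  show False
  proof (cases "\<alpha> = \<alpha>'")
    case True
    then have "x = z" using s1 s2 by simp
    then have "k *\<^sub>R \<alpha> + k' *\<^sub>R \<alpha> = 0" using a a' True by (metis diff_add_cancel add_diff_cancel_right' diff_self diff_add_eq)
    then have "(k + k') *\<^sub>R \<alpha> = 0" by (simp add: scaleR_add_left)
    then show False using nz a a' by simp
  next
    case False
    then have orth: "\<alpha> \<bullet> \<alpha>' = 0" using Delta_orth a d by blast
    define w where "w = reflection \<alpha>' x"
    have x: "x = y + k *\<^sub>R \<alpha>" using a by (simp add: algebra_simps)
    have "reflection \<alpha>' \<alpha> = \<alpha>" using orth nz by (simp add: reflection_fixed_iff)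
    then have w: "w = z + k *\<^sub>R \<alpha>"
      unfolding w_def x by (simp add: linear_add[OF linear_reflection] linear_scale[OF linear_reflection] s2)
    have "w \<in> orb" unfolding w_def using B_orb_inv a' o by blast
    moreover have xw: "x - w = k' *\<^sub>R \<alpha>'" using a a' by (simp add: w x)
    moreover have wz: "w - z = k *\<^sub>R \<alpha>" by (simp add: w)
    ultimately have "w = y" using uniq[of w] a a' aB nz B_cone cone_scale
      by (metis less_imp_le less_irrefl right_minus_eq scaleR_eq_0_iff)
    then have "k *\<^sub>R \<alpha> = k' *\<^sub>R \<alpha>'" using xw a by simp
    then have "(k *\<^sub>R \<alpha>) \<bullet> \<alpha> = (k' *\<^sub>R \<alpha>') \<bullet> \<alpha>" by simp
    then have "k * (\<alpha> \<bullet> \<alpha>) = 0" using orth by (simp add: inner_commute)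
    then show False using nz a by simp
  qed
qed

theorem chain_case:
  assumes refl: "\<And>x y. x \<in> orb \<Longrightarrow> y \<in> orb \<Longrightarrow> x \<noteq> y \<Longrightarrow> reflection (x - y) \<in> W"
    and card: "card orb \<ge> 3"
    and bg: "\<beta> \<in> APR" "\<gamma> \<in> APR" "\<beta> \<noteq> \<gamma>"
  shows "compatible_roots \<Phi> \<Delta> \<beta> \<gamma> \<longleftrightarrow>
    (\<forall>s\<in>diagram \<Phi> \<Delta> c \<omega> orb \<beta>. \<forall>t\<in>diagram \<Phi> \<Delta> c \<omega> orb \<gamma>. crosses s t \<longrightarrow> coincide s t)"
proof -
  define h where "h = card orb"
  obtain e :: "nat \<Rightarrow> 'a" where e: "e ` {1..h} = orb"
    and lt: "\<And>i j. 1 \<le> i \<Longrightarrow> i < j \<Longrightarrow> j \<le> h \<Longrightarrow> e i - e j \<in> cone \<and> e i \<noteq> e j"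
    unfolding h_def using diff_cone refl by (elim enumerate[of orb, rotated 2]) (auto, metis minus_diff_eq)
  have eo: "e i \<in> orb" if "1 \<le> i" "i \<le> h" for i using e that by auto
  have ob: "\<exists>i. 1 \<le> i \<and> i \<le> h \<and> x = e i" if "x \<in> orb" for x
    using that unfolding e[symmetric] by auto
  have le: "e i - e j \<in> cone" if "1 \<le> i" "i \<le> j" "j \<le> h" for i j
    using lt[of i j] that by (cases "i = j") auto
  have below: "i < j" if "1 \<le> i" "i \<le> h" "1 \<le> j" "j \<le> h" "e i - e j \<in> cone" "e i \<noteq> e j" for i j
  proof (rule ccontr)
    assume "\<not> i < j"
    then have "e j - e i \<in> cone" using that le by auto
    then show False using cone_antisym[OF that(5)] that(6) by simp
  qed
  have step: "\<exists>\<alpha>\<in>B. \<exists>k>0. e i - e (Suc i) = k *\<^sub>R \<alpha>" if i: "1 \<le> i" "i < h" for i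
  proof (rule cover_simple)
    show "e i - e (Suc i) \<in> cone" "e i \<noteq> e (Suc i)" using lt[of i "Suc i"] i by auto
    fix \<alpha> assume a: "\<alpha> \<in> B"
    {
      assume p: "e i \<bullet> \<alpha> > 0"
      have "e i \<in> orb" using eo i by simp
      then obtain j where j: "1 \<le> j" "j \<le> h" "reflection \<alpha> (e i) = e j" using ob B_orb_inv[OF a] by blast
      obtain l where "e i - e j \<in> cone" "e j \<noteq> e i" using reflection_below[OF a p] unfolding j by blast
      then have "i < j" using below[of i j] i j by simp
      then show "e (Suc i) - reflection \<alpha> (e i) \<in> cone" using le[of "Suc i" j] j by simp
    next
      assume p: "e (Suc i) \<bullet> \<alpha> < 0"
      have "e (Suc i) \<in> orb" using eo i by simp
      then obtain j where j: "1 \<le> j" "j \<le> h" "reflection \<alpha> (e (Suc i)) = e j" using ob B_orb_inv[OF a] by blast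
      obtain l where "e j - e (Suc i) \<in> cone" "e j \<noteq> e (Suc i)" using reflection_above[OF a p] unfolding j by blast
      then have "j < Suc i" using below[of j "Suc i"] i j by simp
      then show "reflection \<alpha> (e (Suc i)) - e i \<in> cone" using le[of j i] j i by simp
    }
  qed
  obtain a k where a: "\<And>i. 1 \<le> i \<Longrightarrow> i < h \<Longrightarrow> a i \<in> B \<and> k i > (0::real) \<and> e i - e (Suc i) = k i *\<^sub>R a i"
    using step by metis
  have alt: "a (Suc i) \<in> \<Delta> (opp \<epsilon>)" if i: "1 \<le> i" "Suc i < h" "a i \<in> \<Delta> \<epsilon>" for i \<epsilon>
  proof (rule alternate[of "e i" "e (Suc i)" "e (Suc (Suc i))"])
    show "e i \<in> orb" "e (Suc i) \<in> orb" "e (Suc (Suc i)) \<in> orb" using eo i by auto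
    show "a i \<in> \<Delta> \<epsilon>" "k i > 0" "e i - e (Suc i) = k i *\<^sub>R a i" using a[of i] i by auto
    show "a (Suc i) \<in> B" "k (Suc i) > 0" "e (Suc i) - e (Suc (Suc i)) = k (Suc i) *\<^sub>R a (Suc i)"
      using a[of "Suc i"] i by auto
    fix w assume w: "w \<in> orb" "e i - w \<in> cone" "w - e (Suc (Suc i)) \<in> cone" "w \<noteq> e i" "w \<noteq> e (Suc (Suc i))"
    then obtain j where j: "1 \<le> j" "j \<le> h" "w = e j" using e by auto
    then have "i < j" "j < Suc (Suc i)" using below[of i j] below[of j "Suc (Suc i)"] w i by auto
    then have "j = Suc i" by simp
    then show "w = e (Suc i)" using j by simp
  qed
  obtain \<epsilon>0 where e0: "a 1 \<in> \<Delta> \<epsilon>0" using a[of 1] card B_cases by (auto simp: h_def)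
  have par: "a i \<in> \<Delta> (alt \<epsilon>0 i)" if "1 \<le> i" "i < h" for i
    using that
  proof (induction i rule: nat_induct_at_least)
    case base
    then show ?case using e0 by (simp add: alt_def)
  next
    case (Suc i)
    then show ?case using local.alt[of i] by simp
  qed
  \<comment> \<open>Only the roots of the two adjacent steps can be non-orthogonal to
    \<open>e i\<close>: reflecting in \<alpha> moves \<open>e i\<close> by a multiple of \<alpha> at
    least as far as its neighbour, and a simple root dominates no other simple root.\<close>
  have active: "(i < h \<and> \<alpha> = a i) \<or> (i > 1 \<and> \<alpha> = a (i - 1))" if i: "1 \<le> i" "i \<le> h" and al: "\<alpha> \<in> B" "e i \<bullet> \<alpha> \<noteq> 0" for i \<alpha>
  proof -
    obtain j where j: "1 \<le> j" "j \<le> h" "reflection \<alpha> (e i) = e j"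
      using B_orb_inv[OF al(1) eo[OF i]] ob by blast
    consider "e i \<bullet> \<alpha> > 0" | "e i \<bullet> \<alpha> < 0" using al by linarith
    then show ?thesis
    proof cases
      case 1
      obtain l where l: "e i - e j = l *\<^sub>R \<alpha>" "e i - e j \<in> cone" "e j \<noteq> e i"
        using reflection_below[OF al(1) 1] unfolding j by blast
      then have ij: "i < j" using below[of i j] i j by simp
      have ai: "e i - e (Suc i) = k i *\<^sub>R a i" using a[of i] ij i j by simp
      have "e i - e j = (e i - e (Suc i)) + (e (Suc i) - e j)" by simp
      then have "l *\<^sub>R \<alpha> = k i *\<^sub>R a i + (e (Suc i) - e j)" unfolding l(1) ai .
      then have "a i = \<alpha>" using a[of i] ij i j le[of "Suc i" j] by (intro cone_sum_same[OF al(1)]) auto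
      then show ?thesis using ij j by auto
    next
      case 2
      obtain l where l: "e j - e i = l *\<^sub>R \<alpha>" "e j - e i \<in> cone" "e j \<noteq> e i"
        using reflection_above[OF al(1) 2] unfolding j by blast
      then have ij: "j < i" using below[of j i] i j by simp
      then obtain i' where i': "i = Suc i'" "j \<le> i'" by (cases i) auto
      have ai: "e i' - e i = k i' *\<^sub>R a i'" using a[of i'] i' i j by simp
      have "e j - e i = (e i' - e i) + (e j - e i')" by simp
      then have "l *\<^sub>R \<alpha> = k i' *\<^sub>R a i' + (e j - e i')" unfolding l(1) ai .
      then have "a i' = \<alpha>" using a[of i'] i' i j le[of j i'] by (intro cone_sum_same[OF al(1)]) auto
      then show ?thesis using i' j by auto
    qed
  qed
  \<comment> \<open>Of the at most two simple roots not orthogonal to \<open>e i\<close>, only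
    \<open>a i\<close> lies in the class of step i, so \<open>cx\<close> acts on \<open>e i\<close>
    as a single reflection.\<close>
  have cx_up: "cx (alt \<epsilon>0 i) (e i) = e (Suc i)" if i: "1 \<le> i" "i < h" for i
  proof -
    have "cx (alt \<epsilon>0 i) (e i) = reflection (a i) (e i)"
    proof (rule cx_single)
      show "a i \<in> \<Delta> (alt \<epsilon>0 i)" using par i by blast
      fix \<alpha> assume al: "\<alpha> \<in> \<Delta> (alt \<epsilon>0 i)" "\<alpha> \<noteq> a i"
      show "e i \<bullet> \<alpha> = 0"
      proof (rule ccontr)
        assume "e i \<bullet> \<alpha> \<noteq> 0"
        then have 1: "i > 1" "\<alpha> = a (i - 1)" using active[of i \<alpha>] al i Delta_subset by auto
        then obtain j where j: "i = Suc j" "1 \<le> j" by (cases i) auto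
        then have "\<alpha> \<in> \<Delta> (alt \<epsilon>0 j)" using par[of j] 1 i by simp
        then show False using al(1) Delta_disj[of \<alpha> "alt \<epsilon>0 j"] j by simp
      qed
    qed
    also have "\<dots> = e (Suc i)" using swap[OF eo eo, of i "Suc i" "k i" "a i"] a[of i] i by auto
    finally show ?thesis .
  qed
  have cx_1: "cx (opp \<epsilon>0) (e 1) = e 1"
  proof (rule cx_fix, rule ccontr)
    fix \<alpha> assume al: "\<alpha> \<in> \<Delta> (opp \<epsilon>0)" "e 1 \<bullet> \<alpha> \<noteq> 0"
    then have "\<alpha> = a 1" using active[of 1 \<alpha>] Delta_subset card by (auto simp: h_def)
    then show False using al e0 Delta_disj by blast
  qed
  have cx_h: "cx (alt \<epsilon>0 h) (e h) = e h"
  proof (rule cx_fix, rule ccontr)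
    fix \<alpha> assume al: "\<alpha> \<in> \<Delta> (alt \<epsilon>0 h)" "e h \<bullet> \<alpha> \<noteq> 0"
    obtain j where j: "h = Suc j" "1 \<le> j" using card by (cases h) (auto simp: h_def)
    then have "\<alpha> = a j" using active[of h \<alpha>] al Delta_subset by auto
    then have "\<alpha> \<in> \<Delta> (alt \<epsilon>0 j)" using par[of j] j by simp
    then show False using al(1) Delta_disj[of \<alpha> "alt \<epsilon>0 j"] j by simp
  qed
  have pair: "\<exists>p\<in>{1..h}. \<exists>q\<in>{1..h}. \<exists>k. k \<noteq> 0 \<and> e p - e q = k *\<^sub>R \<beta>" if b: "\<beta> \<in> \<Phi>" for \<beta>
  proof -
    obtain x where x: "x \<in> orb" "reflection \<beta> x \<noteq> x" using moves[OF b] by auto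
    obtain p where p: "p \<in> {1..h}" "e p = x" using x e by auto
    obtain q where q: "q \<in> {1..h}" "e q = reflection \<beta> x" using orb_inv[OF b x(1)] e by auto
    have "e p - e q = (2 * (x \<bullet> \<beta>) / (\<beta> \<bullet> \<beta>)) *\<^sub>R \<beta>" unfolding p q by (rule reflection_diff)
    moreover have "2 * (x \<bullet> \<beta>) / (\<beta> \<bullet> \<beta>) \<noteq> 0" using x by (auto simp: reflection_def)
    ultimately show ?thesis using p q by blast
  qed
  have span: "B \<subseteq> span (e ` {1..h} \<union> {})"
  proof
    fix \<alpha> assume "\<alpha> \<in> B"
    then obtain p q k where pq: "p \<in> {1..h}" "q \<in> {1..h}" "k \<noteq> 0" "e p - e q = k *\<^sub>R \<alpha>" using pair[of \<alpha>] B_subset by blast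
    then have "\<alpha> = (1 / k) *\<^sub>R (e p - e q)" by simp
    moreover have "e p \<in> span (e ` {1..h} \<union> {})" "e q \<in> span (e ` {1..h} \<union> {})" using pq by (auto intro: span_base)
    ultimately show "\<alpha> \<in> span (e ` {1..h} \<union> {})" by (simp add: span_diff span_scale)
  qed
  have ne: "\<Delta> \<epsilon> \<noteq> {}" for \<epsilon>
    using par[of 1] par[of 2] card sign_cases2[of \<epsilon> \<epsilon>0] by (auto simp: h_def alt_def)
  have step_ge: "(e i - e (Suc i)) \<bullet> \<omega> \<alpha> \<ge> 0" if "1 \<le> i" "i < h" "\<alpha> \<in> B" for i \<alpha>
    using cone_ge[OF le[of i "Suc i"]] that by auto
  have step_pos: "\<exists>\<alpha>\<in>\<Delta> (alt \<epsilon>0 i). (e i - e (Suc i)) \<bullet> \<omega> \<alpha> > 0" if i: "1 \<le> i" "i < h" for i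
  proof -
    have "(e i - e (Suc i)) \<bullet> \<omega> (a i) > 0"
      using a[OF i] B_nonzero[of "a i"] by (auto simp: omega_inner)
    then show ?thesis using par[OF i] by blast
  qed
  have single: "\<exists>\<alpha>\<in>\<Delta> (alt \<epsilon>0 i). \<exists>k>0. e i - e (Suc i) = k *\<^sub>R \<alpha>" if "1 \<le> i" "i < h" for i
    using a[OF that] par[OF that] by blast
  have card': "3 \<le> h" using card by (simp add: h_def)
  have orb': "orb = e ` {1..h} \<union> {}" using e by simp
  \<comment> \<open>\<open>0\<close> is a placeholder for the middle index, which the assumptions
    mention only for a nonempty \<open>F\<close>.\<close>
  interpret zigzag_orbit W \<Phi> \<Delta> \<omega> c h e \<epsilon>0 "{}" orb 0
    by (unfold_locales, fact ev, fact ne, fact card', fact cx_up, fact cx_1, fact cx_h, fact step_ge,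
        fact step_pos, simp, fact span, fact orb', fact orb_norm, fact orb_inv, fact pair,
        erule (1) single, simp_all)
  show ?thesis by (rule compatible_iff_diagrams[OF bg])
qed

end

section \<open>Centrally symmetric orbits with one incomparable pair\<close>

context orbit_setup
begin

text \<open>The hypotheses list the properties of the icosahedron that enter: only antipodal points
  may be incomparable, and no nonzero vector is orthogonal to three points on different axes. The
  orbit is sorted as an upper half, the incomparable pair, and the negatives of the upper half;
  covering is checked in the upper half and transferred by negation.\<close>

theorem central_case:
  assumes neg: "\<And>x. x \<in> orb \<Longrightarrow> - x \<in> orb" and zero: "0 \<notin> orb"
    and refl: "\<And>x y. x \<in> orb \<Longrightarrow> y \<in> orb \<Longrightarrow> x \<noteq> y \<Longrightarrow> x \<noteq> - y \<Longrightarrow> reflection (x - y) \<in> W"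
    and no_refl: "\<And>x. x \<in> orb \<Longrightarrow> reflection x \<notin> W"
    and three: "\<And>x y z \<beta>. x \<in> orb \<Longrightarrow> y \<in> orb \<Longrightarrow> z \<in> orb \<Longrightarrow> x \<noteq> y \<Longrightarrow> x \<noteq> - y \<Longrightarrow> y \<noteq> z \<Longrightarrow> y \<noteq> - z
      \<Longrightarrow> x \<noteq> z \<Longrightarrow> x \<noteq> - z \<Longrightarrow> x \<bullet> \<beta> = 0 \<Longrightarrow> y \<bullet> \<beta> = 0 \<Longrightarrow> z \<bullet> \<beta> = 0 \<Longrightarrow> \<beta> = 0"
    and card: "card orb = 2 * m + 2" "m \<ge> 4"
    and bg: "\<beta> \<in> APR" "\<gamma> \<in> APR" "\<beta> \<noteq> \<gamma>"
  shows "compatible_roots \<Phi> \<Delta> \<beta> \<gamma> \<longleftrightarrow>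
    (\<forall>s\<in>diagram \<Phi> \<Delta> c \<omega> orb \<beta>. \<forall>t\<in>diagram \<Phi> \<Delta> c \<omega> orb \<gamma>. crosses s t \<longrightarrow> coincide s t)"
proof -
  have no_root: "x \<noteq> k *\<^sub>R \<beta>" if "x \<in> orb" "\<beta> \<in> \<Phi>" for x k \<beta>
  proof
    assume x: "x = k *\<^sub>R \<beta>"
    then have "k \<noteq> 0" using zero that by auto
    then have "reflection x = reflection \<beta>" unfolding x by (rule reflection_scaleR)
    then show False using no_refl that reflection_in_W by metis
  qed
  have no_root2: "x - - x \<noteq> k *\<^sub>R \<beta>" if "x \<in> orb" "\<beta> \<in> \<Phi>" for x k \<beta>
  proof
    assume "x - - x = k *\<^sub>R \<beta>"
    then have "(1/2) *\<^sub>R (x + x) = (1/2) *\<^sub>R (k *\<^sub>R \<beta>)" by simp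
    then have "x = (k/2) *\<^sub>R \<beta>" by (simp add: scaleR_2[symmetric])
    then show False using no_root that by blast
  qed
  have cmp: "x - y \<in> cone \<or> y - x \<in> cone" if "x \<in> orb" "y \<in> orb" "x \<noteq> - y" for x y
    using diff_cone[OF refl[of x y]] that by (cases "x = y") auto
  have refl_neg: "reflection \<alpha> x \<noteq> - x" if "\<alpha> \<in> B" "x \<in> orb" for \<alpha> x
    using no_root2[OF that(2), of \<alpha>] reflection_diff[of x \<alpha>] that B_subset by (metis subsetD)
  text \<open>An element that is minimal among those lying in the cone would have to be a multiple of a
    simple root, so some element is not comparable with its negative.\<close>
  obtain f where f: "f \<in> orb" "f \<notin> cone" "- f \<notin> cone"
  proof (rule ccontr)
    assume "\<not> thesis"
    then have all: "x \<in> cone \<or> - x \<in> cone" if "x \<in> orb" for x using that \<open>\<And>f. f \<in> orb \<Longrightarrow> f \<notin> cone \<Longrightarrow> - f \<notin> cone \<Longrightarrow> thesis\<close> by blast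
    let ?P = "{x \<in> orb. x \<in> cone}"
    have "orb \<noteq> {}" using card by auto
    then have "?P \<noteq> {}" using all neg by blast
    then obtain x where x: "x \<in> orb" "x \<in> cone" and min: "\<And>y. y \<in> orb \<Longrightarrow> y \<in> cone \<Longrightarrow> ht x \<le> ht y"
      using arg_min_if_finite[of ?P ht] fin by fastforce
    have x0: "x \<noteq> 0" using x zero by auto
    obtain \<alpha> where a: "\<alpha> \<in> B" "x \<bullet> \<alpha> > 0" using cone_inner_pos[OF x(2) x0] by blast
    define w where "w = reflection \<alpha> x"
    obtain k where k: "k > 0" "x - w = k *\<^sub>R \<alpha>" "x - w \<in> cone" "w \<noteq> x"
      unfolding w_def using reflection_below[OF a] by blast
    have w: "w \<in> orb" "w \<noteq> - x" using B_orb_inv[OF a(1) x(1)] refl_neg[OF a(1) x(1)] by (auto simp: w_def)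
    have hw: "ht w < ht x" using ht_pos[OF k(3)] k(4) by (simp add: ht_diff)
    \<comment> \<open>If \<open>w\<close> is above \<open>- x\<close>, then \<open>- w\<close> lies
      in the cone and is lower than \<open>x\<close>, against minimality. If \<open>w\<close> is
      below \<open>- x\<close>, then \<open>k *\<^sub>R \<alpha>\<close> is the sum of
      \<open>x\<close> and a cone element, so \<open>x\<close> is a multiple of \<alpha>.\<close>
    have "w - - x \<in> cone \<or> - x - w \<in> cone" using cmp[of w "- x"] w k neg[OF x(1)] by auto
    then show False
    proof
      assume c: "w - - x \<in> cone"
      have "w \<notin> cone" using min[OF w(1)] hw by auto
      then have "- w \<in> cone" using all w by blast
      then have "ht x \<le> ht (- w)" using min neg w by blast
      moreover have "ht (w - - x) > 0" using c w(2) by (intro ht_pos) (auto simp: eq_neg_iff_add_eq_0)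
      moreover have "ht (- w) = - ht w" "ht (- x) = - ht x" using ht_diff[of 0 w] ht_diff[of 0 x] by (simp_all add: ht_def)
      moreover have "ht (w - - x) = ht w - ht (- x)" by (rule ht_diff)
      ultimately show False by linarith
    next
      assume c: "- x - w \<in> cone"
      have "k *\<^sub>R \<alpha> = x + (x + (- x - w))" using k(2) by simp
      then have "x = (x \<bullet> \<omega> \<alpha> / norm \<alpha>) *\<^sub>R \<alpha>" using cone_add[OF x(2) c] by (intro cone_sum_single[OF a(1)]) (use x in auto)
      then show False using no_root[OF x(1)] a B_subset by blast
    qed
  qed
  define F where "F = {f, - f}"
  have ne_neg: "x \<noteq> - x" if "x \<in> orb" for x
  proof
    assume "x = - x"
    then have "(1/2) *\<^sub>R (x + x) = 0" by (simp add: eq_neg_iff_add_eq_0)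
    then show False using that zero by (simp only: scaleR_half_double)
  qed
  have F: "F \<subseteq> orb" "- g \<in> F" "g \<notin> cone" "g \<noteq> - g" if "g \<in> F" for g
    using that f neg ne_neg[of g] by (auto simp: F_def)
  have Fne: "f \<in> F" by (simp add: F_def)
  \<comment> \<open>The upper half: the points above both \<open>f\<close> and \<open>- f\<close>.
    For each remaining point outside \<open>F\<close>, the negative turns out to lie here.\<close>
  define U where "U = {y \<in> orb. \<forall>g\<in>F. y - g \<in> cone}"
  have no2: "- g - g \<notin> cone" if "g \<in> F" for g
  proof
    assume "- g - g \<in> cone"
    then have "(1/2) *\<^sub>R (- g - g) \<in> cone" by (rule cone_scale) simp
    moreover have "(1/2) *\<^sub>R (- g - g) = - g"
      using scaleR_half_double[of "- g"] by (simp only: diff_conv_add_uminus)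
    ultimately show False using F[OF that] F(3)[OF F(2)[OF that]] by simp
  qed
  have dich: "y \<in> U \<or> - y \<in> U" if y: "y \<in> orb" "y \<notin> F" for y
  proof -
    have c: "y - g \<in> cone \<or> g - y \<in> cone" if "g \<in> F" for g
      using cmp[of y g] F(1,2)[OF that] that y by auto
    \<comment> \<open>Lying above \<open>g\<close> and below \<open>- g\<close> would make
      \<open>g\<close> and \<open>- g\<close> comparable.\<close>
    have mix: "\<not> (y - g \<in> cone \<and> - g - y \<in> cone)" if "g \<in> F" for g
      using cone_trans[of "- g" y g] no2[OF that] by blast
    show ?thesis
    proof (cases "y - f \<in> cone")
      case True
      then have "y - - f \<in> cone" using c[of "- f"] mix[of f] by (auto simp: F_def)
      then show ?thesis using True y by (simp add: U_def F_def)
    next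
      case False
      then have 1: "f - y \<in> cone" using c[of f] Fne by blast
      then have 2: "- f - y \<in> cone" using c[of "- f"] mix[of "- f"] by (auto simp: F_def)
      have "- y - f = - f - y" "- y - - f = f - y" by simp_all
      then have "- y - f \<in> cone" "- y - - f \<in> cone" using 1 2 by metis+
      then show ?thesis using y neg by (simp add: U_def F_def)
    qed
  qed
  have Uorb: "U \<subseteq> orb" and UF: "U \<inter> F = {}"
  proof -
    show "U \<subseteq> orb" by (auto simp: U_def)
    show "U \<inter> F = {}"
    proof (rule ccontr)
      assume "U \<inter> F \<noteq> {}"
      then obtain g where g: "g \<in> U" "g \<in> F" by auto
      then have "g - - g \<in> cone" using F(2)[OF g(2)] unfolding U_def by blast
      then show False using no2[OF F(2)[OF g(2)]] by simp
    qed
  qed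
  have UU: "- y \<notin> U" if "y \<in> U" for y
  proof
    assume "- y \<in> U"
    then have "y - f \<in> cone" "- y - f \<in> cone" using that Fne by (auto simp: U_def)
    then have "(y - f) + (- y - f) \<in> cone" by (rule cone_add)
    then show False using no2[OF Fne] by simp
  qed
  have cardU: "card U = m"
  proof -
    have e: "orb = U \<union> uminus ` U \<union> F"
    proof (intro equalityI subsetI)
      fix y assume "y \<in> orb"
      then show "y \<in> U \<union> uminus ` U \<union> F" using dich[of y] by (metis UnCI image_eqI minus_minus)
    qed (use Uorb neg F Fne in auto)
    have fU: "finite U" using finite_subset[OF Uorb fin] .
    have d: "U \<inter> uminus ` U = {}" using UU by auto
    have d2: "(U \<union> uminus ` U) \<inter> F = {}" using UF F(2) by auto (metis Int_iff emptyE minus_minus)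
    have "f \<noteq> - f" using F(4)[OF Fne] .
    then have "card F = 2" by (simp add: F_def)
    moreover have "card (uminus ` U) = card U" by (rule card_image) simp
    moreover have "finite F" by (simp add: F_def)
    ultimately have "card orb = card U + card U + 2"
      unfolding e using fU d d2 by (simp add: card_Un_disjoint)
    then show ?thesis using card by simp
  qed
  obtain e0 :: "nat \<Rightarrow> 'a" where e0: "e0 ` {1..m} = U"
    and lt0: "\<And>i j. 1 \<le> i \<Longrightarrow> i < j \<Longrightarrow> j \<le> m \<Longrightarrow> e0 i - e0 j \<in> cone \<and> e0 i \<noteq> e0 j"
  proof (rule enumerate[OF Uorb])
    fix x y assume "x \<in> U" "y \<in> U" "x \<noteq> y"
    then show "x - y \<in> cone \<or> y - x \<in> cone" using cmp[of x y] Uorb UU by auto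
  qed (use that cardU in auto)
  define h where "h = 2 * m"
  define e where "e i = (if i \<le> m then e0 i else - e0 (h + 1 - i))" for i
  have e_neg: "e (h + 1 - i) = - e i" if "i \<in> {1..h}" for i
    using that by (auto simp: e_def h_def)
  have eU: "e i \<in> U" if "1 \<le> i" "i \<le> m" for i using that e0 by (auto simp: e_def)
  have lt: "e i - e j \<in> cone" "e i \<noteq> e j" if "1 \<le> i" "i < j" "j \<le> m" for i j
    using lt0[OF that] that by (auto simp: e_def)
  have eo: "e i \<in> orb" if "1 \<le> i" "i \<le> m" for i using eU that Uorb by blast
  have le: "e i - e j \<in> cone" if "1 \<le> i" "i \<le> j" "j \<le> m" for i j
    using lt[of i j] that by (cases "i = j") auto
  \<comment> \<open>The points below the whole upper chain: the middle pair and the lower half,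
    without any order among them.\<close>
  define low where "low w \<longleftrightarrow> w \<in> F \<or> - w \<in> U" for w
  have low_F: "g - w \<in> cone" if "- w \<in> U" "g \<in> F" for g w
  proof -
    have "- w - - g \<in> cone" using that(1) F(2)[OF that(2)] unfolding U_def by blast
    moreover have "- w - - g = g - w" by simp
    ultimately show ?thesis by metis
  qed
  have e_F: "e i - g \<in> cone" if "1 \<le> i" "i \<le> m" "g \<in> F" for i g
    using eU[of i] that by (auto simp: U_def)
  have low_e: "e i - w \<in> cone" if "low w" "1 \<le> i" "i \<le> m" for i w
    using that low_F[of w f] e_F[of i] Fne cone_trans[of "e i" f w] unfolding low_def by blast
  have cases: "(\<exists>j. 1 \<le> j \<and> j \<le> m \<and> w = e j) \<or> low w" if w: "w \<in> orb" for w
  proof (cases "w \<in> U")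
    case True
    then obtain j where "j \<in> {1..m}" "w = e0 j" using e0 by auto
    then show ?thesis by (auto simp: e_def)
  next
    case False
    then show ?thesis using dich[OF w] by (auto simp: low_def)
  qed
  have ne_low: "\<not> low (e i)" if "1 \<le> i" "i \<le> m" for i
    using eU[OF that] UU UF by (auto simp: low_def)
  have anti: "x = y" if "x - y \<in> cone" "y - x \<in> cone" for x y
    using cone_antisym[OF that(1)] that(2) by simp
  have above: "\<exists>j. 1 \<le> j \<and> j < i \<and> w = e j" if w: "w \<in> orb" and "1 \<le> i" "i \<le> m" "w - e i \<in> cone" "w \<noteq> e i" for w i
  proof -
    have "\<not> low w" using low_e[of w i] anti[of w "e i"] that by auto
    then obtain j where j: "1 \<le> j" "j \<le> m" "w = e j" using cases[OF w] by blast
    have "\<not> i \<le> j"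
    proof
      assume "i \<le> j"
      then have "e i - w \<in> cone" using le[of i j] j that by simp
      then show False using anti[of w "e i"] that by simp
    qed
    then have "j < i" by simp
    then show ?thesis using j(1,3) by blast
  qed
  have below: "(\<exists>j. i < j \<and> j \<le> m \<and> w = e j) \<or> low w" if w: "w \<in> orb" and "1 \<le> i" "i \<le> m" "e i - w \<in> cone" "w \<noteq> e i" for w i
  proof (cases "low w")
    case False
    then obtain j where j: "1 \<le> j" "j \<le> m" "w = e j" using cases[OF w] by blast
    have "\<not> j \<le> i"
    proof
      assume "j \<le> i"
      then have "w - e i \<in> cone" using le[of j i] j that by simp
      then show False using anti[of w "e i"] that by simp
    qed
    then have "i < j" by simp
    then show ?thesis using j(2,3) by blast
  qed simp
  have aboveF: "\<exists>j. 1 \<le> j \<and> j \<le> m \<and> w = e j" if "w \<in> orb" "g \<in> F" "w - g \<in> cone" "w \<noteq> g" for w g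
  proof -
    have "w \<noteq> - g" using no2[OF that(2)] that(3) by auto
    then have "w \<notin> F" using that f by (auto simp: F_def)
    moreover have "- w \<notin> U" using low_F[of w g] anti that by blast
    ultimately show ?thesis using cases that by (auto simp: low_def)
  qed
  have step: "\<exists>\<alpha>\<in>B. \<exists>k>0. e i - e (Suc i) = k *\<^sub>R \<alpha>" if i: "1 \<le> i" "i < m" for i
  proof (rule cover_simple)
    show "e i - e (Suc i) \<in> cone" "e i \<noteq> e (Suc i)" using lt[of i "Suc i"] i by auto
    fix \<alpha> assume a: "\<alpha> \<in> B"
    {
      assume p: "e i \<bullet> \<alpha> > 0"
      have o: "reflection \<alpha> (e i) \<in> orb" using B_orb_inv a eo i by simp
      have "e i - reflection \<alpha> (e i) \<in> cone" "reflection \<alpha> (e i) \<noteq> e i" using reflection_below[OF a p] by blast+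
      then consider j where "i < j" "j \<le> m" "reflection \<alpha> (e i) = e j" | "low (reflection \<alpha> (e i))"
        using below[OF o i(1) less_imp_le[OF i(2)]] by blast
      then show "e (Suc i) - reflection \<alpha> (e i) \<in> cone"
        by cases (use le[of "Suc i"] low_e i in auto)
    next
      assume p: "e (Suc i) \<bullet> \<alpha> < 0"
      have o: "reflection \<alpha> (e (Suc i)) \<in> orb" using B_orb_inv a eo i by simp
      have "reflection \<alpha> (e (Suc i)) - e (Suc i) \<in> cone" "reflection \<alpha> (e (Suc i)) \<noteq> e (Suc i)"
        using reflection_above[OF a p] by blast+
      moreover have "1 \<le> Suc i" "Suc i \<le> m" using i by auto
      ultimately obtain j where "1 \<le> j" "j < Suc i" "reflection \<alpha> (e (Suc i)) = e j"
        using above[OF o] by blast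
      then show "reflection \<alpha> (e (Suc i)) - e i \<in> cone" using le[of j i] i by simp
    }
  qed
  have m1: "1 \<le> m" "m \<le> m" using card by auto
  have stepF: "\<exists>\<alpha>\<in>B. \<exists>k>0. e m - g = k *\<^sub>R \<alpha>" if g: "g \<in> F" for g
  proof (rule cover_simple)
    show "e m - g \<in> cone" using e_F m1 g by simp
    show "e m \<noteq> g" using eU[OF m1] UF g by auto
    fix \<alpha> assume a: "\<alpha> \<in> B" and pos: "(e m - g) \<bullet> \<alpha> > 0"
    {
      assume p: "e m \<bullet> \<alpha> > 0"
      have o: "reflection \<alpha> (e m) \<in> orb" using B_orb_inv a eo m1 by simp
      obtain k where k: "k > 0" "e m - reflection \<alpha> (e m) = k *\<^sub>R \<alpha>" "e m - reflection \<alpha> (e m) \<in> cone" "reflection \<alpha> (e m) \<noteq> e m"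
        using reflection_below[OF a p] by blast
      then have "low (reflection \<alpha> (e m))" using below[OF o m1] by fastforce
      then consider "- reflection \<alpha> (e m) \<in> U" | "reflection \<alpha> (e m) = g" | "reflection \<alpha> (e m) = - g"
        using g by (auto simp: low_def F_def)
      then show "g - reflection \<alpha> (e m) \<in> cone"
      proof cases
        \<comment> \<open>\<open>e m\<close> has two lower neighbours, so its reflection may be the
          wrong one, \<open>- g\<close>. Then \<open>e m + g\<close> is a multiple of \<alpha>, and
          since \<open>e m\<close> and \<open>g\<close> have equal norm, \<open>e m - g\<close> is
          orthogonal to it, against the choice of \<alpha>.\<close>
        case 3
        then have "k * ((e m - g) \<bullet> \<alpha>) = (e m - g) \<bullet> (e m + g)" using k(2) by (metis diff_minus_eq_add inner_scaleR_right)
        also have "\<dots> = e m \<bullet> e m - g \<bullet> g" by (simp add: algebra_simps inner_commute)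
        also have "\<dots> = 0" using orb_norm[of "e m" g] eo[OF m1] F(1)[OF g] g by (auto simp: norm_eq)
        finally show ?thesis using k pos by simp
      qed (use low_F g in auto)
    next
      assume p: "g \<bullet> \<alpha> < 0"
      have go: "g \<in> orb" using F(1)[OF g] g by blast
      have o: "reflection \<alpha> g \<in> orb" using B_orb_inv a go by simp
      have "reflection \<alpha> g - g \<in> cone" "reflection \<alpha> g \<noteq> g" using reflection_above[OF a p] by blast+
      then obtain j where "1 \<le> j" "j \<le> m" "reflection \<alpha> g = e j" using aboveF[OF o g] by auto
      then show "reflection \<alpha> g - e m \<in> cone" using le[of j m] by simp
    }
  qed
  obtain a k where a: "\<And>i. 1 \<le> i \<Longrightarrow> i < m \<Longrightarrow> a i \<in> B \<and> k i > (0::real) \<and> e i - e (Suc i) = k i *\<^sub>R a i"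
    using step by metis
  obtain b l where b: "\<And>g. g \<in> F \<Longrightarrow> b g \<in> B \<and> l g > (0::real) \<and> e m - g = l g *\<^sub>R b g"
    using stepF by metis
  have alt: "a (Suc i) \<in> \<Delta> (opp \<epsilon>)" if i: "1 \<le> i" "Suc i < m" "a i \<in> \<Delta> \<epsilon>" for i \<epsilon>
  proof (rule alternate[of "e i" "e (Suc i)" "e (Suc (Suc i))"])
    show "e i \<in> orb" "e (Suc i) \<in> orb" "e (Suc (Suc i)) \<in> orb" using eo i by auto
    show "a i \<in> \<Delta> \<epsilon>" "k i > 0" "e i - e (Suc i) = k i *\<^sub>R a i" using a[of i] i by auto
    show "a (Suc i) \<in> B" "k (Suc i) > 0" "e (Suc i) - e (Suc (Suc i)) = k (Suc i) *\<^sub>R a (Suc i)"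
      using a[of "Suc i"] i by auto
    fix w assume w: "w \<in> orb" "e i - w \<in> cone" "w - e (Suc (Suc i)) \<in> cone" "w \<noteq> e i" "w \<noteq> e (Suc (Suc i))"
    then obtain j where j: "1 \<le> j" "j < Suc (Suc i)" "w = e j" using above[of w "Suc (Suc i)"] i by auto
    have "\<not> j \<le> i" using le[of j i] anti[of w "e i"] j w i by auto
    then have "j = Suc i" using j by simp
    then show "w = e (Suc i)" using j by simp
  qed
  have altF: "b g \<in> \<Delta> (opp \<epsilon>)" if i: "a (m - 1) \<in> \<Delta> \<epsilon>" "g \<in> F" for g \<epsilon>
  proof (rule alternate[of "e (m - 1)" "e m" g])
    have mm: "1 \<le> m - 1" "m - 1 < m" "Suc (m - 1) = m" using card by auto
    show "e (m - 1) \<in> orb" "e m \<in> orb" "g \<in> orb" using eo mm F(1)[OF i(2)] i(2) by auto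
    show "a (m - 1) \<in> \<Delta> \<epsilon>" "k (m - 1) > 0" "e (m - 1) - e m = k (m - 1) *\<^sub>R a (m - 1)" using a[of "m - 1"] i mm by auto
    show "b g \<in> B" "l g > 0" "e m - g = l g *\<^sub>R b g" using b[OF i(2)] by auto
    fix w assume w: "w \<in> orb" "e (m - 1) - w \<in> cone" "w - g \<in> cone" "w \<noteq> e (m - 1)" "w \<noteq> g"
    then obtain j where j: "1 \<le> j" "j \<le> m" "w = e j" using aboveF[of w g] i by auto
    have "\<not> j \<le> m - 1" using le[of j "m - 1"] anti[of w "e (m - 1)"] j w by auto
    then have "j = m" using j by simp
    then show "w = e m" using j by simp
  qed
  obtain \<epsilon>0 where e0: "a 1 \<in> \<Delta> \<epsilon>0" using a[of 1] card B_cases by fastforce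
  have par: "a i \<in> \<Delta> (alt \<epsilon>0 i)" if "1 \<le> i" "i < m" for i
    using that
  proof (induction i rule: nat_induct_at_least)
    case base
    then show ?case using e0 by (simp add: alt_def)
  next
    case (Suc i)
    then show ?case using local.alt[of i] by simp
  qed
  have parF: "b g \<in> \<Delta> (alt \<epsilon>0 m)" if "g \<in> F" for g
  proof -
    have "Suc (m - 1) = m" "1 \<le> m - 1" "m - 1 < m" using card by auto
    then show ?thesis using altF[OF par[of "m - 1"] that] alt_Suc[of \<epsilon>0 "m - 1"] by simp
  qed
  have clash: False if "\<alpha> \<in> \<Delta> (alt \<epsilon>0 i)" "\<alpha> \<in> \<Delta> (alt \<epsilon>0 (Suc i))" for \<alpha> i
    using that Delta_disj[of \<alpha> "alt \<epsilon>0 i"] by simp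
  have up: "i > 1 \<and> \<alpha> = a (i - 1)" if i: "1 \<le> i" "i \<le> m" and al: "\<alpha> \<in> B" "e i \<bullet> \<alpha> < 0" for i \<alpha>
  proof -
    obtain t where t: "reflection \<alpha> (e i) - e i = t *\<^sub>R \<alpha>" "reflection \<alpha> (e i) - e i \<in> cone" "reflection \<alpha> (e i) \<noteq> e i"
      using reflection_above[OF al] by blast
    have "reflection \<alpha> (e i) \<in> orb" using B_orb_inv al eo i by simp
    then obtain j where j: "1 \<le> j" "j < i" "reflection \<alpha> (e i) = e j" using above t i by blast
    then obtain i' where i': "i = Suc i'" "j \<le> i'" by (cases i) auto
    have ai: "e i' - e i = k i' *\<^sub>R a i'" using a[of i'] i' i j by simp
    have "e j - e i = (e i' - e i) + (e j - e i')" by simp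
    then have "t *\<^sub>R \<alpha> = k i' *\<^sub>R a i' + (e j - e i')" using t(1) unfolding j(3) ai by simp
    then have "a i' = \<alpha>" using a[of i'] i' i j le[of j i'] by (intro cone_sum_same[OF al(1)]) auto
    then show ?thesis using i' j by auto
  qed
  have down: "\<alpha> = a i" if i: "1 \<le> i" "i < m" and al: "\<alpha> \<in> B" "e i \<bullet> \<alpha> > 0" for i \<alpha>
  proof -
    obtain t where t: "e i - reflection \<alpha> (e i) = t *\<^sub>R \<alpha>" "e i - reflection \<alpha> (e i) \<in> cone" "reflection \<alpha> (e i) \<noteq> e i"
      using reflection_below[OF al] by blast
    have "reflection \<alpha> (e i) \<in> orb" using B_orb_inv al eo i by simp
    then consider j where "i < j" "j \<le> m" "reflection \<alpha> (e i) = e j" | "low (reflection \<alpha> (e i))"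
      using below[OF _ i(1) less_imp_le[OF i(2)] t(2,3)] by blast
    then have "e (Suc i) - reflection \<alpha> (e i) \<in> cone" by cases (use le[of "Suc i"] low_e i in auto)
    moreover have "t *\<^sub>R \<alpha> = k i *\<^sub>R a i + (e (Suc i) - reflection \<alpha> (e i))"
    proof -
      have "e i - reflection \<alpha> (e i) = (e i - e (Suc i)) + (e (Suc i) - reflection \<alpha> (e i))" by simp
      then show ?thesis using a[OF i] unfolding t(1) by simp
    qed
    ultimately have "a i = \<alpha>" using a[OF i] by (intro cone_sum_same[OF al(1)]) auto
    then show ?thesis by simp
  qed
  have downm: "\<exists>g\<in>F. \<alpha> = b g" if al: "\<alpha> \<in> B" "e m \<bullet> \<alpha> > 0" for \<alpha>
  proof -
    obtain t where t: "e m - reflection \<alpha> (e m) = t *\<^sub>R \<alpha>" "e m - reflection \<alpha> (e m) \<in> cone" "reflection \<alpha> (e m) \<noteq> e m"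
      using reflection_below[OF al] by blast
    have "reflection \<alpha> (e m) \<in> orb" using B_orb_inv al eo m1 by simp
    then have "low (reflection \<alpha> (e m))" using below[OF _ m1 t(2,3)] by fastforce
    then obtain g where g: "g \<in> F" "g - reflection \<alpha> (e m) \<in> cone" using low_F Fne unfolding low_def
      by (metis cone_0 diff_self)
    have "e m - reflection \<alpha> (e m) = (e m - g) + (g - reflection \<alpha> (e m))" by simp
    then have "t *\<^sub>R \<alpha> = l g *\<^sub>R b g + (g - reflection \<alpha> (e m))" using b[OF g(1)] unfolding t(1) by simp
    then have "b g = \<alpha>" using b[OF g(1)] g by (intro cone_sum_same[OF al(1)]) auto
    then show ?thesis using g by auto
  qed
  \<comment> \<open>A simple reflection that moves \<open>g\<close> raises \<open>g\<close> or
    raises \<open>- g\<close>; the image is then a point of the upper chain, so the step up to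
    \<open>e m\<close> is part of the displacement and determines \<alpha>.\<close>
  have actF: "\<alpha> = b g \<or> \<alpha> = b (- g)" if al: "\<alpha> \<in> B" "g \<bullet> \<alpha> \<noteq> 0" and g: "g \<in> F" for g \<alpha>
  proof -
    have upF: "\<alpha> = b g" if al2: "g \<bullet> \<alpha> < 0" and g: "g \<in> F" for g
    proof -
      obtain t where t: "reflection \<alpha> g - g = t *\<^sub>R \<alpha>" "reflection \<alpha> g - g \<in> cone" "reflection \<alpha> g \<noteq> g"
        using reflection_above[OF al(1) al2] by blast
      have "reflection \<alpha> g \<in> orb" using B_orb_inv al(1) F(1)[OF g] g by blast
      then obtain j where j: "1 \<le> j" "j \<le> m" "reflection \<alpha> g = e j" using aboveF t g by blast
      have "e j - g = (e m - g) + (e j - e m)" by simp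
      then have "t *\<^sub>R \<alpha> = l g *\<^sub>R b g + (e j - e m)" using b[OF g] t(1) unfolding j(3) by simp
      then have "b g = \<alpha>" using b[OF g] le[of j m] j by (intro cone_sum_same[OF al(1)]) auto
      then show ?thesis by simp
    qed
    show ?thesis
    proof (cases "g \<bullet> \<alpha> < 0")
      case True
      then show ?thesis using upF g by blast
    next
      case False
      then have "(- g) \<bullet> \<alpha> < 0" using al by simp
      then show ?thesis using upF F(2)[OF g] by blast
    qed
  qed
  have cx_up: "cx (alt \<epsilon>0 i) (e i) = e (Suc i)" if i: "1 \<le> i" "i < m" for i
  proof -
    have "cx (alt \<epsilon>0 i) (e i) = reflection (a i) (e i)"
    proof (rule cx_single)
      show "a i \<in> \<Delta> (alt \<epsilon>0 i)" using par i by blast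
      fix \<alpha> assume al: "\<alpha> \<in> \<Delta> (alt \<epsilon>0 i)" "\<alpha> \<noteq> a i"
      have aB: "\<alpha> \<in> B" using al Delta_subset by blast
      show "e i \<bullet> \<alpha> = 0"
      proof (rule ccontr)
        assume n: "e i \<bullet> \<alpha> \<noteq> 0"
        have "\<not> e i \<bullet> \<alpha> > 0" using down[OF i aB] al by blast
        then have 1: "i > 1" "\<alpha> = a (i - 1)" using up[of i \<alpha>] aB i n by auto
        then obtain j where j: "i = Suc j" "1 \<le> j" by (cases i) auto
        then have "\<alpha> \<in> \<Delta> (alt \<epsilon>0 j)" using par[of j] 1 i by simp
        then show False using al(1) clash[of \<alpha> j] j by simp
      qed
    qed
    also have "\<dots> = e (Suc i)" using swap[OF eo eo, of i "Suc i" "k i" "a i"] a[of i] i by auto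
    finally show ?thesis .
  qed
  have bne: "b g \<noteq> b (- g)" if g: "g \<in> F" for g
  proof
    assume eq: "b g = b (- g)"
    have "e m - g = l g *\<^sub>R b g" "e m - - g = l (- g) *\<^sub>R b g" using b[OF g] b[OF F(2)[OF g]] eq by auto
    then have "reflection (b g) (e m) = g" "reflection (b g) (e m) = - g"
      using swap[of "e m" g "l g" "b g"] swap[of "e m" "- g" "l (- g)" "b g"] b[OF g] b[OF F(2)[OF g]] eo[OF m1] F(1,2)[OF g] g by auto
    then show False using F(4)[OF g] by metis
  qed
  have rb: "reflection (b g) (e m) = g" "reflection (b g) g = e m" if g: "g \<in> F" for g
    using swap[of "e m" g "l g" "b g"] b[OF g] eo[OF m1] F(1)[OF g] g by auto
  \<comment> \<open>Two simple roots of this class move \<open>e m\<close>, one to \<open>f\<close>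
    and one to \<open>- f\<close>; subtracting both displacements gives
    \<open>e m - (e m - f) - (e m + f) = - e m\<close>.\<close>
  have cx_m: "cx (alt \<epsilon>0 m) (e m) = - e m"
  proof -
    have "cx (alt \<epsilon>0 m) (e m) = e m - (e m - reflection (b f) (e m)) - (e m - reflection (b (- f)) (e m))"
    proof (rule cx_double)
      show "b f \<in> \<Delta> (alt \<epsilon>0 m)" "b (- f) \<in> \<Delta> (alt \<epsilon>0 m)" "b f \<noteq> b (- f)"
        using parF bne Fne F(2)[OF Fne] by auto
      fix \<alpha> assume al: "\<alpha> \<in> \<Delta> (alt \<epsilon>0 m)" "\<alpha> \<noteq> b f" "\<alpha> \<noteq> b (- f)"
      have aB: "\<alpha> \<in> B" using al Delta_subset by blast
      show "e m \<bullet> \<alpha> = 0"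
      proof (rule ccontr)
        assume n: "e m \<bullet> \<alpha> \<noteq> 0"
        have "\<not> e m \<bullet> \<alpha> > 0" using downm[OF aB] al by (auto simp: F_def)
        then have 1: "m > 1" "\<alpha> = a (m - 1)" using up[of m \<alpha>] aB m1 n by auto
        then have "\<alpha> \<in> \<Delta> (alt \<epsilon>0 (m - 1))" using par[of "m - 1"] by simp
        then show False using al(1) clash[of \<alpha> "m - 1"] 1 by simp
      qed
    qed
    then show ?thesis using rb[OF Fne] rb[OF F(2)[OF Fne]] by simp
  qed
  have cx_F1: "cx (alt \<epsilon>0 m) g = - g" if g: "g \<in> F" for g
  proof -
    have "cx (alt \<epsilon>0 m) g = g - (g - reflection (b g) g) - (g - reflection (b (- g)) g)"
    proof (rule cx_double)
      show "b g \<in> \<Delta> (alt \<epsilon>0 m)" "b (- g) \<in> \<Delta> (alt \<epsilon>0 m)" "b g \<noteq> b (- g)"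
        using parF bne g F(2)[OF g] by auto
      fix \<alpha> assume al: "\<alpha> \<in> \<Delta> (alt \<epsilon>0 m)" "\<alpha> \<noteq> b g" "\<alpha> \<noteq> b (- g)"
      then show "g \<bullet> \<alpha> = 0" using actF[of \<alpha> g] g Delta_subset by blast
    qed
    moreover have "reflection (b (- g)) (- g) = - reflection (b (- g)) g" by (rule linear_neg[OF linear_reflection])
    then have "reflection (b (- g)) g = - e m" using rb(2)[OF F(2)[OF g]] by simp
    ultimately show ?thesis using rb(2)[OF g] by simp
  qed
  have cx_F2: "cx (opp (alt \<epsilon>0 m)) g = g" if g: "g \<in> F" for g
  proof (rule cx_fix, rule ccontr)
    fix \<alpha> assume al: "\<alpha> \<in> \<Delta> (opp (alt \<epsilon>0 m))" "g \<bullet> \<alpha> \<noteq> 0"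
    then have "\<alpha> = b g \<or> \<alpha> = b (- g)" using actF[of \<alpha> g] g Delta_subset by blast
    then have "\<alpha> \<in> \<Delta> (alt \<epsilon>0 m)" using parF g F(2)[OF g] by auto
    then show False using al Delta_disj by blast
  qed
  have e_up: "e (Suc i) = - e (h - i)" "e i = - e (Suc (h - i))" if "m < i" "i < h" for i
    using e_neg[of "h - i"] e_neg[of "Suc (h - i)"] that by (auto simp: Suc_diff_le)
  \<comment> \<open>Since \<open>h\<close> is even, the classes of the steps are symmetric about the
    middle, which lets negation transfer the upper half of the chain to the lower half.\<close>
  have alt_refl: "alt \<epsilon>0 (h - i) = alt \<epsilon>0 i" if "i \<le> h" for i
    using that by (auto simp: alt_def h_def)
  have e_mid: "e (Suc m) = - e m" using e_neg[of m] card by (auto simp: h_def)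
  have cx_all: "cx (alt \<epsilon>0 i) (e i) = e (Suc i)" if i: "1 \<le> i" "i < h" for i
  proof -
    consider "i < m" | "i = m" | "i > m" by linarith
    then show ?thesis
    proof cases
      case 3
      have hi: "1 \<le> h - i" "h - i < m" using 3 i by (auto simp: h_def)
      have "cx (alt \<epsilon>0 (h - i)) (e (Suc (h - i))) = e (h - i)" using cx_up[OF hi] cx_cx by metis
      then show ?thesis using e_up[OF 3 i(2)] alt_refl[of i] i by (simp add: cx_minus)
    qed (use cx_up cx_m e_mid i in auto)
  qed
  have cx_1: "cx (opp \<epsilon>0) (e 1) = e 1"
  proof (rule cx_fix, rule ccontr)
    fix \<alpha> assume al: "\<alpha> \<in> \<Delta> (opp \<epsilon>0)" "e 1 \<bullet> \<alpha> \<noteq> 0"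
    have aB: "\<alpha> \<in> B" using al Delta_subset by blast
    have "e 1 \<bullet> \<alpha> > 0" using up[of 1 \<alpha>] al aB m1 by fastforce
    then have "\<alpha> = a 1" using down[of 1 \<alpha>] aB card by simp
    then show False using al e0 Delta_disj by blast
  qed
  have cx_h: "cx (alt \<epsilon>0 h) (e h) = e h"
  proof -
    have "e h = - e 1" using e_neg[of 1] card by (simp add: h_def)
    moreover have "alt \<epsilon>0 h = opp \<epsilon>0" by (simp add: alt_def h_def)
    ultimately show ?thesis using cx_1 by (simp add: cx_minus)
  qed
  have single: "\<exists>\<alpha>\<in>\<Delta> (alt \<epsilon>0 i). \<exists>k>0. e i - e (Suc i) = k *\<^sub>R \<alpha>" if i: "1 \<le> i" "i < h" "i \<noteq> m" for i
  proof (cases "i < m")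
    case True
    then show ?thesis using a[of i] par[of i] i by blast
  next
    case False
    then have 3: "m < i" using i by simp
    have hi: "1 \<le> h - i" "h - i < m" using 3 i by (auto simp: h_def)
    have "e i - e (Suc i) = e (h - i) - e (Suc (h - i))" using e_up[OF 3 i(2)] by simp
    then show ?thesis using a[OF hi] par[OF hi] alt_refl[of i] i by auto
  qed
  have coef: "(k *\<^sub>R \<alpha>) \<bullet> \<omega> \<alpha> > 0" "\<alpha>' \<in> B \<Longrightarrow> (k *\<^sub>R \<alpha>) \<bullet> \<omega> \<alpha>' \<ge> 0" if "\<alpha> \<in> B" "k > 0" for k \<alpha> \<alpha>'
    using that B_nonzero[OF that(1)] by (auto simp: omega_inner)
  have mid: "e m - e (Suc m) = l f *\<^sub>R b f + l (- f) *\<^sub>R b (- f)"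
    using b[OF Fne] b[OF F(2)[OF Fne]] e_mid by (metis add_diff_eq diff_add_cancel diff_minus_eq_add add.commute diff_add_eq)
  have step_ge: "(e i - e (Suc i)) \<bullet> \<omega> \<alpha> \<ge> 0" if i: "1 \<le> i" "i < h" and "\<alpha> \<in> B" for i \<alpha>
  proof (cases "i = m")
    case True
    show ?thesis unfolding True mid inner_add_left using coef(2) b[OF Fne] b[OF F(2)[OF Fne]] that by auto
  next
    case False
    then obtain \<alpha>' k' where "\<alpha>' \<in> \<Delta> (alt \<epsilon>0 i)" "k' > 0" "e i - e (Suc i) = k' *\<^sub>R \<alpha>'" using single[OF i False] by blast
    then show ?thesis using coef(2) that Delta_subset by (metis subsetD)
  qed
  have step_pos: "\<exists>\<alpha>\<in>\<Delta> (alt \<epsilon>0 i). (e i - e (Suc i)) \<bullet> \<omega> \<alpha> > 0" if i: "1 \<le> i" "i < h" for i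
  proof (cases "i = m")
    case True
    have "(l f *\<^sub>R b f) \<bullet> \<omega> (b f) > 0" "(l (- f) *\<^sub>R b (- f)) \<bullet> \<omega> (b f) \<ge> 0"
      using coef b[OF Fne] b[OF F(2)[OF Fne]] by auto
    then have "(e m - e (Suc m)) \<bullet> \<omega> (b f) > 0" unfolding mid inner_add_left by linarith
    then show ?thesis using parF[OF Fne] True by blast
  next
    case False
    then obtain \<alpha>' k' where "\<alpha>' \<in> \<Delta> (alt \<epsilon>0 i)" "k' > 0" "e i - e (Suc i) = k' *\<^sub>R \<alpha>'" using single[OF i False] by blast
    then show ?thesis using coef(1) Delta_subset by (metis subsetD)
  qed
  have orb_eq: "orb = e ` {1..h} \<union> F"
  proof (intro equalityI subsetI)
    fix w assume w: "w \<in> orb"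
    then consider j where "1 \<le> j" "j \<le> m" "w = e j" | "w \<in> F" | "- w \<in> U" using cases unfolding low_def by blast
    then show "w \<in> e ` {1..h} \<union> F"
    proof cases
      case 3
      then obtain j where j: "1 \<le> j" "j \<le> m" "- w = e j" using cases[of "- w"] UU UF Uorb unfolding low_def by blast
      have "w = e (h + 1 - j)" using e_neg[of j] j by (auto simp: h_def) (metis minus_minus)
      then show ?thesis using j by (auto simp: h_def intro!: image_eqI[of _ _ "h + 1 - j"])
    qed (auto simp: h_def)
  next
    fix w assume "w \<in> e ` {1..h} \<union> F"
    then consider i where "1 \<le> i" "i \<le> h" "w = e i" | "w \<in> F" by auto
    then show "w \<in> orb"
    proof cases
      case 1
      then show ?thesis
      proof (cases "i \<le> m")
        case False
        then have "e (h + 1 - i) \<in> orb" using eo 1 by (auto simp: h_def)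
        then show ?thesis using e_neg[of i] neg 1 by fastforce
      qed (use eo in auto)
    qed (use F(1)[OF Fne] in auto)
  qed
  \<comment> \<open>If no two chain points served, the reflection would send every chain point that
    it moves to \<open>f\<close> or \<open>- f\<close>, so at most one of \<open>e 1\<close>, ...,
    \<open>e m\<close> would be moved. With \<open>m \<ge> 4\<close>, three of the first four would
    be orthogonal to \<beta>, against \<open>three\<close>.\<close>
  have pair: "\<exists>p\<in>{1..h}. \<exists>q\<in>{1..h}. \<exists>k. k \<noteq> 0 \<and> e p - e q = k *\<^sub>R \<beta>" if bt: "\<beta> \<in> \<Phi>" for \<beta>
  proof (rule ccontr)
    assume no: "\<not> ?thesis"
    have b0: "\<beta> \<noteq> 0" using bt zero_notin by auto
    have fixF: "reflection \<beta> (e p) \<in> F" if p: "p \<in> {1..h}" "reflection \<beta> (e p) \<noteq> e p" for p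
    proof (rule ccontr)
      assume nF: "reflection \<beta> (e p) \<notin> F"
      have "e p \<in> orb" using p orb_eq by blast
      then have "reflection \<beta> (e p) \<in> orb" using orb_inv bt by blast
      then obtain q where q: "q \<in> {1..h}" "reflection \<beta> (e p) = e q" using orb_eq nF by blast
      have "e p - e q = (2 * (e p \<bullet> \<beta>) / (\<beta> \<bullet> \<beta>)) *\<^sub>R \<beta>" unfolding q(2)[symmetric] by (rule reflection_diff)
      moreover have "2 * (e p \<bullet> \<beta>) / (\<beta> \<bullet> \<beta>) \<noteq> 0" using p by (auto simp: reflection_def)
      ultimately show False using no p q by blast
    qed
    have uniq: "p = q" if pq: "1 \<le> p" "p \<le> m" "1 \<le> q" "q \<le> m" "e p \<bullet> \<beta> \<noteq> 0" "e q \<bullet> \<beta> \<noteq> 0" for p q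
    proof -
      have "reflection \<beta> (e p) \<in> F" "reflection \<beta> (e q) \<in> F"
        using fixF[of p] fixF[of q] pq b0 by (auto simp: reflection_fixed_iff h_def)
      then have "reflection \<beta> (e p) = reflection \<beta> (e q) \<or> reflection \<beta> (e p) = - reflection \<beta> (e q)"
        by (auto simp: F_def)
      then have "reflection \<beta> (e p) = reflection \<beta> (e q) \<or> reflection \<beta> (e p) = reflection \<beta> (- e q)"
        by (simp add: linear_neg[OF linear_reflection])
      then have "e p = e q \<or> e p = - e q" using reflection_reflection by metis
      then have "e p = e q" using eU[of p] eU[of q] UU pq by auto
      then show ?thesis using lt(2)[of p q] lt(2)[of q p] pq by (metis linorder_neqE_nat)
    qed
    have tr: False if ijk: "1 \<le> i" "i < j" "j < l" "l \<le> m" "e i \<bullet> \<beta> = 0" "e j \<bullet> \<beta> = 0" "e l \<bullet> \<beta> = 0" for i j l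
    proof -
      have nn: "e p \<noteq> e q \<and> e p \<noteq> - e q" if "1 \<le> p" "p < q" "q \<le> m" for p q
        using lt(2)[of p q] eU[of p] eU[of q] UU that by auto
      have "e i \<in> orb" "e j \<in> orb" "e l \<in> orb" using eo ijk by auto
      then have "\<beta> = 0" using three[of "e i" "e j" "e l" \<beta>] nn[of i j] nn[of j l] nn[of i l] ijk by auto
      then show False using b0 by simp
    qed
    have "e 2 \<bullet> \<beta> \<noteq> 0 \<or> e 3 \<bullet> \<beta> \<noteq> 0 \<or> e 4 \<bullet> \<beta> \<noteq> 0" using tr[of 2 3 4] card by auto
    moreover have "e 1 \<bullet> \<beta> \<noteq> 0 \<or> e 3 \<bullet> \<beta> \<noteq> 0 \<or> e 4 \<bullet> \<beta> \<noteq> 0" using tr[of 1 3 4] card by auto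
    moreover have "e 1 \<bullet> \<beta> \<noteq> 0 \<or> e 2 \<bullet> \<beta> \<noteq> 0 \<or> e 4 \<bullet> \<beta> \<noteq> 0" using tr[of 1 2 4] card by auto
    moreover have "e 1 \<bullet> \<beta> \<noteq> 0 \<or> e 2 \<bullet> \<beta> \<noteq> 0 \<or> e 3 \<bullet> \<beta> \<noteq> 0" using tr[of 1 2 3] card by auto
    ultimately show False using uniq[of 1 2] uniq[of 1 3] uniq[of 1 4] uniq[of 2 3] uniq[of 2 4] uniq[of 3 4] card by auto
  qed
  have span: "B \<subseteq> span (e ` {1..h} \<union> F)"
  proof
    fix \<alpha> assume "\<alpha> \<in> B"
    then obtain p q k where pq: "p \<in> {1..h}" "q \<in> {1..h}" "k \<noteq> 0" "e p - e q = k *\<^sub>R \<alpha>" using pair[of \<alpha>] B_subset by blast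
    then have "\<alpha> = (1 / k) *\<^sub>R (e p - e q)" by simp
    moreover have "e p \<in> span (e ` {1..h} \<union> F)" "e q \<in> span (e ` {1..h} \<union> F)" using pq by (auto intro: span_base)
    ultimately show "\<alpha> \<in> span (e ` {1..h} \<union> F)" by (simp add: span_diff span_scale)
  qed
  have ne: "\<Delta> \<epsilon> \<noteq> {}" for \<epsilon>
    using par[of 1] par[of 2] card sign_cases2[of \<epsilon> \<epsilon>0] by (auto simp: alt_def)
  have card': "3 \<le> h" using card by (simp add: h_def)
  have F_cx: "cx (alt \<epsilon>0 m) g = - g \<and> cx (opp (alt \<epsilon>0 m)) g = g" if "g \<in> F" for g
    using cx_F1 cx_F2 that by blast
  have F_ev: "even h \<and> (\<exists>\<epsilon>. cx \<epsilon> g = - g \<and> cx (opp \<epsilon>) g = g)" if "g \<in> F" for g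
    using F_cx[OF that] by (auto simp: h_def)
  have F_pm: "h = 2 * m \<and> - g \<in> F \<and> (g' \<in> F \<longrightarrow> g' = g \<or> g' = - g)" if "g \<in> F" for g g'
    using that by (auto simp: h_def F_def)
  have F_st: "\<exists>\<alpha>\<in>\<Delta> (alt \<epsilon>0 m). \<exists>k>0. e m - g = k *\<^sub>R \<alpha>" if "g \<in> F" for g
    using b[OF that] parF[OF that] by blast
  have single': "\<exists>\<alpha>\<in>\<Delta> (alt \<epsilon>0 i). \<exists>k>0. e i - e (Suc i) = k *\<^sub>R \<alpha>" if "1 \<le> i" "i < h" "F = {} \<or> i \<noteq> m" for i
    using single[of i] that Fne by blast
  interpret zigzag_orbit W \<Phi> \<Delta> \<omega> c h e \<epsilon>0 F orb m
    by (unfold_locales, fact ev, fact ne, fact card', fact cx_all, fact cx_1, fact cx_h, fact step_ge,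
        fact step_pos, fact F_ev, fact span, fact orb_eq, fact orb_norm, fact orb_inv, fact pair,
        fact single', fact F_pm, fact F_cx, fact F_st, erule e_neg, erule (1) no_root)
  show ?thesis by (rule compatible_iff_diagrams[OF bg])
qed

end

section \<open>The four types\<close>

lemma orthonormal_zero:
  fixes U :: "nat \<Rightarrow> 'a::euclidean_space"
  assumes U: "\<And>i j. i < DIM('a) \<Longrightarrow> j < DIM('a) \<Longrightarrow> U i \<bullet> U j = (if i = j then 1 else 0)"
    and z: "\<And>i. i < DIM('a) \<Longrightarrow> z \<bullet> U i = 0"
  shows "z = 0"
proof -
  let ?S = "U ` {..<DIM('a)}"
  have inj: "inj_on U {..<DIM('a)}"
    by (rule inj_onI) (metis U lessThan_iff zero_neq_one)
  have "pairwise orthogonal ?S"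
    using U by (auto simp: pairwise_def orthogonal_def)
  moreover have "0 \<notin> ?S" using U by (metis imageE inner_zero_left lessThan_iff zero_neq_one)
  ultimately have ind: "independent ?S" by (intro pairwise_orthogonal_independent)
  have "UNIV \<subseteq> span ?S"
    using ind by (intro card_ge_dim_independent) (auto simp: card_image[OF inj])
  then have "orthogonal z z"
    using z by (intro orthogonal_to_span[of z ?S z]) (auto simp: orthogonal_def)
  then show ?thesis by (simp add: orthogonal_def)
qed

lemma orthonormal_map:
  fixes U U' :: "nat \<Rightarrow> 'a::euclidean_space"
  assumes U: "\<And>i j. i < DIM('a) \<Longrightarrow> j < DIM('a) \<Longrightarrow> U i \<bullet> U j = (if i = j then 1 else 0)"
    and U': "\<And>i j. i < DIM('a) \<Longrightarrow> j < DIM('a) \<Longrightarrow> U' i \<bullet> U' j = (if i = j then 1 else 0)"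
  obtains g where "orthogonal_transformation g" "\<And>i. i < DIM('a) \<Longrightarrow> g (U i) = U' i"
proof -
  let ?I = "{..<DIM('a)}"
  define g where "g z = (\<Sum>i\<in>?I. (z \<bullet> U i) *\<^sub>R U' i)" for z
  have ex: "z = (\<Sum>i\<in>?I. (z \<bullet> U i) *\<^sub>R U i)" for z
  proof -
    have "z - (\<Sum>i\<in>?I. (z \<bullet> U i) *\<^sub>R U i) = 0"
    proof (rule orthonormal_zero[OF U])
      fix j assume j: "j < DIM('a)"
      have "(\<Sum>i\<in>?I. (z \<bullet> U i) *\<^sub>R U i) \<bullet> U j = (\<Sum>i\<in>?I. if j = i then z \<bullet> U i else 0)"
        unfolding inner_sum_left using U j by (intro sum.cong) auto
      then show "(z - (\<Sum>i\<in>?I. (z \<bullet> U i) *\<^sub>R U i)) \<bullet> U j = 0" using j by (simp add: inner_diff_left)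
    qed
    then show ?thesis by simp
  qed
  have nU: "(\<Sum>i\<in>?I. a i *\<^sub>R X i) \<bullet> (\<Sum>i\<in>?I. a i *\<^sub>R X i) = (\<Sum>i\<in>?I. a i * a i)"
    if X: "\<And>i j. i < DIM('a) \<Longrightarrow> j < DIM('a) \<Longrightarrow> X i \<bullet> X j = (if i = j then 1 else 0)" for X :: "nat \<Rightarrow> 'a" and a
  proof -
    have "(\<Sum>i\<in>?I. a i *\<^sub>R X i) \<bullet> (\<Sum>i\<in>?I. a i *\<^sub>R X i) = (\<Sum>i\<in>?I. \<Sum>j\<in>?I. if i = j then a i * a j else 0)"
      unfolding inner_sum_left inner_sum_right using X by (intro sum.cong) auto
    then show ?thesis by simp
  qed
  have "linear g"
    unfolding g_def by (rule linearI) (simp_all add: inner_add_left scaleR_add_left sum.distrib scaleR_sum_right)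
  moreover have "norm (g z) = norm z" for z
  proof -
    have "g z \<bullet> g z = z \<bullet> z"
      using nU[OF U', of "\<lambda>i. z \<bullet> U i"] nU[OF U, of "\<lambda>i. z \<bullet> U i"] ex[of z] by (simp add: g_def)
    then show ?thesis by (simp add: norm_eq_sqrt_inner)
  qed
  ultimately have "orthogonal_transformation g" by (simp add: orthogonal_transformation)
  moreover have "g (U j) = U' j" if j: "j < DIM('a)" for j
  proof -
    have "g (U j) = (\<Sum>i\<in>?I. if j = i then U' i else 0)"
      unfolding g_def using U j by (intro sum.cong) auto
    then show ?thesis using j by simp
  qed
  ultimately show ?thesis using that by blast
qed

lemma symmetry_group_compose: "f \<in> symmetry_group Q \<Longrightarrow> g \<in> symmetry_group Q \<Longrightarrow> f \<circ> g \<in> symmetry_group Q"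
  unfolding symmetry_group_def using image_comp[of f g Q] by (simp add: orthogonal_transformation_compose)

lemma reflection_orthogonal: "orthogonal_transformation (reflection \<alpha>)"
  by (simp add: orthogonal_transformation linear_reflection)

lemma reflection_symmetry:
  assumes "finite Q" "\<And>x. x \<in> Q \<Longrightarrow> reflection \<alpha> x \<in> Q"
  shows "reflection \<alpha> \<in> symmetry_group Q"
proof -
  have "reflection \<alpha> ` Q = Q"
  proof (rule card_subset_eq[OF assms(1)])
    show "reflection \<alpha> ` Q \<subseteq> Q" using assms(2) by auto
    show "card (reflection \<alpha> ` Q) = card Q"
      by (rule card_image) (metis inj_onI reflection_reflection)
  qed
  then show ?thesis by (simp add: symmetry_group_def reflection_orthogonal)
qed

text \<open>Similar figures have equally many symmetries, so an inclusion of their symmetry groups is an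
  equality.\<close>

lemma symmetry_group_eq:
  fixes Q :: "'a::euclidean_space set"
  assumes g: "orthogonal_transformation g" and s: "s \<noteq> 0" and orb: "orb = (\<lambda>z. s *\<^sub>R g z) ` Q"
    and fin: "finite orb" and spn: "\<And>z. (\<And>x. x \<in> orb \<Longrightarrow> z \<bullet> x = 0) \<Longrightarrow> z = 0"
    and sub: "symmetry_group Q \<subseteq> symmetry_group orb"
  shows "symmetry_group Q = symmetry_group orb"
proof -
  have det: "f = f'" if f: "f \<in> symmetry_group orb" "f' \<in> symmetry_group orb" "\<And>x. x \<in> orb \<Longrightarrow> f x = f' x" for f f'
  proof
    fix z
    have o: "orthogonal_transformation f" "orthogonal_transformation f'" "f ` orb = orb"
      using f by (auto simp: symmetry_group_def)
    have "f z - f' z = 0"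
    proof (rule spn)
      fix y assume "y \<in> orb"
      then obtain x where x: "x \<in> orb" "y = f x" using o by auto
      then have "f z \<bullet> f x = f' z \<bullet> f' x" using o by (simp add: orthogonal_transformation_def)
      then show "(f z - f' z) \<bullet> y = 0" using x f(3) by (simp add: inner_diff_left)
    qed
    then show "f z = f' z" by simp
  qed
  have "inj_on (\<lambda>f. restrict f orb) (symmetry_group orb)"
    by (rule inj_onI, rule det) (auto simp: restrict_def fun_eq_iff, metis)
  moreover have "(\<lambda>f. restrict f orb) ` symmetry_group orb \<subseteq> orb \<rightarrow>\<^sub>E orb"
    by (auto simp: symmetry_group_def)
  moreover have "finite (orb \<rightarrow>\<^sub>E orb)" using fin by (intro finite_PiE) auto
  ultimately have fs: "finite (symmetry_group orb)" using finite_imageD finite_subset by blast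
  have bij: "bij g" using g by (rule orthogonal_transformation_bij)
  have gi: "orthogonal_transformation (inv g)" using g by (rule orthogonal_transformation_inv)
  define \<phi> where "\<phi> f = inv g \<circ> (f \<circ> g)" for f :: "'a \<Rightarrow> 'a"
  have "\<phi> ` symmetry_group orb \<subseteq> symmetry_group Q"
  proof
    fix f' assume "f' \<in> \<phi> ` symmetry_group orb"
    then obtain f where f: "f' = \<phi> f" "orthogonal_transformation f" "f ` orb = orb" by (auto simp: symmetry_group_def)
    have lin: "linear f" using f by (simp add: orthogonal_transformation_linear)
    have gQ: "g ` Q = (\<lambda>z. (1 / s) *\<^sub>R z) ` orb" unfolding orb image_image using s by simp
    have "f ` g ` Q = (\<lambda>z. (1 / s) *\<^sub>R z) ` f ` orb"
      unfolding gQ image_image by (simp add: linear_scale[OF lin])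
    then have "f ` g ` Q = g ` Q" unfolding f(3) gQ .
    moreover have "f' ` Q = inv g ` f ` g ` Q" by (simp add: f(1) \<phi>_def image_image)
    ultimately have "f' ` Q = inv g ` g ` Q" by simp
    also have "\<dots> = Q" using bij by (simp add: bij_is_inj image_inv_f_f)
    finally show "f' \<in> symmetry_group Q"
      using f(1,2) g gi by (simp add: symmetry_group_def \<phi>_def orthogonal_transformation_compose)
  qed
  moreover have "inj_on \<phi> (symmetry_group orb)"
  proof (rule inj_onI)
    fix f f' assume "\<phi> f = \<phi> f'"
    then have "g \<circ> \<phi> f \<circ> inv g = g \<circ> \<phi> f' \<circ> inv g" by simp
    then show "f = f'" using bij by (simp add: \<phi>_def fun_eq_iff bij_is_surj surj_f_inv_f)
  qed
  ultimately have "card (symmetry_group orb) \<le> card (symmetry_group Q)"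
    using finite_subset[OF sub fs] by (metis card_inj_on_le)
  then show ?thesis using card_seteq[OF fs sub] by simp
qed

lemma orbit_symmetric:
  assumes "orbit_of (symmetry_group Q) orb" "f \<in> symmetry_group Q" "finite orb"
  shows "f \<in> symmetry_group orb"
proof -
  obtain x where x: "orb = (\<lambda>w. w x) ` symmetry_group Q" using assms(1) by (auto simp: orbit_of_def)
  have "f ` orb \<subseteq> orb"
  proof
    fix y assume "y \<in> f ` orb"
    then obtain w where "w \<in> symmetry_group Q" "y = (f \<circ> w) x" using x by auto
    then show "y \<in> orb" using symmetry_group_compose[OF assms(2)] x by blast
  qed
  moreover have ot: "orthogonal_transformation f" using assms(2) by (simp add: symmetry_group_def)
  then have "card (f ` orb) = card orb"
    by (intro card_image inj_on_subset[OF orthogonal_transformation_inj]) auto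
  ultimately have "f ` orb = orb" using assms(3) by (intro card_subset_eq)
  then show ?thesis using ot by (simp add: symmetry_group_def)
qed

text \<open>\<open>spn\<close> speaks only of vectors whose reflection belongs to the group, because
  in type A the orbit does not span the ambient space.\<close>

lemma orbit_setup_spanning:
  assumes "root_system W \<Phi>" "simple_system \<Phi> (simple_roots \<Delta>)" "bipartition \<Delta>"
    and "positive_min_eigenvector (simple_roots \<Delta>) c" "dual_to_unit_roots (simple_roots \<Delta>) \<omega>"
    and "finite orb" "\<And>x y. x \<in> orb \<Longrightarrow> y \<in> orb \<Longrightarrow> norm x = norm y"
    and "\<And>f x. f \<in> W \<Longrightarrow> x \<in> orb \<Longrightarrow> f x \<in> orb"
    and spn: "\<And>z. reflection z \<in> W \<Longrightarrow> (\<And>x. x \<in> orb \<Longrightarrow> x \<bullet> z = 0) \<Longrightarrow> z = 0"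
  shows "orbit_setup W \<Phi> \<Delta> \<omega> c orb"
proof -
  interpret root_setup W \<Phi> \<Delta> \<omega> by unfold_locales (use assms in auto)
  show ?thesis
  proof unfold_locales
    fix \<alpha> assume a: "\<alpha> \<in> \<Phi>"
    then have r: "reflection \<alpha> \<in> W" by (rule reflection_in_W)
    have "\<alpha> \<noteq> 0" using a zero_notin by auto
    then obtain x where "x \<in> orb" "x \<bullet> \<alpha> \<noteq> 0" using spn[OF r] by blast
    then show "\<exists>x\<in>orb. reflection \<alpha> x \<noteq> x" using \<open>\<alpha> \<noteq> 0\<close> by (auto simp: reflection_fixed_iff)
  next
    fix \<alpha> x assume "\<alpha> \<in> \<Phi>" "x \<in> orb"
    then show "reflection \<alpha> x \<in> orb" using assms(8)[OF reflection_in_W] by blast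
  qed (fact assms)+
qed

section \<open>The orbits of types A, B and I2\<close>

lemma type_A_facts:
  fixes W :: "('a::euclidean_space \<Rightarrow> 'a) set"
  assumes "type_A n W orb"
  shows "finite orb" "card orb \<ge> 3" "\<And>x y. x \<in> orb \<Longrightarrow> y \<in> orb \<Longrightarrow> norm x = norm y"
    and "\<And>f x. f \<in> W \<Longrightarrow> x \<in> orb \<Longrightarrow> f x \<in> orb"
    and "\<And>z. reflection z \<in> W \<Longrightarrow> (\<And>x. x \<in> orb \<Longrightarrow> x \<bullet> z = 0) \<Longrightarrow> z = 0"
    and "\<And>x y. x \<in> orb \<Longrightarrow> y \<in> orb \<Longrightarrow> x \<noteq> y \<Longrightarrow> reflection (x - y) \<in> W"
proof -
  define k where "k = 1 / real (n + 1)"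
  define s :: 'a where "s = \<Sum>Basis"
  have n: "n \<ge> 2" "DIM('a) = n + 1"
    and W: "W = {f. linear f \<and> (\<exists>\<pi>. \<pi> permutes Basis \<and> (\<forall>b\<in>Basis. f b = \<pi> b))}"
    and orb: "orb = (\<lambda>b. b - k *\<^sub>R s) ` Basis"
    using assms by (auto simp: type_A_def k_def s_def)
  show "finite orb" by (simp add: orb)
  have "card orb = DIM('a)" unfolding orb by (rule card_image) (simp add: inj_on_def)
  then show "card orb \<ge> 3" using n by simp
  have sb: "b \<bullet> s = 1" "s \<bullet> b = 1" if "b \<in> Basis" for b
    using that by (simp_all add: s_def inner_sum_right inner_sum_left inner_Basis)
  have nrm: "norm (b - k *\<^sub>R s) = sqrt (1 - 2 * k + k * k * (s \<bullet> s))" if "b \<in> Basis" for b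
    using that by (simp add: norm_eq_sqrt_inner inner_diff_left inner_diff_right sb algebra_simps)
  show "norm x = norm y" if "x \<in> orb" "y \<in> orb" for x y
    using that nrm by (auto simp: orb)
  show "f x \<in> orb" if fx: "f \<in> W" "x \<in> orb" for f x
  proof -
    obtain \<pi> where p: "linear f" "\<pi> permutes Basis" "\<And>b. b \<in> Basis \<Longrightarrow> f b = \<pi> b" using fx W by auto
    have "f s = (\<Sum>b\<in>Basis. \<pi> b)" unfolding s_def by (simp add: linear_sum[OF p(1)] p(3))
    also have "\<dots> = s" unfolding s_def using sum.permute[OF p(2), of "\<lambda>b. b"] by (simp add: o_def)
    finally have fs: "f s = s" .
    obtain b where b: "b \<in> Basis" "x = b - k *\<^sub>R s" using fx orb by auto
    then have "f x = \<pi> b - k *\<^sub>R s" using p fs by (simp add: linear_diff[OF p(1)] linear_scale[OF p(1)])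
    then show ?thesis using b permutes_in_image[OF p(2)] by (simp add: orb)
  qed
  show "z = 0" if r: "reflection z \<in> W" and z: "\<And>x. x \<in> orb \<Longrightarrow> x \<bullet> z = 0" for z
  proof (rule ccontr)
    assume nz: "z \<noteq> 0"
    define t where "t = k * (s \<bullet> z)"
    have "z \<bullet> b = t" if "b \<in> Basis" for b
      using z[of "b - k *\<^sub>R s"] that by (simp add: orb inner_diff_left t_def inner_commute[of z b])
    then have "z = (\<Sum>b\<in>Basis. t *\<^sub>R b)" by (subst euclidean_representation[of z, symmetric]) (rule sum.cong, auto)
    then have zt: "z = t *\<^sub>R s" by (simp add: s_def scaleR_sum_right)
    then have "t \<noteq> 0" using nz by auto
    then have r': "reflection s \<in> W" using r zt by (simp add: reflection_scaleR)
    then obtain \<pi> where p: "\<pi> permutes Basis" "\<And>b. b \<in> Basis \<Longrightarrow> reflection s b = \<pi> b" using W by auto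
    have "1 < card (Basis :: 'a set)" using n by simp
    then obtain b b' :: 'a where b: "b \<in> Basis" "b' \<in> Basis" "b \<noteq> b'"
      by (metis card_1_singleton_iff card_le_Suc0_iff_eq finite_Basis leD One_nat_def)
    have ss: "s \<bullet> s > 0" using sb[OF b(1)] by (metis inner_gt_zero_iff inner_zero_right zero_neq_one)
    \<comment> \<open>A vector orthogonal to the orbit is a multiple of the all-ones vector
      \<open>s\<close>. Its reflection does not permute the basis: this coordinate of the image of
      \<open>b\<close> is negative, and a basis vector has no negative coordinate.\<close>
    have "\<pi> b \<bullet> b' = b \<bullet> b' - (2 * (b \<bullet> s) / (s \<bullet> s)) * (s \<bullet> b')"
      using p(2)[OF b(1)] by (metis inner_diff_left inner_scaleR_left reflection_def)
    also have "\<dots> < 0" using b ss by (simp add: sb inner_Basis)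
    finally have "\<pi> b \<bullet> b' < 0" .
    moreover have "\<pi> b \<bullet> b' \<ge> 0" using b permutes_in_image[OF p(1)] by (simp add: inner_Basis)
    ultimately show False by simp
  qed
  show "reflection (x - y) \<in> W" if xy: "x \<in> orb" "y \<in> orb" "x \<noteq> y" for x y
  proof -
    obtain b b' where b: "b \<in> Basis" "b' \<in> Basis" "x - y = b - b'" "b \<noteq> b'" using xy by (auto simp: orb)
    have "reflection (b - b') b'' = Transposition.transpose b b' b''" if "b'' \<in> Basis" for b''
      using b that by (auto simp: reflection_def transpose_def inner_diff_left inner_diff_right inner_Basis)
    then show ?thesis unfolding W b(3) using permutes_swap_id[OF b(1,2)] linear_reflection by auto
  qed
qed

lemma type_B_facts:
  fixes W :: "('a::euclidean_space \<Rightarrow> 'a) set"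
  assumes "type_B n W orb"
  shows "finite orb" "card orb \<ge> 3" "\<And>x y. x \<in> orb \<Longrightarrow> y \<in> orb \<Longrightarrow> norm x = norm y"
    and "\<And>f x. f \<in> W \<Longrightarrow> x \<in> orb \<Longrightarrow> f x \<in> orb"
    and "\<And>z. (\<And>x. x \<in> orb \<Longrightarrow> x \<bullet> z = 0) \<Longrightarrow> z = 0"
    and "\<And>x y. x \<in> orb \<Longrightarrow> y \<in> orb \<Longrightarrow> x \<noteq> y \<Longrightarrow> reflection (x - y) \<in> W"
proof -
  have n: "n \<ge> 2" "DIM('a) = n"
    and W: "W = {f. linear f \<and> (\<exists>\<pi> \<sigma>. \<pi> permutes Basis \<and>
            (\<forall>b\<in>Basis. \<sigma> b \<in> {1, -1::real} \<and> f b = \<sigma> b *\<^sub>R \<pi> b))}"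
    and orb: "orb = Basis \<union> uminus ` Basis"
    using assms by (auto simp: type_B_def)
  show fin: "finite orb" by (simp add: orb)
  have "1 < card (Basis :: 'a set)" using n by simp
  then obtain b1 b2 :: 'a where b12: "b1 \<in> Basis" "b2 \<in> Basis" "b1 \<noteq> b2"
    by (metis card_1_singleton_iff card_le_Suc0_iff_eq finite_Basis leD One_nat_def)
  have nneg: "b \<noteq> - b'" if "b \<in> Basis" "b' \<in> Basis" for b b' :: 'a
  proof
    assume "b = - b'"
    then have "b \<bullet> b = - (b' \<bullet> b)" by (metis inner_minus_left)
    then show False using that by (auto simp: inner_Basis split: if_splits)
  qed
  have "card {b1, b2, - b1} = 3" using b12 nneg[of b1 b1] nneg[of b2 b1] by auto
  moreover have "{b1, b2, - b1} \<subseteq> orb" using b12 by (auto simp: orb)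
  ultimately show "card orb \<ge> 3" using card_mono[OF fin] by metis
  show "norm x = norm y" if "x \<in> orb" "y \<in> orb" for x y using that by (auto simp: orb)
  show "f x \<in> orb" if fx: "f \<in> W" "x \<in> orb" for f x
  proof -
    obtain \<pi> \<sigma> where p: "linear f" "\<pi> permutes Basis" "\<And>b. b \<in> Basis \<Longrightarrow> \<sigma> b \<in> {1, -1::real} \<and> f b = \<sigma> b *\<^sub>R \<pi> b"
      using fx W by auto
    have "f b \<in> orb \<and> - f b \<in> orb" if "b \<in> Basis" for b
      using p(3)[OF that] permutes_in_image[OF p(2), of b] that by (auto simp: orb)
    moreover obtain b where "b \<in> Basis" "x = b \<or> x = - b" using fx(2) by (auto simp: orb)
    ultimately show ?thesis using linear_neg[OF p(1), of b] by auto
  qed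
  show "z = 0" if z: "\<And>x. x \<in> orb \<Longrightarrow> x \<bullet> z = 0" for z
    using z by (auto simp: orb inner_commute intro!: euclidean_eqI[of z 0])
  show "reflection (x - y) \<in> W" if xy: "x \<in> orb" "y \<in> orb" "x \<noteq> y" for x y
  proof -
    have "x \<in> Basis \<and> x = 1 *\<^sub>R x \<or> - x \<in> Basis \<and> x = (-1) *\<^sub>R (- x)" using xy(1) by (auto simp: orb)
    then obtain b s where b: "b \<in> Basis" "s \<in> {1, -1::real}" "x = s *\<^sub>R b" by blast
    have "y \<in> Basis \<and> y = 1 *\<^sub>R y \<or> - y \<in> Basis \<and> y = (-1) *\<^sub>R (- y)" using xy(2) by (auto simp: orb)
    then obtain b' t where b': "b' \<in> Basis" "t \<in> {1, -1::real}" "y = t *\<^sub>R b'" by blast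
    have "\<exists>\<pi> \<sigma>. \<pi> permutes Basis \<and>
        (\<forall>b\<in>Basis. \<sigma> b \<in> {1, -1::real} \<and> reflection (x - y) b = \<sigma> b *\<^sub>R \<pi> b)"
    proof (cases "b = b'")
      case True
      then have "s - t \<noteq> 0" using xy b b' by auto
      moreover have "x - y = (s - t) *\<^sub>R b" using True b b' by (simp add: scaleR_left_diff_distrib)
      ultimately have "reflection (x - y) = reflection b" by (simp add: reflection_scaleR)
      moreover have "reflection b b'' = (if b'' = b then -1 else 1) *\<^sub>R b''" if "b'' \<in> Basis" for b''
      proof (cases "b'' = b")
        case False
        then show ?thesis using b that by (simp add: reflection_def inner_Basis)
      qed simp
      ultimately show ?thesis
        by (intro exI[of _ id] exI[of _ "\<lambda>b''. if b'' = b then -1 else 1"]) (auto simp: permutes_id)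
    next
      case False
      \<comment> \<open>The reflection exchanges \<open>s *\<^sub>R b\<close> and
        \<open>t *\<^sub>R b'\<close>, so it exchanges \<open>b\<close> and \<open>b'\<close> with
        the sign \<open>s * t\<close>.\<close>
      have "reflection (x - y) b'' = (if b'' \<in> {b, b'} then s * t else 1) *\<^sub>R Transposition.transpose b b' b''"
        if "b'' \<in> Basis" for b''
        using b b' False that
        by (auto simp: reflection_def transpose_def inner_diff_left inner_diff_right inner_Basis)
      then show ?thesis using b b' permutes_swap_id[OF b(1) b'(1)]
        by (intro exI[of _ "Transposition.transpose b b'"] exI[of _ "\<lambda>b''. if b'' \<in> {b, b'} then s * t else 1"]) auto
    qed
    then show ?thesis unfolding W using linear_reflection by blast
  qed
qed

text \<open>The group is given by some polygon \<open>Q\<close>, and \<open>orb\<close> need not be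
  a multiple of \<open>Q\<close>; it may be rotated against it. Both have equally many symmetries,
  so by \<open>symmetry_group_eq\<close> the group is the full symmetry group of \<open>orb\<close>,
  where its reflections can be computed.\<close>

lemma type_I2_facts:
  fixes W :: "('a::euclidean_space \<Rightarrow> 'a) set"
  assumes "type_I2 m W orb"
  shows "finite orb" "card orb \<ge> 3" "\<And>x y. x \<in> orb \<Longrightarrow> y \<in> orb \<Longrightarrow> norm x = norm y"
    and "\<And>f x. f \<in> W \<Longrightarrow> x \<in> orb \<Longrightarrow> f x \<in> orb"
    and "\<And>z. (\<And>x. x \<in> orb \<Longrightarrow> x \<bullet> z = 0) \<Longrightarrow> z = 0"
    and "\<And>x y. x \<in> orb \<Longrightarrow> y \<in> orb \<Longrightarrow> x \<noteq> y \<Longrightarrow> reflection (x - y) \<in> W"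
proof -
  have m: "m \<ge> 3" and dim: "DIM('a) = 2" using assms by (auto simp: type_I2_def)
  obtain Q where Q: "regular_polygon m Q" and W: "W = symmetry_group Q"
    and oW: "orbit_of W orb" and poly: "regular_polygon m orb"
    using assms by (auto simp: type_I2_def)
  obtain r u v where r: "r > 0" "norm u = 1" "norm v = 1" "u \<bullet> v = 0" and
    orb: "orb = (\<lambda>k. r *\<^sub>R (cos (2 * pi * real k / real m) *\<^sub>R u + sin (2 * pi * real k / real m) *\<^sub>R v)) ` {..<m}"
    using poly unfolding regular_polygon_def by blast
  obtain r' u' v' where r': "r' > 0" "norm u' = 1" "norm v' = 1" "u' \<bullet> v' = 0" and
    Q': "Q = (\<lambda>k. r' *\<^sub>R (cos (2 * pi * real k / real m) *\<^sub>R u' + sin (2 * pi * real k / real m) *\<^sub>R v')) ` {..<m}"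
    using Q unfolding regular_polygon_def by blast
  define U where "U i = (if i = 0 then u else v)" for i :: nat
  define U' where "U' i = (if i = 0 then u' else v')" for i :: nat
  have uu: "u \<bullet> u = 1" "v \<bullet> v = 1" "u' \<bullet> u' = 1" "v' \<bullet> v' = 1" "v \<bullet> u = 0" "v' \<bullet> u' = 0"
    using r r' by (simp_all add: norm_eq_1 inner_commute)
  have U: "U i \<bullet> U j = (if i = j then 1 else 0)" if "i < DIM('a)" "j < DIM('a)" for i j
    using that r uu dim by (auto simp: U_def less_2_cases_iff)
  have U': "U' i \<bullet> U' j = (if i = j then 1 else 0)" if "i < DIM('a)" "j < DIM('a)" for i j
    using that r' uu dim by (auto simp: U'_def less_2_cases_iff)
  define pt where "pt t = r *\<^sub>R (cos t *\<^sub>R u + sin t *\<^sub>R v)" for t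
  have orb': "orb = (\<lambda>k. pt (2 * pi * real k / real m)) ` {..<m}" by (simp add: orb pt_def)
  show fin: "finite orb" by (simp add: orb)
  have dot: "pt s \<bullet> pt t = r * r * cos (s - t)" for s t
    by (simp add: pt_def inner_add_left inner_add_right uu r(4) cos_diff algebra_simps)
  have nrm: "norm (pt t) = r" for t using dot[of t t] r by (simp add: norm_eq_sqrt_inner)
  show "norm x = norm y" if "x \<in> orb" "y \<in> orb" for x y using that nrm by (auto simp: orb')
  have ptc: "cos s = cos t \<and> sin s = sin t" if "pt s = pt t" for s t
  proof -
    have "pt s \<bullet> u = pt t \<bullet> u" "pt s \<bullet> v = pt t \<bullet> v" using that by simp_all
    then show ?thesis using r(1) by (simp add: pt_def inner_add_left uu r(4))
  qed
  have "inj_on (\<lambda>k. pt (2 * pi * real k / real m)) {..<m}"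
  proof (rule inj_onI)
    fix i j assume ij: "i \<in> {..<m}" "j \<in> {..<m}" "pt (2 * pi * real i / real m) = pt (2 * pi * real j / real m)"
    then have "cis (of_int (2 * int i) * pi / real m) = cis (of_int (2 * int j) * pi / real m)"
      using ptc[OF ij(3)] by (simp add: complex_eq_iff mult.commute mult.left_commute)
    then have "2 * int i = 2 * int j" using ij m by (intro cis_multiples_inj[of m]) auto
    then show "i = j" by simp
  qed
  then show "card orb \<ge> 3" using m by (simp add: orb' card_image)
  have pt_orb: "pt (2 * pi * of_int k / real m) \<in> orb" for k :: int
  proof -
    have "real_of_int k = of_int (k mod int m) + of_int (k div int m) * real m"
      by (metis add.commute div_mult_mod_eq of_int_add of_int_mult of_int_of_nat_eq)
    then have e: "2 * pi * of_int k / real m = 2 * pi * of_int (k mod int m) / real m + 2 * pi * of_int (k div int m)"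
      using m by (simp add: field_simps)
    have "pt (2 * pi * of_int k / real m) = pt (2 * pi * of_int (k mod int m) / real m)"
      using sin_cos_eq_iff[of "2 * pi * of_int k / real m" "2 * pi * of_int (k mod int m) / real m"] e
      by (auto simp: pt_def)
    also have "real_of_int (k mod int m) = real (nat (k mod int m))" using m by simp
    finally show ?thesis unfolding orb' using m pos_mod_bound[of "int m" k]
      by (intro image_eqI[of _ _ "nat (k mod int m)"]) (auto simp: nat_less_iff)
  qed
  show spn: "z = 0" if z: "\<And>x. x \<in> orb \<Longrightarrow> x \<bullet> z = 0" for z
  proof (rule orthonormal_zero[OF U])
    have "pt 0 \<in> orb" "pt (2 * pi / real m) \<in> orb" using pt_orb[of 0] pt_orb[of 1] by simp_all
    then have 0: "pt 0 \<bullet> z = 0" "pt (2 * pi / real m) \<bullet> z = 0" using z by auto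
    have "sin (2 * pi / real m) > 0" using m by (intro sin_gt_zero) (auto simp: field_simps)
    then have "u \<bullet> z = 0" "v \<bullet> z = 0" using 0 r(1) by (auto simp: pt_def inner_add_left)
    then show "z \<bullet> U i = 0" for i by (simp add: U_def inner_commute)
  qed
  obtain g where g: "orthogonal_transformation g" "\<And>i. i < DIM('a) \<Longrightarrow> g (U' i) = U i"
    using orthonormal_map[OF U' U] by blast
  have gl: "linear g" using g(1) by (rule orthogonal_transformation_linear)
  have "g u' = u" "g v' = v" using g(2)[of 0] g(2)[of 1] dim by (simp_all add: U_def U'_def)
  then have "orb = (\<lambda>z. (r / r') *\<^sub>R g z) ` Q"
    using r' unfolding orb Q' image_image by (simp add: linear_add[OF gl] linear_scale[OF gl])
  moreover have "symmetry_group Q \<subseteq> symmetry_group orb" using orbit_symmetric oW fin unfolding W by blast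
  ultimately have WS: "W = symmetry_group orb"
    unfolding W using r r' fin spn by (intro symmetry_group_eq[OF g(1), of "r / r'"]) (auto simp: inner_commute)
  show "f x \<in> orb" if "f \<in> W" "x \<in> orb" for f x using that unfolding WS symmetry_group_def by auto
  show "reflection (x - y) \<in> W" if xy: "x \<in> orb" "y \<in> orb" "x \<noteq> y" for x y
    unfolding WS
  proof (rule reflection_symmetry[OF fin])
    fix z assume z: "z \<in> orb"
    obtain i j l where ijl: "x = pt (2 * pi * real i / real m)" "y = pt (2 * pi * real j / real m)" "z = pt (2 * pi * real l / real m)"
      using xy z by (auto simp: orb')
    define a b t where abt: "a = 2 * pi * real i / real m" "b = 2 * pi * real j / real m" "t = 2 * pi * real l / real m"
    \<comment> \<open>Points at angles a and b are exchanged by the reflection in the line at the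
      mean angle \<phi>, with unit normal \<open>n\<close>; it takes the angle t to a + b - t, again
      an integer multiple of 2 \<pi> / m.\<close>
    define \<phi> where "\<phi> = (a + b) / 2"
    define n where "n = cos \<phi> *\<^sub>R v - sin \<phi> *\<^sub>R u"
    have n1: "n \<bullet> n = 1" by (simp add: n_def inner_diff_left inner_diff_right uu r(4) flip: power2_eq_square)
    have "x - y = (2 * r * sin ((a - b) / 2)) *\<^sub>R n"
    proof -
      have c: "cos a - cos b = - 2 * sin ((a - b) / 2) * sin \<phi>" "sin a - sin b = 2 * sin ((a - b) / 2) * cos \<phi>"
        using cos_diff_cos[of a b] sin_diff_sin[of a b] sin_minus[of "(a - b) / 2"]
        by (simp_all add: \<phi>_def minus_divide_left algebra_simps)
      have "x - y = r *\<^sub>R ((cos a - cos b) *\<^sub>R u + (sin a - sin b) *\<^sub>R v)"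
        unfolding ijl pt_def abt[symmetric] by (simp add: algebra_simps)
      then show ?thesis unfolding c n_def by (simp add: algebra_simps)
    qed
    moreover from this have "2 * r * sin ((a - b) / 2) \<noteq> 0" using xy(3) by auto
    ultimately have "reflection (x - y) = reflection n" by (simp add: reflection_scaleR)
    moreover have "reflection n z = pt (a + b - t)"
    proof -
      have zn: "z \<bullet> n = r * sin (t - \<phi>)"
        unfolding ijl abt[symmetric] by (simp add: pt_def n_def inner_add_left inner_diff_right uu r(4) sin_diff algebra_simps)
      define d where "d = t - \<phi>"
      have td: "t = \<phi> + d" "a + b - t = \<phi> - d" by (simp_all add: d_def \<phi>_def)
      have "reflection n z = pt (\<phi> + d) - (2 * r * sin d) *\<^sub>R n"
      proof -
        have zt: "z = pt (\<phi> + d)" unfolding td(1)[symmetric] abt(3) by (rule ijl(3))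
        have "reflection n z = z - (2 * (r * sin d) / 1) *\<^sub>R n"
          unfolding reflection_def zn n1 d_def ..
        then show ?thesis unfolding zt by simp
      qed
      also have "\<dots> = pt (\<phi> - d)"
      proof -
        have lin: "r *\<^sub>R (A *\<^sub>R u + B *\<^sub>R v) - k *\<^sub>R (C *\<^sub>R v - D *\<^sub>R u) = (r * A + k * D) *\<^sub>R u + (r * B - k * C) *\<^sub>R v"
          for A B C D k by (simp add: algebra_simps)
        have "r * cos (\<phi> + d) + 2 * r * sin d * sin \<phi> = r * cos (\<phi> - d)"
          "r * sin (\<phi> + d) - 2 * r * sin d * cos \<phi> = r * sin (\<phi> - d)"
          unfolding cos_add sin_add cos_diff sin_diff by (simp_all add: algebra_simps)
        then show ?thesis unfolding pt_def n_def lin by (simp add: scaleR_add_right)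
      qed
      finally show ?thesis unfolding td(2) .
    qed
    moreover have "a + b - t = 2 * pi * of_int (int i + int j - int l) / real m"
      by (simp add: abt add_divide_distrib diff_divide_distrib algebra_simps)
    ultimately show "reflection (x - y) z \<in> orb" using pt_orb by metis
  qed
qed

section \<open>The regular icosahedron in coordinates\<close>

definition golden :: real where "golden = (1 + sqrt 5) / 2"

lemma golden_mult: "golden * golden = golden + 1" "golden * (golden * x) = golden * x + x"
proof -
  show 1: "golden * golden = golden + 1"
    by (simp add: golden_def field_simps) 
  show "golden * (golden * x) = golden * x + x"
    by (simp only: mult.assoc[symmetric] 1) (simp add: distrib_right)
qed

lemma golden_gt: "golden > 1"
proof -
  have "sqrt 5 > sqrt 1" by (subst real_sqrt_less_iff) simp
  then show ?thesis by (simp add: golden_def)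
qed

definition ivec :: "real \<Rightarrow> 'a::euclidean_space \<Rightarrow> 'a \<Rightarrow> 'a \<Rightarrow> real \<Rightarrow> real \<Rightarrow> real \<Rightarrow> 'a" where
  "ivec r u v w a b c = r *\<^sub>R (a *\<^sub>R u + b *\<^sub>R v + c *\<^sub>R w)"

text \<open>The frame \<open>u\<close>, \<open>v\<close>, \<open>w\<close> is a parameter because
  the set of twelve vertices is unchanged by cyclic rotation and by sign changes of the frame; these
  symmetries shorten the later case distinctions.\<close>

definition icosa :: "real \<Rightarrow> 'a::euclidean_space \<Rightarrow> 'a \<Rightarrow> 'a \<Rightarrow> 'a set \<Rightarrow> bool" where
  "icosa r u v w Q \<longleftrightarrow> r > 0 \<and> u \<bullet> u = 1 \<and> v \<bullet> v = 1 \<and> w \<bullet> w = 1 \<and> u \<bullet> v = 0 \<and> v \<bullet> w = 0 \<and> w \<bullet> u = 0 \<and>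
    Q = {ivec r u v w 1 golden 0, ivec r u v w 1 (- golden) 0,
         ivec r u v w (- 1) golden 0, ivec r u v w (- 1) (- golden) 0,
         ivec r u v w 0 1 golden, ivec r u v w 0 1 (- golden),
         ivec r u v w 0 (- 1) golden, ivec r u v w 0 (- 1) (- golden),
         ivec r u v w golden 0 1, ivec r u v w (- golden) 0 1,
         ivec r u v w golden 0 (- 1), ivec r u v w (- golden) 0 (- 1)}"

lemma ivec_minus: "- ivec r u v w a b c = ivec r u v w (- a) (- b) (- c)"
  by (simp add: ivec_def algebra_simps)

lemma ivec_diff: "ivec r u v w a b c - ivec r u v w a' b' c' = ivec r u v w (a - a') (b - b') (c - c')"
  by (simp add: ivec_def algebra_simps)

lemma ivec_scale: "k *\<^sub>R ivec r u v w a b c = ivec r u v w (k * a) (k * b) (k * c)"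
  by (simp add: ivec_def algebra_simps)

lemma ivec_rotate: "ivec r v w u a b c = ivec r u v w c a b"
  by (simp add: ivec_def add.commute add.left_commute)

lemma ivec_flip: "ivec r (- u) v w a b c = ivec r u v w (- a) b c"
  by (simp add: ivec_def)

lemma regular_icosahedron_icosa:
  assumes "regular_icosahedron Q"
  obtains r u v w where "icosa r u v w Q"
proof -
  obtain r u v w where r: "r > 0" "norm u = 1" "norm v = 1" "norm w = 1" "u \<bullet> v = 0" "v \<bullet> w = 0" "w \<bullet> u = 0"
    and Q: "Q = {r *\<^sub>R (s *\<^sub>R a + (t * golden) *\<^sub>R b) | s t a b.
               s \<in> {1, -1} \<and> t \<in> {1, -1} \<and> (a, b) \<in> {(u, v), (v, w), (w, u)}}"
    using assms unfolding regular_icosahedron_def golden_def by blast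
  have "Q = (\<Union>s\<in>{1,-1}. \<Union>t\<in>{1,-1}. {r *\<^sub>R (s *\<^sub>R u + (t * golden) *\<^sub>R v),
      r *\<^sub>R (s *\<^sub>R v + (t * golden) *\<^sub>R w), r *\<^sub>R (s *\<^sub>R w + (t * golden) *\<^sub>R u)})"
    unfolding Q by blast
  moreover have "r *\<^sub>R (a *\<^sub>R u + b *\<^sub>R v) = ivec r u v w a b 0"
    "r *\<^sub>R (a *\<^sub>R v + b *\<^sub>R w) = ivec r u v w 0 a b" "r *\<^sub>R (a *\<^sub>R w + b *\<^sub>R u) = ivec r u v w b 0 a" for a b
    by (simp_all add: ivec_def add.commute)
  ultimately have "Q = (\<Union>s\<in>{1,-1}. \<Union>t\<in>{1,-1}. {ivec r u v w s (t * golden) 0,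
      ivec r u v w 0 s (t * golden), ivec r u v w (t * golden) 0 s})"
    by simp
  then have "icosa r u v w Q" unfolding icosa_def using r
    by (simp add: norm_eq_1) blast
  then show ?thesis by (rule that)
qed

lemma icosa_rotate: "icosa r u v w Q \<Longrightarrow> icosa r v w u Q"
  unfolding icosa_def ivec_rotate[of r v w u] by (elim conjE, intro conjI; (assumption | blast))

lemma icosa_flip: "icosa r u v w Q \<Longrightarrow> icosa r (- u) v w Q"
  unfolding icosa_def ivec_flip minus_minus minus_zero
  by (elim conjE, intro conjI; (assumption | blast | simp only: inner_minus_left inner_minus_right minus_minus minus_zero))

lemma icosa_flip2: "icosa r u v w Q \<Longrightarrow> icosa r u (- v) w Q" "icosa r u v w Q \<Longrightarrow> icosa r u v (- w) Q"
  using icosa_flip icosa_rotate by metis+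

text \<open>Three cyclic rotations of the frame and four choices of signs for its first two vectors
  account for all twelve vertices.\<close>

lemma icosa_frame_at:
  assumes "icosa r u v w Q" "x \<in> Q"
  obtains u v w where "icosa r u v w Q" "x = ivec r u v w 1 golden 0"
proof -
  note result = that
  have 1: thesis if i: "icosa r u v w Q" and x: "x = ivec r u v w 1 golden 0 \<or> x = ivec r u v w 1 (- golden) 0
    \<or> x = ivec r u v w (- 1) golden 0 \<or> x = ivec r u v w (- 1) (- golden) 0" for u v w
  proof -
    have "ivec r u v w 1 (- golden) 0 = ivec r u (- v) w 1 golden 0"
      "ivec r u v w (- 1) golden 0 = ivec r (- u) v w 1 golden 0"
      "ivec r u v w (- 1) (- golden) 0 = ivec r (- u) (- v) w 1 golden 0"
      by (simp_all add: ivec_def)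
    then show ?thesis using x result i icosa_flip[OF i] icosa_flip2(1)[OF i] icosa_flip2(1)[OF icosa_flip[OF i]] by metis
  qed
  note rot = icosa_rotate[OF assms(1)]
  have "x \<in> {ivec r u v w 1 golden 0, ivec r u v w 1 (- golden) 0,
         ivec r u v w (- 1) golden 0, ivec r u v w (- 1) (- golden) 0} \<or>
    x \<in> {ivec r v w u 1 golden 0, ivec r v w u 1 (- golden) 0,
         ivec r v w u (- 1) golden 0, ivec r v w u (- 1) (- golden) 0} \<or>
    x \<in> {ivec r w u v 1 golden 0, ivec r w u v 1 (- golden) 0,
         ivec r w u v (- 1) golden 0, ivec r w u v (- 1) (- golden) 0}"
    using assms unfolding icosa_def ivec_rotate[of r w u v] ivec_rotate[of r v w u] by blast
  then show ?thesis using 1[OF assms(1)] 1[OF rot] 1[OF icosa_rotate[OF rot]] by blast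
qed

text \<open>The sign of \<open>w\<close> does not affect the vertex \<open>(1, golden, 0)\<close>.
  This remaining freedom makes the third coordinate of \<open>y\<close> nonnegative, which leaves
  eight cases out of twelve.\<close>

lemma icosa_cases:
  assumes "icosa r u v w Q" "y \<in> Q"
  obtains w' where "w' = w \<or> w' = - w" "icosa r u v w' Q"
    "y \<in> {ivec r u v w' 1 golden 0, ivec r u v w' 1 (- golden) 0, ivec r u v w' (- 1) golden 0,
      ivec r u v w' (- 1) (- golden) 0, ivec r u v w' 0 1 golden, ivec r u v w' 0 (- 1) golden,
      ivec r u v w' golden 0 1, ivec r u v w' (- golden) 0 1}"
proof -
  have f: "ivec r u v (- w) a b c = ivec r u v w a b (- c)" for a b c by (simp add: ivec_def)
  have "y \<in> {ivec r u v w 1 golden 0, ivec r u v w 1 (- golden) 0, ivec r u v w (- 1) golden 0,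
      ivec r u v w (- 1) (- golden) 0, ivec r u v w 0 1 golden, ivec r u v w 0 (- 1) golden,
      ivec r u v w golden 0 1, ivec r u v w (- golden) 0 1}
    \<or> y \<in> {ivec r u v (- w) 1 golden 0, ivec r u v (- w) 1 (- golden) 0, ivec r u v (- w) (- 1) golden 0,
      ivec r u v (- w) (- 1) (- golden) 0, ivec r u v (- w) 0 1 golden, ivec r u v (- w) 0 (- 1) golden,
      ivec r u v (- w) golden 0 1, ivec r u v (- w) (- golden) 0 1}"
    using assms unfolding icosa_def f by blast
  then show ?thesis using that[of w] that[of "- w"] assms(1) icosa_flip2(2)[OF assms(1)] by blast
qed

lemma icosa_inner:
  assumes "icosa r u v w Q"
  shows "ivec r u v w a b c \<bullet> ivec r u v w a' b' c' = r * r * (a * a' + b * b' + c * c')"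
proof -
  have "u \<bullet> u = 1" "v \<bullet> v = 1" "w \<bullet> w = 1" "u \<bullet> v = 0" "v \<bullet> w = 0" "w \<bullet> u = 0"
    "v \<bullet> u = 0" "w \<bullet> v = 0" "u \<bullet> w = 0"
    using assms by (auto simp: icosa_def inner_commute)
  then show ?thesis by (simp add: ivec_def inner_add_left inner_add_right algebra_simps)
qed

lemma icosa_norm:
  assumes "icosa r u v w Q" "x \<in> Q"
  shows "x \<bullet> x = r * r * (golden + 2)"
proof -
  obtain u v w where f: "icosa r u v w Q" "x = ivec r u v w 1 golden 0" using icosa_frame_at[OF assms] .
  then show ?thesis using icosa_inner[OF f(1), of 1 golden 0 1 golden 0] by (simp add: golden_mult)
qed

text \<open>The six axes of the icosahedron are equiangular with cosine \<open>1 / sqrt 5\<close>.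
  In the frame of \<open>x\<close> this comes down to
  \<open>5 * golden\<^sup>2 = (golden + 2)\<^sup>2\<close>.\<close>

lemma icosa_equiangular:
  assumes "icosa r u v w Q" "x \<in> Q" "y \<in> Q" "x \<noteq> y" "x \<noteq> - y"
  shows "5 * (x \<bullet> y)\<^sup>2 = (x \<bullet> x)\<^sup>2"
proof -
  obtain u v w where f: "icosa r u v w Q" "x = ivec r u v w 1 golden 0" using icosa_frame_at[OF assms(1,2)] .
  obtain w' where w: "icosa r u v w' Q" and
    y: "y \<in> {ivec r u v w' 1 golden 0, ivec r u v w' 1 (- golden) 0, ivec r u v w' (- 1) golden 0,
      ivec r u v w' (- 1) (- golden) 0, ivec r u v w' 0 1 golden, ivec r u v w' 0 (- 1) golden,
      ivec r u v w' golden 0 1, ivec r u v w' (- golden) 0 1}"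
    by (rule icosa_cases[OF f(1) assms(3)])
  have x: "x = ivec r u v w' 1 golden 0" by (simp add: f(2) ivec_def)
  have ny: "y \<noteq> ivec r u v w' 1 golden 0" "y \<noteq> ivec r u v w' (- 1) (- golden) 0"
    using assms(4,5) unfolding x by (auto simp: ivec_minus)
  have xy: "x \<bullet> ivec r u v w' a b c = r * r * (a + golden * b)" for a b c
    unfolding x using icosa_inner[OF w, of 1 golden 0 a b c] by simp
  have "x \<bullet> y = r * r * golden \<or> x \<bullet> y = - (r * r * golden)"
    using y ny by (elim insertE emptyE) (simp_all add: xy golden_mult)
  then have "(x \<bullet> y)\<^sup>2 = (r * r * golden)\<^sup>2" by auto
  then show ?thesis unfolding icosa_norm[OF assms(1,2)]
    by (simp add: power2_eq_square golden_mult algebra_simps)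
qed

definition ico_coords :: "(real \<times> real \<times> real) set" where
  "ico_coords = {(1, golden, 0), (1, - golden, 0), (- 1, golden, 0), (- 1, - golden, 0),
       (0, 1, golden), (0, 1, - golden), (0, - 1, golden), (0, - 1, - golden),
       (golden, 0, 1), (- golden, 0, 1), (golden, 0, - 1), (- golden, 0, - 1)}"

text \<open>A reflection in coordinates, for a normal of squared norm 4; hence the division by
  2.\<close>

definition mirror :: "real \<times> real \<times> real \<Rightarrow> real \<times> real \<times> real \<Rightarrow> real \<times> real \<times> real" where
  "mirror = (\<lambda>(a, b, c) (p, q, s). let k = (p * a + q * b + s * c) / 2 in (p - k * a, q - k * b, s - k * c))"

text \<open>Up to scaling, these normals are the differences \<open>x - y\<close> for x at
  \<open>(1, golden, 0)\<close> and y in the list of \<open>icosa_cases\<close> other than x and -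
  x. Each case is a finite check in which squares of \<open>golden\<close> are reduced to linear
  terms.\<close>

lemma mirror_coords:
  assumes "d \<in> {(0, 2, 0), (2, 0, 0), (1, golden - 1, - golden), (golden - 1, golden, - 1),
      (1 - golden, golden, - 1), (golden, 1, 1 - golden)}" "t \<in> ico_coords"
  shows "mirror d t \<in> ico_coords"
proof -
  have 1: "mirror (0, 2, 0) ` ico_coords \<subseteq> ico_coords"
    unfolding ico_coords_def by (simp add: mirror_def Let_def)
  have 2: "mirror (2, 0, 0) ` ico_coords \<subseteq> ico_coords"
    unfolding ico_coords_def by (simp add: mirror_def Let_def)
  have 3: "mirror (1, golden - 1, - golden) ` ico_coords \<subseteq> ico_coords"
    unfolding ico_coords_def
    by (simp add: mirror_def Let_def golden_mult algebra_simps) (intro conjI; argo)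
  have 4: "mirror (golden - 1, golden, - 1) ` ico_coords \<subseteq> ico_coords"
    unfolding ico_coords_def
    by (simp add: mirror_def Let_def golden_mult algebra_simps) (intro conjI; argo)
  have 5: "mirror (1 - golden, golden, - 1) ` ico_coords \<subseteq> ico_coords"
    unfolding ico_coords_def
    by (simp add: mirror_def Let_def golden_mult algebra_simps) (intro conjI; argo)
  have 6: "mirror (golden, 1, 1 - golden) ` ico_coords \<subseteq> ico_coords"
    unfolding ico_coords_def
    by (simp add: mirror_def Let_def golden_mult algebra_simps) (intro conjI; argo)
  have "mirror d ` ico_coords \<subseteq> ico_coords"
    using assms(1) by (elim insertE emptyE) (simp_all only: 1 2 3 4 5 6)
  then show ?thesis using assms(2) by (rule subsetD[OF _ imageI])
qed

text \<open>The multiples of the mirror normals in the last four cases are chosen to have squared norm 4.\<close>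

lemma icosa_reflection:
  assumes "icosa r u v w Q" "x \<in> Q" "y \<in> Q" "x \<noteq> y" "x \<noteq> - y" "z \<in> Q"
  shows "reflection (x - y) z \<in> Q"
proof -
  obtain u v w where f: "icosa r u v w Q" "x = ivec r u v w 1 golden 0" using icosa_frame_at[OF assms(1,2)] .
  obtain w' where w: "icosa r u v w' Q" and
    y: "y \<in> {ivec r u v w' 1 golden 0, ivec r u v w' 1 (- golden) 0, ivec r u v w' (- 1) golden 0,
      ivec r u v w' (- 1) (- golden) 0, ivec r u v w' 0 1 golden, ivec r u v w' 0 (- 1) golden,
      ivec r u v w' golden 0 1, ivec r u v w' (- golden) 0 1}"
    by (rule icosa_cases[OF f(1) assms(3)])
  define T where "T = ivec r u v w'"
  have r: "r > 0" using w by (simp add: icosa_def)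
  have Q: "Q = {T 1 golden 0, T 1 (- golden) 0, T (- 1) golden 0, T (- 1) (- golden) 0,
       T 0 1 golden, T 0 1 (- golden), T 0 (- 1) golden, T 0 (- 1) (- golden),
       T golden 0 1, T (- golden) 0 1, T golden 0 (- 1), T (- golden) 0 (- 1)}"
    using w unfolding icosa_def T_def by blast
  have x: "x = T 1 golden 0" by (simp add: f(2) T_def ivec_def)
  have ny: "y \<noteq> T 1 golden 0" "y \<noteq> T (- 1) (- golden) 0"
    using assms(4,5) unfolding x by (auto simp: T_def ivec_minus)
  note Td = ivec_diff[of r u v w', folded T_def] and Tk = ivec_scale[of _ r u v w', folded T_def]
    and inner = icosa_inner[OF w, folded T_def]
  have refl: "reflection (T a b c) (T p q s) = (let k = (p * a + q * b + s * c) / 2 in T (p - k * a) (q - k * b) (s - k * c))"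
    if "a * a + b * b + c * c = 4" for a b c p q s
  proof -
    have "2 * (r * r * (p * a + q * b + s * c)) / (r * r * (a * a + b * b + c * c)) = (p * a + q * b + s * c) / 2"
      unfolding that using r by (simp add: field_simps)
    then show ?thesis unfolding reflection_def inner by (simp only: Tk Td Let_def)
  qed
  have par: "reflection (T a b c) = reflection (T a' b' c')" if "a = k * a'" "b = k * b'" "c = k * c'" "k \<noteq> 0" for k a b c a' b' c'
    using that by (simp add: Tk[symmetric] reflection_scaleR)
  define G where "G = golden"
  have G: "G * G = G + 1" "G * (G * t) = G * t + t" for t by (simp_all add: G_def golden_mult)
  have G0: "G > 0" using golden_gt by (simp add: G_def)
  consider "y = T 1 (- G) 0" | "y = T (- 1) G 0" | "y = T 0 1 G" | "y = T 0 (- 1) G" | "y = T G 0 1" | "y = T (- G) 0 1"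
    using y ny unfolding G_def T_def[symmetric] by blast
  then obtain a b c where d: "reflection (x - y) = reflection (T a b c)"
    and abc: "(a, b, c) \<in> {(0, 2, 0), (2, 0, 0), (1, G - 1, - G), (G - 1, G, - 1), (1 - G, G, - 1), (G, 1, 1 - G)}"
  proof cases
    case 1
    then show ?thesis using G0 by (intro that[of 0 2 0]) (auto simp: x Td G_def[symmetric] intro!: par[of _ G])
  next
    case 2
    then show ?thesis by (intro that[of 2 0 0]) (auto simp: x Td G_def[symmetric] intro!: par[of _ 1])
  next
    case 3
    then show ?thesis by (intro that[of 1 "G - 1" "- G"]) (auto simp: x Td G_def[symmetric])
  next
    case 4
    then show ?thesis using G0 by (intro that[of "G - 1" G "- 1"]) (auto simp: x Td G G_def[symmetric] algebra_simps intro!: par[of _ G])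
  next
    case 5
    then show ?thesis by (intro that[of "1 - G" G "- 1"]) (auto simp: x Td G_def[symmetric])
  next
    case 6
    then show ?thesis using G0 by (intro that[of G 1 "1 - G"]) (auto simp: x Td G G_def[symmetric] algebra_simps intro!: par[of _ G])
  qed
  have n4: "a * a + b * b + c * c = 4"
  proof -
    have "\<forall>(a, b, c)\<in>{(0, 2, 0), (2, 0, 0), (1, G - 1, - G), (G - 1, G, - 1), (1 - G, G, - 1), (G, 1, 1 - G)}.
        a * a + b * b + c * c = 4"
      by (simp add: G algebra_simps)
    then show ?thesis using abc by blast
  qed
  have QT: "Q = (\<lambda>(p, q, s). T p q s) ` ico_coords" unfolding Q ico_coords_def by simp
  then obtain t where t: "z = (\<lambda>(p, q, s). T p q s) t" "t \<in> ico_coords" using assms(6) by blast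
  obtain p q s where pqs: "t = (p, q, s)" by (cases t)
  have "reflection (x - y) z = (\<lambda>(p, q, s). T p q s) (mirror (a, b, c) t)"
    unfolding d using refl[OF n4, of p q s] t(1) by (simp add: pqs mirror_def Let_def)
  moreover have "mirror (a, b, c) t \<in> ico_coords"
    using abc t(2) unfolding G_def by (rule mirror_coords)
  ultimately show ?thesis unfolding QT by blast
qed

text \<open>\<open>d\<close> is the Gram determinant. As the off-diagonal entries have squares
  \<open>N\<^sup>2 / 5\<close>, its vanishing would mean
  \<open>5 * (p * q * s) = - (N * N * N)\<close>, but the squares of the two sides differ by the
  factor 5. So \<open>x\<close>, \<open>y\<close>, \<open>z\<close> form a basis.\<close>

lemma equiangular_three:
  fixes x y z :: "'a::euclidean_space"
  assumes dim: "DIM('a) = 3" and N: "N > 0" "x \<bullet> x = N" "y \<bullet> y = N" "z \<bullet> z = N"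
    and eq: "5 * (x \<bullet> y)\<^sup>2 = N\<^sup>2" "5 * (x \<bullet> z)\<^sup>2 = N\<^sup>2" "5 * (y \<bullet> z)\<^sup>2 = N\<^sup>2"
    and ne: "x \<noteq> y" "x \<noteq> z" "y \<noteq> z"
    and \<beta>: "x \<bullet> \<beta> = 0" "y \<bullet> \<beta> = 0" "z \<bullet> \<beta> = 0"
  shows "\<beta> = 0"
proof -
  define p q s where "p = x \<bullet> y" and "q = x \<bullet> z" and "s = y \<bullet> z"
  define d where "d = N * N * N + 2 * p * q * s - N * (p * p) - N * (q * q) - N * (s * s)"
  have sq: "p * p = N * N / 5" "q * q = N * N / 5" "s * s = N * N / 5"
    using eq by (simp_all add: p_def q_def s_def power2_eq_square)
  have d: "d \<noteq> 0"
  proof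
    assume "d = 0"
    then have "5 * (p * q * s) = - (N * N * N)" unfolding d_def sq by (simp add: field_simps)
    then have "(5 * (p * q * s)) * (5 * (p * q * s)) = (- (N * N * N)) * (- (N * N * N))" by simp
    moreover have "(5 * (p * q * s)) * (5 * (p * q * s)) = 25 * ((p * p) * (q * q) * (s * s))"
      by (simp add: algebra_simps)
    ultimately show False using N(1) unfolding sq by (simp add: field_simps)
  qed
  have lin: "a = 0 \<and> b = 0 \<and> c = 0" if abc: "a *\<^sub>R x + b *\<^sub>R y + c *\<^sub>R z = 0" for a b c
  proof -
    have e: "a * N + b * p + c * q = 0" "a * p + b * N + c * s = 0" "a * q + b * s + c * N = 0"
      using arg_cong[OF abc, of "\<lambda>t. t \<bullet> x"] arg_cong[OF abc, of "\<lambda>t. t \<bullet> y"] arg_cong[OF abc, of "\<lambda>t. t \<bullet> z"] N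
      by (simp_all add: inner_add_left p_def q_def s_def inner_commute[of y x] inner_commute[of z x] inner_commute[of z y])
    \<comment> \<open>The multipliers here and below are the rows of the adjugate of the Gram
      matrix, as in Cramer's rule.\<close>
    have "a * d = (N * N - s * s) * (a * N + b * p + c * q) - (p * N - q * s) * (a * p + b * N + c * s)
        + (p * s - q * N) * (a * q + b * s + c * N)"
      unfolding d_def by (simp add: algebra_simps)
    then have 1: "a * d = 0" unfolding e by simp
    have "b * d = - (p * N - q * s) * (a * N + b * p + c * q) + (N * N - q * q) * (a * p + b * N + c * s)
        - (N * s - p * q) * (a * q + b * s + c * N)"
      unfolding d_def by (simp add: algebra_simps)
    then have 2: "b * d = 0" unfolding e by simp
    have "c * d = (p * s - q * N) * (a * N + b * p + c * q) - (N * s - p * q) * (a * p + b * N + c * s)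
        + (N * N - p * p) * (a * q + b * s + c * N)"
      unfolding d_def by (simp add: algebra_simps)
    then have 3: "c * d = 0" unfolding e by simp
    show ?thesis using 1 2 3 d by simp
  qed
  have ind: "independent {x, y, z}"
  proof
    assume "dependent {x, y, z}"
    then obtain f where f: "\<exists>v\<in>{x, y, z}. f v \<noteq> 0" "(\<Sum>v\<in>{x, y, z}. f v *\<^sub>R v) = 0"
      using real_vector.dependent_finite[of "{x, y, z}"] by auto
    then have "f x *\<^sub>R x + f y *\<^sub>R y + f z *\<^sub>R z = 0" using ne by (simp add: add.assoc)
    then show False using lin f(1) by blast
  qed
  have "UNIV \<subseteq> span {x, y, z}"
    using ind ne dim by (intro card_ge_dim_independent) auto
  then have "orthogonal \<beta> \<beta>"
    using \<beta> by (intro orthogonal_to_span[of \<beta> "{x, y, z}" \<beta>]) (auto simp: orthogonal_def inner_commute)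
  then show ?thesis by (simp add: orthogonal_def)
qed

lemma icosa_card:
  assumes "icosa r u v w Q"
  shows "card Q = 12" "0 \<notin> Q" "\<And>x. x \<in> Q \<Longrightarrow> - x \<in> Q"
proof -
  have Q: "Q = {ivec r u v w 1 golden 0, ivec r u v w 1 (- golden) 0,
         ivec r u v w (- 1) golden 0, ivec r u v w (- 1) (- golden) 0,
         ivec r u v w 0 1 golden, ivec r u v w 0 1 (- golden),
         ivec r u v w 0 (- 1) golden, ivec r u v w 0 (- 1) (- golden),
         ivec r u v w golden 0 1, ivec r u v w (- golden) 0 1,
         ivec r u v w golden 0 (- 1), ivec r u v w (- golden) 0 (- 1)}" and r: "r > 0"
    using assms unfolding icosa_def by blast+
  have co: "ivec r u v w a b c \<bullet> ivec r u v w 1 0 0 = r * r * a" "ivec r u v w a b c \<bullet> ivec r u v w 0 1 0 = r * r * b"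
    "ivec r u v w a b c \<bullet> ivec r u v w 0 0 1 = r * r * c" for a b c
    by (simp_all add: icosa_inner[OF assms])
  have inj: "ivec r u v w a b c = ivec r u v w a' b' c' \<longleftrightarrow> a = a' \<and> b = b' \<and> c = c'" for a b c a' b' c'
  proof
    assume "ivec r u v w a b c = ivec r u v w a' b' c'"
    then have "r * r * a = r * r * a'" "r * r * b = r * r * b'" "r * r * c = r * r * c'" using co by metis+
    then show "a = a' \<and> b = b' \<and> c = c'" using r by simp
  qed simp
  have g: "golden \<noteq> 1" "golden \<noteq> 0" "golden \<noteq> - 1" "1 \<noteq> golden" "- golden \<noteq> 1" "1 \<noteq> - golden" "- 1 \<noteq> golden"
    using golden_gt by auto
  show "card Q = 12" unfolding Q by (simp add: inj g)
  have "ivec r u v w 0 0 0 = 0" by (simp add: ivec_def)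
  then have z: "(0 = ivec r u v w a b c) \<longleftrightarrow> a = 0 \<and> b = 0 \<and> c = 0" for a b c using inj by metis
  show "0 \<notin> Q" unfolding Q by (simp add: z g)
  show "- x \<in> Q" if "x \<in> Q" for x
    using that unfolding Q by (elim insertE emptyE) (simp_all add: ivec_minus)
qed

lemma type_H3_facts:
  fixes W :: "('a::euclidean_space \<Rightarrow> 'a) set"
  assumes "type_H3 W orb"
  shows "card orb = 12" "0 \<notin> orb" "\<And>x. x \<in> orb \<Longrightarrow> - x \<in> orb" "\<And>x y. x \<in> orb \<Longrightarrow> y \<in> orb \<Longrightarrow> norm x = norm y"
    and "\<And>f x. f \<in> W \<Longrightarrow> x \<in> orb \<Longrightarrow> f x \<in> orb"
    and "\<And>z. (\<And>x. x \<in> orb \<Longrightarrow> x \<bullet> z = 0) \<Longrightarrow> z = 0"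
    and "\<And>x y. x \<in> orb \<Longrightarrow> y \<in> orb \<Longrightarrow> x \<noteq> y \<Longrightarrow> x \<noteq> - y \<Longrightarrow> reflection (x - y) \<in> W"
    and "\<And>x. x \<in> orb \<Longrightarrow> reflection x \<notin> W"
    and "\<And>x y z \<beta>. x \<in> orb \<Longrightarrow> y \<in> orb \<Longrightarrow> z \<in> orb \<Longrightarrow> x \<noteq> y \<Longrightarrow> x \<noteq> - y \<Longrightarrow> y \<noteq> z \<Longrightarrow> y \<noteq> - z
      \<Longrightarrow> x \<noteq> z \<Longrightarrow> x \<noteq> - z \<Longrightarrow> x \<bullet> \<beta> = 0 \<Longrightarrow> y \<bullet> \<beta> = 0 \<Longrightarrow> z \<bullet> \<beta> = 0 \<Longrightarrow> \<beta> = 0"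
proof -
  have dim: "DIM('a) = 3" using assms by (simp add: type_H3_def)
  obtain Q where Q: "regular_icosahedron Q" and W: "W = symmetry_group Q"
    and oW: "orbit_of W orb" and ico: "regular_icosahedron orb"
    using assms by (auto simp: type_H3_def)
  obtain r u v w where I: "icosa r u v w orb" using regular_icosahedron_icosa[OF ico] .
  obtain r' u' v' w' where I': "icosa r' u' v' w' Q" using regular_icosahedron_icosa[OF Q] .
  show card: "card orb = 12" and "0 \<notin> orb" and neg: "\<And>x. x \<in> orb \<Longrightarrow> - x \<in> orb" using icosa_card[OF I] by auto
  have fin: "finite orb" using card by (intro card_ge_0_finite) simp
  define N where "N = r * r * (golden + 2)"
  have N: "N > 0" and xx: "\<And>x. x \<in> orb \<Longrightarrow> x \<bullet> x = N"
    using I golden_gt icosa_norm[OF I] by (auto simp: N_def icosa_def)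
  show "norm x = norm y" if "x \<in> orb" "y \<in> orb" for x y using xx that by (simp add: norm_eq)
  have ang: "5 * (x \<bullet> y)\<^sup>2 = N\<^sup>2" if "x \<in> orb" "y \<in> orb" "x \<noteq> y" "x \<noteq> - y" for x y
    using icosa_equiangular[OF I that] xx that by simp
  show three: "\<beta> = 0" if "x \<in> orb" "y \<in> orb" "z \<in> orb" "x \<noteq> y" "x \<noteq> - y" "y \<noteq> z" "y \<noteq> - z"
      "x \<noteq> z" "x \<noteq> - z" "x \<bullet> \<beta> = 0" "y \<bullet> \<beta> = 0" "z \<bullet> \<beta> = 0" for x y z \<beta>
    using that N xx ang by (intro equiangular_three[OF dim N, of x y z \<beta>]) auto
  define U where "U i = (if i = 0 then u else if i = 1 then v else w)" for i :: nat
  define U' where "U' i = (if i = 0 then u' else if i = 1 then v' else w')" for i :: nat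
  have U: "U i \<bullet> U j = (if i = j then 1 else 0)" if "i < DIM('a)" "j < DIM('a)" for i j
    using that I dim by (auto simp: U_def icosa_def inner_commute numeral_3_eq_3 less_Suc_eq)
  have U': "U' i \<bullet> U' j = (if i = j then 1 else 0)" if "i < DIM('a)" "j < DIM('a)" for i j
    using that I' dim by (auto simp: U'_def icosa_def inner_commute numeral_3_eq_3 less_Suc_eq)
  have orbV: "ivec r u v w 1 golden 0 \<in> orb" "ivec r u v w 1 (- golden) 0 \<in> orb"
    "ivec r u v w 0 1 golden \<in> orb" "ivec r u v w 0 1 (- golden) \<in> orb"
    using I unfolding icosa_def by blast+
  show spn: "z = 0" if z: "\<And>x. x \<in> orb \<Longrightarrow> x \<bullet> z = 0" for z
  proof (rule orthonormal_zero[OF U])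
    have r: "r > 0" using I by (simp add: icosa_def)
    have "u \<bullet> z + golden * (v \<bullet> z) = 0" "u \<bullet> z - golden * (v \<bullet> z) = 0" "v \<bullet> z + golden * (w \<bullet> z) = 0" "v \<bullet> z - golden * (w \<bullet> z) = 0"
      using z[OF orbV(1)] z[OF orbV(2)] z[OF orbV(3)] z[OF orbV(4)] r by (simp_all add: ivec_def inner_add_left inner_diff_left)
    then have "u \<bullet> z = 0" "v \<bullet> z = 0" "golden * (w \<bullet> z) = 0" by linarith+
    then show "z \<bullet> U i = 0" for i using golden_gt by (simp add: U_def inner_commute)
  qed
  obtain g where g: "orthogonal_transformation g" "\<And>i. i < DIM('a) \<Longrightarrow> g (U' i) = U i"
    using orthonormal_map[OF U' U] by blast
  have gl: "linear g" using g(1) by (rule orthogonal_transformation_linear)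
  have gu: "g u' = u" "g v' = v" "g w' = w" using g(2)[of 0] g(2)[of 1] g(2)[of 2] dim by (simp_all add: U_def U'_def)
  have rr: "r > 0" "r' > 0" using I I' by (auto simp: icosa_def)
  have "(r / r') *\<^sub>R g (ivec r' u' v' w' a b c) = ivec r u v w a b c" for a b c
    using rr by (simp add: ivec_def linear_add[OF gl] linear_scale[OF gl] gu)
  then have "orb = (\<lambda>z. (r / r') *\<^sub>R g z) ` Q"
    using I I' unfolding icosa_def by (elim conjE) (simp only: image_insert image_empty)
  moreover have "symmetry_group Q \<subseteq> symmetry_group orb" using orbit_symmetric oW fin unfolding W by blast
  ultimately have WS: "W = symmetry_group orb"
    unfolding W using rr fin spn by (intro symmetry_group_eq[OF g(1), of "r / r'"]) (auto simp: inner_commute)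
  show inv: "f x \<in> orb" if "f \<in> W" "x \<in> orb" for f x using that unfolding WS symmetry_group_def by auto
  show "reflection (x - y) \<in> W" if "x \<in> orb" "y \<in> orb" "x \<noteq> y" "x \<noteq> - y" for x y
    unfolding WS by (rule reflection_symmetry[OF fin]) (rule icosa_reflection[OF I that])
  \<comment> \<open>The image \<open>z\<close> of a vertex \<open>y\<close> on another axis would be
    a vertex with \<open>z \<bullet> y = 3 / 5 * N\<close>, whereas inner products of vertices are
    N, - N or have square \<open>N\<^sup>2 / 5\<close>.\<close>
  show "reflection x \<notin> W" if x: "x \<in> orb" for x
  proof
    assume rW: "reflection x \<in> W"
    have "card {x, - x} \<le> 2" using card_insert_le_m1[of 2 "{- x}" x] by simp
    then have "\<not> orb \<subseteq> {x, - x}" using card card_mono[of "{x, - x}" orb] by auto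
    then obtain y where y: "y \<in> orb" "y \<noteq> x" "y \<noteq> - x" by blast
    define z where "z = reflection x y"
    have z: "z \<in> orb" unfolding z_def using inv rW y by blast
    have a: "5 * (x \<bullet> y) * (x \<bullet> y) = N * N" 
    proof -
      have "x \<noteq> y" "x \<noteq> - y" using y by auto
      then have "5 * (x \<bullet> y)\<^sup>2 = N\<^sup>2" by (rule ang[OF x y(1)])
      then show ?thesis by (simp add: power2_eq_square)
    qed
    have "z \<bullet> y = N - 2 * (x \<bullet> y) * (x \<bullet> y) / N"
      unfolding z_def reflection_def inner_diff_left inner_scaleR_left xx[OF x] xx[OF y(1)]
      by (simp add: inner_commute[of y x])
    also have "2 * (x \<bullet> y) * (x \<bullet> y) / N = 2 / 5 * N" using a N by (simp add: field_simps)
    finally have zy: "z \<bullet> y = 3 / 5 * N" by simp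
    consider "z = y" | "z = - y" | "5 * (z \<bullet> y)\<^sup>2 = N\<^sup>2" using ang[OF z y(1)] by blast
    then show False
    proof cases
      case 1
      then show False using zy xx[OF y(1)] N by simp
    next
      case 2
      then show False using zy xx[OF y(1)] N by simp
    next
      case 3
      then show False unfolding zy using N by (simp add: power2_eq_square)
    qed
  qed
qed

theorem mainTheorem4:
  fixes W :: "('a::euclidean_space \<Rightarrow> 'a) set"
    and orb \<Phi> :: "'a set"
    and \<Delta> :: "sign \<Rightarrow> 'a set"
    and c :: "'a \<Rightarrow> real"
    and \<omega> :: "'a \<Rightarrow> 'a"
    and \<beta> \<gamma> :: 'a
    and n m :: nat
  assumes "type_A n W orb \<or> type_B n W orb \<or> type_I2 m W orb \<or> type_H3 W orb"
    and "root_system W \<Phi>"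
    and "simple_system \<Phi> (simple_roots \<Delta>)"
    and "bipartition \<Delta>"
    and "positive_min_eigenvector (simple_roots \<Delta>) c"
    and "dual_to_unit_roots (simple_roots \<Delta>) \<omega>"
    and "\<beta> \<in> almost_positive_roots \<Phi> \<Delta>"
    and "\<gamma> \<in> almost_positive_roots \<Phi> \<Delta>"
    and "\<beta> \<noteq> \<gamma>"
  shows "compatible_roots \<Phi> \<Delta> \<beta> \<gamma> \<longleftrightarrow>
    (\<forall>s\<in>diagram \<Phi> \<Delta> c \<omega> orb \<beta>. \<forall>t\<in>diagram \<Phi> \<Delta> c \<omega> orb \<gamma>.
       crosses s t \<longrightarrow> coincide s t)"
proof -
  note os = orbit_setup_spanning[OF assms(2-6), where orb = orb]
  consider "type_A n W orb" | "type_B n W orb" | "type_I2 m W orb" | "type_H3 W orb" using assms(1) by blast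
  then show ?thesis
  proof cases
    case 1
    note A = type_A_facts[OF 1]
    have "orbit_setup W \<Phi> \<Delta> \<omega> c orb" by (rule os) (fact A(1), fact A(3), fact A(4), fact A(5))
    then show ?thesis by (rule orbit_setup.chain_case) (fact A(6), fact A(2), fact+)
  next
    case 2
    note A = type_B_facts[OF 2]
    have "orbit_setup W \<Phi> \<Delta> \<omega> c orb" by (rule os) (fact A(1), fact A(3), fact A(4), rule A(5), simp)
    then show ?thesis by (rule orbit_setup.chain_case) (fact A(6), fact A(2), fact+)
  next
    case 3
    note A = type_I2_facts[OF 3]
    have "orbit_setup W \<Phi> \<Delta> \<omega> c orb" by (rule os) (fact A(1), fact A(3), fact A(4), rule A(5), simp)
    then show ?thesis by (rule orbit_setup.chain_case) (fact A(6), fact A(2), fact+)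
  next
    case 4
    note A = type_H3_facts[OF 4]
    have fin: "finite orb" using A(1) by (intro card_ge_0_finite) simp
    have "orbit_setup W \<Phi> \<Delta> \<omega> c orb" by (rule os) (fact fin, fact A(4), fact A(5), rule A(6), simp)
    then show ?thesis
    \<comment> \<open>Of the twelve vertices five lie above the incomparable pair and five below
      it.\<close>
    proof (rule orbit_setup.central_case[where m = 5])
      show "card orb = 2 * 5 + 2" using A(1) by simp
    qed (fact A(3), fact A(2), fact A(7), fact A(8), fact A(9), simp, fact+)
  qed
qed

end
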